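(* Let $c\in\mathbb{R}$ and let $\mathscr{M}^3(c)=(M,\eta,\xi,\varphi,g)$ be the $3$-dimensional simply connected Sasakian space form of constant holomorphic sectional curvature $c$, with Levi-Civita connection $\nabla$. For $r\in\mathbb{R}$ let $A^{r}(X)Y=\mathrm{d}\eta(X,Y)\xi-r\,\eta(X)\varphi Y+\eta(Y)\varphi X$. Then the set of all homogeneous contact Riemannian structures on $\mathscr{M}^3(c)$ coincides with the set $\mathcal{S}$ of all homogeneous Riemannian structures on $\mathscr{M}^3(c)$ described as follows: (i) $\mathcal{S}=\{A^r\mid r\in\mathbb{R}\}$ if $c\geq-3$ (including $c=1$); (ii) $\mathcal{S}=\{A^r\mid r\in\mathbb{R}\}\cup\{\nabla^{(-)}-\nabla\}$ if $c<-3$, where $\nabla^{(-)}$ is the Cartan-Schouten $(-)$-connection of the Sasakian Lie group $\mathrm{GA}^+(1)\times\mathbb{R}$.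
   Context: **Contact Riemannian and Sasakian manifolds.** A contact Riemannian $3$-manifold $(M,\eta,\xi,\varphi,g)$ consists of a contact form $\eta$ ($\eta\wedge\mathrm{d}\eta\neq0$), its Reeb vector field $\xi$ ($\eta(\xi)=1$, $\mathrm{d}\eta(\xi,\cdot)=0$), an endomorphism field $\varphi$ and a Riemannian metric $g$ with $\varphi^2=-I+\eta\otimes\xi$, $g(\varphi X,\varphi Y)=g(X,Y)-\eta(X)\eta(Y)$, $g(\xi,\cdot)=\eta$, $\mathrm{d}\eta(X,Y)=g(X,\varphi Y)$, where $\mathrm{d}\eta(X,Y)=\frac12\left(X\eta(Y)-Y\eta(X)-\eta([X,Y])\right)$. It is Sasakian if $(\nabla_X\varphi)Y=g(X,Y)\xi-\eta(Y)X$ for all $X,Y$. Constant holomorphic sectional curvature $c$ means that every $\varphi$-invariant tangent plane has sectional curvature $c$. A Sasakian space form is a complete connected Sasakian manifold of constant holomorphic sectional curvature. **Model of $\mathscr{M}^3(c)$.** The simply connected one is unique up to isomorphism (diffeomorphism preserving $\eta,\xi,\varphi,g$). It is realized as the simply connected Lie group ($\mathrm{SU}(2)$ for $c>-3$, the Heisenberg group for $c=-3$, the universal covering group of $\mathrm{SL}_2\mathbb{R}$ for $c<-3$) with left invariant orthonormal frame satisfying $[e_1,e_2]=2e_3$, $[e_2,e_3]=\frac{c+3}{2}e_1$, $[e_3,e_1]=\frac{c+3}{2}e_2$, and $\varphi e_1=e_2$, $\varphi e_2=-e_1$, $\varphi e_3=0$, $\xi=e_3$, $\eta=g(\cdot,e_3)$.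 For $c=1$ it is the unit $3$-sphere with its standard Sasakian structure. **The Sasakian Lie group $\mathrm{GA}^+(1)\times\mathbb{R}$, $c<-3$.** $\mathrm{GA}^{+}(1)$ is the identity component of the affine group of the real line. Put $\alpha=\sqrt{-(c+3)}$. The simply connected Lie group $\mathrm{GA}^+(1)\times\mathbb{R}$ has a Lie algebra with basis satisfying $[e_1,e_2]=\alpha e_2+2e_3$, $[e_2,e_3]=[e_3,e_1]=0$; it is equipped with the left invariant structure for which this basis is orthonormal and $\varphi e_1=e_2$, $\varphi e_2=-e_1$, $\varphi e_3=0$, $\xi=e_3$, $\eta=g(\cdot,e_3)$. It is Sasakian of constant holomorphic sectional curvature $c$, and so is identified with $\mathscr{M}^3(c)$ as a Sasakian manifold. **Cartan-Schouten $(-)$-connection** of a Lie group: the linear connection with $\nabla^{(-)}_XY=0$ for all left invariant $X,Y$. **Homogeneous structures.** A homogeneous Riemannian structure on $(M,g)$ is a $(1,2)$-tensor field $S$ such that $\tilde\nabla=\nabla+S$ (i.e. $\tilde\nabla_XY=\nabla_XY+S(X)Y$) satisfies $\tilde\nabla g=0$, $\tilde\nabla R=0$, $\tilde\nabla S=0$, where $R$ is the Riemannian curvature. A homogeneous contact Riemannian structure on a contact Riemannian manifold is a homogeneous Riemannian structure with in addition $\tilde\nabla\varphi=0$.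
   Formalization: In (ii) the single element ∇^(-)−∇ is replaced by the nonempty set of all F*∇^(-)−∇, F ranging over the identifications of M³(c) with GA⁺(1)×ℝ; for one fixed identification equality fails, since isotropy rotations carry ∇^(-)−∇ to other homogeneous contact structures. *)

theory Defs
  imports "HOL-Analysis.Analysis"
begin

section \<open>Smooth manifolds\<close>

text \<open>
  \<open>Ck_on k f S\<close> is meant for open \<open>S\<close> in a Euclidean space: all iterated directional
  derivatives of \<open>f\<close> of order at most \<open>k\<close> exist and are continuous on \<open>S\<close>.
\<close>

primrec Ck_on :: "nat \<Rightarrow> ('e::euclidean_space \<Rightarrow> real) \<Rightarrow> 'e set \<Rightarrow> bool" where
  "Ck_on 0 f S \<longleftrightarrow> continuous_on S f"
| "Ck_on (Suc k) f S \<longleftrightarrow>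
     (\<forall>x\<in>S. f differentiable (at x)) \<and>
     (\<forall>v. Ck_on k (\<lambda>x. frechet_derivative f (at x) v) S)"

definition Cinf_on :: "('e::euclidean_space \<Rightarrow> real) \<Rightarrow> 'e set \<Rightarrow> bool" where
  "Cinf_on f S \<longleftrightarrow> (\<forall>k. Ck_on k f S)"

text \<open>
  An atlas is a set of charts, a chart being a domain together with a coordinate map. The
  values of the coordinate map outside its domain are irrelevant.
\<close>

type_synonym ('a, 'e) atlas = "('a set \<times> ('a \<Rightarrow> 'e)) set"

definition chart :: "'a::topological_space set \<Rightarrow> ('a \<Rightarrow> 'e::euclidean_space) \<Rightarrow> bool" where
  "chart U u \<longleftrightarrow> open U \<and> open (u ` U) \<and> homeomorphism U (u ` U) u (inv_into U u)"

definition smooth_manifold ::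
    "('a::{t2_space,second_countable_topology}, 'e::euclidean_space) atlas \<Rightarrow> bool" where
  "smooth_manifold A \<longleftrightarrow>
     (\<forall>(U, u)\<in>A. chart U u) \<and> (\<Union>(U, u)\<in>A. U) = UNIV \<and>
     (\<forall>(U, u)\<in>A. \<forall>(V, v)\<in>A. \<forall>b\<in>Basis.
        Cinf_on (\<lambda>x. v (inv_into U u x) \<bullet> b) (u ` (U \<inter> V)))"

definition Cinf :: "('a, 'e::euclidean_space) atlas \<Rightarrow> ('a \<Rightarrow> real) set" where
  "Cinf A = {f. \<forall>(U, u)\<in>A. Cinf_on (f \<circ> inv_into U u) (u ` U)}"

definition smooth_map ::
    "('a, 'e::euclidean_space) atlas \<Rightarrow> ('b, 'd::euclidean_space) atlas \<Rightarrow> ('a \<Rightarrow> 'b) \<Rightarrow> bool" where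
  "smooth_map A B F \<longleftrightarrow> (\<forall>f\<in>Cinf B. f \<circ> F \<in> Cinf A)"

definition diffeomorphism ::
    "('a, 'e::euclidean_space) atlas \<Rightarrow> ('b, 'd::euclidean_space) atlas \<Rightarrow> ('a \<Rightarrow> 'b) \<Rightarrow> bool" where
  "diffeomorphism A B F \<longleftrightarrow> bij F \<and> smooth_map A B F \<and> smooth_map B A (inv F)"

section \<open>Vector fields, tensor fields and connections\<close>

text \<open>
  Vector fields are derivations of the algebra of smooth functions. A derivation is
  represented by a function on all of \<open>'a \<Rightarrow> real\<close>, so it is normalised to be \<open>0\<close> on
  functions that are not smooth; equality of vector fields is then equality in HOL.
\<close>

type_synonym 'a vfield = "('a \<Rightarrow> real) \<Rightarrow> 'a \<Rightarrow> real"

definition vzero :: "'a vfield" where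
  "vzero = (\<lambda>f p. 0)"

definition vadd :: "'a vfield \<Rightarrow> 'a vfield \<Rightarrow> 'a vfield"  (infixl "\<oplus>\<^sub>v" 65) where
  "X \<oplus>\<^sub>v Y = (\<lambda>f p. X f p + Y f p)"

definition vdiff :: "'a vfield \<Rightarrow> 'a vfield \<Rightarrow> 'a vfield"  (infixl "\<ominus>\<^sub>v" 65) where
  "X \<ominus>\<^sub>v Y = (\<lambda>f p. X f p - Y f p)"

definition vscale :: "('a \<Rightarrow> real) \<Rightarrow> 'a vfield \<Rightarrow> 'a vfield"  (infixr "\<odot>\<^sub>v" 70) where
  "h \<odot>\<^sub>v X = (\<lambda>f p. h p * X f p)"

definition bracket :: "'a vfield \<Rightarrow> 'a vfield \<Rightarrow> 'a vfield" where
  "bracket X Y = (\<lambda>f p. X (Y f) p - Y (X f) p)"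

definition vfields :: "('a, 'e::euclidean_space) atlas \<Rightarrow> 'a vfield set" where
  "vfields A = {X.
     (\<forall>f\<in>Cinf A. X f \<in> Cinf A) \<and>
     (\<forall>f. f \<notin> Cinf A \<longrightarrow> X f = (\<lambda>p. 0)) \<and>
     (\<forall>f\<in>Cinf A. \<forall>h\<in>Cinf A. \<forall>a b.
        X (\<lambda>p. a * f p + b * h p) = (\<lambda>p. a * X f p + b * X h p)) \<and>
     (\<forall>f\<in>Cinf A. \<forall>h\<in>Cinf A. X (\<lambda>p. f p * h p) = (\<lambda>p. f p * X h p + h p * X f p))}"

definition one_form :: "('a, 'e::euclidean_space) atlas \<Rightarrow> ('a vfield \<Rightarrow> 'a \<Rightarrow> real) \<Rightarrow> bool" where
  "one_form A \<omega> \<longleftrightarrow>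
     (\<forall>X\<in>vfields A. \<omega> X \<in> Cinf A) \<and>
     (\<forall>X\<in>vfields A. \<forall>Y\<in>vfields A. \<omega> (X \<oplus>\<^sub>v Y) = (\<lambda>p. \<omega> X p + \<omega> Y p)) \<and>
     (\<forall>h\<in>Cinf A. \<forall>X\<in>vfields A. \<omega> (h \<odot>\<^sub>v X) = (\<lambda>p. h p * \<omega> X p))"

definition endo_field :: "('a, 'e::euclidean_space) atlas \<Rightarrow> ('a vfield \<Rightarrow> 'a vfield) \<Rightarrow> bool" where
  "endo_field A \<phi> \<longleftrightarrow>
     (\<forall>X\<in>vfields A. \<phi> X \<in> vfields A) \<and>
     (\<forall>X\<in>vfields A. \<forall>Y\<in>vfields A. \<phi> (X \<oplus>\<^sub>v Y) = \<phi> X \<oplus>\<^sub>v \<phi> Y) \<and>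
     (\<forall>h\<in>Cinf A. \<forall>X\<in>vfields A. \<phi> (h \<odot>\<^sub>v X) = h \<odot>\<^sub>v \<phi> X)"

text \<open>
  Unlike the other tensor fields, (1,2)-tensor fields are required to be extensional, since
  sets of them are going to be compared.
\<close>

definition tensor12 ::
    "('a, 'e::euclidean_space) atlas \<Rightarrow> ('a vfield \<Rightarrow> 'a vfield \<Rightarrow> 'a vfield) \<Rightarrow> bool" where
  "tensor12 A S \<longleftrightarrow>
     S \<in> vfields A \<rightarrow>\<^sub>E vfields A \<rightarrow>\<^sub>E vfields A \<and>
     (\<forall>X\<in>vfields A. endo_field A (S X)) \<and>
     (\<forall>Y\<in>vfields A. endo_field A (\<lambda>X. S X Y))"

definition riemannian_metric ::
    "('a, 'e::euclidean_space) atlas \<Rightarrow> ('a vfield \<Rightarrow> 'a vfield \<Rightarrow> 'a \<Rightarrow> real) \<Rightarrow> bool" where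
  "riemannian_metric A g \<longleftrightarrow>
     (\<forall>X\<in>vfields A. one_form A (g X)) \<and>
     (\<forall>X\<in>vfields A. \<forall>Y\<in>vfields A. g X Y = g Y X) \<and>
     (\<forall>X\<in>vfields A. \<forall>p. (\<exists>f. X f p \<noteq> 0) \<longrightarrow> g X X p > 0)"

definition linear_connection ::
    "('a, 'e::euclidean_space) atlas \<Rightarrow> ('a vfield \<Rightarrow> 'a vfield \<Rightarrow> 'a vfield) \<Rightarrow> bool" where
  "linear_connection A D \<longleftrightarrow>
     (\<forall>Y\<in>vfields A. endo_field A (\<lambda>X. D X Y)) \<and>
     (\<forall>X\<in>vfields A. \<forall>Y\<in>vfields A. \<forall>Z\<in>vfields A. D X (Y \<oplus>\<^sub>v Z) = D X Y \<oplus>\<^sub>v D X Z) \<and>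
     (\<forall>h\<in>Cinf A. \<forall>X\<in>vfields A. \<forall>Y\<in>vfields A. D X (h \<odot>\<^sub>v Y) = X h \<odot>\<^sub>v Y \<oplus>\<^sub>v h \<odot>\<^sub>v D X Y)"

definition cov_metric ::
    "('a vfield \<Rightarrow> 'a vfield \<Rightarrow> 'a vfield) \<Rightarrow> ('a vfield \<Rightarrow> 'a vfield \<Rightarrow> 'a \<Rightarrow> real) \<Rightarrow>
     'a vfield \<Rightarrow> 'a vfield \<Rightarrow> 'a vfield \<Rightarrow> 'a \<Rightarrow> real" where
  "cov_metric D g W X Y = (\<lambda>p. W (g X Y) p - g (D W X) Y p - g X (D W Y) p)"

definition cov_endo ::
    "('a vfield \<Rightarrow> 'a vfield \<Rightarrow> 'a vfield) \<Rightarrow> ('a vfield \<Rightarrow> 'a vfield) \<Rightarrow>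
     'a vfield \<Rightarrow> 'a vfield \<Rightarrow> 'a vfield" where
  "cov_endo D \<phi> W X = D W (\<phi> X) \<ominus>\<^sub>v \<phi> (D W X)"

definition cov_tensor12 ::
    "('a vfield \<Rightarrow> 'a vfield \<Rightarrow> 'a vfield) \<Rightarrow> ('a vfield \<Rightarrow> 'a vfield \<Rightarrow> 'a vfield) \<Rightarrow>
     'a vfield \<Rightarrow> 'a vfield \<Rightarrow> 'a vfield \<Rightarrow> 'a vfield" where
  "cov_tensor12 D S W X Y = D W (S X Y) \<ominus>\<^sub>v S (D W X) Y \<ominus>\<^sub>v S X (D W Y)"

definition cov_tensor13 ::
    "('a vfield \<Rightarrow> 'a vfield \<Rightarrow> 'a vfield) \<Rightarrow> ('a vfield \<Rightarrow> 'a vfield \<Rightarrow> 'a vfield \<Rightarrow> 'a vfield) \<Rightarrow>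
     'a vfield \<Rightarrow> 'a vfield \<Rightarrow> 'a vfield \<Rightarrow> 'a vfield \<Rightarrow> 'a vfield" where
  "cov_tensor13 D R W X Y Z =
     D W (R X Y Z) \<ominus>\<^sub>v R (D W X) Y Z \<ominus>\<^sub>v R X (D W Y) Z \<ominus>\<^sub>v R X Y (D W Z)"

definition levi_civita ::
    "('a, 'e::euclidean_space) atlas \<Rightarrow> ('a vfield \<Rightarrow> 'a vfield \<Rightarrow> 'a \<Rightarrow> real) \<Rightarrow>
     ('a vfield \<Rightarrow> 'a vfield \<Rightarrow> 'a vfield) \<Rightarrow> bool" where
  "levi_civita A g D \<longleftrightarrow>
     linear_connection A D \<and>
     (\<forall>X\<in>vfields A. \<forall>Y\<in>vfields A. D X Y \<ominus>\<^sub>v D Y X = bracket X Y) \<and>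
     (\<forall>X\<in>vfields A. \<forall>Y\<in>vfields A. \<forall>Z\<in>vfields A. cov_metric D g X Y Z = (\<lambda>p. 0))"

definition curvature ::
    "('a vfield \<Rightarrow> 'a vfield \<Rightarrow> 'a vfield) \<Rightarrow> 'a vfield \<Rightarrow> 'a vfield \<Rightarrow> 'a vfield \<Rightarrow> 'a vfield" where
  "curvature D X Y Z = D X (D Y Z) \<ominus>\<^sub>v D Y (D X Z) \<ominus>\<^sub>v D (bracket X Y) Z"

text \<open>The sectional curvature at \<open>p\<close> of the plane spanned by the values of \<open>X\<close> and \<open>Y\<close> at \<open>p\<close>.\<close>

definition sectional_curvature ::
    "('a vfield \<Rightarrow> 'a vfield \<Rightarrow> 'a \<Rightarrow> real) \<Rightarrow> ('a vfield \<Rightarrow> 'a vfield \<Rightarrow> 'a vfield) \<Rightarrow>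
     'a vfield \<Rightarrow> 'a vfield \<Rightarrow> 'a \<Rightarrow> real" where
  "sectional_curvature g D X Y p =
     g (curvature D X Y Y) X p / (g X X p * g Y Y p - (g X Y p)\<^sup>2)"

section \<open>Completeness\<close>

text \<open>
  The Riemannian distance is the infimum of the lengths of smooth curves. Curves are
  parametrised by all of \<open>real\<close> and used on \<open>[0,1]\<close>; they may have zero velocity, so that
  every piecewise smooth curve is covered after a reparametrisation.
  \<open>speed A g \<gamma> t\<close> is the norm of the velocity vector \<open>f \<mapsto> (f \<circ> \<gamma>)'(t)\<close>, computed with any
  vector field \<open>X\<close> that takes this value at \<open>\<gamma> t\<close>.
\<close>

definition smooth_curve :: "('a, 'e::euclidean_space) atlas \<Rightarrow> (real \<Rightarrow> 'a) \<Rightarrow> bool" where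
  "smooth_curve A \<gamma> \<longleftrightarrow> (\<forall>f\<in>Cinf A. Cinf_on (f \<circ> \<gamma>) UNIV)"

definition speed ::
    "('a, 'e::euclidean_space) atlas \<Rightarrow> ('a vfield \<Rightarrow> 'a vfield \<Rightarrow> 'a \<Rightarrow> real) \<Rightarrow>
     (real \<Rightarrow> 'a) \<Rightarrow> real \<Rightarrow> real" where
  "speed A g \<gamma> t = (THE s. \<exists>X\<in>vfields A.
     (\<forall>f\<in>Cinf A. ((f \<circ> \<gamma>) has_real_derivative X f (\<gamma> t)) (at t)) \<and> s = sqrt (g X X (\<gamma> t)))"

definition riemannian_dist ::
    "('a, 'e::euclidean_space) atlas \<Rightarrow> ('a vfield \<Rightarrow> 'a vfield \<Rightarrow> 'a \<Rightarrow> real) \<Rightarrow> 'a \<Rightarrow> 'a \<Rightarrow> real" where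
  "riemannian_dist A g p q =
     Inf {integral {0..1} (speed A g \<gamma>) | \<gamma>. smooth_curve A \<gamma> \<and> \<gamma> 0 = p \<and> \<gamma> 1 = q}"

definition riemannian_complete ::
    "('a, 'e::euclidean_space) atlas \<Rightarrow> ('a vfield \<Rightarrow> 'a vfield \<Rightarrow> 'a \<Rightarrow> real) \<Rightarrow> bool" where
  "riemannian_complete A g \<longleftrightarrow> Metric_space.mcomplete UNIV (riemannian_dist A g)"

section \<open>Contact Riemannian and Sasakian manifolds\<close>

text \<open>The exterior derivative carries the factor 1/2, as usual in contact metric geometry.\<close>

definition ext_deriv :: "('a vfield \<Rightarrow> 'a \<Rightarrow> real) \<Rightarrow> 'a vfield \<Rightarrow> 'a vfield \<Rightarrow> 'a \<Rightarrow> real" where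
  "ext_deriv \<omega> X Y = (\<lambda>p. (X (\<omega> Y) p - Y (\<omega> X) p - \<omega> (bracket X Y) p) / 2)"

text \<open>
  The cyclic sum below is \<open>\<eta> \<and> d\<eta>\<close> up to a positive constant depending on the convention for
  the wedge product; in dimension 3 it must vanish nowhere.
\<close>

definition contact_form :: "('a, 'e::euclidean_space) atlas \<Rightarrow> ('a vfield \<Rightarrow> 'a \<Rightarrow> real) \<Rightarrow> bool" where
  "contact_form A \<eta> \<longleftrightarrow> one_form A \<eta> \<and>
     (\<forall>p. \<exists>X\<in>vfields A. \<exists>Y\<in>vfields A. \<exists>Z\<in>vfields A.
        \<eta> X p * ext_deriv \<eta> Y Z p + \<eta> Y p * ext_deriv \<eta> Z X p + \<eta> Z p * ext_deriv \<eta> X Y p \<noteq> 0)"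

record 'a contact_structure =
  form :: "'a vfield \<Rightarrow> 'a \<Rightarrow> real"
  reeb :: "'a vfield"
  endo :: "'a vfield \<Rightarrow> 'a vfield"
  rmetric :: "'a vfield \<Rightarrow> 'a vfield \<Rightarrow> 'a \<Rightarrow> real"

definition contact_riemannian_3manifold ::
    "('a::{t2_space,second_countable_topology}, real^3) atlas \<Rightarrow> 'a contact_structure \<Rightarrow> bool" where
  "contact_riemannian_3manifold A M \<longleftrightarrow>
     (let \<eta> = form M; \<xi> = reeb M; \<phi> = endo M; g = rmetric M in
       smooth_manifold A \<and> contact_form A \<eta> \<and> \<xi> \<in> vfields A \<and>
       endo_field A \<phi> \<and> riemannian_metric A g \<and>
       \<eta> \<xi> = (\<lambda>p. 1) \<and>
       (\<forall>X\<in>vfields A. ext_deriv \<eta> \<xi> X = (\<lambda>p. 0)) \<and>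
       (\<forall>X\<in>vfields A. \<phi> (\<phi> X) = \<eta> X \<odot>\<^sub>v \<xi> \<ominus>\<^sub>v X) \<and>
       (\<forall>X\<in>vfields A. \<forall>Y\<in>vfields A. g (\<phi> X) (\<phi> Y) = (\<lambda>p. g X Y p - \<eta> X p * \<eta> Y p)) \<and>
       (\<forall>X\<in>vfields A. g \<xi> X = \<eta> X) \<and>
       (\<forall>X\<in>vfields A. \<forall>Y\<in>vfields A. ext_deriv \<eta> X Y = g X (\<phi> Y)))"

text \<open>In the following definitions \<open>D\<close> is the Levi-Civita connection of the metric.\<close>

definition sasakian ::
    "('a::{t2_space,second_countable_topology}, real^3) atlas \<Rightarrow> 'a contact_structure \<Rightarrow>
     ('a vfield \<Rightarrow> 'a vfield \<Rightarrow> 'a vfield) \<Rightarrow> bool" where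
  "sasakian A M D \<longleftrightarrow>
     contact_riemannian_3manifold A M \<and> levi_civita A (rmetric M) D \<and>
     (\<forall>X\<in>vfields A. \<forall>Y\<in>vfields A.
        cov_endo D (endo M) X Y = rmetric M X Y \<odot>\<^sub>v reeb M \<ominus>\<^sub>v form M Y \<odot>\<^sub>v X)"

text \<open>\<open>Z\<close> takes at \<open>p\<close> a value in the span of the values of \<open>X\<close> and \<open>Y\<close>.\<close>

definition in_span_at :: "'a vfield \<Rightarrow> 'a vfield \<Rightarrow> 'a vfield \<Rightarrow> 'a \<Rightarrow> bool" where
  "in_span_at X Y Z p \<longleftrightarrow> (\<exists>a b. \<forall>f. Z f p = a * X f p + b * Y f p)"

definition independent_at :: "'a vfield \<Rightarrow> 'a vfield \<Rightarrow> 'a \<Rightarrow> bool" where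
  "independent_at X Y p \<longleftrightarrow> (\<forall>a b. (\<forall>f. a * X f p + b * Y f p = 0) \<longrightarrow> a = 0 \<and> b = 0)"

definition constant_holomorphic_curvature ::
    "('a, 'e::euclidean_space) atlas \<Rightarrow> 'a contact_structure \<Rightarrow>
     ('a vfield \<Rightarrow> 'a vfield \<Rightarrow> 'a vfield) \<Rightarrow> real \<Rightarrow> bool" where
  "constant_holomorphic_curvature A M D c \<longleftrightarrow>
     (\<forall>p. \<forall>X\<in>vfields A. \<forall>Y\<in>vfields A.
        independent_at X Y p \<and> in_span_at X Y (endo M X) p \<and> in_span_at X Y (endo M Y) p \<longrightarrow>
        sectional_curvature (rmetric M) D X Y p = c)"

definition sasakian_space_form ::
    "('a::{t2_space,second_countable_topology}, real^3) atlas \<Rightarrow> 'a contact_structure \<Rightarrow>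
     ('a vfield \<Rightarrow> 'a vfield \<Rightarrow> 'a vfield) \<Rightarrow> real \<Rightarrow> bool" where
  "sasakian_space_form A M D c \<longleftrightarrow>
     sasakian A M D \<and> connected (UNIV :: 'a set) \<and> riemannian_complete A (rmetric M) \<and>
     constant_holomorphic_curvature A M D c"

section \<open>Homogeneous structures\<close>

definition homogeneous_riemannian_structure ::
    "('a, 'e::euclidean_space) atlas \<Rightarrow> ('a vfield \<Rightarrow> 'a vfield \<Rightarrow> 'a \<Rightarrow> real) \<Rightarrow>
     ('a vfield \<Rightarrow> 'a vfield \<Rightarrow> 'a vfield) \<Rightarrow> ('a vfield \<Rightarrow> 'a vfield \<Rightarrow> 'a vfield) \<Rightarrow> bool" where
  "homogeneous_riemannian_structure A g D S \<longleftrightarrow>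
     tensor12 A S \<and>
     (let D' = (\<lambda>X Y. D X Y \<oplus>\<^sub>v S X Y) in
       (\<forall>W\<in>vfields A. \<forall>X\<in>vfields A. \<forall>Y\<in>vfields A. cov_metric D' g W X Y = (\<lambda>p. 0)) \<and>
       (\<forall>W\<in>vfields A. \<forall>X\<in>vfields A. \<forall>Y\<in>vfields A. \<forall>Z\<in>vfields A.
          cov_tensor13 D' (curvature D) W X Y Z = vzero) \<and>
       (\<forall>W\<in>vfields A. \<forall>X\<in>vfields A. \<forall>Y\<in>vfields A. cov_tensor12 D' S W X Y = vzero))"

definition homogeneous_contact_riemannian_structure ::
    "('a, 'e::euclidean_space) atlas \<Rightarrow> 'a contact_structure \<Rightarrow>
     ('a vfield \<Rightarrow> 'a vfield \<Rightarrow> 'a vfield) \<Rightarrow> ('a vfield \<Rightarrow> 'a vfield \<Rightarrow> 'a vfield) \<Rightarrow> bool" where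
  "homogeneous_contact_riemannian_structure A M D S \<longleftrightarrow>
     homogeneous_riemannian_structure A (rmetric M) D S \<and>
     (\<forall>W\<in>vfields A. \<forall>X\<in>vfields A. cov_endo (\<lambda>X Y. D X Y \<oplus>\<^sub>v S X Y) (endo M) W X = vzero)"

definition A_tensor ::
    "('a, 'e::euclidean_space) atlas \<Rightarrow> 'a contact_structure \<Rightarrow> real \<Rightarrow>
     'a vfield \<Rightarrow> 'a vfield \<Rightarrow> 'a vfield" where
  "A_tensor A M r = (\<lambda>X\<in>vfields A. \<lambda>Y\<in>vfields A.
     ext_deriv (form M) X Y \<odot>\<^sub>v reeb M
       \<ominus>\<^sub>v (\<lambda>p. r * form M X p) \<odot>\<^sub>v endo M Y \<oplus>\<^sub>v form M Y \<odot>\<^sub>v endo M X)"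

text \<open>The difference \<open>D' - D\<close> of two linear connections, as an extensional tensor field.\<close>

definition connection_diff ::
    "('a, 'e::euclidean_space) atlas \<Rightarrow> ('a vfield \<Rightarrow> 'a vfield \<Rightarrow> 'a vfield) \<Rightarrow>
     ('a vfield \<Rightarrow> 'a vfield \<Rightarrow> 'a vfield) \<Rightarrow> 'a vfield \<Rightarrow> 'a vfield \<Rightarrow> 'a vfield" where
  "connection_diff A D' D = (\<lambda>X\<in>vfields A. \<lambda>Y\<in>vfields A. D' X Y \<ominus>\<^sub>v D X Y)"

section \<open>Isomorphisms\<close>

definition push_vfield :: "('a \<Rightarrow> 'b) \<Rightarrow> 'a vfield \<Rightarrow> 'b vfield" where
  "push_vfield F X = (\<lambda>f. X (f \<circ> F) \<circ> inv F)"

definition pull_connection ::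
    "('a \<Rightarrow> 'b) \<Rightarrow> ('b vfield \<Rightarrow> 'b vfield \<Rightarrow> 'b vfield) \<Rightarrow> 'a vfield \<Rightarrow> 'a vfield \<Rightarrow> 'a vfield" where
  "pull_connection F D X Y = push_vfield (inv F) (D (push_vfield F X) (push_vfield F Y))"

definition contact_isomorphism ::
    "('a, 'e::euclidean_space) atlas \<Rightarrow> 'a contact_structure \<Rightarrow>
     ('b, 'd::euclidean_space) atlas \<Rightarrow> 'b contact_structure \<Rightarrow> ('a \<Rightarrow> 'b) \<Rightarrow> bool" where
  "contact_isomorphism A M B N F \<longleftrightarrow>
     diffeomorphism A B F \<and>
     (\<forall>X\<in>vfields A. form N (push_vfield F X) \<circ> F = form M X) \<and>
     push_vfield F (reeb M) = reeb N \<and>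
     (\<forall>X\<in>vfields A. push_vfield F (endo M X) = endo N (push_vfield F X)) \<and>
     (\<forall>X\<in>vfields A. \<forall>Y\<in>vfields A.
        rmetric N (push_vfield F X) (push_vfield F Y) \<circ> F = rmetric M X Y)"

section \<open>The Sasakian Lie group \<open>GA\<^sup>+(1) \<times> \<real>\<close>\<close>

text \<open>
  An orientation preserving affine map \<open>s \<mapsto> a s + b\<close>, \<open>a > 0\<close>, is represented by
  \<open>(ln a, b)\<close>. In these global coordinates the manifold underlying the group is a vector space.
\<close>

type_synonym ga = "real \<times> real \<times> real"

definition ga_atlas :: "(ga, ga) atlas" where
  "ga_atlas = {(UNIV, id)}"

fun ga_action :: "ga \<Rightarrow> real \<times> real \<Rightarrow> real \<times> real" where
  "ga_action (x, y, t) (s, v) = (exp x * s + y, t + v)"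

fun ga_mult :: "ga \<Rightarrow> ga \<Rightarrow> ga" where
  "ga_mult (x, y, t) (x', y', t') = (x + x', exp x * y' + y, t + t')"

lemma ga_action_mult: "ga_action (ga_mult k l) = ga_action k \<circ> ga_action l"
  by (cases k rule: prod_cases3; cases l rule: prod_cases3)
    (auto simp: fun_eq_iff exp_add algebra_simps)

lemma range_ga_action:
  "range ga_action = {\<lambda>(s, v). (a * s + b, d + v) | a b d. a > 0}"
proof (intro subset_antisym subsetI)
  fix h assume "h \<in> range ga_action"
  then obtain x y t where "h = ga_action (x, y, t)" by auto
  then have "h = (\<lambda>(s, v). (exp x * s + y, t + v))" by (auto simp: fun_eq_iff)
  then show "h \<in> {\<lambda>(s, v). (a * s + b, d + v) | a b d. a > 0}" using exp_gt_zero by blast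
next
  fix h assume "h \<in> {\<lambda>(s, v). (a * s + b, d + v) :: real \<times> real | a b d. a > 0}"
  then obtain a b d where "a > 0" "h = (\<lambda>(s, v). (a * s + b, d + v))" by blast
  then have "h = ga_action (ln a, b, d)" by (auto simp: fun_eq_iff)
  then show "h \<in> range ga_action" by blast
qed

lemma inj_ga_action: "inj ga_action"
proof (rule injI)
  fix k l assume eq: "ga_action k = ga_action l"
  obtain x y t x' y' t' where kl: "k = (x, y, t)" "l = (x', y', t')"
    by (metis prod_cases3)
  have "ga_action k (0, 0) = ga_action l (0, 0)" "ga_action k (1, 0) = ga_action l (1, 0)"
    using eq by simp_all
  then show "k = l" by (simp add: kl)
qed

definition left_invariant ::
    "('a, 'e::euclidean_space) atlas \<Rightarrow> ('a \<Rightarrow> 'a \<Rightarrow> 'a) \<Rightarrow> 'a vfield \<Rightarrow> bool" where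
  "left_invariant A m X \<longleftrightarrow> X \<in> vfields A \<and> (\<forall>a. \<forall>f\<in>Cinf A. X (f \<circ> m a) = X f \<circ> m a)"

definition cartan_schouten_minus ::
    "('a, 'e::euclidean_space) atlas \<Rightarrow> ('a \<Rightarrow> 'a \<Rightarrow> 'a) \<Rightarrow>
     ('a vfield \<Rightarrow> 'a vfield \<Rightarrow> 'a vfield) \<Rightarrow> bool" where
  "cartan_schouten_minus A m D \<longleftrightarrow>
     linear_connection A D \<and>
     (\<forall>X Y. left_invariant A m X \<and> left_invariant A m Y \<longrightarrow> D X Y = vzero)"

text \<open>
  The structure is determined by the frame \<open>e1, e2, e3\<close>; the frame itself is unique up to an
  automorphism of the Lie algebra.
\<close>

definition ga_sasakian_structure :: "real \<Rightarrow> ga contact_structure \<Rightarrow> bool" where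
  "ga_sasakian_structure c N \<longleftrightarrow>
     one_form ga_atlas (form N) \<and> endo_field ga_atlas (endo N) \<and>
     riemannian_metric ga_atlas (rmetric N) \<and>
     (\<exists>e1 e2 e3.
        left_invariant ga_atlas ga_mult e1 \<and>
        left_invariant ga_atlas ga_mult e2 \<and>
        left_invariant ga_atlas ga_mult e3 \<and>
        bracket e1 e2 = (\<lambda>p. sqrt (- (c + 3))) \<odot>\<^sub>v e2 \<oplus>\<^sub>v (\<lambda>p. 2) \<odot>\<^sub>v e3 \<and>
        bracket e2 e3 = vzero \<and> bracket e3 e1 = vzero \<and>
        rmetric N e1 e1 = (\<lambda>p. 1) \<and> rmetric N e2 e2 = (\<lambda>p. 1) \<and> rmetric N e3 e3 = (\<lambda>p. 1) \<and>
        rmetric N e1 e2 = (\<lambda>p. 0) \<and> rmetric N e2 e3 = (\<lambda>p. 0) \<and> rmetric N e3 e1 = (\<lambda>p. 0) \<and>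
        endo N e1 = e2 \<and> endo N e2 = vzero \<ominus>\<^sub>v e1 \<and> endo N e3 = vzero \<and>
        reeb N = e3 \<and> (\<forall>X\<in>vfields ga_atlas. form N X = rmetric N X e3))"

text \<open>
  The identifications of a Sasakian manifold with the Sasakian Lie group. They differ by
  automorphisms of the Sasakian manifold, which do not in general preserve the
  \<open>(-)\<close>-connection.
\<close>

definition ga_identification ::
    "real \<Rightarrow> ('a, 'e::euclidean_space) atlas \<Rightarrow> 'a contact_structure \<Rightarrow> ('a \<Rightarrow> ga) \<Rightarrow> bool" where
  "ga_identification c A M F \<longleftrightarrow>
     (\<exists>N. ga_sasakian_structure c N \<and> contact_isomorphism A M ga_atlas N F)"

end

theory Submission
  imports Defs
begin

text \<open>On a Sasakian 3-manifold the homogeneous contact structures are the tensors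
  \<open>S X Y = A\<^sup>r X Y + g(U, X) \<phi> Y\<close> with \<open>U\<close> horizontal and parallel for \<open>D + S\<close>; conversely every such
  \<open>U\<close> gives one when the holomorphic curvature is constant. If \<open>U \<noteq> 0\<close>, then \<open>U\<close> has constant length \<open>\<alpha>\<close>
  and the structure equations of the frame \<open>e, \<phi> e = U / \<alpha>, \<xi>\<close> force \<open>r = -1\<close>, \<open>\<alpha>\<^sup>2 = -(c + 3)\<close> and the
  bracket relations of the Lie algebra of \<open>GA\<^sup>+(1) \<times> \<real>\<close>; then \<open>D + S\<close> is the connection for which this
  frame is parallel.

  A frame with these brackets exists whenever \<open>c < -3\<close>: the lift of \<open>f\<close> with Hessian \<open>\<alpha>\<^sup>2 f\<close> times the
  metric from the hyperbolic plane solves a flat linear system, and \<open>e = - grad f / (\<alpha> f)\<close> works for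
  a null solution. From such a frame one reads off closed 1-forms, whose potentials \<open>(x, y, t)\<close>
  form a local diffeomorphism to the group carrying the frame to a left invariant one. Completeness
  extends its local inverses along straight lines, so it is a global diffeomorphism.\<close>

text \<open>The sign of \<open>c + 3\<close> decides because \<open>c + 3\<close> is the curvature
  of the local quotient by the Reeb flow. A nonzero \<open>U\<close> descends to that quotient, of
  curvature \<open>- \<alpha>\<^sup>2\<close>. There \<open>e\<close> is tangent to geodesics with
  one common ideal end point, \<open>\<phi> e\<close> to the horocycles around it, and a null
  solution \<open>f\<close> is the exponential of a multiple of a Busemann function. Each ideal
  point gives its own \<open>e\<close>, hence its own identification with the group and its own
  connection, which is why the second set of the theorem ranges over all identifications. The
  obstacle that shapes the text is that no tangent spaces are at hand: fields are derivations of the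
  algebra of global smooth functions. Pointwise statements are recovered by cutoffs and Hadamard's
  formula, and local constructions have to be extended to global functions before a field can be
  applied to them. For the same reason solutions of the linear system are continued abstractly, as
  values in the fibres of a local system, and only afterwards reassembled into a function and a
  field.\<close>

lemma has_derivative_cong_open:
  assumes "(f has_derivative f') (at x)" "open S" "x \<in> S" "\<And>y. y \<in> S \<Longrightarrow> f y = g y"
  shows "(g has_derivative f') (at x)"
  using has_derivative_transform_within_open[of f f' x UNIV S g] assms by auto

section \<open>Calculus of \<open>Ck_on\<close> and \<open>Cinf_on\<close> on open sets\<close>

lemma Ck_on_imp_continuous: "Ck_on k f S \<Longrightarrow> continuous_on S f"
proof (cases k)
  case (Suc n)
  assume "Ck_on k f S"
  with Suc have "f differentiable_on S"
    by (auto simp: differentiable_on_def intro: differentiable_at_withinI)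
  then show ?thesis by (rule differentiable_imp_continuous_on)
qed auto

lemma Ck_on_subset: "Ck_on k f S \<Longrightarrow> T \<subseteq> S \<Longrightarrow> Ck_on k f T"
  by (induction k arbitrary: f) (auto intro: continuous_on_subset)

lemma Ck_on_SucD: "Ck_on (Suc k) f S \<Longrightarrow> Ck_on k f S"
proof (induction k arbitrary: f)
  case 0 then show ?case using Ck_on_imp_continuous[OF 0] by simp
qed simp

lemma Ck_on_Suc_has_derivative:
  "Ck_on (Suc k) f S \<Longrightarrow> x \<in> S \<Longrightarrow> (f has_derivative frechet_derivative f (at x)) (at x)"
  using frechet_derivative_works by (metis Ck_on.simps(2))

text \<open>The derivatives in \<open>Ck_on\<close> are taken in the whole space, so agreement on
  \<open>S\<close> passes on to them only because \<open>S\<close> is open.\<close>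

lemma Ck_on_cong_imp:
  assumes "open S" "\<And>x. x \<in> S \<Longrightarrow> f x = g x" "Ck_on k f S"
  shows "Ck_on k g S"
  using assms(2,3)
proof (induction k arbitrary: f g)
  case 0 then show ?case using continuous_on_cong[of S S f g] by auto
next
  case (Suc k)
  have d: "(g has_derivative frechet_derivative f (at x)) (at x)" if "x \<in> S" for x
    by (rule has_derivative_cong_open[OF Ck_on_Suc_has_derivative[OF Suc.prems(2) that] assms(1) that])
      (use Suc.prems(1) in auto)
  have e: "frechet_derivative g (at x) = frechet_derivative f (at x)" if "x \<in> S" for x
    using frechet_derivative_at[OF d[OF that]] by simp
  show ?case
  proof (simp, intro conjI ballI allI)
    show "g differentiable at x" if "x \<in> S" for x using d[OF that] differentiableI by blast
    show "Ck_on k (\<lambda>x. frechet_derivative g (at x) v) S" for v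
      by (rule Suc.IH[of "\<lambda>x. frechet_derivative f (at x) v"]) (use Suc.prems e in auto)
  qed
qed

lemma Ck_on_cong:
  assumes "open S" "\<And>x. x \<in> S \<Longrightarrow> f x = g x"
  shows "Ck_on k f S \<longleftrightarrow> Ck_on k g S"
  using Ck_on_cong_imp[OF assms(1), of f g] Ck_on_cong_imp[OF assms(1), of g f] assms(2) by auto

text \<open>Lets an explicit family of derivatives replace the chosen
  \<open>frechet_derivative\<close>; the inductive closure properties for sums, products and
  compositions go through this rule.\<close>

lemma Ck_on_SucI:
  assumes "open S" "\<And>x. x \<in> S \<Longrightarrow> (f has_derivative f' x) (at x)"
    "\<And>v. Ck_on k (\<lambda>x. f' x v) S"
  shows "Ck_on (Suc k) f S"
proof -
  have e: "frechet_derivative f (at x) = f' x" if "x \<in> S" for x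
    using frechet_derivative_at[OF assms(2)[OF that]] by simp
  have "Ck_on k (\<lambda>x. frechet_derivative f (at x) v) S" for v
    by (rule Ck_on_cong_imp[OF assms(1) _ assms(3)[of v]]) (use e in auto)
  then show ?thesis using assms(2) differentiableI by fastforce
qed

lemma Ck_on_local:
  assumes "\<And>x. x \<in> S \<Longrightarrow> \<exists>T. open T \<and> x \<in> T \<and> Ck_on k f T"
  shows "Ck_on k f S"
  using assms
proof (induction k arbitrary: f)
  case 0
  have "continuous (at x within S) f" if "x \<in> S" for x
    using 0[OF that] by (auto simp: continuous_on_eq_continuous_at intro: continuous_at_imp_continuous_at_within)
  then show ?case by (simp add: continuous_on_eq_continuous_within)
next
  case (Suc k)
  show ?case
  proof (simp, intro conjI ballI allI)
    show "f differentiable at x" if "x \<in> S" for x using Suc.prems[OF that] by auto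
    show "Ck_on k (\<lambda>x. frechet_derivative f (at x) v) S" for v
      by (rule Suc.IH) (use Suc.prems in fastforce)
  qed
qed

lemma Ck_on_const: "Ck_on k (\<lambda>x. c) S"
proof (induction k arbitrary: c)
  case (Suc k)
  have "frechet_derivative (\<lambda>x. c) (at x) v = 0" for x v :: 'a
    using frechet_derivative_at[OF has_derivative_const[of c "at x"]] by metis
  then show ?case using Suc by simp
qed simp

lemma Ck_on_linear:
  assumes "open S" "bounded_linear f" shows "Ck_on k f S"
proof (cases k)
  case 0 then show ?thesis using assms(2) by (simp add: bounded_linear.continuous_on linear_continuous_on)
next
  case (Suc n)
  show ?thesis unfolding Suc
    by (rule Ck_on_SucI[OF assms(1), of _ "\<lambda>x. f"])
       (auto intro: bounded_linear_imp_has_derivative assms Ck_on_const)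
qed

lemma Ck_on_add:
  assumes "open S" "Ck_on k f S" "Ck_on k g S" shows "Ck_on k (\<lambda>x. f x + g x) S"
  using assms(2,3)
proof (induction k arbitrary: f g)
  case 0 then show ?case by (simp add: continuous_on_add)
next
  case (Suc k)
  show ?case
  proof (rule Ck_on_SucI[OF assms(1)])
    show "((\<lambda>x. f x + g x) has_derivative
        (\<lambda>v. frechet_derivative f (at x) v + frechet_derivative g (at x) v)) (at x)" if "x \<in> S" for x
      using Suc.prems that by (intro has_derivative_add Ck_on_Suc_has_derivative)
  qed (use Suc in auto)
qed

lemma Ck_on_mult:
  assumes "open S" "Ck_on k f S" "Ck_on k g S" shows "Ck_on k (\<lambda>x. f x * g x) S"
  using assms(2,3)
proof (induction k arbitrary: f g)
  case 0 then show ?case by (simp add: continuous_on_mult)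
next
  case (Suc k)
  show ?case
  proof (rule Ck_on_SucI[OF assms(1)])
    show "((\<lambda>x. f x * g x) has_derivative
        (\<lambda>v. f x * frechet_derivative g (at x) v + frechet_derivative f (at x) v * g x)) (at x)" if "x \<in> S" for x
      using Suc.prems that by (intro has_derivative_mult Ck_on_Suc_has_derivative)
    show "Ck_on k (\<lambda>x. f x * frechet_derivative g (at x) v + frechet_derivative f (at x) v * g x) S" for v
      using Ck_on_SucD[OF Suc.prems(1)] Ck_on_SucD[OF Suc.prems(2)] Suc.prems
      by (intro Ck_on_add[OF assms(1)] Suc.IH) auto
  qed
qed

lemma Ck_on_sum:
  assumes "open S" "\<And>i. i \<in> I \<Longrightarrow> Ck_on k (f i) S" shows "Ck_on k (\<lambda>x. \<Sum>i\<in>I. f i x) S"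
  using assms(2) by (induction I rule: infinite_finite_induct)
    (auto intro: Ck_on_const Ck_on_add[OF assms(1)])

text \<open>Induction on \<open>k\<close> for all \<open>f\<close> at once. The chain rule gives a
  sum over the basis of a derivative of a component of \<open>G\<close> times a directional
  derivative of \<open>f\<close> at \<open>G x\<close>; the second factor falls to the induction
  hypothesis after one order of \<open>G\<close> is given up.\<close>

lemma Ck_on_compose:
  fixes G :: "'d::euclidean_space \<Rightarrow> 'e::euclidean_space"
  assumes "open S" "open T" "G ` S \<subseteq> T" "Ck_on k f T" "\<And>b. b \<in> Basis \<Longrightarrow> Ck_on k (\<lambda>x. G x \<bullet> b) S"
  shows "Ck_on k (\<lambda>x. f (G x)) S"
  using assms(4,5)
proof (induction k arbitrary: f)
  case 0
  then have "continuous_on S G"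
    by (subst continuous_on_componentwise) (use 0 in simp)
  with 0 show ?case using continuous_on_compose2[of T f S G] assms(3) by auto
next
  case (Suc k)
  define G' where "G' x v = (\<Sum>b\<in>Basis. frechet_derivative (\<lambda>y. G y \<bullet> b) (at x) v *\<^sub>R b)" for x v
  have dG: "(G has_derivative G' x) (at x)" if "x \<in> S" for x
  proof (subst has_derivative_componentwise_within, intro ballI)
    fix b :: 'e assume b: "b \<in> Basis"
    have "(\<lambda>v. G' x v \<bullet> b) = frechet_derivative (\<lambda>y. G y \<bullet> b) (at x)"
      using b by (simp add: G'_def fun_eq_iff inner_sum_left inner_Basis if_distrib[of "(*) _"] sum.delta' cong: if_cong)
    then show "((\<lambda>x. G x \<bullet> b) has_derivative (\<lambda>v. G' x v \<bullet> b)) (at x)"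
      using Ck_on_Suc_has_derivative[OF Suc.prems(2)[OF b] that] by simp
  qed
  have df: "(f has_derivative frechet_derivative f (at y)) (at y)" if "y \<in> T" for y
    using Ck_on_Suc_has_derivative[OF Suc.prems(1) that] .
  show ?case
  proof (rule Ck_on_SucI[OF assms(1)])
    fix x assume x: "x \<in> S"
    have *: "((\<lambda>x. f (G x)) has_derivative (\<lambda>v. frechet_derivative f (at (G x)) (G' x v))) (at x)"
      using has_derivative_compose[OF dG[OF x] df] x assms(3) by auto
    have lin: "linear (frechet_derivative f (at (G x)))"
      using df[of "G x"] x assms(3) has_derivative_linear by blast
    have "frechet_derivative f (at (G x)) (G' x v) =
      (\<Sum>b\<in>Basis. frechet_derivative (\<lambda>y. G y \<bullet> b) (at x) v * frechet_derivative f (at (G x)) b)" for v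
      by (simp add: G'_def linear_sum[OF lin] linear_cmul[OF lin])
    then show "((\<lambda>x. f (G x)) has_derivative (\<lambda>v. \<Sum>b\<in>Basis. frechet_derivative (\<lambda>y. G y \<bullet> b) (at x) v *
        frechet_derivative f (at (G x)) b)) (at x)" using * by simp
  next
    fix v
    show "Ck_on k (\<lambda>x. \<Sum>b\<in>Basis. frechet_derivative (\<lambda>y. G y \<bullet> b) (at x) v *
        frechet_derivative f (at (G x)) b) S"
    proof (rule Ck_on_sum[OF assms(1)], rule Ck_on_mult[OF assms(1)])
      fix b :: 'e assume b: "b \<in> Basis"
      show "Ck_on k (\<lambda>x. frechet_derivative (\<lambda>y. G y \<bullet> b) (at x) v) S"
        using Suc.prems(2)[OF b] by simp
      show "Ck_on k (\<lambda>x. frechet_derivative f (at (G x)) b) S"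
        by (rule Suc.IH) (use Suc.prems(1) Ck_on_SucD[OF Suc.prems(2)] in simp_all)
    qed
  qed
qed

lemma Cinf_on_imp_continuous: "Cinf_on f S \<Longrightarrow> continuous_on S f"
  using Ck_on_imp_continuous Cinf_on_def by blast

lemma Cinf_on_subset: "Cinf_on f S \<Longrightarrow> T \<subseteq> S \<Longrightarrow> Cinf_on f T"
  unfolding Cinf_on_def using Ck_on_subset by blast

lemma Cinf_on_cong:
  "open S \<Longrightarrow> (\<And>x. x \<in> S \<Longrightarrow> f x = g x) \<Longrightarrow> Cinf_on f S \<longleftrightarrow> Cinf_on g S"
  unfolding Cinf_on_def using Ck_on_cong by blast

lemma Cinf_on_local:
  "(\<And>x. x \<in> S \<Longrightarrow> \<exists>T. open T \<and> x \<in> T \<and> Cinf_on f T) \<Longrightarrow> Cinf_on f S"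
  unfolding Cinf_on_def by (intro allI Ck_on_local) blast

lemma Cinf_on_has_derivative:
  "Cinf_on f S \<Longrightarrow> x \<in> S \<Longrightarrow> (f has_derivative frechet_derivative f (at x)) (at x)"
  unfolding Cinf_on_def using Ck_on_Suc_has_derivative by blast

lemma Cinf_on_deriv: "Cinf_on f S \<Longrightarrow> Cinf_on (\<lambda>x. frechet_derivative f (at x) v) S"
  unfolding Cinf_on_def by (metis Ck_on.simps(2))

text \<open>Smoothness as a greatest fixed point: a class of functions closed under directional
  derivatives contains only smooth ones. It serves where the derivatives of all orders stay in one
  explicit family: exponentials, powers, integrals along rays, pullbacks by a section.\<close>

lemma Cinf_on_coinduct:
  assumes "open S" "P f"
    "\<And>f. P f \<Longrightarrow> \<exists>f'. (\<forall>x\<in>S. (f has_derivative f' x) (at x)) \<and> (\<forall>v. P (\<lambda>x. f' x v))"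
  shows "Cinf_on f S"
proof -
  have "Ck_on k f S" for k
    using assms(2)
  proof (induction k arbitrary: f)
    case 0
    from assms(3)[OF 0] have "f differentiable_on S"
      by (meson differentiable_at_withinI differentiable_on_def differentiableI)
    then show ?case by (simp add: differentiable_imp_continuous_on)
  next
    case (Suc k)
    from assms(3)[OF Suc.prems] obtain f' where
      "\<forall>x\<in>S. (f has_derivative f' x) (at x)" "\<forall>v. P (\<lambda>x. f' x v)" by blast
    then show ?case by (intro Ck_on_SucI[OF assms(1)]) (auto intro: Suc.IH)
  qed
  then show ?thesis by (simp add: Cinf_on_def)
qed

lemma Cinf_on_const [simp, intro]: "Cinf_on (\<lambda>x. c) S"
  unfolding Cinf_on_def using Ck_on_const by blast

lemma Cinf_on_linear: "open S \<Longrightarrow> bounded_linear f \<Longrightarrow> Cinf_on f S"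
  unfolding Cinf_on_def using Ck_on_linear by blast

lemma Cinf_on_inner [intro]: "open S \<Longrightarrow> Cinf_on (\<lambda>x. x \<bullet> b) S"
  by (rule Cinf_on_linear) (auto intro: bounded_linear_inner_left)

lemma Cinf_on_id [intro]: "open S \<Longrightarrow> Cinf_on (\<lambda>x. x) S"
  by (rule Cinf_on_linear) auto

lemma Cinf_on_add [intro]:
  "open S \<Longrightarrow> Cinf_on f S \<Longrightarrow> Cinf_on g S \<Longrightarrow> Cinf_on (\<lambda>x. f x + g x) S"
  unfolding Cinf_on_def using Ck_on_add by blast

lemma Cinf_on_mult [intro]:
  "open S \<Longrightarrow> Cinf_on f S \<Longrightarrow> Cinf_on g S \<Longrightarrow> Cinf_on (\<lambda>x. f x * g x) S"
  unfolding Cinf_on_def using Ck_on_mult by blast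

lemma Cinf_on_minus [intro]: "open S \<Longrightarrow> Cinf_on f S \<Longrightarrow> Cinf_on (\<lambda>x. - f x) S"
  using Cinf_on_mult[of S "\<lambda>x. -1" f] by auto

lemma Cinf_on_diff [intro]:
  "open S \<Longrightarrow> Cinf_on f S \<Longrightarrow> Cinf_on g S \<Longrightarrow> Cinf_on (\<lambda>x. f x - g x) S"
  using Cinf_on_add[of S f "\<lambda>x. - g x"] Cinf_on_minus by fastforce

lemma Cinf_on_sum [intro]:
  "open S \<Longrightarrow> (\<And>i. i \<in> I \<Longrightarrow> Cinf_on (f i) S) \<Longrightarrow> Cinf_on (\<lambda>x. \<Sum>i\<in>I. f i x) S"
  unfolding Cinf_on_def by (intro allI Ck_on_sum) simp_all

lemma Cinf_on_compose:
  fixes G :: "'d::euclidean_space \<Rightarrow> 'e::euclidean_space"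
  assumes "open S" "open T" "G ` S \<subseteq> T" "Cinf_on f T" "\<And>b. b \<in> Basis \<Longrightarrow> Cinf_on (\<lambda>x. G x \<bullet> b) S"
  shows "Cinf_on (\<lambda>x. f (G x)) S"
  unfolding Cinf_on_def
proof
  show "Ck_on k (\<lambda>x. f (G x)) S" for k
    by (rule Ck_on_compose[OF assms(1-3)])
      (use assms(4) assms(5)[unfolded Cinf_on_def] in \<open>auto simp only: Cinf_on_def\<close>)
qed

lemma Cinf_on_compose_real:
  fixes G :: "'d::euclidean_space \<Rightarrow> real"
  assumes "open S" "open T" "G ` S \<subseteq> T" "Cinf_on f T" "Cinf_on G S"
  shows "Cinf_on (\<lambda>x. f (G x)) S"
  using assms by (intro Cinf_on_compose[OF assms(1-4)]) auto

lemma Cinf_on_exp: "Cinf_on (exp :: real \<Rightarrow> real) UNIV"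
proof (rule Cinf_on_coinduct[where P = "\<lambda>f. \<exists>c. f = (\<lambda>x. c * exp x)"])
  fix f :: "real \<Rightarrow> real" assume "\<exists>c. f = (\<lambda>x. c * exp x)"
  then obtain c where f: "f = (\<lambda>x. c * exp x)" by blast
  have "(f has_derivative (\<lambda>v. (c * v) * exp x)) (at x)" for x
    unfolding f by (auto intro!: derivative_eq_intros)
  then show "\<exists>f'. (\<forall>x\<in>UNIV. (f has_derivative f' x) (at x)) \<and> (\<forall>v. \<exists>c. (\<lambda>x. f' x v) = (\<lambda>x. c * exp x))"
    by (intro exI[of _ "\<lambda>x v. (c * v) * exp x"]) auto
qed (auto intro: exI[of _ 1])

lemma Cinf_on_powr: "Cinf_on (\<lambda>x::real. x powr a) {0<..}"
proof (rule Cinf_on_coinduct[where P = "\<lambda>f. \<exists>c a. \<forall>x>0. f x = c * x powr a"])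
  fix f :: "real \<Rightarrow> real" assume "\<exists>c a. \<forall>x>0. f x = c * x powr a"
  then obtain c a where f: "\<And>x. x > 0 \<Longrightarrow> f x = c * x powr a" by blast
  have "(f has_derivative (\<lambda>v. (c * a * v) * x powr (a - 1))) (at x)" if "x > 0" for x
    by (rule has_derivative_cong_open[of "\<lambda>x. c * x powr a" _ _ "{0<..}"])
      (use that f in \<open>auto intro!: derivative_eq_intros simp: powr_diff field_simps\<close>)
  then show "\<exists>f'. (\<forall>x\<in>{0<..}. (f has_derivative f' x) (at x)) \<and>
     (\<forall>v. \<exists>c a. \<forall>x>0. f' x v = c * x powr a)"
    by (intro exI[of _ "\<lambda>x v. (c * a * v) * x powr (a - 1)"]) auto
next
  have "\<forall>x>0. x powr a = 1 * x powr a" by simp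
  then show "\<exists>c b. \<forall>x>0. x powr a = c * x powr b" by blast
qed simp

lemma Cinf_on_compose_powr:
  assumes "open S" "Cinf_on f S" "\<And>x. x \<in> S \<Longrightarrow> f x > 0"
  shows "Cinf_on (\<lambda>x. f x powr a) S"
  by (rule Cinf_on_compose_real[OF assms(1) _ _ Cinf_on_powr assms(2)]) (use assms(3) in auto)

text \<open>The quotient is \<open>f * g\<close> times the power -1 of the square of
  \<open>g\<close>, so that only powers of a positive function occur whatever the sign of
  \<open>g\<close>.\<close>

lemma Cinf_on_divide:
  assumes "open S" "Cinf_on f S" "Cinf_on g S" "\<And>x. x \<in> S \<Longrightarrow> g x \<noteq> 0"
  shows "Cinf_on (\<lambda>x. f x / g x) S"
proof -
  have "Cinf_on (\<lambda>x. (g x * g x) powr (-1)) S"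
    by (rule Cinf_on_compose_powr)
      (use assms in \<open>auto intro!: Cinf_on_mult simp: zero_less_mult_iff linorder_neq_iff[symmetric]\<close>)
  then have "Cinf_on (\<lambda>x. f x * g x * (g x * g x) powr (-1)) S"
    using assms by (intro Cinf_on_mult) auto
  moreover have "f x * g x * (g x * g x) powr (-1) = f x / g x" if "x \<in> S" for x
    using assms(4)[OF that] by (simp add: powr_minus field_simps powr_one_gt_zero_iff)
  ultimately show ?thesis using Cinf_on_cong[OF assms(1)] by (metis (no_types, lifting))
qed

subsection \<open>Smooth cutoff functions\<close>

text \<open>\<open>flat_fun 0\<close> is the classical flat function \<open>exp (- 1 / t)\<close>
  continued by 0; the powers of \<open>1 / t\<close> make the linear span of the family closed under
  differentiation.\<close>

definition flat_fun :: "nat \<Rightarrow> real \<Rightarrow> real" where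
  "flat_fun m t = (if t \<le> 0 then 0 else (1 / t) ^ m * exp (- (1 / t)))"

text \<open>This is the difference quotient at 0, the one point where differentiating
  \<open>flat_fun\<close> is not elementary. The substitution of \<open>1 / t\<close> turns it into
  a power against an exponential.\<close>

lemma flat_fun_over: "((\<lambda>t. flat_fun m t / t) \<longlongrightarrow> 0) (at 0)"
proof -
  have "((\<lambda>t::real. (1 / t) ^ Suc m * exp (- (1 / t))) \<longlongrightarrow> 0) (at_right 0)"
  proof -
    have "((\<lambda>y::real. y ^ Suc m / exp y) \<longlongrightarrow> 0) at_top" by (rule tendsto_power_div_exp_0)
    from filterlim_compose[OF this filterlim_inverse_at_top_right]
    show ?thesis by (simp add: exp_minus divide_inverse)
  qed
  then have "((\<lambda>t. flat_fun m t / t) \<longlongrightarrow> 0) (at_right 0)"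
    by (rule Lim_transform_eventually)
      (auto simp: flat_fun_def eventually_at_right_field intro!: exI[of _ 1])
  moreover have "((\<lambda>t. flat_fun m t / t) \<longlongrightarrow> 0) (at_left 0)"
    by (rule Lim_transform_eventually[OF tendsto_const])
      (auto simp: flat_fun_def eventually_at_left_field intro!: exI[of _ "-1"])
  ultimately show ?thesis by (simp add: filterlim_at_split)
qed

lemma flat_fun_deriv:
  "(flat_fun m has_real_derivative flat_fun (m + 2) t - real m * flat_fun (m + 1) t) (at t)"
proof -
  consider "t < 0" | "t = 0" | "t > 0" by linarith
  then show ?thesis
  proof cases
    case 1
    have "((\<lambda>t. 0) has_real_derivative 0) (at t)" by simp
    then have "(flat_fun m has_real_derivative 0) (at t)"
      by (rule has_field_derivative_transform_within_open[of _ _ _ "{..<0}"])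
        (use 1 in \<open>auto simp: flat_fun_def\<close>)
    then show ?thesis using 1 by (simp add: flat_fun_def)
  next
    case 2
    then show ?thesis using flat_fun_over[of m] by (simp add: has_field_derivative_iff flat_fun_def)
  next
    case 3
    have "((\<lambda>t. (1 / t) ^ m * exp (- (1 / t))) has_real_derivative
      flat_fun (m + 2) t - real m * flat_fun (m + 1) t) (at t)"
    proof (cases m)
      case 0
      then show ?thesis using 3
        by (auto intro!: derivative_eq_intros simp: flat_fun_def power2_eq_square)
    next
      case (Suc n)
      then show ?thesis using 3
        by (auto intro!: derivative_eq_intros simp: flat_fun_def power2_eq_square) (cases n; simp add: field_simps)
    qed
    then show ?thesis
      by (rule has_field_derivative_transform_within_open[of _ _ _ "{0<..}"])
        (use 3 in \<open>auto simp: flat_fun_def\<close>)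
  qed
qed

lemma Cinf_on_flat_fun: "Cinf_on (flat_fun m) UNIV"
proof -
  have "Ck_on k (flat_fun m) UNIV" for k
  proof (induction k arbitrary: m)
    case 0
    show ?case using flat_fun_deriv
      by (auto simp: continuous_on_eq_continuous_at intro: DERIV_isCont)
  next
    case (Suc k)
    show ?case
    proof (rule Ck_on_SucI[OF open_UNIV])
      show "(flat_fun m has_derivative (*) (flat_fun (m + 2) t - real m * flat_fun (m + 1) t)) (at t)" for t
        using flat_fun_deriv[of m t] has_field_derivative_def by blast
      show "Ck_on k (\<lambda>x. (flat_fun (m + 2) x - real m * flat_fun (m + 1) x) * v) UNIV" for v
      proof -
        have "Ck_on k (\<lambda>x. v * flat_fun (m + 2) x + (- real m * v) * flat_fun (m + 1) x) UNIV"
          by (intro Ck_on_add Ck_on_mult Ck_on_const Suc open_UNIV)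
        then show ?thesis by (simp add: algebra_simps)
      qed
    qed
  qed
  then show ?thesis by (simp add: Cinf_on_def)
qed

definition smooth_step :: "real \<Rightarrow> real" where
  "smooth_step t = flat_fun 0 t / (flat_fun 0 t + flat_fun 0 (1 - t))"

lemma flat_fun_0_pos: "flat_fun 0 t \<ge> 0" "t > 0 \<Longrightarrow> flat_fun 0 t > 0"
  by (auto simp: flat_fun_def)

lemma smooth_step_denom: "flat_fun 0 t + flat_fun 0 (1 - t) > 0"
proof (cases "t > 0")
  case True then show ?thesis using flat_fun_0_pos(2)[of t] flat_fun_0_pos(1)[of "1 - t"] by linarith
next
  case False then show ?thesis using flat_fun_0_pos(2)[of "1 - t"] flat_fun_0_pos(1)[of t] by linarith
qed

lemma Cinf_on_smooth_step: "Cinf_on smooth_step UNIV"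
proof -
  have "Cinf_on (\<lambda>t. flat_fun 0 (1 - t)) UNIV"
    by (rule Cinf_on_compose_real[OF _ _ _ Cinf_on_flat_fun])
      (auto intro!: Cinf_on_diff Cinf_on_id simp del: diff_conv_add_uminus)
  then show ?thesis unfolding smooth_step_def
    by (intro Cinf_on_divide) (use less_imp_neq[OF smooth_step_denom] in \<open>auto intro: Cinf_on_flat_fun\<close>)
qed

lemma smooth_step_le_0: "t \<le> 0 \<Longrightarrow> smooth_step t = 0"
  by (simp add: smooth_step_def flat_fun_def)

lemma smooth_step_ge_1: "t \<ge> 1 \<Longrightarrow> smooth_step t = 1"
  using smooth_step_denom[of t] by (simp add: smooth_step_def flat_fun_def)

lemma smooth_step_bounds: "0 \<le> smooth_step t" "smooth_step t \<le> 1"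
  using smooth_step_denom[of t] flat_fun_0_pos(1)[of t] flat_fun_0_pos(1)[of "1 - t"]
  by (auto simp: smooth_step_def)

lemma flat_fun_mono: "s \<le> t \<Longrightarrow> flat_fun 0 s \<le> flat_fun 0 t"
  by (auto simp: flat_fun_def frac_le)

text \<open>Monotonicity is what allows \<open>smooth_step\<close> to reparametrise curves without
  changing their length.\<close>

lemma smooth_step_mono: "s \<le> t \<Longrightarrow> smooth_step s \<le> smooth_step t"
proof -
  assume st: "s \<le> t"
  define a b c d where "a = flat_fun 0 s" "b = flat_fun 0 (1 - s)" "c = flat_fun 0 t" "d = flat_fun 0 (1 - t)"
  have "a \<le> c" "d \<le> b" "0 \<le> a" "0 \<le> d" unfolding a_b_c_d_def
    using st flat_fun_mono flat_fun_0_pos by auto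
  then have "a * d \<le> c * b" by (intro mult_mono) auto
  then have "a * (c + d) \<le> c * (a + b)" by (simp add: algebra_simps)
  moreover have "a + b > 0" "c + d > 0" unfolding a_b_c_d_def using smooth_step_denom by auto
  ultimately have "a / (a + b) \<le> c / (c + d)" by (simp add: field_simps)
  then show ?thesis by (simp add: smooth_step_def a_b_c_d_def)
qed

lemma bump_exists:
  fixes a :: "'e::euclidean_space"
  assumes "0 < r" "r < s"
  shows "\<exists>\<psi>. Cinf_on \<psi> UNIV \<and> (\<forall>x\<in>cball a r. \<psi> x = 1) \<and> (\<forall>x. x \<notin> ball a s \<longrightarrow> \<psi> x = 0)"
proof (intro exI conjI ballI allI impI)
  \<comment> \<open>The squared distance is smooth at \<open>a\<close>, unlike the distance itself.
    The affine rescaling puts the value 1 on the sphere of radius \<open>r\<close> and 0 on the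
    sphere of radius \<open>s\<close>, where \<open>smooth_step\<close> becomes constant.\<close>
  let ?q = "\<lambda>x. (s\<^sup>2 - (x - a) \<bullet> (x - a)) / (s\<^sup>2 - r\<^sup>2)"
  let ?psi = "\<lambda>x. smooth_step (?q x)"
  have pos: "s\<^sup>2 - r\<^sup>2 > 0" using assms by (simp add: power_strict_mono)
  have "Cinf_on (\<lambda>x. (x - a) \<bullet> (x - a)) UNIV"
  proof -
    have "Cinf_on (\<lambda>x. \<Sum>b\<in>Basis. (x \<bullet> b - a \<bullet> b) * (x \<bullet> b - a \<bullet> b)) UNIV"
      by (intro Cinf_on_sum Cinf_on_mult Cinf_on_diff) auto
    moreover have "(x - a) \<bullet> (x - a) = (\<Sum>b\<in>Basis. (x \<bullet> b - a \<bullet> b) * (x \<bullet> b - a \<bullet> b))" for x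
      by (subst euclidean_inner) (simp add: inner_diff_left)
    ultimately show ?thesis by presburger
  qed
  then have "Cinf_on (\<lambda>x. inverse (s\<^sup>2 - r\<^sup>2) * (s\<^sup>2 - (x - a) \<bullet> (x - a))) UNIV"
    by (intro Cinf_on_mult Cinf_on_diff) auto
  then have "Cinf_on ?q UNIV" by (simp add: field_simps)
  then show "Cinf_on ?psi UNIV"
    by (intro Cinf_on_compose_real[OF _ _ _ Cinf_on_smooth_step]) auto
  show "?psi x = 1" if "x \<in> cball a r" for x
  proof (rule smooth_step_ge_1)
    have "(x - a) \<bullet> (x - a) \<le> r\<^sup>2"
      using that assms by (simp add: dist_norm norm_minus_commute power2_norm_eq_inner[symmetric] power_mono)
    then show "1 \<le> ?q x" using pos by (simp add: field_simps)
  qed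
  show "?psi x = 0" if "x \<notin> ball a s" for x
  proof (rule smooth_step_le_0)
    have "(x - a) \<bullet> (x - a) \<ge> s\<^sup>2"
      using that assms by (simp add: dist_norm norm_minus_commute power2_norm_eq_inner[symmetric] power_mono)
    then show "?q x \<le> 0" using pos by (simp add: divide_le_0_iff)
  qed
qed

subsection \<open>Integration along rays\<close>

text \<open>The weight \<open>t ^ m\<close> counts how often the integral has been differentiated:
  each derivative in \<open>x\<close> brings out one factor \<open>t\<close>.\<close>

definition ray_integral :: "nat \<Rightarrow> 'e::euclidean_space \<Rightarrow> ('e \<Rightarrow> real) \<Rightarrow> 'e \<Rightarrow> real" where
  "ray_integral m a h x = integral {0..1} (\<lambda>t. t ^ m * h (a + t *\<^sub>R (x - a)))"

lemma ray_in_ball: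
  fixes a :: "'e::euclidean_space"
  shows "x \<in> ball a r \<Longrightarrow> t \<in> {0..1} \<Longrightarrow> a + t *\<^sub>R (x - a) \<in> ball a r"
proof -
  assume "x \<in> ball a r" "t \<in> {0..1}"
  then have "t * norm (x - a) \<le> 1 * norm (x - a)" by (intro mult_right_mono) auto
  with \<open>x \<in> ball a r\<close> \<open>t \<in> {0..1}\<close> show ?thesis by (auto simp: dist_norm norm_minus_commute)
qed

lemma ray_continuous:
  fixes a :: "'e::euclidean_space"
  assumes "continuous_on (ball a r) h"
  shows "continuous_on (ball a r \<times> {0..1}) (\<lambda>(x, t). t ^ m * h (a + t *\<^sub>R (x - a)))"
proof -
  have "continuous_on (ball a r \<times> {0..1}) (\<lambda>z. h (a + snd z *\<^sub>R (fst z - a)))"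
  proof (rule continuous_on_compose2[OF assms])
    show "continuous_on (ball a r \<times> {0..1}) (\<lambda>z. a + snd z *\<^sub>R (fst z - a))"
      by (intro continuous_intros)
    show "(\<lambda>z. a + snd z *\<^sub>R (fst z - a)) ` (ball a r \<times> {0..1}) \<subseteq> ball a r"
      using ray_in_ball[of _ a r] by (force simp del: mem_ball)
  qed
  then have "continuous_on (ball a r \<times> {0..1}) (\<lambda>z. snd z ^ m * h (a + snd z *\<^sub>R (fst z - a)))"
    by (intro continuous_intros)
  then show ?thesis by (simp add: case_prod_unfold)
qed

lemma ray_integrable:
  fixes a :: "'e::euclidean_space"
  assumes "continuous_on (ball a r) h" "x \<in> ball a r"
  shows "(\<lambda>t. t ^ m * h (a + t *\<^sub>R (x - a))) integrable_on {0..1}"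
proof (rule integrable_continuous_interval)
  show "continuous_on {0..1} (\<lambda>t. t ^ m * h (a + t *\<^sub>R (x - a)))"
  proof -
    have "continuous_on {0..1} (\<lambda>t. (x, t))" by (intro continuous_intros)
    from continuous_on_compose2[OF ray_continuous[OF assms(1), of m] this] assms(2)
    show ?thesis by (auto simp del: mem_ball)
  qed
qed

lemma ray_integral_has_derivative:
  assumes "Ck_on 1 h (ball a r)" "x \<in> ball a r"
  shows "(ray_integral m a h has_derivative
    (\<lambda>v. ray_integral (Suc m) a (\<lambda>y. frechet_derivative h (at y) v) x)) (at x)"
proof -
  let ?B = "ball a r"
  have ch: "continuous_on ?B h" using assms(1) Ck_on_imp_continuous by blast
  have dh: "(h has_derivative frechet_derivative h (at y)) (at y)" if "y \<in> ?B" for y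
    using assms(1) that Ck_on_Suc_has_derivative[of 0 h ?B] by simp
  have cd: "continuous_on ?B (\<lambda>y. frechet_derivative h (at y) v)" for v
    using assms(1) by simp
  \<comment> \<open>The Leibniz rule asks for the derivative of the integrand as a bounded linear
    operator that depends continuously on \<open>(x, t)\<close>.\<close>
  define fx where "fx x t = Blinfun (\<lambda>v. t ^ Suc m * frechet_derivative h (at (a + t *\<^sub>R (x - a))) v)" for x t
  have bl: "bounded_linear (\<lambda>v. t ^ Suc m * frechet_derivative h (at (a + t *\<^sub>R (x - a))) v)"
    if "x \<in> ?B" "t \<in> {0..1}" for x t
    using bounded_linear_compose[OF bounded_linear_mult_right[of "t ^ Suc m"]
        has_derivative_bounded_linear[OF dh[OF ray_in_ball[OF that]]]] .
  have fx: "blinfun_apply (fx x t) = (\<lambda>v. t ^ Suc m * frechet_derivative h (at (a + t *\<^sub>R (x - a))) v)"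
    if "x \<in> ?B" "t \<in> {0..1}" for x t
    unfolding fx_def using bounded_linear_Blinfun_apply[OF bl[OF that]] .
  have cfx: "continuous_on (?B \<times> cbox 0 1) (\<lambda>(x, t). fx x t)"
  proof (rule continuous_on_blinfun_componentwise)
    fix i :: 'a
    show "continuous_on (?B \<times> cbox 0 1) (\<lambda>z. blinfun_apply (case z of (x, t) \<Rightarrow> fx x t) i)"
      using ray_continuous[OF cd[of i], of "Suc m"] fx
      by (subst continuous_on_cong[OF refl, of _ _ "\<lambda>(x, t). t ^ Suc m * frechet_derivative h (at (a + t *\<^sub>R (x - a))) i"])
        (auto simp: case_prod_unfold simp del: mem_ball)
  qed
  have "((\<lambda>x. integral (cbox 0 1) (\<lambda>t. t ^ m * h (a + t *\<^sub>R (x - a)))) has_derivative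
     blinfun_apply (integral (cbox 0 1) (fx x))) (at x within ?B)"
  proof (rule leibniz_rule[OF _ _ cfx assms(2) convex_ball])
    fix y and t :: real assume yt: "y \<in> ?B" "t \<in> cbox 0 1"
    have "((\<lambda>x. h (a + t *\<^sub>R (x - a))) has_derivative
      (\<lambda>v. frechet_derivative h (at (a + t *\<^sub>R (y - a))) (t *\<^sub>R v))) (at y)"
      by (rule has_derivative_compose[OF _ dh]) (use yt in \<open>auto intro!: derivative_eq_intros ray_in_ball simp del: mem_ball\<close>)
    then have "((\<lambda>x. t ^ m * h (a + t *\<^sub>R (x - a))) has_derivative
      (\<lambda>v. t ^ m * frechet_derivative h (at (a + t *\<^sub>R (y - a))) (t *\<^sub>R v))) (at y)"
      by (intro has_derivative_mult_right)
    moreover have "t ^ m * frechet_derivative h (at (a + t *\<^sub>R (y - a))) (t *\<^sub>R v) = blinfun_apply (fx y t) v" for v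
      using yt fx[of y t] linear_cmul[OF has_derivative_linear[OF dh[OF ray_in_ball[of y a r t]]]] by (simp del: mem_ball)
    ultimately show "((\<lambda>x. t ^ m * h (a + t *\<^sub>R (x - a))) has_derivative blinfun_apply (fx y t)) (at y within ?B)"
      by (simp add: has_derivative_at_withinI)
  next
    show "(\<lambda>t. t ^ m * h (a + t *\<^sub>R (y - a))) integrable_on cbox 0 1" if "y \<in> ?B" for y
      using ray_integrable[OF ch that] by simp
  qed
  moreover have "blinfun_apply (integral (cbox 0 1) (fx x)) v =
      ray_integral (Suc m) a (\<lambda>y. frechet_derivative h (at y) v) x" for v
  proof -
    have "continuous_on (cbox 0 1) (fx x)"
    proof -
      have "continuous_on (cbox 0 1) (\<lambda>t. (x, t))" by (intro continuous_intros)
      from continuous_on_compose2[OF cfx this] assms(2) show ?thesis by (auto simp del: mem_ball)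
    qed
    then have "fx x integrable_on cbox 0 1" by (rule integrable_continuous)
    then have "blinfun_apply (integral (cbox 0 1) (fx x)) v = integral (cbox 0 1) (\<lambda>t. blinfun_apply (fx x t) v)"
      by (simp add: blinfun_apply_integral)
    also have "\<dots> = ray_integral (Suc m) a (\<lambda>y. frechet_derivative h (at y) v) x"
      unfolding ray_integral_def by (auto intro!: integral_cong simp: fx assms(2) simp del: mem_ball)
    finally show ?thesis .
  qed
  ultimately have "(ray_integral m a h has_derivative blinfun_apply (integral (cbox 0 1) (fx x))) (at x)"
    and "blinfun_apply (integral (cbox 0 1) (fx x)) =
      (\<lambda>v. ray_integral (Suc m) a (\<lambda>y. frechet_derivative h (at y) v) x)"
    using at_within_open[OF assms(2) open_ball]
    by (auto simp: ray_integral_def[abs_def] fun_eq_iff)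
  then show ?thesis by (rule has_derivative_eq_rhs)
qed

lemma Cinf_on_ray_integral:
  assumes "Cinf_on h (ball a r)" shows "Cinf_on (ray_integral m a h) (ball a r)"
proof (rule Cinf_on_coinduct[where P = "\<lambda>f. \<exists>m h. f = ray_integral m a h \<and> Cinf_on h (ball a r)"])
  fix f assume "\<exists>m h. f = ray_integral m a h \<and> Cinf_on h (ball a r)"
  then obtain m h where f: "f = ray_integral m a h" "Cinf_on h (ball a r)" by blast
  show "\<exists>f'. (\<forall>x\<in>ball a r. (f has_derivative f' x) (at x)) \<and>
      (\<forall>v. \<exists>m h. (\<lambda>x. f' x v) = ray_integral m a h \<and> Cinf_on h (ball a r))"
  proof (intro exI conjI ballI allI)
    show "(f has_derivative (\<lambda>v. ray_integral (Suc m) a (\<lambda>y. frechet_derivative h (at y) v) x)) (at x)"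
      if "x \<in> ball a r" for x
      unfolding f(1) by (rule ray_integral_has_derivative[OF _ that]) (use f(2) in \<open>auto simp only: Cinf_on_def\<close>)
  qed (auto intro: Cinf_on_deriv f(2))
qed (use assms in auto)

text \<open>The fundamental theorem of calculus on the segment from \<open>a\<close> to
  \<open>x\<close>. Its purpose is algebraic: \<open>f\<close> minus its value at \<open>a\<close>
  becomes a combination of functions vanishing at \<open>a\<close> with smooth coefficients, to
  which a derivation can be applied.\<close>

lemma hadamard:
  assumes "Cinf_on f (ball a r)" "x \<in> ball a r"
  shows "f x = f a + (\<Sum>b\<in>Basis. ((x - a) \<bullet> b) * ray_integral 0 a (\<lambda>y. frechet_derivative f (at y) b) x)"
proof -
  let ?F = "\<lambda>t. f (a + t *\<^sub>R (x - a))"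
  have D: "(f has_derivative frechet_derivative f (at y)) (at y)" if "y \<in> ball a r" for y
    using Cinf_on_has_derivative[OF assms(1) that] .
  have "(?F has_vector_derivative frechet_derivative f (at (a + t *\<^sub>R (x - a))) (x - a)) (at t within {0..1})"
    if "t \<in> {0..1}" for t
  proof -
    have "(?F has_derivative (\<lambda>s. frechet_derivative f (at (a + t *\<^sub>R (x - a))) (s *\<^sub>R (x - a)))) (at t)"
      by (rule has_derivative_compose[OF _ D]) (use that assms(2) in \<open>auto intro!: derivative_eq_intros ray_in_ball simp del: mem_ball\<close>)
    then show ?thesis
      using linear_cmul[OF has_derivative_linear[OF D[OF ray_in_ball[OF assms(2) that]]]]
      by (simp add: has_vector_derivative_def has_derivative_at_withinI)
  qed
  from fundamental_theorem_of_calculus[OF _ this]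
  have I: "((\<lambda>t. frechet_derivative f (at (a + t *\<^sub>R (x - a))) (x - a)) has_integral f x - f a) {0..1}" by simp
  have e: "frechet_derivative f (at (a + t *\<^sub>R (x - a))) (x - a) =
     (\<Sum>b\<in>Basis. ((x - a) \<bullet> b) * frechet_derivative f (at (a + t *\<^sub>R (x - a))) b)" if "t \<in> {0..1}" for t
  proof -
    have lin: "linear (frechet_derivative f (at (a + t *\<^sub>R (x - a))))"
      using has_derivative_linear[OF D[OF ray_in_ball[OF assms(2) that]]] .
    show ?thesis
      by (subst euclidean_representation[of "x - a", symmetric])
        (simp only: linear_sum[OF lin] linear_cmul[OF lin] real_scaleR_def)
  qed
  have ii: "(\<lambda>t. frechet_derivative f (at (a + t *\<^sub>R (x - a))) b) integrable_on {0..1}" for b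
    using ray_integrable[OF Cinf_on_imp_continuous[OF Cinf_on_deriv[OF assms(1), of b]] assms(2), of 0] by simp
  have "f x - f a = integral {0..1} (\<lambda>t. frechet_derivative f (at (a + t *\<^sub>R (x - a))) (x - a))"
    using I by (simp add: integral_unique)
  also have "\<dots> = integral {0..1} (\<lambda>t. \<Sum>b\<in>Basis. ((x - a) \<bullet> b) * frechet_derivative f (at (a + t *\<^sub>R (x - a))) b)"
    by (rule integral_cong) (rule e)
  also have "\<dots> = (\<Sum>b\<in>Basis. ((x - a) \<bullet> b) * ray_integral 0 a (\<lambda>y. frechet_derivative f (at y) b) x)"
    unfolding ray_integral_def by (subst integral_sum) (auto intro!: integrable_on_mult_right ii)
  finally show ?thesis by simp
qed

section \<open>Charts, global smooth functions and cutoffs on a manifold\<close>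

locale smooth_mfd =
  fixes A :: "('a::{t2_space,second_countable_topology}, 'e::euclidean_space) atlas"
  assumes mfd: "smooth_manifold A"
begin

abbreviation "C \<equiv> Cinf A"
abbreviation "VF \<equiv> vfields A"

lemma chartD:
  assumes "(U, u) \<in> A"
  shows "open U" "open (u ` U)" "homeomorphism U (u ` U) u (inv_into U u)"
    "continuous_on U u" "continuous_on (u ` U) (inv_into U u)" "inj_on u U"
    "\<And>q. q \<in> U \<Longrightarrow> inv_into U u (u q) = q" "\<And>x. x \<in> u ` U \<Longrightarrow> inv_into U u x \<in> U"
proof -
  have c: "chart U u" using mfd assms unfolding smooth_manifold_def by blast
  then show "open U" "open (u ` U)" and h: "homeomorphism U (u ` U) u (inv_into U u)"
    by (auto simp: chart_def)
  then show "continuous_on U u" "continuous_on (u ` U) (inv_into U u)"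
    by (auto simp: homeomorphism_def)
  show e: "inv_into U u (u q) = q" if "q \<in> U" for q using h that by (auto simp: homeomorphism_def)
  then show "inj_on u U" by (metis inj_onI)
  show "inv_into U u x \<in> U" if "x \<in> u ` U" for x using that by (rule inv_into_into)
qed

lemma chart_open_image:
  assumes "(U, u) \<in> A" "open S" "S \<subseteq> U" shows "open (u ` S)"
proof -
  have "openin (top_of_set U) S" using assms(2,3) by (metis inf.absorb_iff2 openin_open)
  then have "openin (top_of_set (u ` U)) (u ` S)"
    using homeomorphism_imp_open_map[OF chartD(3)[OF assms(1)]] by blast
  then show ?thesis using chartD(2)[OF assms(1)] openin_open_trans by blast
qed

lemma chart_open_vimage:
  assumes "(U, u) \<in> A" "open S" shows "open {q \<in> U. u q \<in> S}"
  using continuous_open_preimage[OF chartD(4)[OF assms(1)] chartD(1)[OF assms(1)] assms(2)]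
  by (simp add: vimage_def Int_def)

lemma chart_at: obtains U u where "(U, u) \<in> A" "p \<in> U"
proof -
  have "p \<in> (\<Union>(U, u)\<in>A. U)" using mfd unfolding smooth_manifold_def by simp
  then show ?thesis using that by auto
qed

lemma Cinf_on_chart: "f \<in> C \<Longrightarrow> (U, u) \<in> A \<Longrightarrow> Cinf_on (\<lambda>x. f (inv_into U u x)) (u ` U)"
  by (auto simp: Cinf_def o_def)

lemma CinfI:
  "(\<And>U u. (U, u) \<in> A \<Longrightarrow> Cinf_on (\<lambda>x. f (inv_into U u x)) (u ` U)) \<Longrightarrow> f \<in> C"
  by (auto simp: Cinf_def o_def)

lemma C_const [simp, intro]: "(\<lambda>p. c) \<in> C" by (rule CinfI) auto
lemma C_add [intro]: "f \<in> C \<Longrightarrow> h \<in> C \<Longrightarrow> (\<lambda>p. f p + h p) \<in> C"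
  by (rule CinfI) (auto intro: Cinf_on_add chartD Cinf_on_chart)
lemma C_diff [intro]: "f \<in> C \<Longrightarrow> h \<in> C \<Longrightarrow> (\<lambda>p. f p - h p) \<in> C"
  by (rule CinfI) (auto intro: Cinf_on_diff chartD Cinf_on_chart)
lemma C_mult [intro]: "f \<in> C \<Longrightarrow> h \<in> C \<Longrightarrow> (\<lambda>p. f p * h p) \<in> C"
  by (rule CinfI) (auto intro: Cinf_on_mult chartD Cinf_on_chart)
lemma C_minus [intro]: "f \<in> C \<Longrightarrow> (\<lambda>p. - f p) \<in> C"
  by (rule CinfI) (auto intro: Cinf_on_minus chartD Cinf_on_chart)
lemma C_sum [intro]: "(\<And>i. i \<in> I \<Longrightarrow> f i \<in> C) \<Longrightarrow> (\<lambda>p. \<Sum>i\<in>I. f i p) \<in> C"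
  by (rule CinfI, rule Cinf_on_sum[OF chartD(2)]) (auto intro: Cinf_on_chart)
lemma C_divide: "f \<in> C \<Longrightarrow> h \<in> C \<Longrightarrow> (\<And>p. h p \<noteq> 0) \<Longrightarrow> (\<lambda>p. f p / h p) \<in> C"
  by (rule CinfI) (auto intro: Cinf_on_divide chartD Cinf_on_chart)

lemma C_compose: "f \<in> C \<Longrightarrow> Cinf_on k T \<Longrightarrow> open T \<Longrightarrow> range f \<subseteq> T \<Longrightarrow> (\<lambda>p. k (f p)) \<in> C"
  by (rule CinfI, rule Cinf_on_compose_real[OF chartD(2)]) (auto intro: Cinf_on_chart)

lemma C_compose_vec:
  fixes F :: "'a \<Rightarrow> 'd::euclidean_space"
  assumes "\<And>b. b \<in> Basis \<Longrightarrow> (\<lambda>p. F p \<bullet> b) \<in> C" "Cinf_on k UNIV"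
  shows "(\<lambda>p. k (F p)) \<in> C"
  by (rule CinfI, rule Cinf_on_compose[OF chartD(2) open_UNIV _ assms(2)])
    (auto intro: Cinf_on_chart[OF assms(1)])

lemma C_continuous: assumes "f \<in> C" shows "continuous_on UNIV f"
proof -
  have "\<exists>W. open W \<and> p \<in> W \<and> continuous_on W f" for p
  proof -
    obtain U u where U: "(U, u) \<in> A" "p \<in> U" by (rule chart_at)
    have "continuous_on U (\<lambda>q. f (inv_into U u (u q)))"
      by (rule continuous_on_compose2[OF Cinf_on_imp_continuous[OF Cinf_on_chart[OF assms U(1)]] chartD(4)[OF U(1)]]) auto
    then have "continuous_on U f" using chartD(7)[OF U(1)] by (simp cong: continuous_on_cong)
    then show ?thesis using chartD(1)[OF U(1)] U(2) by blast
  qed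
  then show ?thesis
    by (meson UNIV_I continuous_at_imp_continuous_on continuous_on_eq_continuous_at)
qed

lemma C_local:
  assumes "\<And>p. \<exists>W h. open W \<and> p \<in> W \<and> h \<in> C \<and> (\<forall>q\<in>W. f q = h q)"
  shows "f \<in> C"
proof (rule CinfI)
  fix U u assume U: "(U, u) \<in> A"
  show "Cinf_on (\<lambda>x. f (inv_into U u x)) (u ` U)"
  proof (rule Cinf_on_local)
    fix x assume x: "x \<in> u ` U"
    obtain W h where W: "open W" "inv_into U u x \<in> W" "h \<in> C" "\<forall>q\<in>W. f q = h q"
      using assms by blast
    let ?T = "u ` (W \<inter> U)"
    have oT: "open ?T" using chart_open_image[OF U] W(1) chartD(1)[OF U] by auto
    have xT: "x \<in> ?T"
      using W(2) x chartD(8)[OF U x] f_inv_into_f[OF x] by (metis IntI imageI)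
    have "Cinf_on (\<lambda>x. h (inv_into U u x)) ?T"
      by (rule Cinf_on_subset[OF Cinf_on_chart[OF W(3) U]]) auto
    moreover have "f (inv_into U u y) = h (inv_into U u y)" if "y \<in> ?T" for y
      using that W(4) chartD(7)[OF U] by auto
    ultimately have "Cinf_on (\<lambda>x. f (inv_into U u x)) ?T"
      using Cinf_on_cong[OF oT, of "\<lambda>x. f (inv_into U u x)" "\<lambda>x. h (inv_into U u x)"] by blast
    then show "\<exists>T. open T \<and> x \<in> T \<and> Cinf_on (\<lambda>x. f (inv_into U u x)) T" using oT xT by blast
  qed
qed

text \<open>The factor \<open>\<psi>\<close> is meant to be a cutoff function, so that the function vanishes near the
  boundary of its support.\<close>

definition cut where
  "cut U u a R \<psi> \<phi> q = (if q \<in> U \<and> u q \<in> ball a R then \<psi> (u q) * \<phi> (u q) else (0::real))"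

text \<open>Seen from another chart there are two cases. Inside the coordinate ball the function is
  a transition map followed by a smooth function. Any other point lies off the compact set
  \<open>K\<close> outside which the function vanishes, and \<open>K\<close> is closed because the
  manifold is Hausdorff.\<close>

lemma cut_in_C:
  assumes U: "(U, u) \<in> A" "ball a R \<subseteq> u ` U" and "Cinf_on \<phi> (ball a R)" "Cinf_on \<psi> UNIV"
    and s: "s < R" "\<And>x. x \<notin> ball a s \<Longrightarrow> \<psi> x = 0"
  shows "cut U u a R \<psi> \<phi> \<in> C"
proof (rule CinfI)
  fix V v assume V: "(V, v) \<in> A"
  let ?f = "\<lambda>x. cut U u a R \<psi> \<phi> (inv_into V v x)"
  let ?i = "inv_into V v"
  show "Cinf_on ?f (v ` V)"
  proof (rule Cinf_on_local)
    fix x assume x: "x \<in> v ` V"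
    define q where "q = ?i x"
    have q: "q \<in> V" "v q = x" using x chartD(8)[OF V x] f_inv_into_f[OF x] by (auto simp: q_def)
    show "\<exists>T. open T \<and> x \<in> T \<and> Cinf_on ?f T"
    proof (cases "q \<in> U \<and> u q \<in> ball a R")
      case True
      define W where "W = V \<inter> {q \<in> U. u q \<in> ball a R}"
      have oW: "open W" unfolding W_def
        using chart_open_vimage[OF U(1) open_ball] chartD(1)[OF V] by blast
      have oT: "open (v ` W)" by (rule chart_open_image[OF V oW]) (auto simp: W_def)
      have iW: "?i y \<in> W" if "y \<in> v ` W" for y
        using that chartD(7)[OF V] by (auto simp: W_def)
      have tr: "\<And>b. b \<in> Basis \<Longrightarrow> Cinf_on (\<lambda>x. u (?i x) \<bullet> b) (v ` (V \<inter> U))"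
        using mfd V U(1) unfolding smooth_manifold_def by blast
      have "Cinf_on (\<lambda>x. \<psi> x * \<phi> x) (ball a R)"
        by (rule Cinf_on_mult[OF _ Cinf_on_subset[OF assms(4)] assms(3)]) auto
      then have "Cinf_on (\<lambda>y. (\<lambda>x. \<psi> x * \<phi> x) (u (?i y))) (v ` W)"
      proof (rule Cinf_on_compose[OF oT open_ball, rotated])
        show "(\<lambda>y. u (?i y)) ` v ` W \<subseteq> ball a R" using iW by (force simp: W_def)
        show "Cinf_on (\<lambda>x. u (?i x) \<bullet> b) (v ` W)" if "b \<in> Basis" for b
          by (rule Cinf_on_subset[OF tr[OF that]]) (auto simp: W_def)
      qed
      moreover have "?f y = (\<lambda>x. \<psi> x * \<phi> x) (u (?i y))" if "y \<in> v ` W" for y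
        using iW[OF that] by (auto simp: cut_def W_def)
      ultimately have "Cinf_on ?f (v ` W)" using Cinf_on_cong[OF oT, of ?f "\<lambda>y. (\<lambda>x. \<psi> x * \<phi> x) (u (?i y))"] by blast
      moreover have "x \<in> v ` W" using q True by (auto simp: W_def)
      ultimately show ?thesis using oT by blast
    next
      case False
      define K where "K = inv_into U u ` cball a s"
      have sub: "cball a s \<subseteq> u ` U" using s(1) U(2) by force
      have "compact K" unfolding K_def
        by (rule compact_continuous_image[OF continuous_on_subset[OF chartD(5)[OF U(1)] sub]]) simp
      then have oW: "open (V - K)" using chartD(1)[OF V] compact_imp_closed by blast
      have oT: "open (v ` (V - K))" by (rule chart_open_image[OF V oW]) auto
      have "q \<notin> K"
      proof
        assume "q \<in> K"
        then obtain z where z: "z \<in> cball a s" "q = inv_into U u z" by (auto simp: K_def)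
        have "z \<in> u ` U" using z sub by auto
        then have "q \<in> U" "u q = z" using z chartD(8)[OF U(1)] f_inv_into_f by metis+
        with z False s(1) show False by auto
      qed
      then have "x \<in> v ` (V - K)" using q by auto
      moreover have "?f y = 0" if "y \<in> v ` (V - K)" for y
      proof -
        have iy: "?i y \<in> V - K" using that chartD(7)[OF V] by auto
        have "\<psi> (u (?i y)) = 0" if "?i y \<in> U"
        proof (rule s(2), rule)
          assume "u (?i y) \<in> ball a s"
          then have "inv_into U u (u (?i y)) \<in> K" unfolding K_def by auto
          then show False using chartD(7)[OF U(1) that] iy by auto
        qed
        then show ?thesis by (auto simp: cut_def)
      qed
      ultimately have "Cinf_on ?f (v ` (V - K))"
        using Cinf_on_cong[OF oT, of ?f "\<lambda>x. 0"] by auto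
      then show ?thesis using oT \<open>x \<in> v ` (V - K)\<close> by blast
    qed
  qed
qed

subsection \<open>Vector fields\<close>

lemma VF_C: "X \<in> VF \<Longrightarrow> f \<in> C \<Longrightarrow> X f \<in> C" by (auto simp: vfields_def)
lemma VF_0: "X \<in> VF \<Longrightarrow> f \<notin> C \<Longrightarrow> X f p = 0" by (auto simp: vfields_def)
lemma VF_lin: "X \<in> VF \<Longrightarrow> f \<in> C \<Longrightarrow> h \<in> C \<Longrightarrow> X (\<lambda>p. a * f p + b * h p) q = a * X f q + b * X h q"
  by (auto simp: vfields_def fun_eq_iff)
lemma VF_mult: "X \<in> VF \<Longrightarrow> f \<in> C \<Longrightarrow> h \<in> C \<Longrightarrow> X (\<lambda>p. f p * h p) q = f q * X h q + h q * X f q"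
  by (auto simp: vfields_def fun_eq_iff)
lemma VF_add: "X \<in> VF \<Longrightarrow> f \<in> C \<Longrightarrow> h \<in> C \<Longrightarrow> X (\<lambda>p. f p + h p) q = X f q + X h q"
  using VF_lin[of X f h 1 1] by simp
lemma VF_diff: "X \<in> VF \<Longrightarrow> f \<in> C \<Longrightarrow> h \<in> C \<Longrightarrow> X (\<lambda>p. f p - h p) q = X f q - X h q"
  using VF_lin[of X f h 1 "-1"] by simp
lemma VF_cmult: "X \<in> VF \<Longrightarrow> f \<in> C \<Longrightarrow> X (\<lambda>p. a * f p) q = a * X f q"
  using VF_lin[of X f f a 0] by simp
lemma VF_const: "X \<in> VF \<Longrightarrow> X (\<lambda>p. c) q = 0"
proof -
  assume X: "X \<in> VF"
  have "X (\<lambda>p. 1) q = 0" using VF_mult[OF X, of "\<lambda>p. 1" "\<lambda>p. 1" q] by simp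
  then show ?thesis using VF_cmult[OF X, of "\<lambda>p. 1" c q] by simp
qed
lemma VF_sum: "X \<in> VF \<Longrightarrow> (\<And>i. i \<in> I \<Longrightarrow> f i \<in> C) \<Longrightarrow> X (\<lambda>p. \<Sum>i\<in>I. f i p) q = (\<Sum>i\<in>I. X (f i) q)"
  by (induction I rule: infinite_finite_induct) (simp_all add: VF_const VF_add[OF _ _ C_sum])

lemma VFI:
  assumes "\<And>f. f \<in> C \<Longrightarrow> X f \<in> C" "\<And>f p. f \<notin> C \<Longrightarrow> X f p = 0"
    "\<And>f h a b p. f \<in> C \<Longrightarrow> h \<in> C \<Longrightarrow> X (\<lambda>p. a * f p + b * h p) p = a * X f p + b * X h p"
    "\<And>f h p. f \<in> C \<Longrightarrow> h \<in> C \<Longrightarrow> X (\<lambda>p. f p * h p) p = f p * X h p + h p * X f p"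
  shows "X \<in> VF"
  using assms unfolding vfields_def by (auto simp: fun_eq_iff)

lemma VF_eqI: "X \<in> VF \<Longrightarrow> Y \<in> VF \<Longrightarrow> (\<And>f p. f \<in> C \<Longrightarrow> X f p = Y f p) \<Longrightarrow> X = Y"
  by (intro ext) (metis VF_0)

lemma vzero_VF [simp, intro]: "vzero \<in> VF"
  by (rule VFI) (auto simp: vzero_def)
lemma vadd_VF [simp, intro]: "X \<in> VF \<Longrightarrow> Y \<in> VF \<Longrightarrow> X \<oplus>\<^sub>v Y \<in> VF"
  unfolding vadd_def by (rule VFI, rule C_add[OF VF_C VF_C])
    (simp_all add: VF_lin VF_mult VF_0 algebra_simps)
lemma vdiff_VF [simp, intro]: "X \<in> VF \<Longrightarrow> Y \<in> VF \<Longrightarrow> X \<ominus>\<^sub>v Y \<in> VF"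
  unfolding vdiff_def by (rule VFI, rule C_diff[OF VF_C VF_C])
    (simp_all add: VF_lin VF_mult VF_0 algebra_simps)
lemma vscale_VF [simp, intro]: "h \<in> C \<Longrightarrow> X \<in> VF \<Longrightarrow> h \<odot>\<^sub>v X \<in> VF"
  unfolding vscale_def by (rule VFI, rule C_mult[OF _ VF_C])
    (simp_all add: VF_lin VF_mult VF_0 algebra_simps)
lemma bracket_VF [simp, intro]:
  assumes X: "X \<in> VF" and Y: "Y \<in> VF" shows "bracket X Y \<in> VF"
proof (rule VFI)
  show "bracket X Y f \<in> C" if "f \<in> C" for f unfolding bracket_def
    by (rule C_diff[OF VF_C[OF X VF_C[OF Y that]] VF_C[OF Y VF_C[OF X that]]])
  show "bracket X Y f p = 0" if "f \<notin> C" for f p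
  proof -
    have "X f = (\<lambda>p. 0)" "Y f = (\<lambda>p. 0)" using VF_0[OF X that] VF_0[OF Y that] by auto
    then show ?thesis using VF_const[OF X, of 0] VF_const[OF Y, of 0] by (simp add: bracket_def)
  qed
  fix f h p a b assume fh: "f \<in> C" "h \<in> C"
  have "X (\<lambda>p. a * f p + b * h p) = (\<lambda>q. a * X f q + b * X h q)"
    "Y (\<lambda>p. a * f p + b * h p) = (\<lambda>q. a * Y f q + b * Y h q)" using VF_lin X Y fh by auto
  then show "bracket X Y (\<lambda>p. a * f p + b * h p) p = a * bracket X Y f p + b * bracket X Y h p"
    using X Y fh by (simp add: bracket_def VF_lin VF_C algebra_simps)
  have "X (\<lambda>p. f p * h p) = (\<lambda>q. f q * X h q + h q * X f q)"
    "Y (\<lambda>p. f p * h p) = (\<lambda>q. f q * Y h q + h q * Y f q)" using VF_mult X Y fh by auto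
  then show "bracket X Y (\<lambda>p. f p * h p) p = f p * bracket X Y h p + h p * bracket X Y f p"
    using VF_add[OF X C_mult[OF fh(1) VF_C[OF Y fh(2)]] C_mult[OF fh(2) VF_C[OF Y fh(1)]]]
      VF_add[OF Y C_mult[OF fh(1) VF_C[OF X fh(2)]] C_mult[OF fh(2) VF_C[OF X fh(1)]]] X Y fh
    by (simp add: bracket_def VF_mult VF_C algebra_simps)
qed

lemma bracket_antisym: "bracket Y X = vzero \<ominus>\<^sub>v bracket X Y"
  by (simp add: bracket_def vdiff_def vzero_def fun_eq_iff)

text \<open>Recognises as vector fields those assembled from pointwise choices, as in
  \<open>locally_musical\<close>, or by continuation, as in \<open>gaframe_exists\<close>.\<close>

lemma VF_local:
  assumes 0: "\<And>f p. f \<notin> C \<Longrightarrow> Y f p = 0"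
    and loc: "\<And>p. \<exists>W Z. open W \<and> p \<in> W \<and> Z \<in> VF \<and> (\<forall>q\<in>W. \<forall>f\<in>C. Y f q = Z f q)"
  shows "Y \<in> VF"
proof (rule VFI)
  show "Y f \<in> C" if "f \<in> C" for f
  proof (rule C_local)
    fix p
    obtain W Z where "open W" "p \<in> W" "Z \<in> VF" "\<forall>q\<in>W. \<forall>f\<in>C. Y f q = Z f q"
      using loc[of p] by (elim exE conjE) (rule that)
    moreover have "Z f \<in> C" using VF_C[OF calculation(3) that] .
    moreover have "\<forall>q\<in>W. Y f q = Z f q" using calculation(4) that by blast
    ultimately show "\<exists>W h. open W \<and> p \<in> W \<and> h \<in> C \<and> (\<forall>q\<in>W. Y f q = h q)"
      by blast
  qed
  fix f h p a b assume fh: "f \<in> C" "h \<in> C"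
  obtain W Z where Z: "p \<in> W" "Z \<in> VF" "\<forall>q\<in>W. \<forall>f\<in>C. Y f q = Z f q"
    using loc[of p] by (elim exE conjE) (rule that)
  show "Y (\<lambda>p. a * f p + b * h p) p = a * Y f p + b * Y h p"
  proof -
    have "(\<lambda>p. a * f p + b * h p) \<in> C" using fh by (intro C_add C_mult) auto
    then show ?thesis using Z fh VF_lin[OF Z(2) fh] by simp
  qed
  show "Y (\<lambda>p. f p * h p) p = f p * Y h p + h p * Y f p"
    using Z fh VF_mult[OF Z(2) fh] C_mult[OF fh] by simp
qed (rule 0)

text \<open>Derivations act on global functions only, so Hadamard's formula is multiplied by the
  cutoff \<open>?k\<close> before \<open>X\<close> is applied. At \<open>q\<close>, where
  \<open>?k\<close> is 1 and every \<open>h b p - h b q\<close> vanishes, the product rule leaves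
  just the terms with \<open>X (h b)\<close>.\<close>

lemma VF_chart_rep:
  assumes U: "(U, u) \<in> A" "q \<in> U" and r: "r > 0" "ball (u q) r \<subseteq> u ` U"
    and h: "\<And>b. b \<in> Basis \<Longrightarrow> h b \<in> C" "\<And>b x. b \<in> Basis \<Longrightarrow> x \<in> ball (u q) r \<Longrightarrow> h b (inv_into U u x) = x \<bullet> b"
    and X: "X \<in> VF" and f: "f \<in> C"
  shows "X f q = (\<Sum>b\<in>Basis. X (h b) q * frechet_derivative (\<lambda>x. f (inv_into U u x)) (at (u q)) b)"
proof -
  let ?a = "u q"
  let ?F = "\<lambda>x. f (inv_into U u x)"
  define g where "g b = ray_integral 0 ?a (\<lambda>y. frechet_derivative ?F (at y) b)" for b
  obtain \<psi> where \<psi>: "Cinf_on \<psi> UNIV" "\<And>x. x \<in> cball ?a (r/3) \<Longrightarrow> \<psi> x = 1" "\<And>x. x \<notin> ball ?a (r/2) \<Longrightarrow> \<psi> x = (0::real)"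
    using bump_exists[of "r/3" "r/2" ?a] r(1) by force
  have F: "Cinf_on ?F (ball ?a r)" by (rule Cinf_on_subset[OF Cinf_on_chart[OF f U(1)] r(2)])
  have k: "cut U u ?a r \<psi> (\<lambda>x. 1) \<in> C" by (rule cut_in_C[OF U(1) r(2) _ \<psi>(1), of _ "r/2"]) (use r \<psi>(3) in auto)
  have gC: "cut U u ?a r \<psi> (g b) \<in> C" for b unfolding g_def
    by (rule cut_in_C[OF U(1) r(2) Cinf_on_ray_integral[OF Cinf_on_deriv[OF F]] \<psi>(1), of "r/2"])
      (use r \<psi>(3) in auto)
  let ?k = "cut U u ?a r \<psi> (\<lambda>x. 1)"
  let ?g = "\<lambda>b. cut U u ?a r \<psi> (g b)"
  have hq: "h b q = ?a \<bullet> b" if "b \<in> Basis" for b using h(2)[OF that, of ?a] r chartD(7)[OF U] by simp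
  have eq: "?k p * f p = f q * ?k p + (\<Sum>b\<in>Basis. (h b p - h b q) * ?g b p)" for p
  proof (cases "p \<in> U \<and> u p \<in> ball ?a r")
    case True
    then have ip: "inv_into U u (u p) = p" "inv_into U u (u q) = q" using chartD(7)[OF U(1)] U by auto
    have e: "h b p - h b q = (u p - ?a) \<bullet> b" if "b \<in> Basis" for b
      using h(2)[OF that, of "u p"] hq[OF that] True ip by (simp add: inner_diff_left)
    have "(\<Sum>b\<in>Basis. (h b p - h b q) * (\<psi> (u p) * g b (u p))) =
        \<psi> (u p) * (\<Sum>b\<in>Basis. ((u p - ?a) \<bullet> b) * g b (u p))"
      unfolding sum_distrib_left by (rule sum.cong) (simp_all add: e)
    then show ?thesis using hadamard[OF F, of "u p"] True ip
      by (simp add: cut_def g_def algebra_simps del: mem_ball)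
  qed (auto simp: cut_def)
  have kq: "?k q = 1" and gq: "?g b q = g b ?a" for b using U r \<psi>(2)[of ?a] by (auto simp: cut_def)
  have "X (\<lambda>p. ?k p * f p) q = X (\<lambda>p. f q * ?k p + (\<Sum>b\<in>Basis. (h b p - h b q) * ?g b p)) q"
    using eq by presburger
  moreover have "X (\<lambda>p. ?k p * f p) q = X f q + f q * X ?k q" using VF_mult[OF X k f] kq by simp
  moreover have "X (\<lambda>p. f q * ?k p + (\<Sum>b\<in>Basis. (h b p - h b q) * ?g b p)) q =
      f q * X ?k q + (\<Sum>b\<in>Basis. X (h b) q * g b ?a)"
  proof -
    have "X (\<lambda>p. (h b p - h b q) * ?g b p) q = X (h b) q * g b ?a" if "b \<in> Basis" for b
      using VF_mult[OF X C_diff[OF h(1)[OF that] C_const[of "h b q"]] gC[of b], of q]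
        VF_diff[OF X h(1)[OF that] C_const] VF_const[OF X] gq by simp
    then show ?thesis
      using VF_add[OF X C_mult[OF C_const[of "f q"] k] C_sum[of Basis "\<lambda>b p. (h b p - h b q) * ?g b p"], of q]
        VF_sum[OF X, of Basis "\<lambda>b p. (h b p - h b q) * ?g b p" q]
        VF_cmult[OF X k, of "f q" q] C_mult[OF C_diff[OF h(1) C_const] gC] by simp
  qed
  moreover have "g b ?a = frechet_derivative ?F (at ?a) b" for b
    by (simp add: g_def ray_integral_def)
  ultimately show ?thesis by simp
qed

text \<open>Coordinates near a point: \<open>G\<close> is the inverse of a chart on the ball \<open>ball a r\<close>, \<open>h\<close> are
  coordinate functions and \<open>d\<close> coordinate vector fields, extended to the whole manifold.\<close>

definition coords where
  "coords W (a :: 'e) r G h d \<longleftrightarrow>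
     open W \<and> r > 0 \<and> W = G ` ball a r \<and> continuous_on (ball a r) G \<and>
     (\<forall>b\<in>Basis. h b \<in> C) \<and> (\<forall>b. d b \<in> VF) \<and>
     (\<forall>b\<in>Basis. \<forall>x\<in>ball a r. h b (G x) = x \<bullet> b) \<and>
     (\<forall>f\<in>C. Cinf_on (\<lambda>x. f (G x)) (ball a r)) \<and>
     (\<forall>f\<in>C. \<forall>x\<in>ball a r. ((\<lambda>x. f (G x)) has_derivative (\<lambda>v. \<Sum>b\<in>Basis. (v \<bullet> b) * d b f (G x))) (at x)) \<and>
     (\<forall>X\<in>VF. \<forall>f\<in>C. \<forall>q\<in>W. X f q = (\<Sum>b\<in>Basis. X (h b) q * d b f q)) \<and>
     (\<forall>b\<in>Basis. \<forall>c\<in>Basis. \<forall>q\<in>W. d b (h c) q = (if b = c then 1 else 0)) \<and>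
     (\<forall>\<phi> s. Cinf_on \<phi> (ball a r) \<and> s < r \<longrightarrow> (\<exists>f\<in>C. \<forall>x\<in>ball a s. f (G x) = \<phi> x))"

lemma coords_exist:
  assumes "open V" "p \<in> V"
  obtains W a r G h d where "coords W a r G h d" "p = G a" "p \<in> W" "W \<subseteq> V"
proof -
  obtain U u where U: "(U, u) \<in> A" "p \<in> U" by (rule chart_at)
  let ?a = "u p" and ?G = "inv_into U u"
  have "open (u ` (U \<inter> V))" using chart_open_image[OF U(1)] chartD(1)[OF U(1)] assms by auto
  then obtain R where R: "R > 0" "ball ?a R \<subseteq> u ` (U \<inter> V)"
    using U(2) assms(2) open_contains_ball by (metis IntI imageI)
  have RU: "ball ?a R \<subseteq> u ` U" using R by auto
  \<comment> \<open>The cutoff is 1 up to the radius \<open>R / 2\<close> and vanishes from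
    \<open>3 * R / 4\<close> on. So the extended coordinates and coordinate fields are the true ones
    on the ball of radius \<open>r\<close>, while their supports stay inside the chart.\<close>
  define r where "r = R / 2"
  have r: "r > 0" "r < R" "ball ?a r \<subseteq> ball ?a R" using R by (auto simp: r_def)
  obtain \<psi> where \<psi>: "Cinf_on \<psi> UNIV" "\<And>x. x \<in> cball ?a r \<Longrightarrow> \<psi> x = 1" "\<And>x. x \<notin> ball ?a (3*R/4) \<Longrightarrow> \<psi> x = (0::real)"
    using bump_exists[of r "3*R/4" ?a] R(1) unfolding r_def by force
  have cutC: "cut U u ?a R \<psi> \<phi> \<in> C" if "Cinf_on \<phi> (ball ?a R)" for \<phi>
    by (rule cut_in_C[OF U(1) RU that \<psi>(1), of "3*R/4"]) (use R \<psi>(3) in auto)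
  define h where "h b = cut U u ?a R \<psi> (\<lambda>x. x \<bullet> b)" for b
  define d where "d b f = (if f \<in> C then cut U u ?a R \<psi> (\<lambda>x. frechet_derivative (\<lambda>x. f (?G x)) (at x) b) else (\<lambda>p. 0))" for b f
  define W where "W = ?G ` ball ?a r"
  have uG: "u (?G x) = x" "?G x \<in> U" "?G x \<in> V" if "x \<in> ball ?a R" for x
  proof -
    have "x \<in> u ` (U \<inter> V)" using that R(2) by blast
    then obtain q where "q \<in> U" "q \<in> V" "x = u q" by auto
    then show "u (?G x) = x" "?G x \<in> U" "?G x \<in> V" using chartD(7)[OF U(1)] by auto
  qed
  have uGr: "u (?G x) = x" "?G x \<in> U" "?G x \<in> V" if "x \<in> ball ?a r" for x
    using uG that r(3) by blast+
  have Weq: "W = {q \<in> U. u q \<in> ball ?a r}"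
    using uGr chartD(7)[OF U(1)] by (auto simp: W_def simp del: mem_ball intro!: image_eqI)
  have FC: "Cinf_on (\<lambda>x. f (?G x)) (ball ?a R)" if "f \<in> C" for f
    by (rule Cinf_on_subset[OF Cinf_on_chart[OF that U(1)] RU])
  have hC: "h b \<in> C" for b unfolding h_def by (rule cutC) auto
  have hG: "h b (?G x) = x \<bullet> b" if "x \<in> ball ?a r" for b x
    using uGr[OF that] \<psi>(2)[of x] that r by (simp add: h_def cut_def)
  have dVF: "d b \<in> VF" for b
  proof (rule VFI)
    show "d b f \<in> C" if "f \<in> C" for f using that cutC[OF Cinf_on_deriv[OF FC]] by (simp add: d_def)
    fix f k :: "'a \<Rightarrow> real" and p and s t :: real assume fk: "f \<in> C" "k \<in> C"
    have df: "((\<lambda>x. f (?G x)) has_derivative frechet_derivative (\<lambda>x. f (?G x)) (at y)) (at y)"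
      and dk: "((\<lambda>x. k (?G x)) has_derivative frechet_derivative (\<lambda>x. k (?G x)) (at y)) (at y)"
      if "y \<in> ball ?a R" for y using Cinf_on_has_derivative[OF FC that] fk by auto
    have iu: "?G (u p) = p" if "p \<in> U" using chartD(7)[OF U(1) that] .
    show "d b (\<lambda>p. s * f p + t * k p) p = s * d b f p + t * d b k p"
      using fk frechet_derivative_at[OF has_derivative_add[OF has_derivative_mult_right[OF df, of "u p" s] has_derivative_mult_right[OF dk, of "u p" t]], symmetric]
      by (auto simp: d_def cut_def C_add C_mult algebra_simps)
    show "d b (\<lambda>p. f p * k p) p = f p * d b k p + k p * d b f p"
      using fk frechet_derivative_at[OF has_derivative_mult[OF df[of "u p"] dk[of "u p"]], symmetric] iu
      by (auto simp: d_def cut_def C_mult algebra_simps)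
  qed (auto simp: d_def)
  have dG: "d b f (?G x) = frechet_derivative (\<lambda>x. f (?G x)) (at x) b" if "x \<in> ball ?a r" "f \<in> C" for b f x
    using uGr[OF that(1)] \<psi>(2)[of x] that r by (simp add: d_def cut_def)
  have hd: "((\<lambda>x. f (?G x)) has_derivative (\<lambda>v. \<Sum>b\<in>Basis. (v \<bullet> b) * d b f (?G x))) (at x)"
    if "x \<in> ball ?a r" "f \<in> C" for f x
  proof -
    have D: "((\<lambda>x. f (?G x)) has_derivative frechet_derivative (\<lambda>x. f (?G x)) (at x)) (at x)"
      using Cinf_on_has_derivative[OF FC[OF that(2)]] that(1) r(3) by blast
    have lin: "linear (frechet_derivative (\<lambda>x. f (?G x)) (at x))" using has_derivative_linear[OF D] .
    have "frechet_derivative (\<lambda>x. f (?G x)) (at x) v = (\<Sum>b\<in>Basis. (v \<bullet> b) * d b f (?G x))" for v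
      by (subst euclidean_representation[of v, symmetric])
        (simp only: linear_sum[OF lin] linear_cmul[OF lin] real_scaleR_def dG[OF that])
    then have "frechet_derivative (\<lambda>x. f (?G x)) (at x) = (\<lambda>v. \<Sum>b\<in>Basis. (v \<bullet> b) * d b f (?G x))" by auto
    with D show ?thesis by simp
  qed
  have rep: "X f q = (\<Sum>b\<in>Basis. X (h b) q * d b f q)" if "X \<in> VF" "f \<in> C" "q \<in> W" for X f q
  proof -
    from that(3) obtain x where x: "x \<in> ball ?a r" "q = ?G x" by (auto simp: W_def)
    obtain e where e: "e > 0" "ball x e \<subseteq> ball ?a r" using x(1) open_ball[of ?a r] open_contains_ball by metis
    have uq: "u q = x" "q \<in> U" using x uGr by auto
    show ?thesis
      using VF_chart_rep[OF U(1) uq(2) e(1), of h X f] e(2) r RU hC hG that dG[OF x(1) that(2)] uq x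
      by (simp del: mem_ball) (meson subset_trans subsetD)
  qed
  have "coords W ?a r ?G h d"
    unfolding coords_def
  proof (intro conjI ballI allI impI)
    show "open W" using chart_open_vimage[OF U(1) open_ball] Weq by simp
    show "continuous_on (ball ?a r) ?G" by (rule continuous_on_subset[OF chartD(5)[OF U(1)]]) (use r RU in auto)
    show "Cinf_on (\<lambda>x. f (?G x)) (ball ?a r)" if "f \<in> C" for f using Cinf_on_subset[OF FC[OF that] r(3)] .
    show "d b (h c) q = (if b = c then 1 else 0)" if "b \<in> Basis" "c \<in> Basis" "q \<in> W" for b c q
    proof -
      from that(3) obtain x where x: "x \<in> ball ?a r" "q = ?G x" by (auto simp: W_def)
      have "((\<lambda>y. h c (?G y)) has_derivative (\<lambda>v. v \<bullet> c)) (at x)"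
        by (rule has_derivative_cong_open[of "\<lambda>y. y \<bullet> c" _ _ "ball ?a r"])
          (use x hG in \<open>auto intro!: derivative_eq_intros simp del: mem_ball\<close>)
      then show ?thesis using dG[OF x(1) hC, of b c] x(2) frechet_derivative_at inner_Basis[OF that(1,2)] by metis
    qed
    show "\<exists>f\<in>C. \<forall>x\<in>ball ?a s. f (?G x) = \<phi> x" if "Cinf_on \<phi> (ball ?a r) \<and> s < r" for \<phi> s
    proof (cases "s > 0")
      case True
      have sr: "s < r" using that by simp
      obtain \<rho> where \<rho>: "Cinf_on \<rho> UNIV" "\<And>x. x \<in> cball ?a s \<Longrightarrow> \<rho> x = 1" "\<And>x. x \<notin> ball ?a ((s+r)/2) \<Longrightarrow> \<rho> x = (0::real)"
      proof -
        have "0 < s" "s < (s + r) / 2" using True sr by auto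
        from bump_exists[OF this, of ?a] show thesis using that by blast
      qed
      have "cut U u ?a r \<rho> \<phi> \<in> C"
        by (rule cut_in_C[OF U(1) _ _ \<rho>(1), of _ _ _ "(s+r)/2"]) (use that r RU \<rho>(3) in auto)
      moreover have "\<forall>x\<in>ball ?a s. cut U u ?a r \<rho> \<phi> (?G x) = \<phi> x"
        using uGr \<rho>(2) that by (auto simp: cut_def)
      ultimately show ?thesis by blast
    next
      case False
      then have "ball ?a s = {}" by simp
      then show ?thesis using C_const by blast
    qed
  qed (use r W_def hC dVF hG hd rep in auto)
  moreover have "p = ?G ?a" using chartD(7)[OF U] by simp
  moreover have "W \<subseteq> V" using uGr by (auto simp: W_def simp del: mem_ball)
  ultimately show ?thesis using that[of W ?a r ?G h d] r(1) by (auto simp: W_def)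
qed

end

lemma vfield_apply [simp]:
  "(X \<oplus>\<^sub>v Y) f p = X f p + Y f p" "(X \<ominus>\<^sub>v Y) f p = X f p - Y f p"
  "(h \<odot>\<^sub>v X) f p = h p * X f p" "vzero f p = 0"
  by (simp_all add: vadd_def vdiff_def vscale_def vzero_def)

lemma vfield_simps [simp]:
  "X \<ominus>\<^sub>v X = vzero" "(\<lambda>p. 0) \<odot>\<^sub>v X = vzero" "X \<oplus>\<^sub>v vzero = X" "vzero \<oplus>\<^sub>v X = X" "h \<odot>\<^sub>v vzero = vzero"
  by (simp_all add: fun_eq_iff)

context smooth_mfd begin

text \<open>The support is confined to a compact set and not merely to \<open>V\<close>, because
  \<open>dst_nbhd\<close> has to bound the derivatives of \<open>k\<close>.\<close>

lemma cutoff_exists: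
  assumes "open V" "p \<in> V"
  obtains k K W where "k \<in> C" "compact K" "K \<subseteq> V" "open W" "p \<in> W" "\<And>q. q \<in> W \<Longrightarrow> k q = 1"
    "\<And>q. q \<notin> K \<Longrightarrow> k q = 0"
proof -
  obtain U u where U: "(U, u) \<in> A" "p \<in> U" by (rule chart_at)
  let ?a = "u p" and ?G = "inv_into U u"
  have "open (u ` (U \<inter> V))" using chart_open_image[OF U(1)] chartD(1)[OF U(1)] assms by auto
  then obtain R where R: "R > 0" "ball ?a R \<subseteq> u ` (U \<inter> V)"
    using U(2) assms(2) open_contains_ball by (metis IntI imageI)
  have RU: "ball ?a R \<subseteq> u ` U" using R by auto
  have "0 < R/3" "R/3 < R/2" using R by auto
  from bump_exists[OF this, of ?a] obtain \<psi> where \<psi>: "Cinf_on \<psi> UNIV" "\<And>x. x \<in> cball ?a (R/3) \<Longrightarrow> \<psi> x = 1"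
    "\<And>x. x \<notin> ball ?a (R/2) \<Longrightarrow> \<psi> x = (0::real)" by blast
  define k where "k = cut U u ?a R \<psi> (\<lambda>x. 1)"
  define K where "K = ?G ` cball ?a (R/2)"
  have sub: "cball ?a (R/2) \<subseteq> ball ?a R" using R by auto
  show thesis
  proof (rule that[of k K "{q \<in> U. u q \<in> ball ?a (R/3)}"])
    show "k \<in> C" unfolding k_def
      by (rule cut_in_C[OF U(1) RU _ \<psi>(1), of _ "R/2"]) (use R \<psi>(3) in auto)
    show "compact K" unfolding K_def
      by (rule compact_continuous_image[OF continuous_on_subset[OF chartD(5)[OF U(1)]]])
        (use sub RU in auto)
    show "K \<subseteq> V"
    proof
      fix q assume "q \<in> K"
      then obtain x where x: "x \<in> ball ?a R" "q = ?G x" using sub by (auto simp: K_def)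
      then obtain y where "y \<in> U \<inter> V" "x = u y" using R(2) by blast
      then show "q \<in> V" using x(2) chartD(7)[OF U(1)] by auto
    qed
    show "open {q \<in> U. u q \<in> ball ?a (R/3)}" by (rule chart_open_vimage[OF U(1) open_ball])
    show "p \<in> {q \<in> U. u q \<in> ball ?a (R/3)}" using U R by auto
    show "k q = 1" if "q \<in> {q \<in> U. u q \<in> ball ?a (R/3)}" for q
      using that \<psi>(2)[of "u q"] R by (auto simp: k_def cut_def)
    show "k q = 0" if "q \<notin> K" for q
    proof (cases "q \<in> U \<and> u q \<in> ball ?a R")
      case True
      have "u q \<notin> cball ?a (R/2)"
      proof
        assume "u q \<in> cball ?a (R/2)"
        then have "?G (u q) \<in> K" unfolding K_def by (rule imageI)
        then show False using that chartD(7)[OF U(1)] True by simp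
      qed
      then show ?thesis using \<psi>(3) by (simp add: k_def cut_def)
    qed (auto simp: k_def cut_def)
  qed
qed

text \<open>Derivations are local: the difference of the two functions times a cutoff supported
  where they agree is identically 0, and the product rule at \<open>q\<close> isolates the
  derivative of the difference.\<close>

lemma VF_germ:
  assumes X: "X \<in> VF" and fh: "f \<in> C" "h \<in> C" and W: "open W" "q \<in> W" "\<And>r. r \<in> W \<Longrightarrow> f r = h r"
  shows "X f q = X h q"
proof -
  obtain k K W' where k: "k \<in> C" "K \<subseteq> W" "q \<in> W'" "\<And>q. q \<in> W' \<Longrightarrow> k q = 1" "\<And>q. q \<notin> K \<Longrightarrow> k q = 0"
    by (rule cutoff_exists[OF W(1,2)]) blast
  have "k r * (f r - h r) = 0" for r using k(2,5) W(3) by (cases "r \<in> K") auto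
  then have "(\<lambda>r. k r * (f r - h r)) = (\<lambda>r. 0)" by auto
  then have "X (\<lambda>r. k r * (f r - h r)) q = 0" using VF_const[OF X, of 0 q] by simp
  then show ?thesis
    using VF_mult[OF X k(1) C_diff[OF fh], of q] VF_diff[OF X fh] k(3,4) W by simp
qed

lemma VF_locally_const:
  assumes "X \<in> VF" "f \<in> C" "open W" "q \<in> W" "\<And>r. r \<in> W \<Longrightarrow> f r = c"
  shows "X f q = 0"
  using VF_germ[OF assms(1,2) C_const assms(3-5)] VF_const[OF assms(1)] by simp

text \<open>Tangent vectors at \<open>p\<close> are represented by fields modulo this
  relation.\<close>

definition "eqv p X Y \<longleftrightarrow> (\<forall>f. X f p = Y f p)"

lemma eqvI: "X \<in> VF \<Longrightarrow> Y \<in> VF \<Longrightarrow> (\<And>f. f \<in> C \<Longrightarrow> X f p = Y f p) \<Longrightarrow> eqv p X Y"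
  unfolding eqv_def by (metis VF_0)
lemma eqv_imp_eq: "X \<in> VF \<Longrightarrow> Y \<in> VF \<Longrightarrow> (\<And>p. eqv p X Y) \<Longrightarrow> X = Y"
  by (auto simp: eqv_def fun_eq_iff)

definition "vsum I X = (\<lambda>f p. \<Sum>i\<in>I. X i f p)"

lemma vsum_insert: "finite I \<Longrightarrow> i \<notin> I \<Longrightarrow> vsum (insert i I) X = X i \<oplus>\<^sub>v vsum I X"
  by (simp add: vsum_def vadd_def)
lemma vsum_empty: "vsum {} X = vzero" by (simp add: vsum_def vzero_def)

lemma vsum_VF [intro]: "finite I \<Longrightarrow> (\<And>i. i \<in> I \<Longrightarrow> X i \<in> VF) \<Longrightarrow> vsum I X \<in> VF"
  by (induction I rule: finite_induct) (auto simp: vsum_insert vsum_empty)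

lemma vdiff_eq: "X \<ominus>\<^sub>v Y = X \<oplus>\<^sub>v (\<lambda>p. -1) \<odot>\<^sub>v Y"
  by (simp add: vdiff_def vadd_def vscale_def)

context fixes \<omega> assumes \<omega>: "one_form A \<omega>" begin

lemma form_C: "X \<in> VF \<Longrightarrow> \<omega> X \<in> C" using \<omega> by (simp add: one_form_def)
lemma form_add: "X \<in> VF \<Longrightarrow> Y \<in> VF \<Longrightarrow> \<omega> (X \<oplus>\<^sub>v Y) p = \<omega> X p + \<omega> Y p"
  using \<omega> by (simp add: one_form_def)
lemma form_scale: "h \<in> C \<Longrightarrow> X \<in> VF \<Longrightarrow> \<omega> (h \<odot>\<^sub>v X) p = h p * \<omega> X p"
  using \<omega> by (simp add: one_form_def)
lemma form_diff: "X \<in> VF \<Longrightarrow> Y \<in> VF \<Longrightarrow> \<omega> (X \<ominus>\<^sub>v Y) p = \<omega> X p - \<omega> Y p"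
  unfolding vdiff_eq by (simp add: form_add form_scale)
lemma form_zero: "\<omega> vzero p = 0"
  using form_diff[of vzero vzero p] by simp

lemma form_vsum: "finite I \<Longrightarrow> (\<And>i. i \<in> I \<Longrightarrow> X i \<in> VF) \<Longrightarrow> \<omega> (vsum I X) p = (\<Sum>i\<in>I. \<omega> (X i) p)"
  by (induction I rule: finite_induct) (simp_all add: vsum_insert vsum_empty form_zero form_add vsum_VF)

text \<open>Function-linearity implies pointwise dependence. A field that vanishes at
  \<open>p\<close> is, after multiplication by a cutoff, a combination of coordinate fields whose
  coefficients vanish at \<open>p\<close>.\<close>

lemma form_eqv:
  assumes X: "X \<in> VF" and Y: "Y \<in> VF" and e: "eqv p X Y" shows "\<omega> X p = \<omega> Y p"
proof -
  define Z where "Z = X \<ominus>\<^sub>v Y"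
  have Z: "Z \<in> VF" "\<And>f. Z f p = 0" using X Y e by (auto simp: Z_def eqv_def)
  obtain W a r G h d where cc: "coords W (a::'e) r G h d" "p \<in> W"
    by (rule coords_exist[OF open_UNIV UNIV_I])
  then have hC: "\<And>b. b \<in> Basis \<Longrightarrow> h b \<in> C" and dV: "\<And>b. d b \<in> VF" and oW: "open W"
    and rep: "\<And>X f q. X \<in> VF \<Longrightarrow> f \<in> C \<Longrightarrow> q \<in> W \<Longrightarrow> X f q = (\<Sum>b\<in>Basis. X (h b) q * d b f q)"
    by (auto simp: coords_def)
  obtain k K W' where k: "k \<in> C" "K \<subseteq> W" "p \<in> W'" "\<And>q. q \<in> W' \<Longrightarrow> k q = 1" "\<And>q. q \<notin> K \<Longrightarrow> k q = 0"
    by (rule cutoff_exists[OF oW cc(2)]) blast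
  let ?c = "\<lambda>b p. k p * Z (h b) p"
  have cC: "?c b \<in> C" if "b \<in> Basis" for b using k(1) VF_C[OF Z(1) hC[OF that]] by blast
  have "k \<odot>\<^sub>v Z = vsum Basis (\<lambda>b. ?c b \<odot>\<^sub>v d b)"
  proof (rule VF_eqI)
    fix f q assume f: "f \<in> C"
    show "(k \<odot>\<^sub>v Z) f q = vsum Basis (\<lambda>b. ?c b \<odot>\<^sub>v d b) f q"
    proof (cases "q \<in> K")
      case True
      then have "q \<in> W" using k(2) by auto
      from rep[OF Z(1) f this] show ?thesis
        by (simp add: vsum_def sum_distrib_left mult.assoc)
    qed (simp add: vsum_def k(5))
  qed (use k Z dV cC in auto)
  then have "\<omega> (k \<odot>\<^sub>v Z) p = (\<Sum>b\<in>Basis. ?c b p * \<omega> (d b) p)"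
    using form_vsum[of Basis "\<lambda>b. ?c b \<odot>\<^sub>v d b" p] cC dV by (simp add: form_scale)
  then have "\<omega> Z p = 0" using form_scale[OF k(1) Z(1)] k(3,4) Z(2) by simp
  then show ?thesis using form_diff[OF X Y] by (simp add: Z_def)
qed

end

lemma endo_VF: "endo_field A \<phi> \<Longrightarrow> X \<in> VF \<Longrightarrow> \<phi> X \<in> VF" by (simp add: endo_field_def)
lemma endo_add: "endo_field A \<phi> \<Longrightarrow> X \<in> VF \<Longrightarrow> Y \<in> VF \<Longrightarrow> \<phi> (X \<oplus>\<^sub>v Y) = \<phi> X \<oplus>\<^sub>v \<phi> Y"
  by (simp add: endo_field_def)
lemma endo_scale: "endo_field A \<phi> \<Longrightarrow> h \<in> C \<Longrightarrow> X \<in> VF \<Longrightarrow> \<phi> (h \<odot>\<^sub>v X) = h \<odot>\<^sub>v \<phi> X"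
  by (simp add: endo_field_def)
text \<open>Evaluation on a fixed function reduces pointwise questions about endomorphism fields to
  1-forms.\<close>

lemma endo_form: "endo_field A \<phi> \<Longrightarrow> f \<in> C \<Longrightarrow> one_form A (\<lambda>X. \<phi> X f)"
  by (simp add: one_form_def endo_add endo_scale endo_VF VF_C)

lemma endo_diff: "endo_field A \<phi> \<Longrightarrow> X \<in> VF \<Longrightarrow> Y \<in> VF \<Longrightarrow> \<phi> (X \<ominus>\<^sub>v Y) = \<phi> X \<ominus>\<^sub>v \<phi> Y"
  unfolding vdiff_eq by (simp only: endo_add endo_scale vscale_VF C_const)

lemma endo_zero: "endo_field A \<phi> \<Longrightarrow> \<phi> vzero = vzero"
  using endo_scale[of \<phi> "\<lambda>p. 0" vzero] by simp

lemma endo_eqv: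
  assumes "endo_field A \<phi>" "X \<in> VF" "Y \<in> VF" "eqv p X Y" shows "eqv p (\<phi> X) (\<phi> Y)"
  by (rule eqvI) (use assms endo_VF form_eqv[OF endo_form] in auto)

lemma endoI_local:
  assumes "\<And>X. X \<in> VF \<Longrightarrow> \<phi> X \<in> VF"
    "\<And>X Y f p. X \<in> VF \<Longrightarrow> Y \<in> VF \<Longrightarrow> f \<in> C \<Longrightarrow> \<phi> (X \<oplus>\<^sub>v Y) f p = \<phi> X f p + \<phi> Y f p"
    "\<And>h X f p. h \<in> C \<Longrightarrow> X \<in> VF \<Longrightarrow> f \<in> C \<Longrightarrow> \<phi> (h \<odot>\<^sub>v X) f p = h p * \<phi> X f p"
  shows "endo_field A \<phi>"
  unfolding endo_field_def
  by (intro conjI ballI VF_eqI) (use assms in auto)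

lemma conn_endo: "linear_connection A D \<Longrightarrow> Y \<in> VF \<Longrightarrow> endo_field A (\<lambda>X. D X Y)"
  by (simp add: linear_connection_def)
lemma conn_VF: "linear_connection A D \<Longrightarrow> X \<in> VF \<Longrightarrow> Y \<in> VF \<Longrightarrow> D X Y \<in> VF"
  using endo_VF[OF conn_endo] by blast
lemma conn_add: "linear_connection A D \<Longrightarrow> X \<in> VF \<Longrightarrow> Y \<in> VF \<Longrightarrow> Z \<in> VF \<Longrightarrow> D X (Y \<oplus>\<^sub>v Z) = D X Y \<oplus>\<^sub>v D X Z"
  by (simp add: linear_connection_def)
lemma conn_scale: "linear_connection A D \<Longrightarrow> h \<in> C \<Longrightarrow> X \<in> VF \<Longrightarrow> Y \<in> VF \<Longrightarrow>
    D X (h \<odot>\<^sub>v Y) = X h \<odot>\<^sub>v Y \<oplus>\<^sub>v h \<odot>\<^sub>v D X Y"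
  by (simp add: linear_connection_def)
lemma conn_diff:
  assumes "linear_connection A D" "X \<in> VF" "Y \<in> VF" "Z \<in> VF"
  shows "D X (Y \<ominus>\<^sub>v Z) = D X Y \<ominus>\<^sub>v D X Z"
proof -
  have "X (\<lambda>p. - 1) = (\<lambda>p. 0)" using VF_const[OF assms(2)] by auto
  then show ?thesis using assms unfolding vdiff_eq
    by (simp only: conn_add conn_scale vscale_VF C_const vfield_simps)
qed
lemma conn_zero: "linear_connection A D \<Longrightarrow> X \<in> VF \<Longrightarrow> D X vzero = vzero"
  using conn_diff[of D X vzero vzero] by simp

end

subsection \<open>Riemannian and Sasakian manifolds\<close>

locale riem_mfd = smooth_mfd A for A :: "('a::{t2_space,second_countable_topology}, real^3) atlas" +
  fixes g :: "'a vfield \<Rightarrow> 'a vfield \<Rightarrow> 'a \<Rightarrow> real" and D :: "'a vfield \<Rightarrow> 'a vfield \<Rightarrow> 'a vfield"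
  assumes metric: "riemannian_metric A g" and LC: "levi_civita A g D"
begin

lemma g_form: "X \<in> VF \<Longrightarrow> one_form A (g X)" using metric by (simp add: riemannian_metric_def)
lemma g_C [simp, intro]: "X \<in> VF \<Longrightarrow> Y \<in> VF \<Longrightarrow> g X Y \<in> C" using form_C[OF g_form] by blast
lemma g_sym: "X \<in> VF \<Longrightarrow> Y \<in> VF \<Longrightarrow> g X Y p = g Y X p"
  using metric by (simp add: riemannian_metric_def)
lemma g_pos: "X \<in> VF \<Longrightarrow> X f p \<noteq> 0 \<Longrightarrow> g X X p > 0"
  using metric unfolding riemannian_metric_def by blast
lemma g_add: "X \<in> VF \<Longrightarrow> Y \<in> VF \<Longrightarrow> Z \<in> VF \<Longrightarrow> g X (Y \<oplus>\<^sub>v Z) p = g X Y p + g X Z p"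
  "X \<in> VF \<Longrightarrow> Y \<in> VF \<Longrightarrow> Z \<in> VF \<Longrightarrow> g (Y \<oplus>\<^sub>v Z) X p = g Y X p + g Z X p"
  using form_add[OF g_form] g_sym by auto
lemma g_diff: "X \<in> VF \<Longrightarrow> Y \<in> VF \<Longrightarrow> Z \<in> VF \<Longrightarrow> g X (Y \<ominus>\<^sub>v Z) p = g X Y p - g X Z p"
  "X \<in> VF \<Longrightarrow> Y \<in> VF \<Longrightarrow> Z \<in> VF \<Longrightarrow> g (Y \<ominus>\<^sub>v Z) X p = g Y X p - g Z X p"
  using form_diff[OF g_form] g_sym by auto
lemma g_scale: "X \<in> VF \<Longrightarrow> h \<in> C \<Longrightarrow> Y \<in> VF \<Longrightarrow> g X (h \<odot>\<^sub>v Y) p = h p * g X Y p"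
  "X \<in> VF \<Longrightarrow> h \<in> C \<Longrightarrow> Y \<in> VF \<Longrightarrow> g (h \<odot>\<^sub>v Y) X p = h p * g Y X p"
  using form_scale[OF g_form] g_sym by auto
lemma g_zero: "X \<in> VF \<Longrightarrow> g X vzero p = 0" "X \<in> VF \<Longrightarrow> g vzero X p = 0"
  subgoal by (rule form_zero[OF g_form])
  subgoal using form_zero[OF g_form, of X p] g_sym[of vzero X p] by simp
  done
lemmas g_simps = g_add g_diff g_scale g_zero

lemma g_eqv: "X \<in> VF \<Longrightarrow> Y \<in> VF \<Longrightarrow> Z \<in> VF \<Longrightarrow> eqv p Y Z \<Longrightarrow> g X Y p = g X Z p"
  "X \<in> VF \<Longrightarrow> Y \<in> VF \<Longrightarrow> Z \<in> VF \<Longrightarrow> eqv p Y Z \<Longrightarrow> g Y X p = g Z X p"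
proof -
  show *: "X \<in> VF \<Longrightarrow> Y \<in> VF \<Longrightarrow> Z \<in> VF \<Longrightarrow> eqv p Y Z \<Longrightarrow> g X Y p = g X Z p" for X Y Z
    using form_eqv[OF g_form] by blast
  show "X \<in> VF \<Longrightarrow> Y \<in> VF \<Longrightarrow> Z \<in> VF \<Longrightarrow> eqv p Y Z \<Longrightarrow> g Y X p = g Z X p"
    using *[of X Y Z] g_sym[of X Y p] g_sym[of X Z p] by simp
qed

lemma g_nonneg: "X \<in> VF \<Longrightarrow> g X X p \<ge> 0"
  using g_pos[of X _ p] g_eqv(1)[of X X vzero p] g_zero(1)[of X p]
  by (metis eqv_def less_imp_le order_refl vzero_VF vfield_apply(4))

lemma g_null_eqv:
  assumes "X \<in> VF" "g X X p = 0" shows "eqv p X vzero"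
  using g_pos[OF assms(1), of _ p] assms(2) by (force simp: eqv_def)

lemma eqv_gI:
  assumes "X \<in> VF" "Y \<in> VF" "\<And>Z. Z \<in> VF \<Longrightarrow> g X Z p = g Y Z p" shows "eqv p X Y"
proof -
  have "g (X \<ominus>\<^sub>v Y) (X \<ominus>\<^sub>v Y) p = 0" using assms by (simp add: g_diff)
  from g_null_eqv[OF _ this] assms show ?thesis by (auto simp: eqv_def)
qed

text \<open>The tangent space is at most three-dimensional, so an orthonormal triple spans it.\<close>

definition "onb p E1 E2 E3 \<longleftrightarrow> E1 \<in> VF \<and> E2 \<in> VF \<and> E3 \<in> VF \<and>
  g E1 E1 p = 1 \<and> g E2 E2 p = 1 \<and> g E3 E3 p = 1 \<and> g E1 E2 p = 0 \<and> g E2 E3 p = 0 \<and> g E3 E1 p = 0"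

lemma onb_span:
  assumes o: "onb p E1 E2 E3" and X: "X \<in> VF"
  shows "X f p = g X E1 p * E1 f p + g X E2 p * E2 f p + g X E3 p * E3 f p"
proof -
  from o have E: "E1 \<in> VF" "E2 \<in> VF" "E3 \<in> VF" and
    on: "g E1 E1 p = 1" "g E2 E2 p = 1" "g E3 E3 p = 1" "g E1 E2 p = 0" "g E2 E3 p = 0" "g E3 E1 p = 0"
    "g E2 E1 p = 0" "g E3 E2 p = 0" "g E1 E3 p = 0"
    using g_sym by (auto simp: onb_def)
  define P where "P = (\<lambda>q. g X E1 p) \<odot>\<^sub>v E1 \<oplus>\<^sub>v (\<lambda>q. g X E2 p) \<odot>\<^sub>v E2 \<oplus>\<^sub>v (\<lambda>q. g X E3 p) \<odot>\<^sub>v E3"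
  define Z where "Z = X \<ominus>\<^sub>v P"
  have P: "P \<in> VF" unfolding P_def using E by auto
  have Z: "Z \<in> VF" unfolding Z_def using P X by auto
  have ZE: "g Z E1 p = 0" "g Z E2 p = 0" "g Z E3 p = 0"
    using E P X on by (auto simp: Z_def P_def g_simps)
  have ZE': "g E1 Z p = 0" "g E2 Z p = 0" "g E3 Z p = 0" using ZE g_sym E Z by auto
  obtain W a r G h d where cc: "coords W (a::real^3) r G h d" "p \<in> W"
    by (rule coords_exist[OF open_UNIV UNIV_I])
  then have hC: "\<And>b. b \<in> Basis \<Longrightarrow> h b \<in> C"
    and rep: "\<And>X f q. X \<in> VF \<Longrightarrow> f \<in> C \<Longrightarrow> q \<in> W \<Longrightarrow> X f q = (\<Sum>b\<in>Basis. X (h b) q * d b f q)"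
    by (auto simp: coords_def)
  \<comment> \<open>\<open>T\<close> reads off coordinates at \<open>p\<close> and so embeds the
    tangent space in a three-dimensional space. If the part \<open>Z\<close> of \<open>X\<close>
    orthogonal to the triple were nonzero, the map \<open>L\<close> below would embed a
    four-dimensional space in it.\<close>
  define T where "T Y = (\<Sum>b\<in>Basis. Y (h b) p *\<^sub>R (b::real^3))" for Y :: "'a vfield"
  have T0: "Y f p = 0" if "Y \<in> VF" "T Y = 0" for Y f
  proof (cases "f \<in> C")
    case True
    have "Y (h b) p = 0" if "b \<in> Basis" for b
    proof -
      have "T Y \<bullet> b = Y (h b) p"
        using that by (simp add: T_def inner_sum_left inner_Basis if_distrib[of "(*) _"] sum.delta' cong: if_cong)
      then show ?thesis using \<open>T Y = 0\<close> by simp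
    qed
    then show ?thesis using rep[OF that(1) True cc(2)] by simp
  next
    case False
    then show ?thesis using VF_0[OF that(1)] by simp
  qed
  have "g Z Z p = 0"
  proof (rule ccontr)
    assume nz: "g Z Z p \<noteq> 0"
    define L where "L = (\<lambda>(x1, x2, x3, x4). x1 *\<^sub>R T E1 + x2 *\<^sub>R T E2 + x3 *\<^sub>R T E3 + x4 *\<^sub>R T Z)"
    have lin: "linear (L :: real \<times> real \<times> real \<times> real \<Rightarrow> _)"
      by (rule linearI) (auto simp: L_def algebra_simps scaleR_add_left)
    have inj: "inj L"
    proof (subst linear_injective_0[OF lin], intro allI impI)
      fix v :: "real \<times> real \<times> real \<times> real" assume v: "L v = 0"
      obtain x1 x2 x3 x4 where v4: "v = (x1, x2, x3, x4)" by (metis prod_cases4)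
      define Y where "Y = (\<lambda>q. x1) \<odot>\<^sub>v E1 \<oplus>\<^sub>v (\<lambda>q. x2) \<odot>\<^sub>v E2 \<oplus>\<^sub>v (\<lambda>q. x3) \<odot>\<^sub>v E3 \<oplus>\<^sub>v (\<lambda>q. x4) \<odot>\<^sub>v Z"
      have Y: "Y \<in> VF" unfolding Y_def using E Z by auto
      have "T Y = L v"
        by (simp add: T_def L_def v4 Y_def scaleR_sum_right sum.distrib scaleR_add_left)
      then have "eqv p Y vzero" using T0[OF Y] v by (simp add: eqv_def)
      then have "g E1 Y p = 0" "g E2 Y p = 0" "g E3 Y p = 0" "g Z Y p = 0"
        using g_eqv(1)[OF _ Y vzero_VF] g_zero E Z by auto
      then show "v = 0" using E Z on ZE ZE' nz
        by (simp add: Y_def g_simps v4 zero_prod_def)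
    qed
    have "independent (L ` (Basis :: (real \<times> real \<times> real \<times> real) set))"
      using linear_independent_injective_image[OF lin independent_Basis] inj by (auto simp: inj_on_def)
    then have "card (L ` (Basis :: (real \<times> real \<times> real \<times> real) set)) \<le> DIM(real^3)"
      using independent_bound by blast
    moreover have "card (L ` (Basis :: (real \<times> real \<times> real \<times> real) set)) = 4"
      using inj by (subst card_image) (auto simp: inj_on_def)
    ultimately show False by simp
  qed
  from g_null_eqv[OF Z this] have "Z f p = 0" by (simp add: eqv_def)
  then show ?thesis by (simp add: Z_def P_def)
qed

lemma onb_g:
  assumes o: "onb p E1 E2 E3" and X: "X \<in> VF" and Y: "Y \<in> VF"
  shows "g X Y p = g X E1 p * g Y E1 p + g X E2 p * g Y E2 p + g X E3 p * g Y E3 p"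
proof -
  from o have E: "E1 \<in> VF" "E2 \<in> VF" "E3 \<in> VF" by (auto simp: onb_def)
  let ?P = "(\<lambda>q. g X E1 p) \<odot>\<^sub>v E1 \<oplus>\<^sub>v (\<lambda>q. g X E2 p) \<odot>\<^sub>v E2 \<oplus>\<^sub>v (\<lambda>q. g X E3 p) \<odot>\<^sub>v E3"
  have "eqv p X ?P" using onb_span[OF o X] by (simp add: eqv_def)
  then have "g X Y p = g ?P Y p" by (intro g_eqv) (use X Y E in auto)
  then show ?thesis using E Y by (simp add: g_simps g_sym)
qed

lemma eqv_onbI:
  assumes o: "onb p E1 E2 E3" and X: "X \<in> VF" and Y: "Y \<in> VF"
    and "g X E1 p = g Y E1 p" "g X E2 p = g Y E2 p" "g X E3 p = g Y E3 p"
  shows "eqv p X Y"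
  using onb_span[OF o X] onb_span[OF o Y] assms(4-6) by (simp add: eqv_def)

lemma conn: "linear_connection A D" using LC by (simp add: levi_civita_def)
lemmas D_VF [simp, intro] = conn_VF[OF conn]
lemmas D_add = conn_add[OF conn]
lemmas D_scale = conn_scale[OF conn]
lemmas D_diff = conn_diff[OF conn]
lemmas D_endo = conn_endo[OF conn]

lemma torsion_free: "X \<in> VF \<Longrightarrow> Y \<in> VF \<Longrightarrow> bracket X Y f p = D X Y f p - D Y X f p"
proof -
  assume "X \<in> VF" "Y \<in> VF"
  then have "bracket X Y = D X Y \<ominus>\<^sub>v D Y X" using LC by (simp add: levi_civita_def)
  then show ?thesis by simp
qed

lemma torsion_free_g: "X \<in> VF \<Longrightarrow> Y \<in> VF \<Longrightarrow> Z \<in> VF \<Longrightarrow> g (bracket X Y) Z p = g (D X Y) Z p - g (D Y X) Z p"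
proof -
  assume "X \<in> VF" "Y \<in> VF" "Z \<in> VF"
  then have "bracket X Y = D X Y \<ominus>\<^sub>v D Y X" using LC by (simp add: levi_civita_def)
  then show ?thesis using \<open>X \<in> VF\<close> \<open>Y \<in> VF\<close> \<open>Z \<in> VF\<close> by (simp add: g_simps)
qed

lemma D_metric: "X \<in> VF \<Longrightarrow> Y \<in> VF \<Longrightarrow> Z \<in> VF \<Longrightarrow> X (g Y Z) p = g (D X Y) Z p + g Y (D X Z) p"
proof -
  assume "X \<in> VF" "Y \<in> VF" "Z \<in> VF"
  then have "cov_metric D g X Y Z = (\<lambda>p. 0)" using LC by (simp add: levi_civita_def)
  then have "cov_metric D g X Y Z p = 0" by simp
  then show ?thesis by (simp add: cov_metric_def)
qed

end

section \<open>Symmetries of the curvature tensor and metric duals of forms\<close>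

context riem_mfd begin

lemma bracket_eq_D: "X \<in> VF \<Longrightarrow> Y \<in> VF \<Longrightarrow> bracket X Y = D X Y \<ominus>\<^sub>v D Y X"
  using LC by (simp add: levi_civita_def)

abbreviation "R \<equiv> curvature D"

lemma R_VF [simp, intro]: "X \<in> VF \<Longrightarrow> Y \<in> VF \<Longrightarrow> Z \<in> VF \<Longrightarrow> R X Y Z \<in> VF"
  by (simp add: curvature_def)

lemma R_antisym:
  assumes "X \<in> VF" "Y \<in> VF" "Z \<in> VF" shows "R Y X Z = vzero \<ominus>\<^sub>v R X Y Z"
proof -
  have "D (bracket Y X) Z = vzero \<ominus>\<^sub>v D (bracket X Y) Z"
    using assms endo_diff[OF D_endo[OF assms(3)], of vzero "bracket X Y"] endo_zero[OF D_endo[OF assms(3)]]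
    by (simp add: bracket_antisym[of Y X])
  then show ?thesis by (simp add: curvature_def fun_eq_iff)
qed

lemma g_R_swap12: "X \<in> VF \<Longrightarrow> Y \<in> VF \<Longrightarrow> Z \<in> VF \<Longrightarrow> W \<in> VF \<Longrightarrow> g (R Y X Z) W p = - g (R X Y Z) W p"
  by (simp add: R_antisym[of X Y Z] g_simps)

text \<open>The function \<open>g Z W\<close> is differentiated along \<open>X\<close> and
  \<open>Y\<close> in both orders and along the bracket; the mixed terms cancel and the curvature
  terms remain.\<close>

lemma g_R_swap34:
  assumes X: "X \<in> VF" and Y: "Y \<in> VF" and Z: "Z \<in> VF" and W: "W \<in> VF"
  shows "g (R X Y W) Z p = - g (R X Y Z) W p"
proof -
  have e: "V (g Z W) = (\<lambda>p. g (D V Z) W p + g Z (D V W) p)" if "V \<in> VF" for V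
    using D_metric[OF that Z W] by auto
  have XY: "V (V' (g Z W)) p = g (D V (D V' Z)) W p + g (D V' Z) (D V W) p + g (D V Z) (D V' W) p + g Z (D V (D V' W)) p"
    if "V \<in> VF" "V' \<in> VF" for V V'
    using that Z W by (simp add: e[OF that(2)] VF_add[OF that(1)] D_metric)
  have "bracket X Y (g Z W) p = g (D (bracket X Y) Z) W p + g Z (D (bracket X Y) W) p"
    using D_metric[of "bracket X Y" Z W] X Y Z W by simp
  moreover have "bracket X Y (g Z W) p = X (Y (g Z W)) p - Y (X (g Z W)) p" by (simp add: bracket_def)
  ultimately have "g (R X Y Z) W p + g Z (R X Y W) p = 0"
    using XY[OF X Y] XY[OF Y X] X Y Z W by (simp add: curvature_def g_simps)
  then show ?thesis using g_sym[of Z "R X Y W"] X Y Z W by simp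
qed

text \<open>Vanishing torsion turns the cyclic sum into the Jacobi identity for the
  brackets.\<close>

lemma bianchi:
  assumes X: "X \<in> VF" and Y: "Y \<in> VF" and Z: "Z \<in> VF"
  shows "R X Y Z f p + R Y Z X f p + R Z X Y f p = 0"
proof (cases "f \<in> C")
  case f: True
  have d: "D U (D V W) f p - D U (D W V) f p - D (bracket V W) U f p = bracket U (bracket V W) f p"
    if "U \<in> VF" "V \<in> VF" "W \<in> VF" for U V W
    using that torsion_free[of U "bracket V W" f p] by (simp add: bracket_eq_D[of V W] D_diff)
  have J: "bracket U (bracket V W) f p = U (V (W f)) p - U (W (V f)) p - V (W (U f)) p + W (V (U f)) p"
    if "U \<in> VF" "V \<in> VF" "W \<in> VF" for U V W
  proof -
    have "bracket V W f = (\<lambda>p. V (W f) p - W (V f) p)" by (simp add: bracket_def)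
    then show ?thesis
      using VF_diff[OF that(1) VF_C[OF that(2) VF_C[OF that(3) f]] VF_C[OF that(3) VF_C[OF that(2) f]], of p]
      by (simp add: bracket_def)
  qed
  have "R X Y Z f p + R Y Z X f p + R Z X Y f p =
      bracket X (bracket Y Z) f p + bracket Y (bracket Z X) f p + bracket Z (bracket X Y) f p"
    using d[OF X Y Z] d[OF Y Z X] d[OF Z X Y] by (simp add: curvature_def)
  then show ?thesis using J[OF X Y Z] J[OF Y Z X] J[OF Z X Y] by simp
next
  case False
  then show ?thesis
    using VF_0[OF R_VF[OF X Y Z]] VF_0[OF R_VF[OF Y Z X]] VF_0[OF R_VF[OF Z X Y]] by simp
qed

lemma g_bianchi:
  assumes X: "X \<in> VF" and Y: "Y \<in> VF" and Z: "Z \<in> VF" and W: "W \<in> VF"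
  shows "g (R X Y Z) W p + g (R Y Z X) W p + g (R Z X Y) W p = 0"
proof -
  have "R X Y Z \<oplus>\<^sub>v R Y Z X \<oplus>\<^sub>v R Z X Y = vzero"
    using bianchi[OF X Y Z] by (simp add: fun_eq_iff)
  then have "g (R X Y Z \<oplus>\<^sub>v R Y Z X \<oplus>\<^sub>v R Z X Y) W p = 0" using W by (simp add: g_zero)
  then show ?thesis using assms by (simp add: g_simps)
qed

text \<open>Milnor's octahedron argument: the four Bianchi identities, rewritten by the two
  antisymmetries, combine linearly.\<close>

lemma g_R_pair:
  assumes X: "X \<in> VF" and Y: "Y \<in> VF" and Z: "Z \<in> VF" and W: "W \<in> VF"
  shows "g (R Z W X) Y p = g (R X Y Z) W p"
  using g_bianchi[OF X Y Z W, of p] g_bianchi[OF Y Z W X, of p] g_bianchi[OF Z W X Y, of p] g_bianchi[OF W X Y Z, of p]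
    g_R_swap34[OF Y Z X W, of p] g_R_swap34[OF Z W X Y, of p] g_R_swap12[OF Y W Z X, of p]
    g_R_swap12[OF X W Z Y, of p] g_R_swap34[OF X W Y Z, of p] g_R_swap12[OF Z X W Y, of p] g_R_swap34[OF Z X Y W, of p]
    g_R_swap12[OF X W Y Z, of p] g_R_swap34[OF X Y Z W, of p] g_R_swap34[OF Y W Z X, of p]
  by linarith

text \<open>A skew form has three components in an orthonormal triple. In the applications
  \<open>E3\<close> is \<open>\<xi>\<close> and the two components that involve it are known
  beforehand, so only \<open>B E1 E2\<close> is left to find.\<close>

lemma skew_expand:
  assumes o: "onb p E1 E2 E3"
    and lin: "\<And>Z. Z \<in> VF \<Longrightarrow> one_form A (B Z)" and skew: "\<And>Z W. Z \<in> VF \<Longrightarrow> W \<in> VF \<Longrightarrow> B W Z p = - B Z W p"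
    and Z: "Z \<in> VF" and W: "W \<in> VF"
  shows "B Z W p = (g Z E1 p * g W E2 p - g Z E2 p * g W E1 p) * B E1 E2 p
     + (g Z E3 p * g W E1 p - g Z E1 p * g W E3 p) * B E3 E1 p
     + (g Z E3 p * g W E2 p - g Z E2 p * g W E3 p) * B E3 E2 p"
proof -
  from o have E: "E1 \<in> VF" "E2 \<in> VF" "E3 \<in> VF" by (auto simp: onb_def)
  have ex: "B V Y p = g Y E1 p * B V E1 p + g Y E2 p * B V E2 p + g Y E3 p * B V E3 p"
    if V: "V \<in> VF" and Y: "Y \<in> VF" for V Y
  proof -
    let ?P = "(\<lambda>q. g Y E1 p) \<odot>\<^sub>v E1 \<oplus>\<^sub>v (\<lambda>q. g Y E2 p) \<odot>\<^sub>v E2 \<oplus>\<^sub>v (\<lambda>q. g Y E3 p) \<odot>\<^sub>v E3"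
    have "eqv p Y ?P" using onb_span[OF o Y] by (simp add: eqv_def)
    then have "B V Y p = B V ?P p" by (intro form_eqv[OF lin[OF V]]) (use Y E in auto)
    then show ?thesis using E by (simp add: form_add[OF lin[OF V]] form_scale[OF lin[OF V]])
  qed
  have "B E1 E1 p = 0" "B E2 E2 p = 0" "B E3 E3 p = 0" using skew[of E1 E1] skew[of E2 E2] skew[of E3 E3] E by auto
  then have e: "B Z E1 p = g Z E3 p * B E3 E1 p - g Z E2 p * B E1 E2 p"
    "B Z E2 p = g Z E1 p * B E1 E2 p + g Z E3 p * B E3 E2 p"
    "B Z E3 p = - g Z E1 p * B E3 E1 p - g Z E2 p * B E3 E2 p"
    using skew[OF Z E(1)] skew[OF Z E(2)] skew[OF Z E(3)] ex[OF E(1) Z] ex[OF E(2) Z] ex[OF E(3) Z]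
      skew[OF E(1) E(2)] skew[OF E(3) E(1)] skew[OF E(3) E(2)] by simp_all
  show ?thesis unfolding ex[OF Z W] e by (simp add: algebra_simps)
qed

lemma dual_ext_deriv:
  assumes X: "X \<in> VF" and Y: "Y \<in> VF" and E: "E \<in> VF"
  shows "X (g Y E) p - Y (g X E) p - g (bracket X Y) E p = g Y (D X E) p - g X (D Y E) p"
  using assms D_metric[OF X Y E, of p] D_metric[OF Y X E, of p] torsion_free_g[OF X Y E, of p] by simp

text \<open>The metric dual of \<open>\<omega>\<close>. Since the metric is nondegenerate, a vector
  dual to \<open>\<omega>\<close> at a point is unique, so the pointwise choices coincide with any
  local solution and inherit its smoothness.\<close>

lemma locally_musical:
  assumes "\<And>p. \<exists>W Z. open W \<and> p \<in> W \<and> Z \<in> VF \<and> (\<forall>q\<in>W. \<forall>X\<in>VF. g Z X q = \<omega> X q)"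
  obtains U where "U \<in> VF" "\<And>X p. X \<in> VF \<Longrightarrow> g U X p = \<omega> X p"
proof -
  define V where "V p = (SOME Z. Z \<in> VF \<and> (\<forall>X\<in>VF. g Z X p = \<omega> X p))" for p
  have V: "V p \<in> VF" "\<And>X. X \<in> VF \<Longrightarrow> g (V p) X p = \<omega> X p" for p
  proof -
    have "\<exists>Z. Z \<in> VF \<and> (\<forall>X\<in>VF. g Z X p = \<omega> X p)" using assms[of p] by blast
    from someI_ex[OF this] show "V p \<in> VF" "\<And>X. X \<in> VF \<Longrightarrow> g (V p) X p = \<omega> X p" by (auto simp: V_def)
  qed
  define U where "U f p = V p f p" for f p
  have e: "eqv q (V q) Z" if "Z \<in> VF" "\<forall>X\<in>VF. g Z X q = \<omega> X q" for q Z
    by (rule eqv_gI[OF V(1) that(1)]) (use V(2) that(2) in simp)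
  have U: "U \<in> VF"
  proof (rule VF_local)
    show "U f p = 0" if "f \<notin> C" for f p using VF_0[OF V(1) that] by (simp add: U_def)
    fix p
    obtain W Z where W: "open W" "p \<in> W" "Z \<in> VF" "\<forall>q\<in>W. \<forall>X\<in>VF. g Z X q = \<omega> X q"
      using assms[of p] by (elim exE conjE) (rule that)
    then have "\<forall>q\<in>W. \<forall>f\<in>C. U f q = Z f q" using e by (simp add: U_def eqv_def)
    with W(1-3) show "\<exists>W Z. open W \<and> p \<in> W \<and> Z \<in> VF \<and> (\<forall>q\<in>W. \<forall>f\<in>C. U f q = Z f q)" by blast
  qed
  have "g U X p = \<omega> X p" if "X \<in> VF" for X p
  proof -
    have "eqv p U (V p)" by (simp add: eqv_def U_def)
    then show ?thesis using g_eqv(2)[OF that U V(1)] V(2)[OF that] by simp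
  qed
  with U show thesis using that by blast
qed

end

section \<open>Sasakian identities, adapted frames and their structure equations\<close>

locale sasaki =
  fixes A :: "('a::{t2_space,second_countable_topology}, real^3) atlas" and M D
  assumes sas: "sasakian A M D"

sublocale sasaki \<subseteq> riem_mfd A "rmetric M" D
  by unfold_locales (use sas in \<open>simp_all add: sasakian_def contact_riemannian_3manifold_def Let_def\<close>)

context sasaki begin

abbreviation "\<eta> \<equiv> form M"
abbreviation "\<xi> \<equiv> reeb M"
abbreviation "\<phi> \<equiv> endo M"
abbreviation "g \<equiv> rmetric M"

lemma cm: "contact_form A \<eta>" "\<xi> \<in> VF" "endo_field A \<phi>" "\<eta> \<xi> = (\<lambda>p. 1)"
  "X \<in> VF \<Longrightarrow> ext_deriv \<eta> \<xi> X = (\<lambda>p. 0)"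
  "X \<in> VF \<Longrightarrow> \<phi> (\<phi> X) = \<eta> X \<odot>\<^sub>v \<xi> \<ominus>\<^sub>v X"
  "X \<in> VF \<Longrightarrow> Y \<in> VF \<Longrightarrow> g (\<phi> X) (\<phi> Y) = (\<lambda>p. g X Y p - \<eta> X p * \<eta> Y p)"
  "X \<in> VF \<Longrightarrow> g \<xi> X = \<eta> X"
  "X \<in> VF \<Longrightarrow> Y \<in> VF \<Longrightarrow> ext_deriv \<eta> X Y = g X (\<phi> Y)"
  using sas by (auto simp: sasakian_def contact_riemannian_3manifold_def Let_def)

lemmas xi_VF [simp, intro] = cm(2)
lemmas phi_VF [simp, intro] = endo_VF[OF cm(3)]
lemmas phi_add = endo_add[OF cm(3)]
lemmas phi_scale = endo_scale[OF cm(3)]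
lemmas phi_diff = endo_diff[OF cm(3)]
lemmas phi_zero = endo_zero[OF cm(3)]
lemmas phi_eqv = endo_eqv[OF cm(3)]
lemma eta_form: "one_form A \<eta>" using cm(1) by (simp add: contact_form_def)
lemma eta_C [simp, intro]: "X \<in> VF \<Longrightarrow> \<eta> X \<in> C" using form_C[OF eta_form] by blast
lemmas eta_simps = form_add[OF eta_form] form_diff[OF eta_form] form_scale[OF eta_form] form_zero[OF eta_form]
lemma eta_xi [simp]: "\<eta> \<xi> p = 1" using cm(4) by simp
lemma g_xi [simp]: "X \<in> VF \<Longrightarrow> g \<xi> X p = \<eta> X p" "X \<in> VF \<Longrightarrow> g X \<xi> p = \<eta> X p"
  using cm(8)[of X] g_sym[of X \<xi>] by auto
lemmas phi2 = cm(6)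
lemma g_phi: "X \<in> VF \<Longrightarrow> Y \<in> VF \<Longrightarrow> g (\<phi> X) (\<phi> Y) p = g X Y p - \<eta> X p * \<eta> Y p" using cm(7) by simp

text \<open>Because \<open>g X (\<phi> Y)\<close> is the exterior derivative of
  \<open>\<eta>\<close>, which is antisymmetric.\<close>

lemma phi_skew: "X \<in> VF \<Longrightarrow> Y \<in> VF \<Longrightarrow> g (\<phi> X) Y p = - g X (\<phi> Y) p"
proof -
  assume XY: "X \<in> VF" "Y \<in> VF"
  have "\<eta> (bracket Y X) p = - \<eta> (bracket X Y) p"
    using XY by (simp add: bracket_antisym[of Y X] eta_simps)
  then have "ext_deriv \<eta> Y X p = - ext_deriv \<eta> X Y p" by (simp add: ext_deriv_def field_simps)
  then show ?thesis using cm(9)[OF XY] cm(9)[OF XY(2,1)] g_sym[of Y "\<phi> X"] XY by simp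
qed

lemma phi_xi [simp]: "\<phi> \<xi> = vzero"
proof (rule eqv_imp_eq)
  show "eqv p (\<phi> \<xi>) vzero" for p by (rule g_null_eqv) (auto simp: g_phi)
qed auto

lemma eta_phi [simp]: "X \<in> VF \<Longrightarrow> \<eta> (\<phi> X) p = 0"
  using phi_skew[of X \<xi> p] by (simp add: g_zero)

lemma D_phi: "X \<in> VF \<Longrightarrow> Y \<in> VF \<Longrightarrow> D X (\<phi> Y) f p = \<phi> (D X Y) f p + (g X Y p * \<xi> f p - \<eta> Y p * X f p)"
proof -
  assume "X \<in> VF" "Y \<in> VF"
  then have "cov_endo D \<phi> X Y = g X Y \<odot>\<^sub>v \<xi> \<ominus>\<^sub>v \<eta> Y \<odot>\<^sub>v X" using sas by (simp add: sasakian_def)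
  then have "cov_endo D \<phi> X Y f p = g X Y p * \<xi> f p - \<eta> Y p * X f p" by simp
  then show ?thesis by (simp add: cov_endo_def)
qed

lemma D_unit_xi:
  assumes "X \<in> VF" shows "\<eta> (D X \<xi>) p = 0"
proof -
  have "X (g \<xi> \<xi>) p = 0" using assms cm(4,8) VF_const by simp
  then show ?thesis using D_metric[of X \<xi> \<xi> p] assms by simp
qed

text \<open>The Sasakian condition for \<open>Y = \<xi>\<close>, where \<open>\<phi> \<xi>\<close>
  vanishes, determines \<open>\<phi> (D X \<xi>)\<close>. Applying \<open>\<phi>\<close> once more
  recovers \<open>D X \<xi>\<close> up to its \<open>\<xi>\<close>-component, which is 0 since
  \<open>\<xi>\<close> has unit length.\<close>

lemma D_xi: "X \<in> VF \<Longrightarrow> D X \<xi> = vzero \<ominus>\<^sub>v \<phi> X"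
proof -
  assume X: "X \<in> VF"
  have "\<phi> (D X \<xi>) = X \<ominus>\<^sub>v \<eta> X \<odot>\<^sub>v \<xi>"
  proof (intro ext)
    fix f p
    have "D X vzero f p = 0" using conn_zero[OF conn X] by simp
    then show "\<phi> (D X \<xi>) f p = (X \<ominus>\<^sub>v \<eta> X \<odot>\<^sub>v \<xi>) f p" using D_phi[OF X xi_VF, of f p] X by simp
  qed
  then have "\<phi> (\<phi> (D X \<xi>)) = \<phi> X" using X by (simp add: phi_diff phi_scale) (simp add: fun_eq_iff)
  then have "\<eta> (D X \<xi>) \<odot>\<^sub>v \<xi> \<ominus>\<^sub>v D X \<xi> = \<phi> X" using X phi2[of "D X \<xi>"] by simp
  then have e: "\<eta> (D X \<xi>) p * \<xi> f p - D X \<xi> f p = \<phi> X f p" for f p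
    by (metis vfield_apply(2,3))
  have "D X \<xi> f p = - \<phi> X f p" for f p using e[of p f] D_unit_xi[OF X, of p] by simp
  then show ?thesis by (simp add: fun_eq_iff)
qed

lemma R_xi:
  assumes X: "X \<in> VF" and Y: "Y \<in> VF"
  shows "R X Y \<xi> = \<eta> Y \<odot>\<^sub>v X \<ominus>\<^sub>v \<eta> X \<odot>\<^sub>v Y"
proof (intro ext)
  fix f p
  have d: "D V (D V' \<xi>) f p = - D V (\<phi> V') f p" if "V \<in> VF" "V' \<in> VF" for V V'
    using that by (simp add: D_xi D_diff conn_zero[OF conn])
  have "\<phi> (bracket X Y) f p = \<phi> (D X Y) f p - \<phi> (D Y X) f p"
    using X Y by (simp add: bracket_eq_D phi_diff)
  then show "R X Y \<xi> f p = (\<eta> Y \<odot>\<^sub>v X \<ominus>\<^sub>v \<eta> X \<odot>\<^sub>v Y) f p"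
    using X Y by (simp add: curvature_def d D_xi[of "bracket X Y"] D_phi g_sym)
qed

definition "frame p E \<longleftrightarrow> E \<in> VF \<and> g E E p = 1 \<and> \<eta> E p = 0"

lemma frame_VF: "frame p E \<Longrightarrow> E \<in> VF" by (simp add: frame_def)

lemma frame_onb: "frame p E \<Longrightarrow> onb p E (\<phi> E) \<xi>"
  using phi_skew[of E E p] g_sym[of E "\<phi> E" p] by (simp add: frame_def onb_def g_phi)

lemma phi_frame: "frame p E \<Longrightarrow> X \<in> VF \<Longrightarrow> g (\<phi> X) E p = - g X (\<phi> E) p"
    "frame p E \<Longrightarrow> X \<in> VF \<Longrightarrow> g (\<phi> X) (\<phi> E) p = g X E p"
  by (simp_all add: frame_def phi_skew[of X E] g_phi)

definition "frame_on W E \<longleftrightarrow> open W \<and> (\<forall>q\<in>W. frame q E)"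

text \<open>Some \<open>\<phi> X\<close> is nonzero at \<open>p\<close>, since otherwise the
  exterior derivative of \<open>\<eta>\<close> would vanish there, against the contact condition.
  Normalising this horizontal field near \<open>p\<close> gives the frame.\<close>

lemma frame_exists: obtains W E where "frame_on W E" "p \<in> W"
proof -
  have "\<exists>X\<in>VF. g (\<phi> X) (\<phi> X) p \<noteq> 0"
  proof (rule ccontr)
    assume n: "\<not> (\<exists>X\<in>VF. g (\<phi> X) (\<phi> X) p \<noteq> 0)"
    have z: "eqv p (\<phi> X) vzero" if "X \<in> VF" for X using that n by (intro g_null_eqv) auto
    have "ext_deriv \<eta> Y X p = 0" if "X \<in> VF" "Y \<in> VF" for X Y
      using cm(9)[OF that(2,1)] g_eqv(1)[OF that(2) phi_VF[OF that(1)] vzero_VF z[OF that(1)]] that by (simp add: g_zero)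
    then have "\<not> (\<exists>X\<in>VF. \<exists>Y\<in>VF. \<exists>Z\<in>VF.
        \<eta> X p * ext_deriv \<eta> Y Z p + \<eta> Y p * ext_deriv \<eta> Z X p + \<eta> Z p * ext_deriv \<eta> X Y p \<noteq> 0)"
      by simp
    then show False using cm(1) unfolding contact_form_def by blast
  qed
  then obtain X where X: "X \<in> VF" "g (\<phi> X) (\<phi> X) p \<noteq> 0" by blast
  define n where "n = g (\<phi> X) (\<phi> X)"
  have n: "n \<in> C" "n p > 0" using X g_nonneg[of "\<phi> X" p] by (auto simp: n_def)
  define V where "V = {q. n q > 0}"
  have oV: "open V" unfolding V_def
    using open_Collect_less[OF continuous_on_const C_continuous[OF n(1)]] by simp
  have pV: "p \<in> V" using n by (simp add: V_def)
  obtain k K W where k: "k \<in> C" "K \<subseteq> V" "open W" "p \<in> W" "\<And>q. q \<in> W \<Longrightarrow> k q = 1" "\<And>q. q \<notin> K \<Longrightarrow> k q = 0"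
    by (rule cutoff_exists[OF oV pV]) blast
  \<comment> \<open>Positive everywhere, and equal to \<open>n\<close> where the cutoff is 1, so
    that the normalising factor \<open>s\<close> is a global smooth function.\<close>
  define n' where "n' q = k q * k q * n q + (1 - k q) * (1 - k q)" for q
  define s where "s q = n' q powr (-1/2)" for q
  have n': "n' q > 0" for q
  proof (cases "k q = 0")
    case False
    then have "n q > 0" using k(2,6) by (auto simp: V_def)
    then have "k q * k q * n q > 0" using False by (simp add: zero_less_mult_iff linorder_neq_iff[symmetric] not_square_less_zero)
    then show ?thesis unfolding n'_def using zero_le_square[of "1 - k q"] by linarith
  qed (simp add: n'_def)
  have "n' \<in> C" unfolding n'_def[abs_def] using k(1) n(1) by (intro C_add C_mult C_diff C_const)
  then have sC: "s \<in> C" unfolding s_def[abs_def]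
    using C_compose[OF _ Cinf_on_powr[of "-1/2"], of n'] n' by auto
  define E where "E = s \<odot>\<^sub>v \<phi> X"
  have EV: "E \<in> VF" using sC X by (simp add: E_def)
  have "frame q E" if "q \<in> W \<inter> V" for q
  proof -
    have nq: "n q > 0" using that by (simp add: V_def)
    have "g E E q = s q * (s q * n q)" using sC X by (simp add: E_def g_simps n_def)
    also have "\<dots> = n q powr (-1/2 + -1/2) * n q"
      using that k(5) unfolding powr_add by (simp add: s_def n'_def)
    also have "\<dots> = 1" using nq by (simp add: powr_minus)
    finally show ?thesis using EV sC X by (simp add: frame_def E_def eta_simps)
  qed
  then show thesis using that[of "W \<inter> V" E] k(3,4) oV pV by (auto simp: frame_on_def)
qed

text \<open>Differentiating the constant inner products of the frame leaves
  \<open>g (D X E) (\<phi> E)\<close> as the only free component of \<open>D X E\<close> and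
  \<open>D X (\<phi> E)\<close>; it is the connection form of the contact plane.\<close>

lemma frame_D:
  assumes F: "frame_on W E" and p: "p \<in> W" and X: "X \<in> VF"
  shows "g (D X E) E p = 0" "g (D X E) \<xi> p = - g X (\<phi> E) p"
    "g (D X (\<phi> E)) E p = - g (D X E) (\<phi> E) p" "g (D X (\<phi> E)) (\<phi> E) p = 0" "g (D X (\<phi> E)) \<xi> p = g X E p"
proof -
  have W: "open W" "p \<in> W" "\<And>q. q \<in> W \<Longrightarrow> frame q E" using F p by (auto simp: frame_on_def)
  have E: "E \<in> VF" using W frame_VF by blast
  have o: "onb q E (\<phi> E) \<xi>" if "q \<in> W" for q using frame_onb W(3) that by blast
  have z: "X f p = 0" if "f \<in> C" "\<And>q. q \<in> W \<Longrightarrow> f q = c" for f c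
    using VF_locally_const[OF X that(1) W(1,2) that(2)] .
  have o': "g E E q = 1" "g (\<phi> E) (\<phi> E) q = 1" "g E (\<phi> E) q = 0" "\<eta> E q = 0" if "q \<in> W" for q
    using o[OF that] W(3)[OF that] by (auto simp: onb_def frame_def)
  have "X (g E E) p = 0" by (rule z) (use E o' in auto)
  moreover have "X (g (\<phi> E) (\<phi> E)) p = 0" by (rule z[of _ 1]) (use E o' in auto)
  moreover have "X (g E (\<phi> E)) p = 0" by (rule z[of _ 0]) (use E o' in auto)
  moreover have "X (g E \<xi>) p = 0" by (rule z[of _ 0]) (use E o' in auto)
  moreover have "X (g (\<phi> E) \<xi>) p = 0" by (rule z[of _ 0]) (use E o' in auto)
  ultimately have *: "g (D X E) E p + g E (D X E) p = 0" "g (D X (\<phi> E)) (\<phi> E) p + g (\<phi> E) (D X (\<phi> E)) p = 0"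
    "g (D X E) (\<phi> E) p + g E (D X (\<phi> E)) p = 0" "g (D X E) \<xi> p + g E (D X \<xi>) p = 0"
    "g (D X (\<phi> E)) \<xi> p + g (\<phi> E) (D X \<xi>) p = 0"
    using D_metric[OF X] E by auto
  show "g (D X E) E p = 0" "g (D X (\<phi> E)) (\<phi> E) p = 0" "g (D X (\<phi> E)) E p = - g (D X E) (\<phi> E) p"
    using *(1-3) g_sym[of E "D X E"] g_sym[of "\<phi> E" "D X (\<phi> E)"] g_sym[of E "D X (\<phi> E)"] E X by auto
  have f: "frame p E" using F p by (simp add: frame_on_def)
  show "g (D X E) \<xi> p = - g X (\<phi> E) p" "g (D X (\<phi> E)) \<xi> p = g X E p"
    using *(4,5) E X phi_frame[OF f X] g_sym[of E "\<phi> X"] g_sym[of "\<phi> E" "\<phi> X"]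
    by (auto simp: D_xi g_simps)
qed

lemma R_frame12:
  assumes f: "frame p E" and X: "X \<in> VF" and Y: "Y \<in> VF"
  shows "g (R X Y E) (\<phi> E) p =
    (g X E p * g Y (\<phi> E) p - g X (\<phi> E) p * g Y E p) * g (R E (\<phi> E) E) (\<phi> E) p"
proof -
  have E: "E \<in> VF" using f by (rule frame_VF)
  have o: "onb p E (\<phi> E) \<xi>" using f by (rule frame_onb)
  have "g (R E (\<phi> E) X) Y p = (g X E p * g Y (\<phi> E) p - g X (\<phi> E) p * g Y E p) * g (R E (\<phi> E) E) (\<phi> E) p
     + (g X \<xi> p * g Y E p - g X E p * g Y \<xi> p) * g (R E (\<phi> E) \<xi>) E p
     + (g X \<xi> p * g Y (\<phi> E) p - g X (\<phi> E) p * g Y \<xi> p) * g (R E (\<phi> E) \<xi>) (\<phi> E) p"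
    by (rule skew_expand[OF o, of "\<lambda>X. g (R E (\<phi> E) X)" X Y])
      (rule g_form R_VF g_R_swap34 E X Y phi_VF | assumption)+
  moreover have "g (R E (\<phi> E) \<xi>) V p = 0" if "V \<in> VF" for V
    using f E that by (simp add: R_xi g_simps frame_def)
  ultimately show ?thesis using g_R_pair[OF E phi_VF[OF E] X Y, of p] E by simp
qed

context fixes c assumes chc: "constant_holomorphic_curvature A M D c" begin

lemma R_frame: assumes f: "frame p E" shows "g (R E (\<phi> E) E) (\<phi> E) p = - c"
proof -
  have E: "E \<in> VF" using f by (rule frame_VF)
  have o: "onb p E (\<phi> E) \<xi>" using f by (rule frame_onb)
  have "in_span_at E (\<phi> E) (\<phi> E) p" unfolding in_span_at_def by (rule exI[of _ 0], rule exI[of _ 1]) simp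
  moreover have "in_span_at E (\<phi> E) (\<phi> (\<phi> E)) p" unfolding in_span_at_def
    by (rule exI[of _ "-1"], rule exI[of _ 0]) (use E f in \<open>simp add: phi2 frame_def\<close>)
  moreover have "independent_at E (\<phi> E) p"
    unfolding independent_at_def
  proof (intro allI impI)
    fix a b assume z: "\<forall>f. a * E f p + b * \<phi> E f p = 0"
    let ?Y = "(\<lambda>q. a) \<odot>\<^sub>v E \<oplus>\<^sub>v (\<lambda>q. b) \<odot>\<^sub>v \<phi> E"
    have "eqv p ?Y vzero" using z by (simp add: eqv_def)
    then have "g E ?Y p = 0" "g (\<phi> E) ?Y p = 0"
      using g_eqv(1)[of E ?Y vzero p] g_eqv(1)[of "\<phi> E" ?Y vzero p] E by (auto simp: g_zero)
    then show "a = 0 \<and> b = 0" using o E g_sym[of "\<phi> E" E p] by (auto simp: g_simps onb_def)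
  qed
  ultimately have "sectional_curvature g D E (\<phi> E) p = c"
    using chc E unfolding constant_holomorphic_curvature_def by blast
  then have "g (R E (\<phi> E) (\<phi> E)) E p = c" using o by (simp add: sectional_curvature_def onb_def)
  then show ?thesis using g_R_swap34[of E "\<phi> E" E "\<phi> E" p] E by simp
qed

text \<open>In dimension 3 the components of the curvature that involve \<open>\<xi>\<close> come
  from the Sasakian condition by \<open>R_xi\<close>, and the one remaining component is the
  holomorphic sectional curvature.\<close>

lemma R_formula:
  assumes X: "X \<in> VF" and Y: "Y \<in> VF" and Z: "Z \<in> VF"
  shows "R X Y Z = g Y Z \<odot>\<^sub>v X \<ominus>\<^sub>v g X Z \<odot>\<^sub>v Y \<oplus>\<^sub>v (\<lambda>p. (c - 1) * g X (\<phi> Y) p) \<odot>\<^sub>v \<phi> Z"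
    (is "_ = ?F")
proof (rule eqv_imp_eq)
  show FV: "?F \<in> VF" using X Y Z by (intro vadd_VF vdiff_VF vscale_VF C_mult g_C C_const phi_VF)
  fix p
  obtain W E where F: "frame_on W E" and p: "p \<in> W" by (rule frame_exists[of p])
  then have f: "frame p E" by (simp add: frame_on_def)
  have E: "E \<in> VF" using f by (rule frame_VF)
  have o: "onb p E (\<phi> E) \<xi>" using f by (rule frame_onb)
  show "eqv p (R X Y Z) ?F"
  proof (rule eqv_gI)
    fix V assume V: "V \<in> VF"
    have "g (R X Y Z) V p = (g Z E p * g V (\<phi> E) p - g Z (\<phi> E) p * g V E p) * g (R X Y E) (\<phi> E) p
     + (g Z \<xi> p * g V E p - g Z E p * g V \<xi> p) * g (R X Y \<xi>) E p
     + (g Z \<xi> p * g V (\<phi> E) p - g Z (\<phi> E) p * g V \<xi> p) * g (R X Y \<xi>) (\<phi> E) p"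
      by (rule skew_expand[OF o, of "\<lambda>Z. g (R X Y Z)" Z V])
        (rule g_form R_VF g_R_swap34 E X Y Z V phi_VF | assumption)+
    moreover have "g ?F V p = g Y Z p * g X V p - g X Z p * g Y V p + (c - 1) * g X (\<phi> Y) p * g (\<phi> Z) V p"
      using X Y Z V by (simp add: g_simps C_mult)
    moreover have "g X (\<phi> Y) p = g X (\<phi> E) p * g Y E p - g X E p * g Y (\<phi> E) p"
      "g (\<phi> Z) V p = g Z E p * g V (\<phi> E) p - g Z (\<phi> E) p * g V E p"
      using onb_g[OF o X phi_VF[OF Y]] onb_g[OF o phi_VF[OF Z] V] phi_frame[OF f] X Y Z V by auto
    moreover note R_frame12[OF f X Y] R_frame[OF f] onb_g[OF o Y Z] onb_g[OF o X V] onb_g[OF o X Z] onb_g[OF o Y V]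
    \<comment> \<open>The indices 1, 2, 3 stand for the components along \<open>E\<close>,
      \<open>\<phi> E\<close> and \<open>\<xi>\<close>; after expansion in the frame the claim is
      this polynomial identity.\<close>
    moreover have id: "(z3 * v1 - z1 * v3) * (y3 * x1 - x3 * y1) -
        (z1 * v2 - z2 * v1) * ((x1 * y2 - x2 * y1) * c) + (z3 * v2 - z2 * v3) * (y3 * x2 - x3 * y2) =
        (y1 * z1 + y2 * z2 + y3 * z3) * (x1 * v1 + x2 * v2 + x3 * v3) -
        (x1 * z1 + x2 * z2 + x3 * z3) * (y1 * v1 + y2 * v2 + y3 * v3) +
        (c - 1) * (x2 * y1 - x1 * y2) * (z1 * v2 - z2 * v1)" for x1 x2 x3 y1 y2 y3 z1 z2 z3 v1 v2 v3 :: real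
      by algebra
    ultimately show "g (R X Y Z) V p = g ?F V p"
      using X Y Z V E by (simp add: R_xi g_simps id)
  qed (use FV X Y Z in auto)
qed (use X Y Z in auto)

text \<open>Cartan's second structure equation. The curvature contributes \<open>- c\<close>, and
  the product of the \<open>\<xi>\<close>-components of the derivatives of \<open>E\<close> and
  \<open>\<phi> E\<close> contributes the further \<open>- 1\<close>.\<close>

lemma connection_form_ext_deriv:
  assumes F: "frame_on W E" and p: "p \<in> W" and X: "X \<in> VF" and Y: "Y \<in> VF"
  shows "X (g (D Y E) (\<phi> E)) p - Y (g (D X E) (\<phi> E)) p - g (D (bracket X Y) E) (\<phi> E) p =
    - (c + 1) * (g X E p * g Y (\<phi> E) p - g X (\<phi> E) p * g Y E p)"
proof -
  have f: "frame p E" using F p by (simp add: frame_on_def)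
  have E: "E \<in> VF" using f by (rule frame_VF)
  have o: "onb p E (\<phi> E) \<xi>" using f by (rule frame_onb)
  note D = frame_D[OF F p]
  have d: "V (g (D V' E) (\<phi> E)) p = g (D V (D V' E)) (\<phi> E) p - g V' (\<phi> E) p * g V E p"
    if "V \<in> VF" "V' \<in> VF" for V V'
    using D_metric[OF that(1) D_VF[OF that(2) E] phi_VF[OF E], of p]
      onb_g[OF o D_VF[OF that(2) E] D_VF[OF that(1) phi_VF[OF E]]] D[OF that(1)] D[OF that(2)] E that by simp
  have "g (R X Y E) (\<phi> E) p = g (D X (D Y E)) (\<phi> E) p - g (D Y (D X E)) (\<phi> E) p - g (D (bracket X Y) E) (\<phi> E) p"
    using X Y E by (simp add: curvature_def g_simps)
  then show ?thesis using d[OF X Y] d[OF Y X] R_frame12[OF f X Y] R_frame[OF f] by (simp add: algebra_simps)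
qed

end

text \<open>Cartan's first structure equations for the forms dual to \<open>E\<close> and
  \<open>\<phi> E\<close>. The form \<open>\<tau>\<close> is the connection form of the quotient by
  the Reeb flow: adding \<open>\<eta>\<close> to the connection form of the contact plane changes
  the constant \<open>c + 1\<close> of the preceding equation into \<open>c + 3\<close>.\<close>

lemma coframe_ext_deriv:
  assumes F: "frame_on W E" and p: "p \<in> W" and X: "X \<in> VF" and Y: "Y \<in> VF"
  defines "\<tau> \<equiv> \<lambda>X. g (D X E) (\<phi> E) p + \<eta> X p"
  shows "X (g Y E) p - Y (g X E) p - g (bracket X Y) E p = \<tau> X * g Y (\<phi> E) p - \<tau> Y * g X (\<phi> E) p"
    "X (g Y (\<phi> E)) p - Y (g X (\<phi> E)) p - g (bracket X Y) (\<phi> E) p = - \<tau> X * g Y E p + \<tau> Y * g X E p"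
proof -
  have f: "frame p E" using F p by (simp add: frame_on_def)
  have E: "E \<in> VF" using f by (rule frame_VF)
  have o: "onb p E (\<phi> E) \<xi>" using f by (rule frame_onb)
  note D = frame_D[OF F p]
  show "X (g Y E) p - Y (g X E) p - g (bracket X Y) E p = \<tau> X * g Y (\<phi> E) p - \<tau> Y * g X (\<phi> E) p"
    unfolding dual_ext_deriv[OF X Y E]
    using onb_g[OF o Y D_VF[OF X E]] onb_g[OF o X D_VF[OF Y E]] D[OF X] D[OF Y] X Y E
    by (simp add: \<tau>_def algebra_simps)
  show "X (g Y (\<phi> E)) p - Y (g X (\<phi> E)) p - g (bracket X Y) (\<phi> E) p = - \<tau> X * g Y E p + \<tau> Y * g X E p"
    unfolding dual_ext_deriv[OF X Y phi_VF[OF E]]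
    using onb_g[OF o Y D_VF[OF X phi_VF[OF E]]] onb_g[OF o X D_VF[OF Y phi_VF[OF E]]] D[OF X] D[OF Y] X Y E
    by (simp add: \<tau>_def algebra_simps)
qed

lemma eta_ext_deriv:
  assumes f: "frame p E" and X: "X \<in> VF" and Y: "Y \<in> VF"
  shows "X (\<eta> Y) p - Y (\<eta> X) p - \<eta> (bracket X Y) p = - 2 * (g X E p * g Y (\<phi> E) p - g X (\<phi> E) p * g Y E p)"
proof -
  have o: "onb p E (\<phi> E) \<xi>" using f by (rule frame_onb)
  have "ext_deriv \<eta> X Y p = g X (\<phi> Y) p" using cm(9)[OF X Y] by simp
  moreover have "g X (\<phi> Y) p = g X (\<phi> E) p * g Y E p - g X E p * g Y (\<phi> E) p"
    using onb_g[OF o X phi_VF[OF Y]] phi_frame[OF f] Y by simp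
  ultimately show ?thesis by (simp add: ext_deriv_def field_simps)
qed

end

section \<open>Functions with vanishing derivative, and connections modified by a tensor\<close>

context smooth_mfd begin

lemma deriv_zero_imp_locally_const:
  assumes "f \<in> C" "open V" "p \<in> V" "\<And>X q. X \<in> VF \<Longrightarrow> q \<in> V \<Longrightarrow> X f q = 0"
  shows "\<exists>W. open W \<and> p \<in> W \<and> W \<subseteq> V \<and> (\<forall>q\<in>W. f q = f p)"
proof -
  obtain W a r G h d where cc: "coords W (a::'e) r G h d" "p = G a" "p \<in> W" "W \<subseteq> V"
    by (rule coords_exist[OF assms(2,3)])
  have "((\<lambda>x. f (G x)) has_derivative (\<lambda>v. 0)) (at x within ball a r)" if x: "x \<in> ball a r" for x
  proof -
    have "G x \<in> V" using x cc by (auto simp: coords_def)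
    then have "d b f (G x) = 0" for b using cc assms(4) by (auto simp: coords_def)
    moreover have "((\<lambda>x. f (G x)) has_derivative (\<lambda>v. \<Sum>b\<in>Basis. (v \<bullet> b) * d b f (G x))) (at x)"
      using cc(1) x assms(1) unfolding coords_def by blast
    ultimately show ?thesis by (simp add: has_derivative_at_withinI)
  qed
  then obtain k where k: "\<And>x. x \<in> ball a r \<Longrightarrow> f (G x) = k"
    using has_derivative_zero_constant[OF convex_ball] by blast
  have "W = G ` ball a r" "r > 0" "open W" using cc by (auto simp: coords_def)
  then have "\<forall>q\<in>W. f q = f p" using k cc(2) by auto
  then show ?thesis using \<open>open W\<close> cc by blast
qed

lemma deriv_zero_imp_const:
  assumes "connected (UNIV :: 'a set)" "f \<in> C" "\<And>X q. X \<in> VF \<Longrightarrow> X f q = 0"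
  shows "f p = f q"
proof -
  let ?S = "{p. f p = f q}"
  have "open ?S"
  proof (subst open_subopen, intro ballI)
    fix x assume "x \<in> ?S"
    then show "\<exists>T. open T \<and> x \<in> T \<and> T \<subseteq> ?S"
      using deriv_zero_imp_locally_const[OF assms(2) open_UNIV UNIV_I[of x]] assms(3) by auto
  qed
  moreover have "closed ?S" by (rule closed_Collect_eq[OF C_continuous[OF assms(2)] continuous_on_const])
  ultimately have "?S = {} \<or> ?S = UNIV" using assms(1) unfolding connected_clopen by (metis open_openin closed_closedin subtopology_UNIV)
  then show ?thesis by auto
qed

lemma conn_plus:
  assumes "linear_connection A D" "tensor12 A S"
  shows "linear_connection A (\<lambda>X Y. D X Y \<oplus>\<^sub>v S X Y)"
proof -
  have S1: "endo_field A (S X)" "endo_field A (\<lambda>Y. S Y X)" if "X \<in> VF" for X using assms(2) that by (auto simp: tensor12_def)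
  show ?thesis
    unfolding linear_connection_def
  proof (intro conjI ballI)
    fix Y assume Y: "Y \<in> VF"
    show "endo_field A (\<lambda>X. D X Y \<oplus>\<^sub>v S X Y)"
      using endo_VF[OF S1(2)[OF Y]] conn_VF[OF assms(1) _ Y] conn_endo[OF assms(1) Y]
      by (intro endoI_local)
        (simp_all add: endo_add[OF S1(2)[OF Y]] endo_scale[OF S1(2)[OF Y]] endo_add[OF conn_endo[OF assms(1) Y]] endo_scale[OF conn_endo[OF assms(1) Y]] algebra_simps)
  next
    fix X Y Z assume "X \<in> VF" "Y \<in> VF" "Z \<in> VF"
    then show "D X (Y \<oplus>\<^sub>v Z) \<oplus>\<^sub>v S X (Y \<oplus>\<^sub>v Z) = D X Y \<oplus>\<^sub>v S X Y \<oplus>\<^sub>v (D X Z \<oplus>\<^sub>v S X Z)"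
      by (simp add: conn_add[OF assms(1)] endo_add[OF S1(1)] fun_eq_iff)
  next
    fix h X Y assume "h \<in> C" "X \<in> VF" "Y \<in> VF"
    then show "D X (h \<odot>\<^sub>v Y) \<oplus>\<^sub>v S X (h \<odot>\<^sub>v Y) = X h \<odot>\<^sub>v Y \<oplus>\<^sub>v h \<odot>\<^sub>v (D X Y \<oplus>\<^sub>v S X Y)"
      by (simp add: conn_scale[OF assms(1)] endo_scale[OF S1(1)] fun_eq_iff algebra_simps)
  qed
qed

end

section \<open>The tensors \<open>Sten\<close> and the connections that preserve the contact
  Riemannian structure\<close>

context sasaki begin

text \<open>The candidates for homogeneous contact structures: \<open>A_tensor\<close> plus an
  infinitesimal rotation of the contact plane with rate \<open>g U X\<close>.\<close>

definition Sten where "Sten r U = (\<lambda>X\<in>VF. \<lambda>Y\<in>VF. A_tensor A M r X Y \<oplus>\<^sub>v g U X \<odot>\<^sub>v \<phi> Y)"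

lemma Sten_eq: "X \<in> VF \<Longrightarrow> Y \<in> VF \<Longrightarrow> Sten r U X Y =
    g X (\<phi> Y) \<odot>\<^sub>v \<xi> \<ominus>\<^sub>v (\<lambda>p. r * \<eta> X p) \<odot>\<^sub>v \<phi> Y \<oplus>\<^sub>v \<eta> Y \<odot>\<^sub>v \<phi> X \<oplus>\<^sub>v g U X \<odot>\<^sub>v \<phi> Y"
  by (simp add: Sten_def A_tensor_def cm(9))

lemma Sten_apply: "X \<in> VF \<Longrightarrow> Y \<in> VF \<Longrightarrow> Sten r U X Y f p =
    g X (\<phi> Y) p * \<xi> f p - r * \<eta> X p * \<phi> Y f p + \<eta> Y p * \<phi> X f p + g U X p * \<phi> Y f p"
  by (simp add: Sten_eq)

lemma Sten_VF [simp, intro]: "U \<in> VF \<Longrightarrow> X \<in> VF \<Longrightarrow> Y \<in> VF \<Longrightarrow> Sten r U X Y \<in> VF"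
  unfolding Sten_eq by (intro vadd_VF vdiff_VF vscale_VF C_mult g_C C_const phi_VF eta_C xi_VF)

lemma g_Sten: "U \<in> VF \<Longrightarrow> X \<in> VF \<Longrightarrow> Y \<in> VF \<Longrightarrow> Z \<in> VF \<Longrightarrow> g (Sten r U X Y) Z p =
    g X (\<phi> Y) p * \<eta> Z p - r * \<eta> X p * g (\<phi> Y) Z p + \<eta> Y p * g (\<phi> X) Z p + g U X p * g (\<phi> Y) Z p"
  by (simp add: Sten_eq g_simps C_mult)

lemma Sten_tensor: assumes U: "U \<in> VF" shows "tensor12 A (Sten r U)"
  unfolding tensor12_def
proof (intro conjI ballI)
  show "Sten r U \<in> VF \<rightarrow>\<^sub>E VF \<rightarrow>\<^sub>E VF"
  proof (rule PiE_I)
    fix X assume X: "X \<in> VF"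
    show "Sten r U X \<in> VF \<rightarrow>\<^sub>E VF"
      by (rule PiE_I) (use Sten_VF[OF U X] X in \<open>auto simp: Sten_def\<close>)
  qed (simp add: Sten_def)
  show "endo_field A (Sten r U X)" if "X \<in> VF" for X
    by (rule endoI_local) (use that U in \<open>simp_all add: Sten_apply phi_add phi_scale g_simps eta_simps algebra_simps\<close>)
  show "endo_field A (\<lambda>X. Sten r U X Y)" if "Y \<in> VF" for Y
    by (rule endoI_local) (use that U in \<open>simp_all add: Sten_apply phi_add phi_scale g_simps eta_simps algebra_simps\<close>)
qed

text \<open>Only \<open>g\<close> and \<open>\<phi>\<close> are asked to be parallel. They determine
  \<open>\<xi>\<close> up to sign as the unit kernel of \<open>\<phi>\<close>, so
  \<open>\<xi>\<close> and \<open>\<eta>\<close> are parallel as well.\<close>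

definition "par_conn D' \<longleftrightarrow> linear_connection A D' \<and>
  (\<forall>W\<in>VF. \<forall>X\<in>VF. \<forall>Y\<in>VF. \<forall>p. W (g X Y) p = g (D' W X) Y p + g X (D' W Y) p) \<and>
  (\<forall>W\<in>VF. \<forall>X\<in>VF. D' W (\<phi> X) = \<phi> (D' W X))"

context fixes D' assumes pc: "par_conn D'" begin

lemma lin: "linear_connection A D'" using pc by (simp add: par_conn_def)
lemma met: "W \<in> VF \<Longrightarrow> X \<in> VF \<Longrightarrow> Y \<in> VF \<Longrightarrow> W (g X Y) p = g (D' W X) Y p + g X (D' W Y) p"
  using pc by (simp add: par_conn_def)
lemma par_phi: "W \<in> VF \<Longrightarrow> X \<in> VF \<Longrightarrow> D' W (\<phi> X) = \<phi> (D' W X)"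
  using pc by (simp add: par_conn_def)
lemmas par_VF = conn_VF[OF lin]

text \<open>\<open>D' W \<xi>\<close> lies in the kernel of \<open>\<phi>\<close>, so it is a
  multiple of \<open>\<xi>\<close>; the constant length of \<open>\<xi>\<close> makes the multiple
  0.\<close>

lemma par_xi: assumes W: "W \<in> VF" shows "D' W \<xi> = vzero"
proof -
  have "W (g \<xi> \<xi>) p = 0" for p using VF_const[OF W] cm(4,8) by simp
  then have e: "\<eta> (D' W \<xi>) p = 0" for p using met[OF W xi_VF xi_VF, of p] par_VF[OF W xi_VF] by simp
  have "\<phi> (\<phi> (D' W \<xi>)) = vzero"
    using par_phi[OF W xi_VF] conn_zero[OF lin W] by (simp add: phi_zero flip: par_phi[OF W xi_VF])
  then have "\<eta> (D' W \<xi>) p * \<xi> f p - D' W \<xi> f p = 0" for f p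
    using phi2[OF par_VF[OF W xi_VF]] by (metis vfield_apply(2,3,4))
  then show ?thesis using e by (simp add: fun_eq_iff)
qed

lemma par_eta: "W \<in> VF \<Longrightarrow> X \<in> VF \<Longrightarrow> W (\<eta> X) p = \<eta> (D' W X) p"
  using met[of W \<xi> X p] cm(8)[of X] par_xi[of W] par_VF[of W X] by (simp add: g_zero)

text \<open>By \<open>R_formula\<close> the curvature is built from \<open>g\<close> and
  \<open>\<phi>\<close> with constant coefficients. This is the point where constancy of the
  holomorphic curvature makes the condition on \<open>R\<close> automatic.\<close>

lemma par_R:
  assumes chc: "constant_holomorphic_curvature A M D c"
    and W: "W \<in> VF" and X: "X \<in> VF" and Y: "Y \<in> VF" and Z: "Z \<in> VF"
  shows "cov_tensor13 D' R W X Y Z = vzero"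
proof -
  note V = par_VF[OF W X] par_VF[OF W Y] par_VF[OF W Z]
  have "W (\<lambda>p. (c - 1) * g X (\<phi> Y) p) q = (c - 1) * (g (D' W X) (\<phi> Y) q + g X (\<phi> (D' W Y)) q)" for q
    using VF_cmult[OF W g_C[OF X phi_VF[OF Y]]] met[OF W X phi_VF[OF Y]] par_phi[OF W Y] by simp
  then have "D' W (R X Y Z) f p = R (D' W X) Y Z f p + R X (D' W Y) Z f p + R X Y (D' W Z) f p" for f p
    using X Y Z W V
    by (simp add: R_formula[OF chc] conn_add[OF lin] conn_diff[OF lin] conn_scale[OF lin] C_mult par_phi met) (simp add: algebra_simps)
  then show ?thesis by (simp add: cov_tensor13_def fun_eq_iff)
qed

lemma par_Sten:
  assumes U: "U \<in> VF" "\<And>W. W \<in> VF \<Longrightarrow> D' W U = vzero"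
    and W: "W \<in> VF" and X: "X \<in> VF" and Y: "Y \<in> VF"
  shows "cov_tensor12 D' (Sten r U) W X Y = vzero"
proof -
  note V = par_VF[OF W X] par_VF[OF W Y]
  have "W (\<lambda>p. r * \<eta> X p) q = r * \<eta> (D' W X) q" for q
    using VF_cmult[OF W eta_C[OF X]] par_eta[OF W X] by simp
  then have "D' W (Sten r U X Y) f p = Sten r U (D' W X) Y f p + Sten r U X (D' W Y) f p" for f p
    using X Y W V U
    by (simp add: Sten_eq conn_add[OF lin] conn_diff[OF lin] conn_scale[OF lin] C_mult par_phi met par_xi par_eta g_zero algebra_simps)
  then show ?thesis by (simp add: cov_tensor12_def fun_eq_iff)
qed

end

text \<open>The terms with \<open>g X (\<phi> Y)\<close> and \<open>\<eta> Y\<close> compensate the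
  derivative of \<open>\<phi>\<close> given by the Sasakian condition. The terms with
  \<open>r\<close> and \<open>U\<close> are multiples of \<open>\<phi>\<close>, which is skew and
  commutes with itself, so they are harmless for every \<open>U\<close>.\<close>

lemma Sten_parallel:
  fixes r :: real
  assumes U: "U \<in> VF"
  shows "par_conn (\<lambda>X Y. D X Y \<oplus>\<^sub>v Sten r U X Y)"
  unfolding par_conn_def
proof (intro conjI ballI allI)
  let ?D' = "\<lambda>X Y. D X Y \<oplus>\<^sub>v Sten r U X Y"
  show "linear_connection A ?D'" by (rule conn_plus[OF conn Sten_tensor[OF U]])
  fix W X assume W: "W \<in> VF" and X: "X \<in> VF"
  show "W (g X Y) p = g (?D' W X) Y p + g X (?D' W Y) p" if Y: "Y \<in> VF" for Y p
    using D_metric[OF W X Y] g_sym[of X "Sten r U W Y"] phi_skew[OF X Y] phi_skew[OF W X] phi_skew[OF W Y] g_sym[of X "\<phi> Y"] g_sym[of X "\<phi> W"] U W X Y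
    by (simp add: g_simps g_Sten)
  show "?D' W (\<phi> X) = \<phi> (?D' W X)"
  proof (intro ext)
    fix f p
    have 1: "\<phi> (Sten r U W X) f p = - r * \<eta> W p * \<phi> (\<phi> X) f p + \<eta> X p * \<phi> (\<phi> W) f p + g U W p * \<phi> (\<phi> X) f p"
      using U W X by (simp add: Sten_eq phi_add phi_diff phi_scale C_mult)
    have 2: "g W (\<phi> (\<phi> X)) p = \<eta> X p * \<eta> W p - g W X p" using W X by (simp add: phi2[OF X] g_simps)
    show "?D' W (\<phi> X) f p = \<phi> (?D' W X) f p"
      using U W X D_phi[OF W X, of f p] 1 2
      by (simp add: phi_add Sten_apply phi2[OF W] phi2[OF X]) (simp add: algebra_simps)
  qed
qed

lemma Sten_homogeneous:
  assumes chc: "constant_holomorphic_curvature A M D c"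
    and U: "U \<in> VF" "\<And>W. W \<in> VF \<Longrightarrow> D W U \<oplus>\<^sub>v Sten r U W U = vzero"
  shows "homogeneous_contact_riemannian_structure A M D (Sten r U)"
proof -
  note P = Sten_parallel[OF U(1), where r = r]
  show ?thesis
    unfolding homogeneous_contact_riemannian_structure_def homogeneous_riemannian_structure_def Let_def
  proof (intro conjI ballI)
    show "tensor12 A (Sten r U)" by (rule Sten_tensor[OF U(1)])
    fix W X assume W: "W \<in> VF" and X: "X \<in> VF"
    show "cov_endo (\<lambda>X Y. D X Y \<oplus>\<^sub>v Sten r U X Y) \<phi> W X = vzero"
      using par_phi[OF P W X] by (simp add: cov_endo_def)
    fix Y assume Y: "Y \<in> VF"
    show "cov_metric (\<lambda>X Y. D X Y \<oplus>\<^sub>v Sten r U X Y) g W X Y = (\<lambda>p. 0)"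
      using met[OF P W X Y] by (simp add: cov_metric_def)
    show "cov_tensor12 (\<lambda>X Y. D X Y \<oplus>\<^sub>v Sten r U X Y) (Sten r U) W X Y = vzero"
      by (rule par_Sten[OF P U(1) _ W X Y]) (rule U(2))
    fix Z assume Z: "Z \<in> VF"
    show "cov_tensor13 (\<lambda>X Y. D X Y \<oplus>\<^sub>v Sten r U X Y) R W X Y Z = vzero"
      by (rule par_R[OF P chc W X Y Z])
  qed
qed

lemma Sten_zero: "Sten r vzero = A_tensor A M r"
proof -
  have "Sten r vzero X Y = A_tensor A M r X Y" if "X \<in> VF" "Y \<in> VF" for X Y
    using that by (simp add: Sten_def g_zero fun_eq_iff)
  then show ?thesis by (auto simp: Sten_def A_tensor_def fun_eq_iff restrict_def)
qed

lemma A_tensor_homogeneous: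
  assumes "constant_holomorphic_curvature A M D c"
  shows "homogeneous_contact_riemannian_structure A M D (A_tensor A M r)"
proof -
  have "D W vzero \<oplus>\<^sub>v Sten r vzero W vzero = vzero" if "W \<in> VF" for W
    using that by (simp add: conn_zero[OF conn] fun_eq_iff Sten_apply g_zero phi_zero eta_simps)
  then have "homogeneous_contact_riemannian_structure A M D (Sten r vzero)"
    by (rule Sten_homogeneous[OF assms vzero_VF])
  then show ?thesis by (simp add: Sten_zero)
qed

subsection \<open>Classification\<close>

text \<open>Since \<open>\<xi>\<close> is parallel for \<open>D + S\<close>,
  \<open>S X \<xi>\<close> must be \<open>\<phi> X\<close>. Skewness of \<open>S X\<close> then
  leaves one number per direction, the form \<open>l\<close>, and parallelism of \<open>S\<close>
  amounts to parallelism of \<open>l\<close>. Its \<open>\<xi>\<close>-component is therefore a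
  constant, which defines \<open>r\<close>; its horizontal part is the dual of
  \<open>U\<close>.\<close>

lemma homogeneous_imp_Sten:
  assumes con: "connected (UNIV :: 'a set)" and S: "homogeneous_contact_riemannian_structure A M D S"
  obtains r U where "U \<in> VF" "\<And>p. \<eta> U p = 0" "S = Sten r U" "\<And>W. W \<in> VF \<Longrightarrow> D W U \<oplus>\<^sub>v S W U = vzero"
proof -
  define D' where "D' = (\<lambda>X Y. D X Y \<oplus>\<^sub>v S X Y)"
  have T: "tensor12 A S" and m: "\<And>W X Y. W \<in> VF \<Longrightarrow> X \<in> VF \<Longrightarrow> Y \<in> VF \<Longrightarrow> cov_metric D' g W X Y = (\<lambda>p. 0)"
    and s: "\<And>W X Y. W \<in> VF \<Longrightarrow> X \<in> VF \<Longrightarrow> Y \<in> VF \<Longrightarrow> cov_tensor12 D' S W X Y = vzero"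
    and e: "\<And>W X. W \<in> VF \<Longrightarrow> X \<in> VF \<Longrightarrow> cov_endo D' \<phi> W X = vzero"
    using S unfolding homogeneous_contact_riemannian_structure_def homogeneous_riemannian_structure_def Let_def D'_def by blast+
  have lin: "linear_connection A D'" unfolding D'_def by (rule conn_plus[OF conn T])
  have S1: "endo_field A (S X)" "endo_field A (\<lambda>Y. S Y X)" if "X \<in> VF" for X using T that by (auto simp: tensor12_def)
  have SV: "S X Y \<in> VF" if "X \<in> VF" "Y \<in> VF" for X Y using endo_VF[OF S1(1)] that by blast
  have met: "W (g X Y) p = g (D' W X) Y p + g X (D' W Y) p" if "W \<in> VF" "X \<in> VF" "Y \<in> VF" for W X Y p
    using fun_cong[OF m[OF that], of p] by (simp add: cov_metric_def)
  have par_phi: "D' W (\<phi> X) = \<phi> (D' W X)" if "W \<in> VF" "X \<in> VF" for W X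
    using e[OF that] by (auto simp: cov_endo_def fun_eq_iff)
  have parS: "D' W (S X Y) f p = S (D' W X) Y f p + S X (D' W Y) f p" if "W \<in> VF" "X \<in> VF" "Y \<in> VF" for W X Y f p
    using fun_cong[OF fun_cong[OF s[OF that], of f], of p] by (simp add: cov_tensor12_def)
  have pc: "par_conn D'" unfolding par_conn_def using lin met par_phi by blast
  note px = par_xi[OF pc] and pe = par_eta[OF pc]
  have PV: "D' W X \<in> VF" if "W \<in> VF" "X \<in> VF" for W X using conn_VF[OF lin that] .
  have Sxi: "S X \<xi> = \<phi> X" if X: "X \<in> VF" for X
    using px[OF X] X by (simp add: D'_def D_xi fun_eq_iff)
  have Sskew: "g (S X Y) Z p = - g (S X Z) Y p" if "X \<in> VF" "Y \<in> VF" "Z \<in> VF" for X Y Z p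
    using met[OF that, of p] D_metric[OF that, of p] that SV g_sym[of Y "S X Z"] by (simp add: D'_def g_simps)
  have Sform: "one_form A (g (S X Y))" if "X \<in> VF" "Y \<in> VF" for X Y using g_form[OF SV[OF that]] .
  \<comment> \<open>The frame is chosen at each point without any continuity. That \<open>l\<close>
    does not depend on the choice is \<open>lF\<close>, and its smoothness follows by comparison
    with local frames.\<close>
  define E where "E p = (SOME E. frame p E)" for p
  have E: "frame p (E p)" for p
  proof -
    obtain W V where "frame_on W V" "p \<in> W" by (rule frame_exists[of p])
    then have "frame p V" by (simp add: frame_on_def)
    then show ?thesis unfolding E_def by (metis someI)
  qed
  define l where "l X p = g (S X (E p)) (\<phi> (E p)) p" for X p
  have gS: "g (S X Y) Z p = g X (\<phi> Y) p * \<eta> Z p + \<eta> Y p * g (\<phi> X) Z p + g (S X F) (\<phi> F) p * g (\<phi> Y) Z p"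
    if F: "frame p F" and X: "X \<in> VF" and Y: "Y \<in> VF" and Z: "Z \<in> VF" for F X Y Z p
  proof -
    have o: "onb p F (\<phi> F) \<xi>" using F by (rule frame_onb)
    have FV: "F \<in> VF" using F by (rule frame_VF)
    have "g (S X Y) Z p = (g Y F p * g Z (\<phi> F) p - g Y (\<phi> F) p * g Z F p) * g (S X F) (\<phi> F) p
     + (g Y \<xi> p * g Z F p - g Y F p * g Z \<xi> p) * g (S X \<xi>) F p
     + (g Y \<xi> p * g Z (\<phi> F) p - g Y (\<phi> F) p * g Z \<xi> p) * g (S X \<xi>) (\<phi> F) p"
      by (rule skew_expand[OF o, of "\<lambda>Y. g (S X Y)" Y Z]) (rule Sform X Y Z Sskew | assumption)+
    moreover have "g (\<phi> Y) Z p = g Y F p * g Z (\<phi> F) p - g Y (\<phi> F) p * g Z F p"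
      "g X (\<phi> Y) p = g X (\<phi> F) p * g Y F p - g X F p * g Y (\<phi> F) p"
      "g (\<phi> X) Z p = g X F p * g Z (\<phi> F) p - g X (\<phi> F) p * g Z F p"
      using onb_g[OF o phi_VF[OF Y] Z] onb_g[OF o X phi_VF[OF Y]] onb_g[OF o phi_VF[OF X] Z] phi_frame[OF F] X Y Z by auto
    ultimately show ?thesis
      using phi_frame[OF F X] X Y Z by (simp add: Sxi) (simp add: algebra_simps)
  qed
  have lF: "l X p = g (S X F) (\<phi> F) p" if F: "frame p F" and X: "X \<in> VF" for F X p
  proof -
    have FV: "F \<in> VF" using F by (rule frame_VF)
    have "g (\<phi> F) (\<phi> F) p = 1" "\<eta> F p = 0" using frame_onb[OF F] F by (auto simp: onb_def frame_def)
    then show ?thesis using gS[OF E X FV phi_VF[OF FV], of p] FV by (simp add: l_def)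
  qed
  have lC: "l X \<in> C" if X: "X \<in> VF" for X
  proof (rule C_local)
    fix p
    obtain W V where W: "frame_on W V" "p \<in> W" by (rule frame_exists[of p])
    then have V: "V \<in> VF" by (auto simp: frame_on_def frame_def)
    have "g (S X V) (\<phi> V) \<in> C" using SV X V by simp
    moreover have "\<forall>q\<in>W. l X q = g (S X V) (\<phi> V) q" using lF X W by (simp add: frame_on_def)
    ultimately show "\<exists>W h. open W \<and> p \<in> W \<and> h \<in> C \<and> (\<forall>q\<in>W. l X q = h q)" using W by (auto simp: frame_on_def)
  qed
  have Seq: "S X Y = g X (\<phi> Y) \<odot>\<^sub>v \<xi> \<oplus>\<^sub>v \<eta> Y \<odot>\<^sub>v \<phi> X \<oplus>\<^sub>v l X \<odot>\<^sub>v \<phi> Y" (is "_ = ?F")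
    if X: "X \<in> VF" and Y: "Y \<in> VF" for X Y
  proof (rule eqv_imp_eq)
    show V: "S X Y \<in> VF" "?F \<in> VF" using X Y SV lC by auto
    show "eqv p (S X Y) ?F" for p
      by (rule eqv_gI[OF V]) (use gS[OF E X Y] X Y lC in \<open>simp add: g_simps l_def\<close>)
  qed
  have ladd: "l (X \<oplus>\<^sub>v Y) p = l X p + l Y p" if "X \<in> VF" "Y \<in> VF" for X Y p
    using endo_add[OF S1(2)[OF frame_VF[OF E]] that, of p] SV that frame_VF[OF E, of p] by (simp add: l_def g_simps)
  have lscale: "l (h \<odot>\<^sub>v X) p = h p * l X p" if "h \<in> C" "X \<in> VF" for X h p
    using endo_scale[OF S1(2)[OF frame_VF[OF E]] that, of p] SV that frame_VF[OF E, of p] by (simp add: l_def g_simps)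
  have lform: "one_form A l" using lC ladd lscale by (auto simp: one_form_def fun_eq_iff)
  \<comment> \<open>In the derivative of \<open>Seq\<close> all tensors other than \<open>l\<close>
    are parallel, so the derivative of \<open>l\<close> appears as the coefficient of
    \<open>\<phi> (E p)\<close>, which does not vanish at \<open>p\<close>.\<close>
  have lpar: "W (l X) p = l (D' W X) p" if W: "W \<in> VF" and X: "X \<in> VF" for W X p
  proof -
    let ?E = "E p"
    have EV: "?E \<in> VF" by (rule frame_VF[OF E])
    note V = PV[OF W X] PV[OF W EV] lC[OF X] lC[OF PV[OF W X]]
    have "D' W (S X ?E) f p = S (D' W X) ?E f p + S X (D' W ?E) f p + (W (l X) p - l (D' W X) p) * \<phi> ?E f p" for f
      using W X EV V
      by (simp add: Seq conn_add[OF lin] conn_scale[OF lin] par_phi met px pe algebra_simps)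
    then have "(W (l X) p - l (D' W X) p) * \<phi> ?E f p = 0" for f using parS[OF W X EV, of f p] by simp
    moreover have "\<exists>f. \<phi> ?E f p \<noteq> 0"
    proof (rule ccontr)
      assume "\<nexists>f. \<phi> ?E f p \<noteq> 0"
      then have "eqv p (\<phi> ?E) vzero" by (simp add: eqv_def)
      then have "g (\<phi> ?E) (\<phi> ?E) p = 0" using g_eqv(1)[of "\<phi> ?E" "\<phi> ?E" vzero p] EV by (simp add: g_zero)
      then show False using frame_onb[OF E, of p] by (simp add: onb_def)
    qed
    ultimately show ?thesis by force
  qed
  obtain p0 :: 'a where True by simp
  define r where "r = - l \<xi> p0"
  have lxi: "l \<xi> p = - r" for p
    unfolding r_def using deriv_zero_imp_const[OF con lC[OF xi_VF], of p p0] lpar[OF _ xi_VF] px form_zero[OF lform] by simp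
  \<comment> \<open>Removing the \<open>\<xi>\<close>-component \<open>- r\<close> of
    \<open>l\<close> makes the dual field horizontal.\<close>
  define \<mu> where "\<mu> X p = l X p + r * \<eta> X p" for X p
  have muform: "one_form A \<mu>"
    unfolding one_form_def \<mu>_def[abs_def]
    by (auto intro!: C_add C_mult lC simp: fun_eq_iff ladd lscale eta_simps algebra_simps)
  have loc: "\<exists>W Z. open W \<and> p \<in> W \<and> Z \<in> VF \<and> (\<forall>q\<in>W. \<forall>X\<in>VF. g Z X q = \<mu> X q)" for p
  proof -
    obtain W V where W: "frame_on W V" "p \<in> W" by (rule frame_exists[of p])
    then have V: "V \<in> VF" by (auto simp: frame_on_def frame_def)
    let ?Z = "\<mu> V \<odot>\<^sub>v V \<oplus>\<^sub>v \<mu> (\<phi> V) \<odot>\<^sub>v \<phi> V \<oplus>\<^sub>v \<mu> \<xi> \<odot>\<^sub>v \<xi>"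
    have muC: "\<mu> X \<in> C" if "X \<in> VF" for X using form_C[OF muform that] .
    have "g ?Z X q = \<mu> X q" if q: "q \<in> W" and X: "X \<in> VF" for q X
    proof -
      have f: "frame q V" using W q by (simp add: frame_on_def)
      have o: "onb q V (\<phi> V) \<xi>" using f by (rule frame_onb)
      let ?P = "(\<lambda>r. g X V q) \<odot>\<^sub>v V \<oplus>\<^sub>v (\<lambda>r. g X (\<phi> V) q) \<odot>\<^sub>v \<phi> V \<oplus>\<^sub>v (\<lambda>r. g X \<xi> q) \<odot>\<^sub>v \<xi>"
      have "eqv q X ?P" using onb_span[OF o X] by (simp add: eqv_def)
      then have "\<mu> X q = \<mu> ?P q" by (intro form_eqv[OF muform]) (use X V in auto)
      then show ?thesis using V X muC g_sym[of X V] g_sym[of X "\<phi> V"]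
        by (simp add: form_add[OF muform] form_scale[OF muform] g_simps)
    qed
    moreover have "?Z \<in> VF" using V muC by auto
    ultimately show ?thesis using W unfolding frame_on_def by blast
  qed
  obtain U where U: "U \<in> VF" "\<And>X p. X \<in> VF \<Longrightarrow> g U X p = \<mu> X p" 
    by (rule locally_musical[of \<mu>, OF loc]) blast
  show thesis
  proof (rule that[OF U(1)])
    show "\<eta> U p = 0" for p using U(2)[OF xi_VF, of p] lxi U(1) by (simp add: \<mu>_def)
    show "S = Sten r U"
    proof (intro ext)
      fix X Y f p
      have eqV: "S X Y f p = Sten r U X Y f p" if "X \<in> VF" "Y \<in> VF"
        using that U by (simp add: Seq Sten_apply \<mu>_def algebra_simps)
      have "S X = undefined" if "X \<notin> VF" using T that by (auto simp: tensor12_def PiE_def extensional_def)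
      moreover have "S X Y = undefined" if "X \<in> VF" "Y \<notin> VF" using T that by (auto simp: tensor12_def PiE_def extensional_def Pi_def)
      ultimately show "S X Y f p = Sten r U X Y f p"
        using eqV by (cases "X \<in> VF"; cases "Y \<in> VF") (auto simp: Sten_def)
    qed
    fix W assume W: "W \<in> VF"
    have "D' W U = vzero"
    proof (rule eqv_imp_eq)
      show V: "D' W U \<in> VF" "vzero \<in> VF" using PV W U by auto
      fix p
      show "eqv p (D' W U) vzero"
      proof (rule eqv_gI[OF V])
        fix X assume X: "X \<in> VF"
        have "g U X = (\<lambda>p. l X p + r * \<eta> X p)" using U(2)[OF X] by (auto simp: \<mu>_def)
        then have "W (g U X) p = l (D' W X) p + r * \<eta> (D' W X) p"
          using VF_add[OF W lC[OF X] C_mult[OF C_const[of r] eta_C[OF X]]] VF_cmult[OF W eta_C[OF X]] lpar[OF W X] pe[OF W X] by simp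
        then show "g (D' W U) X p = g vzero X p"
          using met[OF W U(1) X, of p] U(2)[OF PV[OF W X]] X by (simp add: g_zero \<mu>_def)
      qed
    qed
    then show "D W U \<oplus>\<^sub>v S W U = vzero" by (simp add: D'_def)
  qed
qed

end

section \<open>Frames with the brackets of the Lie algebra of the group\<close>

context sasaki begin

text \<open>The frames \<open>(e, \<phi> e, \<xi>)\<close> whose brackets are those of the Lie algebra of the group
  \<open>GA\<^sup>+(1) \<times> \<real>\<close>, expressed by their connection form.\<close>

definition "gaframe \<alpha> e \<longleftrightarrow> (\<forall>p. frame p e) \<and>
  (\<forall>X\<in>VF. \<forall>p. g (D X e) (\<phi> e) p = - \<eta> X p - \<alpha> * g X (\<phi> e) p)"

lemma gaframe_frame: "gaframe \<alpha> e \<Longrightarrow> frame p e" by (simp add: gaframe_def)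

lemma gaframe_bracket:
  assumes ga: "gaframe \<alpha> e"
  shows "bracket e (\<phi> e) = (\<lambda>p. \<alpha>) \<odot>\<^sub>v \<phi> e \<oplus>\<^sub>v (\<lambda>p. 2) \<odot>\<^sub>v \<xi>" "bracket (\<phi> e) \<xi> = vzero" "bracket \<xi> e = vzero"
proof -
  have F: "frame_on UNIV e" using ga by (simp add: frame_on_def gaframe_def)
  have e: "e \<in> VF" using ga by (auto simp: gaframe_def frame_def)
  have o: "onb p e (\<phi> e) \<xi>" for p using frame_onb gaframe_frame[OF ga] by blast
  have oo: "g e e p = 1" "g (\<phi> e) (\<phi> e) p = 1" "g e (\<phi> e) p = 0" "g (\<phi> e) e p = 0" "\<eta> e p = 0" for p
    using o[of p] gaframe_frame[OF ga, of p] g_sym[of e "\<phi> e" p] e by (auto simp: onb_def frame_def)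
  have \<tau>: "g (D X e) (\<phi> e) p = - \<eta> X p - \<alpha> * g X (\<phi> e) p" if "X \<in> VF" for X p
    using ga that by (simp add: gaframe_def)
  note D = frame_D(1,3,4)[OF F UNIV_I]
  have De: "\<eta> (D X e) p = - g X (\<phi> e) p" "\<eta> (D X (\<phi> e)) p = g X e p" if "X \<in> VF" for X p
    using frame_D(2,5)[OF F UNIV_I that, of p] that e by simp_all
  have te: "\<eta> (bracket X Y) p = \<eta> (D X Y) p - \<eta> (D Y X) p" if "X \<in> VF" "Y \<in> VF" for X Y p
    using that by (simp add: bracket_eq_D eta_simps)
  have phiphi: "\<phi> (\<phi> e) = vzero \<ominus>\<^sub>v e" using oo(5) phi2[OF e] by (simp add: fun_eq_iff)
  show "bracket e (\<phi> e) = (\<lambda>p. \<alpha>) \<odot>\<^sub>v \<phi> e \<oplus>\<^sub>v (\<lambda>p. 2) \<odot>\<^sub>v \<xi>"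
    by (rule eqv_imp_eq, simp_all add: e, rule eqv_onbI[OF o])
      (simp_all add: e torsion_free_g D De te \<tau> oo g_simps eta_simps)
  show "bracket (\<phi> e) \<xi> = vzero"
    by (rule eqv_imp_eq, simp_all add: e, rule eqv_onbI[OF o])
      (simp_all add: e torsion_free_g D_xi D De te \<tau> oo g_simps eta_simps phiphi)
  show "bracket \<xi> e = vzero"
    by (rule eqv_imp_eq, simp_all add: e, rule eqv_onbI[OF o])
      (simp_all add: e torsion_free_g D_xi D De te \<tau> oo g_simps eta_simps)
qed

lemma bracket_imp_gaframe:
  assumes fr: "\<And>p. frame p e"
    and b: "bracket e (\<phi> e) = (\<lambda>p. \<alpha>) \<odot>\<^sub>v \<phi> e \<oplus>\<^sub>v (\<lambda>p. 2) \<odot>\<^sub>v \<xi>" "bracket \<xi> e = vzero"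
  shows "gaframe \<alpha> e"
  unfolding gaframe_def
proof (intro conjI ballI allI fr)
  have F: "frame_on UNIV e" using fr by (simp add: frame_on_def)
  have e: "e \<in> VF" using fr by (auto simp: frame_def)
  have o: "onb p e (\<phi> e) \<xi>" for p using frame_onb fr by blast
  have oo: "g e e p = 1" "g (\<phi> e) (\<phi> e) p = 1" "g e (\<phi> e) p = 0" "g (\<phi> e) e p = 0" "\<eta> e p = 0" for p
    using o[of p] fr[of p] g_sym[of e "\<phi> e" p] e by (auto simp: onb_def frame_def)
  note D = frame_D[OF F UNIV_I]
  fix X p assume X: "X \<in> VF"
  have t1: "g (D e e) (\<phi> e) p = 0"
    using torsion_free_g[OF e phi_VF[OF e] e, of p] D(3)[OF e, of p] D(1)[OF phi_VF[OF e], of p] e oo by (simp add: b g_simps)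
  have t2: "g (D (\<phi> e) e) (\<phi> e) p = - \<alpha>"
    using torsion_free_g[OF e phi_VF[OF e] phi_VF[OF e], of p] D(4)[OF e, of p] e oo by (simp add: b g_simps)
  have t3: "g (D \<xi> e) (\<phi> e) p = -1"
    using torsion_free_g[OF xi_VF e phi_VF[OF e], of p] e oo by (simp add: b g_simps D_xi)
  have form: "one_form A (\<lambda>X. g (D X e) (\<phi> e))"
    using e by (simp add: one_form_def endo_add[OF D_endo[OF e]] endo_scale[OF D_endo[OF e]] g_simps fun_eq_iff)
  let ?P = "(\<lambda>q. g X e p) \<odot>\<^sub>v e \<oplus>\<^sub>v (\<lambda>q. g X (\<phi> e) p) \<odot>\<^sub>v \<phi> e \<oplus>\<^sub>v (\<lambda>q. g X \<xi> p) \<odot>\<^sub>v \<xi>"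
  have "eqv p X ?P" using onb_span[OF o X] by (simp add: eqv_def)
  then have "g (D X e) (\<phi> e) p = g (D ?P e) (\<phi> e) p"
    by (rule form_eqv[OF form, rotated 2]) (use X e in auto)
  also have "\<dots> = - \<eta> X p - \<alpha> * g X (\<phi> e) p"
    using X e t1 t2 t3 by (simp add: endo_add[OF D_endo[OF e]] endo_scale[OF D_endo[OF e]] g_simps)
  finally show "g (D X e) (\<phi> e) p = - \<eta> X p - \<alpha> * g X (\<phi> e) p" .
qed

text \<open>The rotation term of \<open>Sten (-1) U\<close> is
  \<open>\<eta> X + \<alpha> * g X (\<phi> e)\<close>, exactly opposite to the connection form
  required by \<open>gaframe\<close>. So \<open>e\<close> is parallel, and with it
  \<open>\<phi> e\<close> and \<open>U\<close>.\<close>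

lemma gaframe_parallel:
  assumes ga: "gaframe \<alpha> e" and X: "X \<in> VF"
  defines "U \<equiv> (\<lambda>p. \<alpha>) \<odot>\<^sub>v \<phi> e"
  defines "D' \<equiv> \<lambda>X Y. D X Y \<oplus>\<^sub>v Sten (-1) U X Y"
  shows "D' X e = vzero" "D' X (\<phi> e) = vzero" "D' X \<xi> = vzero" "D' X U = vzero"
proof -
  have e: "e \<in> VF" using ga by (auto simp: gaframe_def frame_def)
  have U: "U \<in> VF" using e by (simp add: U_def)
  have pc: "par_conn D'" unfolding D'_def by (rule Sten_parallel[OF U])
  have o: "onb p e (\<phi> e) \<xi>" for p using frame_onb gaframe_frame[OF ga] by blast
  have oo: "g e e p = 1" "g (\<phi> e) (\<phi> e) p = 1" "g e (\<phi> e) p = 0" "g (\<phi> e) e p = 0" "\<eta> e p = 0" for p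
    using o[of p] gaframe_frame[OF ga, of p] g_sym[of e "\<phi> e" p] e by (auto simp: onb_def frame_def)
  show xi: "D' X \<xi> = vzero" by (rule par_xi[OF pc X])
  have V: "D' X e \<in> VF" by (rule par_VF[OF pc X e])
  show 1: "D' X e = vzero"
  proof (rule eqv_imp_eq[OF V vzero_VF])
    fix p
    have "g e e = (\<lambda>p. 1)" "g e \<xi> = (\<lambda>p. 0)" using oo e by auto
    then have "X (g e e) p = 0" "X (g e \<xi>) p = 0" using VF_const[OF X] by simp_all
    then have "g (D' X e) e p = 0" "\<eta> (D' X e) p = 0"
      using met[OF pc X e e, of p] met[OF pc X e xi_VF, of p] xi g_sym[OF e V] V e by (auto simp: g_zero)
    moreover have "g (D' X e) (\<phi> e) p = 0"
      using ga X e U oo g_sym[of X "\<phi> e"] by (simp add: D'_def g_simps g_Sten gaframe_def U_def)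
    ultimately show "eqv p (D' X e) vzero"
      using V e by (intro eqv_onbI[OF o]) (auto simp: g_zero eta_simps)
  qed
  show 2: "D' X (\<phi> e) = vzero" using par_phi[OF pc X e] 1 by (simp add: phi_zero)
  show "D' X U = vzero"
    unfolding U_def using conn_scale[OF lin[OF pc] C_const X phi_VF[OF e], of \<alpha>] 2 VF_const[OF X]
    by (simp add: fun_eq_iff)
qed

lemma gaframe_homogeneous:
  assumes "gaframe \<alpha> e" "constant_holomorphic_curvature A M D c"
  shows "homogeneous_contact_riemannian_structure A M D (Sten (-1) ((\<lambda>p. \<alpha>) \<odot>\<^sub>v \<phi> e))"
proof (rule Sten_homogeneous[OF assms(2)])
  show "(\<lambda>p. \<alpha>) \<odot>\<^sub>v \<phi> e \<in> VF" using frame_VF[OF gaframe_frame[OF assms(1)]] by simp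
qed (rule gaframe_parallel(4)[OF assms(1)])

text \<open>A connection is determined by a parallel global frame, and the frame is parallel for
  \<open>D + Sten\<close> by \<open>gaframe_parallel\<close>.\<close>

lemma connection_diff_gaframe:
  assumes ga: "gaframe \<alpha> e" and l: "linear_connection A D''"
    and p: "\<And>X. X \<in> VF \<Longrightarrow> D'' X e = vzero" "\<And>X. X \<in> VF \<Longrightarrow> D'' X (\<phi> e) = vzero" "\<And>X. X \<in> VF \<Longrightarrow> D'' X \<xi> = vzero"
  shows "connection_diff A D'' D = Sten (-1) ((\<lambda>p. \<alpha>) \<odot>\<^sub>v \<phi> e)"
proof -
  have e: "e \<in> VF" using ga by (auto simp: gaframe_def frame_def)
  let ?U = "(\<lambda>p. \<alpha>) \<odot>\<^sub>v \<phi> e"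
  have U: "?U \<in> VF" using e by simp
  define D' where "D' = (\<lambda>X Y. D X Y \<oplus>\<^sub>v Sten (-1) ?U X Y)"
  have pc: "par_conn D'" unfolding D'_def by (rule Sten_parallel[OF U])
  have P: "D' X e = vzero" "D' X (\<phi> e) = vzero" "D' X \<xi> = vzero" if "X \<in> VF" for X
    unfolding D'_def by (rule gaframe_parallel[OF ga that])+
  have ex: "Y = g Y e \<odot>\<^sub>v e \<oplus>\<^sub>v g Y (\<phi> e) \<odot>\<^sub>v \<phi> e \<oplus>\<^sub>v g Y \<xi> \<odot>\<^sub>v \<xi>" if Y: "Y \<in> VF" for Y
    using onb_span[OF frame_onb[OF gaframe_frame[OF ga]] Y] by (simp add: fun_eq_iff)
  have eq: "D'' X Y f p = D' X Y f p" if X: "X \<in> VF" and Y: "Y \<in> VF" for X Y f p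
    apply (subst (1 2) ex[OF Y])
    using X Y e by (simp add: conn_add[OF l] conn_scale[OF l] conn_add[OF lin[OF pc]] conn_scale[OF lin[OF pc]] p P)
  have "D'' X Y \<ominus>\<^sub>v D X Y = Sten (-1) ?U X Y" if "X \<in> VF" "Y \<in> VF" for X Y
    using eq[OF that] by (simp add: fun_eq_iff D'_def)
  then show ?thesis by (auto simp: connection_diff_def Sten_def restrict_def fun_eq_iff)
qed

lemma Sten_imp_gaframe:
  assumes chc: "constant_holomorphic_curvature A M D c" and con: "connected (UNIV :: 'a set)"
    and U: "U \<in> VF" "\<And>p. \<eta> U p = 0" "U \<noteq> vzero"
    and par: "\<And>W. W \<in> VF \<Longrightarrow> D W U \<oplus>\<^sub>v Sten r U W U = vzero"
  obtains e where "c < -3" "r = -1" "gaframe (sqrt (-(c+3))) e" "U = (\<lambda>p. sqrt (-(c+3))) \<odot>\<^sub>v \<phi> e"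
proof -
  define D' where "D' = (\<lambda>X Y. D X Y \<oplus>\<^sub>v Sten r U X Y)"
  have pc: "par_conn D'" unfolding D'_def by (rule Sten_parallel[OF U(1)])
  have parU: "D' X U = vzero" if "X \<in> VF" for X using par[OF that] by (simp add: D'_def)
  have c0: "g U U p = g U U q" for p q
    by (rule deriv_zero_imp_const[OF con]) (use U met[OF pc _ U(1) U(1)] parU in \<open>simp_all add: g_zero\<close>)
  obtain p0 f0 where "U f0 p0 \<noteq> 0" using U(3) by (auto simp: fun_eq_iff)
  then have "g U U p0 > 0" using g_pos[OF U(1)] by blast
  define m where "m = sqrt (g U U p0)"
  have m: "m > 0" "g U U p = m * m" for p using \<open>g U U p0 > 0\<close> c0[of p p0] by (auto simp: m_def)
  \<comment> \<open>Chosen so that \<open>\<phi> e\<close> is \<open>U\<close> divided by its length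
    \<open>m\<close>, since \<open>\<phi>\<close> squares to minus the identity on horizontal
    fields.\<close>
  define e where "e = (\<lambda>p. - (1/m)) \<odot>\<^sub>v \<phi> U"
  have e: "e \<in> VF" using U by (simp add: e_def)
  have phiphi: "\<phi> (\<phi> U) = vzero \<ominus>\<^sub>v U" using U by (simp add: phi2 fun_eq_iff)
  have phie: "\<phi> e f p = (1/m) * U f p" for f p using U by (simp add: e_def phi_scale phiphi)
  have Ue: "U = (\<lambda>p. m) \<odot>\<^sub>v \<phi> e" using m by (simp add: fun_eq_iff phie)
  have fr: "frame p e" for p
    unfolding frame_def using U m e by (simp add: e_def g_simps eta_simps g_phi)
  have F: "frame_on UNIV e" using fr by (simp add: frame_on_def)
  have o: "onb p e (\<phi> e) \<xi>" for p using frame_onb fr by blast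
  have oo: "g e e p = 1" "g (\<phi> e) (\<phi> e) p = 1" "g e (\<phi> e) p = 0" "g (\<phi> e) e p = 0" "\<eta> e p = 0" for p
    using o[of p] fr[of p] g_sym[of e "\<phi> e" p] e by (auto simp: onb_def frame_def)
  have gU: "g U X p = m * g X (\<phi> e) p" if "X \<in> VF" for X p
    using that e g_sym[of X "\<phi> e"] by (subst Ue) (simp add: g_simps)
  have \<tau>: "g (D X e) (\<phi> e) p = r * \<eta> X p - m * g X (\<phi> e) p" if X: "X \<in> VF" for X p
  proof -
    have "D' X e = vzero"
      using conn_scale[OF lin[OF pc] C_const X phi_VF[OF U(1)], of "- (1/m)"] par_phi[OF pc X U(1)] parU[OF X] VF_const[OF X]
      by (simp add: e_def phi_zero fun_eq_iff)
    then have "g (D' X e) (\<phi> e) p = 0" using e by (simp add: g_zero)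
    then show ?thesis using X e U oo by (simp add: D'_def g_simps g_Sten gU)
  qed
  have tauf: "g (D X e) (\<phi> e) = (\<lambda>p. r * \<eta> X p - m * g X (\<phi> e) p)" if "X \<in> VF" for X using \<tau>[OF that] by auto
  have V\<tau>: "V (g (D X e) (\<phi> e)) p = r * V (\<eta> X) p - m * V (g X (\<phi> e)) p" if V: "V \<in> VF" and X: "X \<in> VF" for V X p
    using VF_diff[OF V C_mult[OF C_const[of r] eta_C[OF X]] C_mult[OF C_const[of m] g_C[OF X phi_VF[OF e]]]] X e V
    by (simp add: tauf VF_cmult)
  \<comment> \<open>The connection form is now the explicit combination
    \<open>r * \<eta> X - m * g X (\<phi> e)\<close>. Its exterior derivative, computed from the
    first structure equations and that of \<open>\<eta>\<close>, is compared with the second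
    structure equation.\<close>
  have K: "r * (- 2 * (g X e p * g Y (\<phi> e) p - g X (\<phi> e) p * g Y e p)) -
      m * (- (g (D X e) (\<phi> e) p + \<eta> X p) * g Y e p + (g (D Y e) (\<phi> e) p + \<eta> Y p) * g X e p) =
      - (c + 1) * (g X e p * g Y (\<phi> e) p - g X (\<phi> e) p * g Y e p)" if X: "X \<in> VF" and Y: "Y \<in> VF" for X Y p
  proof -
    have "r * (X (\<eta> Y) p - Y (\<eta> X) p - \<eta> (bracket X Y) p) -
        m * (X (g Y (\<phi> e)) p - Y (g X (\<phi> e)) p - g (bracket X Y) (\<phi> e) p) =
      X (g (D Y e) (\<phi> e)) p - Y (g (D X e) (\<phi> e)) p - g (D (bracket X Y) e) (\<phi> e) p"
      unfolding V\<tau>[OF X Y] V\<tau>[OF Y X] \<tau>[OF bracket_VF[OF X Y]] by (simp add: algebra_simps)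
    then show ?thesis
      unfolding connection_form_ext_deriv[OF chc F UNIV_I X Y] coframe_ext_deriv(2)[OF F UNIV_I X Y] eta_ext_deriv[OF fr X Y] .
  qed
  \<comment> \<open>Evaluation on \<open>(e, \<phi> e)\<close> relates \<open>r\<close>,
    \<open>m\<close> and \<open>c\<close>; evaluation on \<open>(\<xi>, e)\<close> in the next line
    gives \<open>m * (r + 1) = 0\<close>.\<close>
  have 1: "- 2 * r + m * m = - (c + 1)" using K[OF e phi_VF[OF e], of p0] \<tau>[OF phi_VF[OF e], of p0] e oo by simp
  have "m = 0 \<or> r = -1" using K[OF xi_VF e, of p0] \<tau>[OF xi_VF, of p0] e oo by auto
  then have r: "r = -1" using m by simp
  have mm: "m * m = -(c+3)" using 1 r by simp
  then have "c < -3" using m(1) by (smt (verit) mult_pos_pos)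
  moreover have ms: "m = sqrt (-(c+3))" using mm m(1) by (metis abs_of_pos real_sqrt_mult_self real_sqrt_abs2)
  moreover have "gaframe m e" using fr \<tau> r by (simp add: gaframe_def)
  ultimately show thesis using that[of e] r Ue by simp
qed

end

subsection \<open>Monodromy\<close>

text \<open>Think of a locally constant sheaf: \<open>sol W f\<close> says that \<open>f\<close> is a section over \<open>W\<close>, and its value
  \<open>j f q\<close> at a point \<open>q\<close> of \<open>W\<close>, an element of the fibre \<open>V q\<close>, determines it near \<open>q\<close>.\<close>

locale local_system =
  fixes V :: "'a::topological_space \<Rightarrow> 'v set" and sol :: "'a set \<Rightarrow> 'f \<Rightarrow> bool" and j :: "'f \<Rightarrow> 'a \<Rightarrow> 'v"
  assumes nb: "\<And>(p :: 'a) N. open N \<Longrightarrow> p \<in> N \<Longrightarrow> \<exists>W. open W \<and> p \<in> W \<and> W \<subseteq> N \<and> path_connected W"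
    and mono: "\<And>W W' f. sol W f \<Longrightarrow> W' \<subseteq> W \<Longrightarrow> sol W' f"
    and val: "\<And>W f q. sol W f \<Longrightarrow> q \<in> W \<Longrightarrow> j f q \<in> V q"
    and ex: "\<And>p. \<exists>U. open U \<and> p \<in> U \<and> (\<forall>q\<in>U. \<forall>v\<in>V q. \<exists>f. sol U f \<and> j f q = v)"
    and uniq: "\<And>W f f' q r. open W \<Longrightarrow> connected W \<Longrightarrow> sol W f \<Longrightarrow> sol W f' \<Longrightarrow> q \<in> W \<Longrightarrow>
      j f q = j f' q \<Longrightarrow> r \<in> W \<Longrightarrow> j f r = j f' r"
begin

text \<open>Sections along a map \<open>K\<close> of an auxiliary space; paths, homotopy squares and
  their slices all occur as \<open>K\<close>. The fibres carry no topology, so being locally the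
  value of one section takes the place of continuity.\<close>

definition flat_at :: "'s::topological_space set \<Rightarrow> ('s \<Rightarrow> 'a) \<Rightarrow> ('s \<Rightarrow> 'v) \<Rightarrow> 's \<Rightarrow> bool" where
  "flat_at S K h x \<longleftrightarrow> (\<exists>N W f. open N \<and> x \<in> N \<and> open W \<and> sol W f \<and> (\<forall>y\<in>N \<inter> S. K y \<in> W \<and> h y = j f (K y)))"

definition "flat S K h \<longleftrightarrow> (\<forall>x\<in>S. flat_at S K h x)"

lemma flat_cong: "flat S K h \<Longrightarrow> (\<And>y. y \<in> S \<Longrightarrow> K y = K' y) \<Longrightarrow> (\<And>y. y \<in> S \<Longrightarrow> h y = h' y) \<Longrightarrow> flat S K' h'"
  unfolding flat_def flat_at_def by (metis Int_iff)

lemma flat_subset: "flat S K h \<Longrightarrow> T \<subseteq> S \<Longrightarrow> flat T K h"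
proof -
  assume h: "flat S K h" and T: "T \<subseteq> S"
  show ?thesis
    unfolding flat_def flat_at_def
  proof
    fix x assume "x \<in> T"
    then obtain N W f where "open N" "x \<in> N" "open W" "sol W f" "\<forall>y\<in>N \<inter> S. K y \<in> W \<and> h y = j f (K y)"
      using h T unfolding flat_def flat_at_def by (meson subsetD)
    moreover have "\<forall>y\<in>N \<inter> T. K y \<in> W \<and> h y = j f (K y)" using calculation(5) T by auto
    ultimately show "\<exists>N W f. open N \<and> x \<in> N \<and> open W \<and> sol W f \<and> (\<forall>y\<in>N \<inter> T. K y \<in> W \<and> h y = j f (K y))"
      by blast
  qed
qed

lemma flat_compose:
  assumes h: "flat S K h" and \<sigma>: "continuous_on T \<sigma>" "\<sigma> ` T \<subseteq> S"
  shows "flat T (\<lambda>t. K (\<sigma> t)) (\<lambda>t. h (\<sigma> t))"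
  unfolding flat_def
proof
  fix x assume x: "x \<in> T"
  then have "flat_at S K h (\<sigma> x)" using h \<sigma>(2) by (auto simp: flat_def)
  then obtain N W f where N: "open N" "\<sigma> x \<in> N" "open W" "sol W f" "\<forall>y\<in>N \<inter> S. K y \<in> W \<and> h y = j f (K y)"
    unfolding flat_at_def by blast
  obtain N' where N': "open N'" "N' \<inter> T = \<sigma> -` N \<inter> T"
    using \<sigma>(1) N(1) unfolding continuous_on_open_invariant by blast
  have "x \<in> N'" using N' N(2) x by auto
  moreover have "\<forall>y\<in>N' \<inter> T. K (\<sigma> y) \<in> W \<and> h (\<sigma> y) = j f (K (\<sigma> y))" using N' N(5) \<sigma>(2) by blast
  ultimately show "flat_at T (\<lambda>t. K (\<sigma> t)) (\<lambda>t. h (\<sigma> t)) x" unfolding flat_at_def using N N' by blast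
qed

lemma flat_sol: "open W \<Longrightarrow> sol W f \<Longrightarrow> (\<And>y. y \<in> S \<Longrightarrow> K y \<in> W) \<Longrightarrow> flat S K (\<lambda>y. j f (K y))"
  unfolding flat_def flat_at_def by (intro ballI exI[of _ UNIV] exI[of _ W] exI[of _ f]) auto

lemma flat_val: "flat S K h \<Longrightarrow> x \<in> S \<Longrightarrow> h x \<in> V (K x)"
  unfolding flat_def flat_at_def using val by (metis Int_iff)

text \<open>On a connected neighbourhood inside both domains two local sections agree everywhere or
  nowhere; this is what uniqueness and glueing of lifts rest on.\<close>

lemma flat_merge:
  assumes K: "continuous_on S K" and x: "x \<in> S"
    and 1: "open W1" "sol W1 f1" "K x \<in> W1" and 2: "open W2" "sol W2 f2" "K x \<in> W2"
  shows "\<exists>N W. open N \<and> x \<in> N \<and> open W \<and> W \<subseteq> W1 \<inter> W2 \<and> (\<forall>y\<in>N \<inter> S. K y \<in> W) \<and>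
    (\<forall>p\<in>W. \<forall>q\<in>W. j f1 p = j f2 p \<longrightarrow> j f1 q = j f2 q)"
proof -
  obtain W where W: "open W" "K x \<in> W" "W \<subseteq> W1 \<inter> W2" "path_connected W"
    using nb[of "W1 \<inter> W2" "K x"] 1 2 by auto
  obtain N where N: "open N" "N \<inter> S = K -` W \<inter> S" using K W(1) unfolding continuous_on_open_invariant by blast
  have "x \<in> N" using N x W(2) by auto
  moreover have "\<forall>p\<in>W. \<forall>q\<in>W. j f1 p = j f2 p \<longrightarrow> j f1 q = j f2 q"
    using uniq[OF W(1) path_connected_imp_connected[OF W(4)] mono[OF 1(2)] mono[OF 2(2)]] W(3) by blast
  ultimately show ?thesis using N W by blast
qed

lemma flat_uniq:
  assumes S: "connected S" "continuous_on S K" and h: "flat S K h" "flat S K h'"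
    and x: "x \<in> S" "h x = h' x" and y: "y \<in> S"
  shows "h y = h' y"
proof -
  have "(h x = h' x) = (h y = h' y)"
  proof (rule connected_local_const[OF S(1) x(1) y], intro ballI)
    fix a assume a: "a \<in> S"
    obtain N W f where 1: "open N" "a \<in> N" "open W" "sol W f" "\<forall>y\<in>N \<inter> S. K y \<in> W \<and> h y = j f (K y)"
      using h(1) a unfolding flat_def flat_at_def by metis
    obtain N' W' f' where 2: "open N'" "a \<in> N'" "open W'" "sol W' f'" "\<forall>y\<in>N' \<inter> S. K y \<in> W' \<and> h' y = j f' (K y)"
      using h(2) a unfolding flat_def flat_at_def by metis
    obtain M Z where M: "open M" "a \<in> M" "\<forall>y\<in>M \<inter> S. K y \<in> Z" "\<forall>p\<in>Z. \<forall>q\<in>Z. j f p = j f' p \<longrightarrow> j f q = j f' q"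
    proof -
      have "K a \<in> W" "K a \<in> W'" using 1 2 a by auto
      from flat_merge[OF S(2) a 1(3,4) this(1) 2(3,4) this(2)] show thesis using that by blast
    qed
    have "(h a = h' a) = (h b = h' b)" if "b \<in> N \<inter> N' \<inter> M \<inter> S" for b
    proof -
      have "h a = j f (K a)" "h' a = j f' (K a)" "h b = j f (K b)" "h' b = j f' (K b)" "K a \<in> Z" "K b \<in> Z"
        using 1 2 M a that by auto
      then show ?thesis using M(4) by metis
    qed
    moreover have "open (N \<inter> N' \<inter> M)" "a \<in> N \<inter> N' \<inter> M" using 1 2 M by auto
    ultimately show "\<forall>\<^sub>F b in at a within S. (h a = h' a) = (h b = h' b)"
      unfolding eventually_at_topological by blast
  qed
  then show ?thesis using x by simp
qed

text \<open>Only points with \<open>k x = b\<close> need care. There the sections for the two sides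
  agree at \<open>K x\<close>, so by \<open>flat_merge\<close> one of them serves on both
  sides.\<close>

lemma flat_glue:
  fixes k :: "'s::topological_space \<Rightarrow> real"
  assumes K: "continuous_on S K" and k: "continuous_on UNIV k"
    and h: "flat (S \<inter> {x. k x \<le> b}) K h" "flat (S \<inter> {x. b \<le> k x}) K h"
  shows "flat S K h"
  unfolding flat_def
proof
  fix x assume x: "x \<in> S"
  have o1: "open {x. k x < b}" "open {x. b < k x}"
    using k by (auto intro!: open_Collect_less continuous_on_const)
  consider "k x < b" | "b < k x" | "k x = b" by linarith
  then show "flat_at S K h x"
  proof cases
    case 1
    then obtain N W f where N: "open N" "x \<in> N" "open W" "sol W f" "\<forall>y\<in>N \<inter> (S \<inter> {x. k x \<le> b}). K y \<in> W \<and> h y = j f (K y)"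
      using h(1) x unfolding flat_def flat_at_def by (metis (mono_tags, lifting) IntI less_imp_le mem_Collect_eq)
    then show ?thesis unfolding flat_at_def using o1(1) 1
      by (intro exI[of _ "N \<inter> {x. k x < b}"] exI[of _ W] exI[of _ f]) auto
  next
    case 2
    then obtain N W f where N: "open N" "x \<in> N" "open W" "sol W f" "\<forall>y\<in>N \<inter> (S \<inter> {x. b \<le> k x}). K y \<in> W \<and> h y = j f (K y)"
      using h(2) x unfolding flat_def flat_at_def by (metis (mono_tags, lifting) IntI less_imp_le mem_Collect_eq)
    then show ?thesis unfolding flat_at_def using o1(2) 2
      by (intro exI[of _ "N \<inter> {x. b < k x}"] exI[of _ W] exI[of _ f]) auto
  next
    case 3
    obtain N W f where N: "open N" "x \<in> N" "open W" "sol W f" "\<forall>y\<in>N \<inter> (S \<inter> {x. k x \<le> b}). K y \<in> W \<and> h y = j f (K y)"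
      using h(1) x 3 unfolding flat_def flat_at_def by (metis (mono_tags, lifting) IntI order_refl mem_Collect_eq)
    obtain N' W' f' where N': "open N'" "x \<in> N'" "open W'" "sol W' f'" "\<forall>y\<in>N' \<inter> (S \<inter> {x. b \<le> k x}). K y \<in> W' \<and> h y = j f' (K y)"
      using h(2) x 3 unfolding flat_def flat_at_def by (metis (mono_tags, lifting) IntI order_refl mem_Collect_eq)
    have "x \<in> N \<inter> (S \<inter> {x. k x \<le> b})" "x \<in> N' \<inter> (S \<inter> {x. b \<le> k x})" using N(2) N'(2) x 3 by auto
    then have Kx: "K x \<in> W" "K x \<in> W'" "j f (K x) = j f' (K x)" using N(5) N'(5) by metis+
    obtain M Z where M: "open M" "x \<in> M" "Z \<subseteq> W \<inter> W'" "\<forall>y\<in>M \<inter> S. K y \<in> Z" "\<forall>p\<in>Z. \<forall>q\<in>Z. j f p = j f' p \<longrightarrow> j f q = j f' q"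
      using flat_merge[OF K x N(3,4) Kx(1) N'(3,4) Kx(2)] by blast
    have "K y \<in> W \<and> h y = j f (K y)" if y: "y \<in> N \<inter> N' \<inter> M \<inter> S" for y
    proof -
      have Z: "K x \<in> Z" "K y \<in> Z" using M x y by auto
      then have "j f (K y) = j f' (K y)" using M(5) Kx(3) by blast
      then show ?thesis using N(5) N'(5) y Z M(3) by (cases "k y \<le> b") auto
    qed
    moreover have "open (N \<inter> N' \<inter> M)" "x \<in> N \<inter> N' \<inter> M" using N N' M by auto
    ultimately show ?thesis unfolding flat_at_def using N(3,4) by blast
  qed
qed

text \<open>Extends a section given on the bottom edge of a thin vertical strip to the whole strip.
  The width depends only on \<open>K\<close> and \<open>s0\<close>; interval bisection in the second
  variable takes the place of a Lebesgue number.\<close>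

lemma strip_lift:
  fixes K :: "real \<times> real \<Rightarrow> 'a"
  assumes K: "continuous_on ({0..1} \<times> {0..1}) K" and s0: "s0 \<in> {0..1}"
  shows "\<exists>\<delta>>0. \<forall>h. flat (ball s0 \<delta> \<inter> {0..1}) (\<lambda>s. K (s, 0)) h \<longrightarrow>
     (\<exists>H. flat ((ball s0 \<delta> \<inter> {0..1}) \<times> {0..1}) K H \<and> (\<forall>s\<in>ball s0 \<delta> \<inter> {0..1}. H (s, 0) = h s))"
proof -
  let ?B = "\<lambda>\<epsilon>. ball s0 \<epsilon> \<inter> {0..1}"
  \<comment> \<open>The claim is made for all smaller widths too, so that two adjacent intervals can
    be joined over the smaller of their two widths.\<close>
  define P where "P a b \<longleftrightarrow> (0 \<le> a \<and> a \<le> b \<and> b \<le> 1 \<longrightarrow> (\<exists>\<delta>>0. \<forall>\<epsilon>. 0 < \<epsilon> \<and> \<epsilon> \<le> \<delta> \<longrightarrow> (\<forall>h. flat (?B \<epsilon>) (\<lambda>s. K (s, a)) h \<longrightarrow>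
     (\<exists>H. flat (?B \<epsilon> \<times> {a..b}) K H \<and> (\<forall>s\<in>?B \<epsilon>. H (s, a) = h s)))))" for a b
  have Kc: "continuous_on (?B \<epsilon> \<times> {a..b}) K" if "0 \<le> a" "b \<le> 1" for a b \<epsilon>
    by (rule continuous_on_subset[OF K]) (use that in auto)
  have sl: "continuous_on (?B \<epsilon>) (\<lambda>s. K (s, a))" if "0 \<le> a" "a \<le> 1" for a \<epsilon>
    by (rule continuous_on_compose2[OF K]) (use that in \<open>auto intro!: continuous_intros\<close>)
  have "P 0 1"
  proof (rule Bolzano)
    fix a b c assume P: "P a b" "P b c" and abc: "a \<le> b" "b \<le> c"
    show "P a c"
      unfolding P_def
    proof (intro impI)
      assume ac: "0 \<le> a \<and> a \<le> c \<and> c \<le> 1"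
      obtain \<delta>1 where 1: "\<delta>1 > 0" "\<And>\<epsilon> h. 0 < \<epsilon> \<Longrightarrow> \<epsilon> \<le> \<delta>1 \<Longrightarrow> flat (?B \<epsilon>) (\<lambda>s. K (s, a)) h \<Longrightarrow>
         \<exists>H. flat (?B \<epsilon> \<times> {a..b}) K H \<and> (\<forall>s\<in>?B \<epsilon>. H (s, a) = h s)"
        using P(1) abc ac unfolding P_def by force
      obtain \<delta>2 where 2: "\<delta>2 > 0" "\<And>\<epsilon> h. 0 < \<epsilon> \<Longrightarrow> \<epsilon> \<le> \<delta>2 \<Longrightarrow> flat (?B \<epsilon>) (\<lambda>s. K (s, b)) h \<Longrightarrow>
         \<exists>H. flat (?B \<epsilon> \<times> {b..c}) K H \<and> (\<forall>s\<in>?B \<epsilon>. H (s, b) = h s)"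
        using P(2) abc ac unfolding P_def by force
      show "\<exists>\<delta>>0. \<forall>\<epsilon>. 0 < \<epsilon> \<and> \<epsilon> \<le> \<delta> \<longrightarrow> (\<forall>h. flat (?B \<epsilon>) (\<lambda>s. K (s, a)) h \<longrightarrow>
         (\<exists>H. flat (?B \<epsilon> \<times> {a..c}) K H \<and> (\<forall>s\<in>?B \<epsilon>. H (s, a) = h s)))"
      proof (intro exI[of _ "min \<delta>1 \<delta>2"] conjI allI impI)
        fix \<epsilon> h assume e: "0 < \<epsilon> \<and> \<epsilon> \<le> min \<delta>1 \<delta>2" and h: "flat (?B \<epsilon>) (\<lambda>s. K (s, a)) h"
        obtain H1 where H1: "flat (?B \<epsilon> \<times> {a..b}) K H1" "\<forall>s\<in>?B \<epsilon>. H1 (s, a) = h s" using 1(2)[OF _ _ h] e by auto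
        have "flat (?B \<epsilon>) (\<lambda>s. K (s, b)) (\<lambda>s. H1 (s, b))"
          by (rule flat_compose[OF H1(1)]) (use abc in \<open>auto intro!: continuous_intros\<close>)
        then obtain H2 where H2: "flat (?B \<epsilon> \<times> {b..c}) K H2" "\<forall>s\<in>?B \<epsilon>. H2 (s, b) = H1 (s, b)"
          using 2(2)[of \<epsilon>] e by auto
        define H where "H z = (if snd z \<le> b then H1 z else H2 z)" for z
        have "flat (?B \<epsilon> \<times> {a..c}) K H"
        proof (rule flat_glue[where k = snd and b = b])
          show "continuous_on (?B \<epsilon> \<times> {a..c}) K" by (rule Kc) (use ac in auto)
          show "flat (?B \<epsilon> \<times> {a..c} \<inter> {x. snd x \<le> b}) K H"
            by (rule flat_cong[OF flat_subset[OF H1(1)]]) (auto simp: H_def)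
          show "flat (?B \<epsilon> \<times> {a..c} \<inter> {x. b \<le> snd x}) K H"
            by (rule flat_cong[OF flat_subset[OF H2(1)]]) (use H2(2) in \<open>auto simp: H_def\<close>)
        qed (intro continuous_intros)
        moreover have "\<forall>s\<in>?B \<epsilon>. H (s, a) = h s" using H1(2) abc by (simp add: H_def)
        ultimately show "\<exists>H. flat (?B \<epsilon> \<times> {a..c}) K H \<and> (\<forall>s\<in>?B \<epsilon>. H (s, a) = h s)" by blast
      qed (use 1 2 in auto)
    qed
  next
    fix x :: real assume x: "0 \<le> x" "x \<le> 1"
    obtain U where U: "open U" "K (s0, x) \<in> U" "\<And>q v. q \<in> U \<Longrightarrow> v \<in> V q \<Longrightarrow> \<exists>f. sol U f \<and> j f q = v"
      using ex[of "K (s0, x)"] by blast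
    obtain N where N: "open N" "N \<inter> ({0..1} \<times> {0..1}) = K -` U \<inter> ({0..1} \<times> {0..1})"
      using K U(1) unfolding continuous_on_open_invariant by blast
    have "(s0, x) \<in> N" using N U(2) s0 x by auto
    then obtain A B where AB: "open A" "open B" "s0 \<in> A" "x \<in> B" "A \<times> B \<subseteq> N"
      using N(1) open_prod_elim by (metis mem_Sigma_iff)
    obtain d1 where d1: "d1 > 0" "ball s0 d1 \<subseteq> A" using AB(1,3) open_contains_ball by blast
    obtain d2 where d2: "d2 > 0" "ball x d2 \<subseteq> B" using AB(2,4) open_contains_ball by blast
    have KU: "K (s, t) \<in> U" if "s \<in> ?B d1" "t \<in> ball x d2" "0 \<le> t" "t \<le> 1" for s t
    proof -
      have "s \<in> A" "t \<in> B" using that d1 d2 by auto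
      then have "(s, t) \<in> N \<inter> ({0..1} \<times> {0..1})" using that AB(5) by auto
      then show ?thesis using N by auto
    qed
    show "\<exists>d>0. \<forall>a b. a \<le> x \<and> x \<le> b \<and> b - a < d \<longrightarrow> P a b"
    proof (intro exI[of _ d2] conjI allI impI)
      fix a b assume ab: "a \<le> x \<and> x \<le> b \<and> b - a < d2"
      show "P a b"
        unfolding P_def
      proof (intro impI exI[of _ d1] conjI allI)
        fix \<epsilon> h assume b1: "0 \<le> a \<and> a \<le> b \<and> b \<le> 1" and e: "0 < \<epsilon> \<and> \<epsilon> \<le> d1" and h: "flat (?B \<epsilon>) (\<lambda>s. K (s, a)) h"
        have KU': "K (s, t) \<in> U" if "s \<in> ?B \<epsilon>" "t \<in> {a..b}" for s t
          by (rule KU) (use that e ab b1 in \<open>auto simp: dist_real_def\<close>)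
        have s0B: "s0 \<in> ?B \<epsilon>" using s0 e by auto
        then have "h s0 \<in> V (K (s0, a))" using flat_val[OF h] by blast
        then obtain f where f: "sol U f" "j f (K (s0, a)) = h s0" using U(3)[OF KU'[OF s0B]] b1 by auto
        have cB: "connected (?B \<epsilon>)" by (intro convex_connected convex_Int) auto
        have "flat (?B \<epsilon>) (\<lambda>s. K (s, a)) (\<lambda>s. j f (K (s, a)))"
          by (rule flat_sol[OF U(1) f(1)]) (use KU' b1 in auto)
        then have "j f (K (s, a)) = h s" if "s \<in> ?B \<epsilon>" for s
          using flat_uniq[of "?B \<epsilon>" "\<lambda>s. K (s, a)" "\<lambda>s. j f (K (s, a))" h s0 s] cB sl[of a \<epsilon>] h s0B f(2) that b1
          by auto
        moreover have "flat (?B \<epsilon> \<times> {a..b}) K (\<lambda>z. j f (K z))"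
          by (rule flat_sol[OF U(1) f(1)]) (use KU' in auto)
        ultimately show "\<exists>H. flat (?B \<epsilon> \<times> {a..b}) K H \<and> (\<forall>s\<in>?B \<epsilon>. H (s, a) = h s)" by blast
      qed (use d1 in auto)
    qed (use d2 in auto)
  qed simp
  then show ?thesis unfolding P_def by (metis order_refl zero_le_one)
qed

text \<open>The path is regarded as a strip on which \<open>K\<close> is constant in the first
  variable.\<close>

lemma path_lift:
  assumes \<gamma>: "path \<gamma>" and v: "v \<in> V (\<gamma> 0)"
  shows "\<exists>h. flat {0..1} \<gamma> h \<and> h 0 = v"
proof -
  have K: "continuous_on ({0..1} \<times> {0..1}) (\<lambda>z. \<gamma> (snd z))"
    by (rule continuous_on_compose2[OF \<gamma>[unfolded path_def]]) (auto intro!: continuous_intros)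
  obtain U where U: "open U" "\<gamma> 0 \<in> U" "\<And>q v. q \<in> U \<Longrightarrow> v \<in> V q \<Longrightarrow> \<exists>f. sol U f \<and> j f q = v"
    using ex[of "\<gamma> 0"] by blast
  obtain f where f: "sol U f" "j f (\<gamma> 0) = v" using U(3)[OF U(2) v] by blast
  have fl: "flat S (\<lambda>s. \<gamma> 0) (\<lambda>s. v)" for S :: "real set" using flat_sol[OF U(1) f(1), of S "\<lambda>s. \<gamma> 0"] U(2) f(2) by simp
  have z: "(0::real) \<in> {0..1}" by simp
  obtain \<delta> where d: "\<delta> > 0" "\<forall>h. flat (ball (0::real) \<delta> \<inter> {0..1}) (\<lambda>s. \<gamma> (snd (s, 0::real))) h \<longrightarrow>
     (\<exists>H. flat ((ball (0::real) \<delta> \<inter> {0..1}) \<times> {0..1}) (\<lambda>z. \<gamma> (snd z)) H \<and> (\<forall>s\<in>ball (0::real) \<delta> \<inter> {0..1}. H (s, 0) = h s))"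
    using strip_lift[OF K z] by (elim exE conjE) (rule that)
  have "flat (ball (0::real) \<delta> \<inter> {0..1}) (\<lambda>s. \<gamma> (snd (s, 0::real))) (\<lambda>s. v)" using fl by simp
  from d(2)[rule_format, OF this] obtain H where H: "flat ((ball (0::real) \<delta> \<inter> {0..1}) \<times> {0..1}) (\<lambda>z. \<gamma> (snd z)) H"
    "\<forall>s\<in>ball (0::real) \<delta> \<inter> {0..1}. H (s, 0) = v" by blast
  have "flat {0..1} (\<lambda>t. \<gamma> (snd (0::real, t))) (\<lambda>t. H (0, t))"
    by (rule flat_compose[OF H(1)]) (use d(1) in \<open>auto intro!: continuous_intros\<close>)
  then show ?thesis using H(2) d(1) by auto
qed

lemma lift_unique: "path \<gamma> \<Longrightarrow> flat {0..1} \<gamma> h \<Longrightarrow> flat {0..1} \<gamma> h' \<Longrightarrow> h 0 = h' 0 \<Longrightarrow> t \<in> {0..1} \<Longrightarrow> h t = h' t"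
  using flat_uniq[of "{0..1}" \<gamma> h h' 0 t] by (simp add: path_def)

text \<open>Under a free homotopy from a loop to a constant loop, the lifts of the loops close up because the
  two ends of the lifts are lifts of the same path that agree at the constant loop.\<close>

lemma loop_lift_closed:
  assumes sc: "simply_connected (UNIV :: 'a set)" and \<gamma>: "path \<gamma>" "\<gamma> 1 = \<gamma> 0" and h: "flat {0..1} \<gamma> h"
  shows "h 1 = h 0"
proof -
  have "homotopic_loops UNIV \<gamma> (\<lambda>t. \<gamma> 0)"
    using sc \<gamma> unfolding simply_connected_def by (auto simp: pathfinish_def pathstart_def path_def)
  then obtain K :: "real \<times> real \<Rightarrow> 'a" where K: "continuous_on ({0..1} \<times> {0..1}) K" "\<And>t. t \<in> {0..1} \<Longrightarrow> K (0, t) = \<gamma> t"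
    "\<And>t. t \<in> {0..1} \<Longrightarrow> K (1, t) = \<gamma> 0" "\<And>s. s \<in> {0..1} \<Longrightarrow> K (s, 1) = K (s, 0)"
    unfolding homotopic_loops pathfinish_def pathstart_def o_def by blast
  have pK: "path (\<lambda>t. K (s, t))" if "s \<in> {0..1}" for s
    unfolding path_def by (rule continuous_on_compose2[OF K(1)]) (use that in \<open>auto intro!: continuous_intros\<close>)
  \<comment> \<open>The common track of both ends of the loops \<open>K (s, _)\<close>. It is lifted
    by the starting values \<open>k\<close>, and \<open>e\<close> below shows that the end values
    \<open>L s 1\<close> form another lift.\<close>
  define \<sigma> where "\<sigma> s = K (s, 0)" for s
  have p\<sigma>: "path \<sigma>" unfolding path_def \<sigma>_def
    by (rule continuous_on_compose2[OF K(1)]) (auto intro!: continuous_intros)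
  have "h 0 \<in> V (\<sigma> 0)" using flat_val[OF h, of 0] K(2)[of 0] by (simp add: \<sigma>_def)
  then obtain k where k: "flat {0..1} \<sigma> k" "k 0 = h 0" using path_lift[OF p\<sigma>] by blast
  have "\<exists>L. flat {0..1} (\<lambda>t. K (s, t)) L \<and> L 0 = k s" if "s \<in> {0..1}" for s
    using path_lift[OF pK[OF that]] flat_val[OF k(1) that] by (simp add: \<sigma>_def)
  then obtain L where L: "\<And>s. s \<in> {0..1} \<Longrightarrow> flat {0..1} (\<lambda>t. K (s, t)) (L s)" "\<And>s. s \<in> {0..1} \<Longrightarrow> L s 0 = k s"
    by metis
  have e: "flat {0..1} \<sigma> (\<lambda>s. L s 1)"
    unfolding flat_def
  proof
    fix s0 :: real assume s0: "s0 \<in> {0..1}"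
    obtain \<delta> where d: "\<delta> > 0" "\<forall>h. flat (ball s0 \<delta> \<inter> {0..1}) (\<lambda>s. K (s, 0)) h \<longrightarrow>
       (\<exists>H. flat ((ball s0 \<delta> \<inter> {0..1}) \<times> {0..1}) K H \<and> (\<forall>s\<in>ball s0 \<delta> \<inter> {0..1}. H (s, 0) = h s))"
      using strip_lift[OF K(1) s0] by (elim exE conjE) (rule that)
    let ?B = "ball s0 \<delta> \<inter> {0..1}"
    have "flat ?B (\<lambda>s. K (s, 0)) k" using flat_subset[OF k(1)] by (simp add: \<sigma>_def[abs_def])
    from d(2)[rule_format, OF this] obtain H where H: "flat (?B \<times> {0..1}) K H" "\<And>s. s \<in> ?B \<Longrightarrow> H (s, 0) = k s" by blast
    \<comment> \<open>The lifts \<open>L s\<close> were chosen separately for each \<open>s\<close>;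
      uniqueness identifies them near \<open>s0\<close> with the slices of the single section
      \<open>H\<close>.\<close>
    have HL: "H (s, 1) = L s 1" if s: "s \<in> ?B" for s
    proof (rule lift_unique[where \<gamma> = "\<lambda>t. K (s, t)" and h = "\<lambda>t. H (s, t)" and t = 1])
      show "flat {0..1} (\<lambda>t. K (s, t)) (\<lambda>t. H (s, t))"
        by (rule flat_compose[OF H(1)]) (use s in \<open>auto intro!: continuous_intros\<close>)
    qed (use pK L H(2) s in auto)
    have "flat ?B (\<lambda>s. K (s, 1)) (\<lambda>s. H (s, 1))"
      by (rule flat_compose[OF H(1)]) (auto intro!: continuous_intros)
    then have "flat ?B \<sigma> (\<lambda>s. L s 1)"
      by (rule flat_cong) (use HL K(4) in \<open>auto simp: \<sigma>_def\<close>)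
    then obtain N W f where N: "open N" "s0 \<in> N" "open W" "sol W f" "\<forall>y\<in>N \<inter> ?B. \<sigma> y \<in> W \<and> L y 1 = j f (\<sigma> y)"
      using s0 d(1) unfolding flat_def flat_at_def by (metis IntI centre_in_ball)
    then show "flat_at {0..1} \<sigma> (\<lambda>s. L s 1) s0"
      unfolding flat_at_def using d(1)
      by (intro exI[of _ "N \<inter> ball s0 \<delta>"] exI[of _ W] exI[of _ f]) auto
  qed
  have "L 1 1 = k 1"
  proof -
    obtain U where U: "open U" "\<gamma> 0 \<in> U" "\<And>q v. q \<in> U \<Longrightarrow> v \<in> V q \<Longrightarrow> \<exists>f. sol U f \<and> j f q = v"
      using ex[of "\<gamma> 0"] by blast
    have "k 1 \<in> V (\<gamma> 0)" using flat_val[OF k(1), of 1] K(3)[of 0] by (simp add: \<sigma>_def)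
    then obtain f where f: "sol U f" "j f (\<gamma> 0) = k 1" using U(3)[OF U(2)] by blast
    have "flat {0..1} (\<lambda>t. \<gamma> 0) (\<lambda>t::real. k 1)" using flat_sol[OF U(1) f(1), of "{0..1}" "\<lambda>t. \<gamma> 0"] U(2) f(2) by simp
    then have "flat {0..1} (\<lambda>t. K (1, t)) (\<lambda>t. k 1)" by (rule flat_cong) (use K(3) in auto)
    from lift_unique[OF pK[of 1] L(1)[of 1] this, of 1] L(2)[of 1] show ?thesis by simp
  qed
  then have "L 0 1 = k 0"
    using flat_uniq[OF connected_Icc p\<sigma>[unfolded path_def] e k(1), of 1 0] by simp
  moreover have "L 0 1 = h 1"
  proof (rule lift_unique[OF \<gamma>(1) _ h])
    show "flat {0..1} \<gamma> (L 0)" by (rule flat_cong[OF L(1)]) (use K(2) in auto)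
  qed (use L(2)[of 0] k in auto)
  ultimately show ?thesis using k by simp
qed

text \<open>Lift the loop made of \<open>p\<close> and the reverse of \<open>q\<close>. Its lift
  closes up, so the two halves are lifts of \<open>p\<close> and of \<open>q\<close> with the same
  start, and they meet in the middle.\<close>

lemma lift_end_unique:
  assumes sc: "simply_connected (UNIV :: 'a set)" and p: "path p" "path q" "p 0 = q 0" "p 1 = q 1"
    and h: "flat {0..1} p hp" "flat {0..1} q hq" "hp 0 = hq 0"
  shows "hp 1 = hq 1"
proof -
  define \<gamma> where "\<gamma> = p +++ reversepath q"
  have g: "path \<gamma>" "\<gamma> 1 = \<gamma> 0" "\<gamma> 0 = p 0"
  proof -
    show "path \<gamma>" unfolding \<gamma>_def using p
      by (intro path_join_imp path_reversepath[THEN iffD2]) (auto simp: pathfinish_def pathstart_def reversepath_def)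
  qed (use p in \<open>auto simp: \<gamma>_def joinpaths_def reversepath_def\<close>)
  have "hp 0 \<in> V (\<gamma> 0)" using flat_val[OF h(1), of 0] g by simp
  then obtain L where L: "flat {0..1} \<gamma> L" "L 0 = hp 0" using path_lift[OF g(1)] by blast
  have L1: "L 1 = L 0" by (rule loop_lift_closed[OF sc g(1,2) L(1)])
  have "flat {0..1} (\<lambda>t. \<gamma> (t / 2)) (\<lambda>t. L (t / 2))"
    by (rule flat_compose[OF L(1)]) (auto intro!: continuous_intros)
  then have "flat {0..1} p (\<lambda>t. L (t / 2))" by (rule flat_cong) (auto simp: \<gamma>_def joinpaths_def)
  from lift_unique[OF p(1) this h(1), of 1] L have 1: "L (1/2) = hp 1" by simp
  have "flat {0..1} (\<lambda>t. \<gamma> (1 - t / 2)) (\<lambda>t. L (1 - t / 2))"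
    by (rule flat_compose[OF L(1)]) (auto intro!: continuous_intros)
  then have "flat {0..1} q (\<lambda>t. L (1 - t / 2))"
    by (rule flat_cong) (use p in \<open>auto simp: \<gamma>_def joinpaths_def reversepath_def\<close>)
  from lift_unique[OF p(2) this h(2), of 1] L L1 h(3) have 2: "L (1/2) = hq 1" by simp
  from 1 2 show ?thesis by simp
qed

text \<open>Simple connectedness is formulated by free homotopies of loops. Applied to two constant
  loops it yields a homotopy whose base points trace the path.\<close>

lemma simply_connected_path:
  assumes "simply_connected (UNIV :: 'a set)" shows "\<exists>\<gamma>. path \<gamma> \<and> \<gamma> 0 = a \<and> \<gamma> 1 = (b :: 'a)"
proof -
  have "homotopic_loops UNIV (\<lambda>t. a) (\<lambda>t. b)"
    using assms unfolding simply_connected_def by (auto simp: pathfinish_def pathstart_def path_def)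
  then obtain K :: "real \<times> real \<Rightarrow> 'a" where K: "continuous_on ({0..1} \<times> {0..1}) K" "\<And>t. t \<in> {0..1} \<Longrightarrow> K (0, t) = a"
    "\<And>t. t \<in> {0..1} \<Longrightarrow> K (1, t) = b"
    unfolding homotopic_loops by blast
  have "path (\<lambda>t. K (t, 0))" unfolding path_def
    by (rule continuous_on_compose2[OF K(1)]) (auto intro!: continuous_intros)
  then show ?thesis using K(2,3)[of 0] by (intro exI[of _ "\<lambda>t. K (t, 0)"]) auto
qed

text \<open>The value at \<open>q\<close> is the end value of a lift along any path from
  \<open>z\<close> to \<open>q\<close>. Near a point \<open>p\<close> the paths are prolonged inside
  a path-connected neighbourhood on which one local section continues the lift.\<close>

theorem monodromy:
  assumes sc: "simply_connected (UNIV :: 'a set)" and v: "v \<in> V z"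
  obtains s where "s z = v" "\<And>p. \<exists>W f. open W \<and> p \<in> W \<and> sol W f \<and> (\<forall>q\<in>W. s q = j f q)"
proof -
  have "\<exists>e. \<forall>\<gamma> h. path \<gamma> \<and> \<gamma> 0 = z \<and> \<gamma> 1 = q \<and> flat {0..1} \<gamma> h \<and> h 0 = v \<longrightarrow> h 1 = e" for q
  proof -
    obtain \<gamma> where g: "path \<gamma>" "\<gamma> 0 = z" "\<gamma> 1 = q" using simply_connected_path[OF sc] by blast
    obtain h where h: "flat {0..1} \<gamma> h" "h 0 = v" using path_lift[OF g(1)] v g by blast
    show ?thesis
    proof (intro exI[of _ "h 1"] allI impI)
      fix \<beta> k assume "path \<beta> \<and> \<beta> 0 = z \<and> \<beta> 1 = q \<and> flat {0..1} \<beta> k \<and> k 0 = v"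
      then show "k 1 = h 1" using g h by (intro lift_end_unique[OF sc, of \<beta> \<gamma> k h]) auto
    qed
  qed
  then obtain s where s: "\<And>\<gamma> h. path \<gamma> \<Longrightarrow> \<gamma> 0 = z \<Longrightarrow> flat {0..1} \<gamma> h \<Longrightarrow> h 0 = v \<Longrightarrow> h 1 = s (\<gamma> 1)"
    by metis
  show thesis
  proof (rule that)
    have pz: "path (\<lambda>t. z)" by (simp add: path_def)
    obtain U where U: "open U" "z \<in> U" "\<And>q v. q \<in> U \<Longrightarrow> v \<in> V q \<Longrightarrow> \<exists>f. sol U f \<and> j f q = v"
      using ex[of z] by blast
    obtain f where f: "sol U f" "j f z = v" using U(3)[OF U(2) v] by blast
    show "s z = v" using s[OF pz refl flat_sol[OF U(1) f(1)]] U(2) f(2) by simp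
  next
    fix p
    obtain U where U: "open U" "p \<in> U" "\<And>q v. q \<in> U \<Longrightarrow> v \<in> V q \<Longrightarrow> \<exists>f. sol U f \<and> j f q = v"
      using ex[of p] by blast
    obtain W where W: "open W" "p \<in> W" "W \<subseteq> U" "path_connected W" using nb[OF U(1,2)] by blast
    obtain \<gamma> where g: "path \<gamma>" "\<gamma> 0 = z" "\<gamma> 1 = p" using simply_connected_path[OF sc] by blast
    obtain h where h: "flat {0..1} \<gamma> h" "h 0 = v" using path_lift[OF g(1)] v g by blast
    have "h 1 \<in> V p" using flat_val[OF h(1), of 1] g by simp
    then obtain f where f: "sol U f" "j f p = h 1" using U(3)[OF U(2)] by blast
    have "s q = j f q" if q: "q \<in> W" for q
    proof -
      obtain \<beta> where b: "path \<beta>" "path_image \<beta> \<subseteq> W" "\<beta> 0 = p" "\<beta> 1 = q"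
        using W(2,4) q unfolding path_connected_def pathstart_def pathfinish_def by metis
      have bU: "\<beta> t \<in> U" if "t \<in> {0..1}" for t using b(2) W(3) that unfolding path_image_def by blast
      let ?c = "\<gamma> +++ \<beta>"
      define k where "k t = (if t \<le> 1/2 then h (2 * t) else j f (\<beta> (2 * t - 1)))" for t
      have pc: "path ?c" using g b by (intro path_join_imp) (auto simp: pathfinish_def pathstart_def)
      have "flat {0..1} ?c k"
      proof (rule flat_glue[where k = "\<lambda>t. t" and b = "1/2"])
        show "continuous_on {0..1} ?c" using pc by (simp add: path_def)
        have "flat ({0..1} \<inter> {x. x \<le> 1/2}) (\<lambda>t. \<gamma> (2 * t)) (\<lambda>t. h (2 * t))"
          by (rule flat_compose[OF h(1)]) (auto intro!: continuous_intros)
        then show "flat ({0..1} \<inter> {x. x \<le> 1/2}) ?c k"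
          by (rule flat_cong) (auto simp: k_def joinpaths_def)
        have "flat ({0..1} \<inter> {x. 1/2 \<le> x}) (\<lambda>t. \<beta> (2 * t - 1)) (\<lambda>t. j f (\<beta> (2 * t - 1)))"
          by (rule flat_sol[OF U(1) f(1)]) (use bU in auto)
        then show "flat ({0..1} \<inter> {x. 1/2 \<le> x}) ?c k"
        proof (rule flat_cong)
          fix y :: real assume y: "y \<in> {0..1} \<inter> {x. 1/2 \<le> x}"
          have 1: "\<gamma> 1 = \<beta> 0" "h 1 = j f (\<beta> 0)" using g(3) b(3) f(2) by simp_all
          have "\<beta> (2 * y - 1) = ?c y \<and> j f (\<beta> (2 * y - 1)) = k y"
          proof (cases "y = 1/2")
            case True
            show ?thesis unfolding True by (simp add: k_def joinpaths_def 1)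
          next
            case False
            then have "\<not> y \<le> 1/2" using y by simp
            then show ?thesis by (simp add: k_def joinpaths_def)
          qed
          then show "\<beta> (2 * y - 1) = ?c y" "j f (\<beta> (2 * y - 1)) = k y" by auto
        qed
      qed (intro continuous_intros)
      from s[OF pc _ this] g b h(2) show ?thesis by (simp add: joinpaths_def k_def)
    qed
    then show "\<exists>W f. open W \<and> p \<in> W \<and> sol W f \<and> (\<forall>q\<in>W. s q = j f q)"
      using W mono[OF f(1)] by blast
  qed
qed

end

subsection \<open>Flat linear systems\<close>

abbreviation (input) "dd f b x \<equiv> frechet_derivative f (at x) b"

lemma ray_integral_bound:
  fixes a :: "'e::euclidean_space"
  assumes "continuous_on (ball a r) h" "x \<in> ball a r" "\<And>y. y \<in> ball a r \<Longrightarrow> \<bar>h y\<bar> \<le> K"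
  shows "\<bar>ray_integral m a h x\<bar> \<le> K"
proof -
  have K: "0 \<le> K" using assms(3)[OF assms(2)] by linarith
  have "norm (integral {0..1} (\<lambda>t. t ^ m * h (a + t *\<^sub>R (x - a)))) \<le> K * (1 - 0)"
  proof (rule integral_bound)
    show "continuous_on {0..1} (\<lambda>t. t ^ m * h (a + t *\<^sub>R (x - a)))"
    proof -
      have "continuous_on {0..1} (\<lambda>t. (x, t))" by (intro continuous_intros)
      from continuous_on_compose2[OF ray_continuous[OF assms(1), of m] this] assms(2)
      show ?thesis by (auto simp del: mem_ball)
    qed
    fix t :: real assume t: "t \<in> {0..1}"
    have "\<bar>t ^ m\<bar> * \<bar>h (a + t *\<^sub>R (x - a))\<bar> \<le> 1 * K"
      by (rule mult_mono) (use t assms(3)[OF ray_in_ball[OF assms(2) t]] in \<open>auto simp: power_le_one\<close>)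
    then show "norm (t ^ m * h (a + t *\<^sub>R (x - a))) \<le> K" by (simp add: abs_mult)
  qed simp
  then show ?thesis by (simp add: ray_integral_def)
qed

lemma ray_integral_diff:
  fixes a :: "'e::euclidean_space"
  assumes "continuous_on (ball a r) h" "continuous_on (ball a r) k" "x \<in> ball a r"
  shows "ray_integral m a h x - ray_integral m a k x = ray_integral m a (\<lambda>y. h y - k y) x"
  unfolding ray_integral_def right_diff_distrib
  by (rule integral_diff[OF ray_integrable[OF assms(1,3)] ray_integrable[OF assms(2,3)], symmetric])

lemma ray_integral_cong:
  fixes a :: "'e::euclidean_space"
  assumes "x \<in> ball a r" "\<And>y. y \<in> ball a r \<Longrightarrow> h y = k y"
  shows "ray_integral m a h x = ray_integral m a k x"
  unfolding ray_integral_def by (rule integral_cong) (use assms(2)[OF ray_in_ball[OF assms(1)]] in auto)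

lemma Cinf_on_dir:
  assumes "Cinf_on f S" "x \<in> S"
  shows "dd f v x = (\<Sum>b\<in>Basis. (v \<bullet> b) * dd f b x)"
proof -
  have lin: "linear (frechet_derivative f (at x))" using has_derivative_linear[OF Cinf_on_has_derivative[OF assms]] .
  show ?thesis
    by (subst euclidean_representation[of v, symmetric]) (simp only: linear_sum[OF lin] linear_cmul[OF lin] real_scaleR_def)
qed

text \<open>Integrate the derivative of \<open>t * h (a + t *\<^sub>R (x - a))\<close> over the unit
  interval.\<close>

lemma ray_identity:
  fixes a :: "'e::euclidean_space"
  assumes h: "Cinf_on h (ball a r)" and x: "x \<in> ball a r"
  shows "h x = ray_integral 0 a h x + (\<Sum>b\<in>Basis. ((x - a) \<bullet> b) * ray_integral 1 a (\<lambda>y. dd h b y) x)"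
proof -
  let ?p = "\<lambda>t. a + t *\<^sub>R (x - a)"
  have D: "(h has_derivative frechet_derivative h (at y)) (at y)" if "y \<in> ball a r" for y
    using Cinf_on_has_derivative[OF h that] .
  have "((\<lambda>t. t * h (?p t)) has_vector_derivative (h (?p t) + t * dd h (x - a) (?p t))) (at t within {0..1})"
    if t: "t \<in> {0..1}" for t
  proof -
    have "((\<lambda>t. h (?p t)) has_derivative (\<lambda>s. frechet_derivative h (at (?p t)) (s *\<^sub>R (x - a)))) (at t)"
      by (rule has_derivative_compose[OF _ D]) (use t x in \<open>auto intro!: derivative_eq_intros ray_in_ball simp del: mem_ball\<close>)
    then have "((\<lambda>t. h (?p t)) has_vector_derivative dd h (x - a) (?p t)) (at t)"
      using linear_cmul[OF has_derivative_linear[OF D[OF ray_in_ball[OF x t]]]]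
      by (simp add: has_vector_derivative_def)
    then have "((\<lambda>t. h (?p t)) has_real_derivative dd h (x - a) (?p t)) (at t within {0..1})"
      by (simp add: has_real_derivative_iff_has_vector_derivative has_vector_derivative_at_within)
    then show ?thesis
      unfolding has_real_derivative_iff_has_vector_derivative[symmetric]
      by (auto intro!: derivative_eq_intros)
  qed
  from fundamental_theorem_of_calculus[OF _ this]
  have I: "((\<lambda>t. h (?p t) + t * dd h (x - a) (?p t)) has_integral h x) {0..1}" by simp
  have ci: "(\<lambda>t. t ^ m * k (?p t)) integrable_on {0..1}" if "Cinf_on k (ball a r)" for m k
    using ray_integrable[OF Cinf_on_imp_continuous[OF that] x] .
  have "h x = integral {0..1} (\<lambda>t. h (?p t) + t * dd h (x - a) (?p t))" using I by (simp add: integral_unique)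
  also have "\<dots> = integral {0..1} (\<lambda>t. h (?p t) + (\<Sum>b\<in>Basis. ((x - a) \<bullet> b) * (t * dd h b (?p t))))"
  proof (rule integral_cong)
    fix t :: real assume t: "t \<in> {0..1}"
    show "h (?p t) + t * dd h (x - a) (?p t) = h (?p t) + (\<Sum>b\<in>Basis. ((x - a) \<bullet> b) * (t * dd h b (?p t)))"
      by (subst Cinf_on_dir[OF h ray_in_ball[OF x t]]) (simp add: sum_distrib_left mult.left_commute)
  qed
  also have "\<dots> = ray_integral 0 a h x + (\<Sum>b\<in>Basis. ((x - a) \<bullet> b) * ray_integral 1 a (\<lambda>y. dd h b y) x)"
    unfolding ray_integral_def
  proof -
    have 1: "(\<lambda>t. h (?p t)) integrable_on {0..1}" using ci[OF h, of 0] by simp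
    have 2: "(\<lambda>t. ((x - a) \<bullet> b) * (t * dd h b (?p t))) integrable_on {0..1}" for b
      using integrable_on_mult_right[OF ci[OF Cinf_on_deriv[OF h], of 1]] by simp
    show "integral {0..1} (\<lambda>t. h (?p t) + (\<Sum>b\<in>Basis. ((x - a) \<bullet> b) * (t * dd h b (?p t)))) =
      integral {0..1} (\<lambda>t. t ^ 0 * h (?p t)) + (\<Sum>b\<in>Basis. ((x - a) \<bullet> b) * integral {0..1} (\<lambda>t. t ^ 1 * dd h b (?p t)))"
    proof -
      have 3: "(\<lambda>t. \<Sum>b\<in>Basis. ((x - a) \<bullet> b) * (t * dd h b (?p t))) integrable_on {0..1}"
        by (intro integrable_sum finite_Basis 2)
      have 4: "integral {0..1} (\<lambda>t. \<Sum>b\<in>Basis. ((x - a) \<bullet> b) * (t * dd h b (?p t))) =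
          (\<Sum>b\<in>Basis. integral {0..1} (\<lambda>t. ((x - a) \<bullet> b) * (t * dd h b (?p t))))"
        by (rule integral_sum) (simp_all add: 2)
      show ?thesis unfolding integral_add[OF 1 3] 4 by simp
    qed
  qed
  finally show ?thesis .
qed

text \<open>The homotopy formula behind the Poincare lemma, for the 1-form with components \<open>\<beta>\<close>.\<close>

lemma homotopy_formula:
  fixes a :: "'e::euclidean_space"
  assumes \<beta>: "\<And>b. b \<in> Basis \<Longrightarrow> Cinf_on (\<beta> b) (ball a r)" and c: "c \<in> Basis" and x: "x \<in> ball a r"
  shows "dd (\<lambda>x. k + (\<Sum>b\<in>Basis. ((x - a) \<bullet> b) * ray_integral 0 a (\<beta> b) x)) c x =
    \<beta> c x + (\<Sum>b\<in>Basis. ((x - a) \<bullet> b) * ray_integral 1 a (\<lambda>y. dd (\<beta> b) c y - dd (\<beta> c) b y) x)"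
proof -
  have D: "(ray_integral 0 a (\<beta> b) has_derivative (\<lambda>v. ray_integral 1 a (\<lambda>y. dd (\<beta> b) v y) x)) (at x)" if "b \<in> Basis" for b
    using ray_integral_has_derivative[OF _ x, of "\<beta> b" 0] \<beta>[OF that] by (simp only: Cinf_on_def One_nat_def)
  have "((\<lambda>x. k + (\<Sum>b\<in>Basis. ((x - a) \<bullet> b) * ray_integral 0 a (\<beta> b) x)) has_derivative
    (\<lambda>v. \<Sum>b\<in>Basis. ((x - a) \<bullet> b) * ray_integral 1 a (\<lambda>y. dd (\<beta> b) v y) x + (v \<bullet> b) * ray_integral 0 a (\<beta> b) x)) (at x)"
  proof -
    have inn: "((\<lambda>x. (x - a) \<bullet> b) has_derivative (\<lambda>v. v \<bullet> b)) (at x)" for b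
      by (auto intro!: derivative_eq_intros)
    have "((\<lambda>x. k + (\<Sum>b\<in>Basis. ((x - a) \<bullet> b) * ray_integral 0 a (\<beta> b) x)) has_derivative
      (\<lambda>v. 0 + (\<Sum>b\<in>Basis. ((x - a) \<bullet> b) * ray_integral 1 a (\<lambda>y. dd (\<beta> b) v y) x + (v \<bullet> b) * ray_integral 0 a (\<beta> b) x))) (at x)"
      by (intro has_derivative_add has_derivative_const has_derivative_sum has_derivative_mult inn D)
    then show ?thesis by simp
  qed
  from fun_cong[OF frechet_derivative_at[OF this, symmetric], of c]
  have "dd (\<lambda>x. k + (\<Sum>b\<in>Basis. ((x - a) \<bullet> b) * ray_integral 0 a (\<beta> b) x)) c x =
    (\<Sum>b\<in>Basis. ((x - a) \<bullet> b) * ray_integral 1 a (\<lambda>y. dd (\<beta> b) c y) x + (c \<bullet> b) * ray_integral 0 a (\<beta> b) x)" .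
  also have "\<dots> = (\<Sum>b\<in>Basis. ((x - a) \<bullet> b) * ray_integral 1 a (\<lambda>y. dd (\<beta> b) c y) x) + ray_integral 0 a (\<beta> c) x"
  proof -
    have "(\<Sum>b\<in>Basis. (c \<bullet> b) * ray_integral 0 a (\<beta> b) x) = (\<Sum>b\<in>Basis. if b = c then ray_integral 0 a (\<beta> b) x else 0)"
      by (rule sum.cong) (use c in \<open>auto simp: inner_Basis\<close>)
    then show ?thesis using c by (simp add: sum.distrib sum.delta)
  qed
  also have "ray_integral 0 a (\<beta> c) x = \<beta> c x - (\<Sum>b\<in>Basis. ((x - a) \<bullet> b) * ray_integral 1 a (\<lambda>y. dd (\<beta> c) b y) x)"
    using ray_identity[OF \<beta>[OF c] x] by simp
  finally show ?thesis
    using ray_integral_diff[OF Cinf_on_imp_continuous[OF Cinf_on_deriv[OF \<beta>]] Cinf_on_imp_continuous[OF Cinf_on_deriv[OF \<beta>[OF c]]] x, of _ 1]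
    by (simp add: sum_subtractf[symmetric] right_diff_distrib[symmetric])
qed

text \<open>Coefficients of the system in which the derivative of \<open>u j\<close> along
  \<open>b\<close> is the sum of \<open>A b j k * u k\<close> over \<open>k\<close>. The condition
  \<open>flat\<close> is the symmetry of second derivatives of solutions, that is, zero curvature of
  the connection with matrix \<open>- A\<close>.\<close>

locale flat_system =
  fixes A :: "'e::euclidean_space \<Rightarrow> 'n::finite \<Rightarrow> 'n \<Rightarrow> 'e \<Rightarrow> real" and a :: 'e and r :: real
  assumes r: "r > 0" and smooth: "\<And>b j k. b \<in> Basis \<Longrightarrow> Cinf_on (A b j k) (ball a r)"
    and flat: "\<And>x b c j k. x \<in> ball a r \<Longrightarrow> b \<in> Basis \<Longrightarrow> c \<in> Basis \<Longrightarrow>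
      dd (A b j k) c x - dd (A c j k) b x = (\<Sum>l\<in>UNIV. A c j l x * A b l k x - A b j l x * A c l k x)"
begin

text \<open>Picard iteration in all directions at once: the summand is the Poincare primitive, by
  integration along rays from \<open>a\<close>, of the 1-form obtained by inserting the previous
  iterate.\<close>

primrec picard :: "('n \<Rightarrow> real) \<Rightarrow> nat \<Rightarrow> 'n \<Rightarrow> 'e \<Rightarrow> real" where
  "picard w 0 = (\<lambda>j x. w j)"
| "picard w (Suc n) = (\<lambda>j x. w j +
     (\<Sum>b\<in>Basis. ((x - a) \<bullet> b) * ray_integral 0 a (\<lambda>y. \<Sum>k\<in>UNIV. A b j k y * picard w n k y) x))"

lemma picard_smooth: "Cinf_on (picard w n j) (ball a r)"
proof (induction n arbitrary: j)
  case (Suc n)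
  have "Cinf_on (\<lambda>x. (x - a) \<bullet> b) (ball a r)" for b
    unfolding inner_diff_left by (intro Cinf_on_diff) auto
  then show ?case
    by (auto intro!: Cinf_on_add Cinf_on_sum Cinf_on_mult Cinf_on_ray_integral smooth Suc)
qed auto

text \<open>The 1-form that is integrated need not be closed for an iterate, so its primitive misses
  the system; this is the amount.\<close>

definition "defect w n c j x = dd (picard w n j) c x - (\<Sum>k\<in>UNIV. A c j k x * picard w n k x)"

lemma defect_continuous: "c \<in> Basis \<Longrightarrow> continuous_on (ball a r) (defect w n c j)"
  unfolding defect_def[abs_def]
  by (intro Cinf_on_imp_continuous Cinf_on_diff Cinf_on_deriv Cinf_on_sum Cinf_on_mult picard_smooth smooth) auto

text \<open>By the homotopy formula the new defect consists of the last increment and of a ray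
  integral of the exterior derivative of the integrated form. Flatness cancels all terms without
  derivatives there, which makes that derivative linear in the old defect.\<close>

lemma defect_Suc:
  assumes c: "c \<in> Basis" and x: "x \<in> ball a r"
  shows "defect w (Suc n) c j x = (\<Sum>k\<in>UNIV. A c j k x * (picard w n k x - picard w (Suc n) k x)) +
    (\<Sum>b\<in>Basis. ((x - a) \<bullet> b) * ray_integral 1 a
       (\<lambda>y. \<Sum>k\<in>UNIV. A b j k y * defect w n c k y - A c j k y * defect w n b k y) x)"
proof -
  let ?u = "picard w n"
  let ?\<beta> = "\<lambda>b y. \<Sum>k\<in>UNIV. A b j k y * ?u k y"
  have \<beta>: "Cinf_on (?\<beta> b) (ball a r)" if "b \<in> Basis" for b
    by (intro Cinf_on_sum Cinf_on_mult picard_smooth smooth that) auto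
  have dA: "(A b j k has_derivative frechet_derivative (A b j k) (at y)) (at y)"
    and du: "(?u k has_derivative frechet_derivative (?u k) (at y)) (at y)" if "b \<in> Basis" "y \<in> ball a r" for b j k y
    using Cinf_on_has_derivative[OF smooth[OF that(1)] that(2)] Cinf_on_has_derivative[OF picard_smooth that(2)] by auto
  have d\<beta>: "dd (?\<beta> b) v y = (\<Sum>k\<in>UNIV. A b j k y * dd (?u k) v y + dd (A b j k) v y * ?u k y)"
    if b: "b \<in> Basis" and y: "y \<in> ball a r" for b v y
  proof -
    have "(?\<beta> b has_derivative (\<lambda>v. \<Sum>k\<in>UNIV. A b j k y * dd (?u k) v y + dd (A b j k) v y * ?u k y)) (at y)"
      by (intro has_derivative_sum has_derivative_mult dA[OF b y] du[OF b y])
    from fun_cong[OF frechet_derivative_at[OF this, symmetric], of v] show ?thesis .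
  qed
  have key: "dd (?\<beta> b) c y - dd (?\<beta> c) b y =
      (\<Sum>k\<in>UNIV. A b j k y * defect w n c k y - A c j k y * defect w n b k y)"
    if b: "b \<in> Basis" and y: "y \<in> ball a r" for b y
  proof -
    have "dd (?\<beta> b) c y - dd (?\<beta> c) b y = (\<Sum>k\<in>UNIV. A b j k y * dd (?u k) c y - A c j k y * dd (?u k) b y +
        (dd (A b j k) c y - dd (A c j k) b y) * ?u k y)"
      by (simp add: d\<beta>[OF b y] d\<beta>[OF c y] sum_subtractf[symmetric] algebra_simps)
    also have "\<dots> = (\<Sum>k\<in>UNIV. A b j k y * dd (?u k) c y - A c j k y * dd (?u k) b y) +
        (\<Sum>k\<in>UNIV. \<Sum>l\<in>UNIV. (A c j l y * A b l k y - A b j l y * A c l k y) * ?u k y)"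
      by (simp add: flat[OF y b c] sum.distrib sum_distrib_right)
    also have "(\<Sum>k\<in>UNIV. \<Sum>l\<in>UNIV. (A c j l y * A b l k y - A b j l y * A c l k y) * ?u k y) =
        (\<Sum>k\<in>UNIV. \<Sum>l\<in>UNIV. (A c j k y * A b k l y - A b j k y * A c k l y) * ?u l y)"
      by (rule sum.swap)
    finally show ?thesis
      by (simp add: defect_def sum.distrib sum_distrib_left sum_subtractf algebra_simps)
  qed
  have "defect w (Suc n) c j x = ?\<beta> c x + (\<Sum>b\<in>Basis. ((x - a) \<bullet> b) * ray_integral 1 a (\<lambda>y. dd (?\<beta> b) c y - dd (?\<beta> c) b y) x)
      - (\<Sum>k\<in>UNIV. A c j k x * picard w (Suc n) k x)"
    unfolding defect_def using homotopy_formula[of ?\<beta>, OF \<beta> c x, of "w j"] by simp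
  also have "(\<Sum>b\<in>Basis. ((x - a) \<bullet> b) * ray_integral 1 a (\<lambda>y. dd (?\<beta> b) c y - dd (?\<beta> c) b y) x) =
     (\<Sum>b\<in>Basis. ((x - a) \<bullet> b) * ray_integral 1 a
       (\<lambda>y. \<Sum>k\<in>UNIV. A b j k y * defect w n c k y - A c j k y * defect w n b k y) x)"
    using ray_integral_cong[OF x key] by simp
  finally show ?thesis by (simp add: right_diff_distrib sum_subtractf)
qed

lemma bounded_coeffs:
  obtains C where "C > 0" "\<And>b j k x. b \<in> Basis \<Longrightarrow> x \<in> ball a (r / 2) \<Longrightarrow> \<bar>A b j k x\<bar> \<le> C"
proof -
  have sub: "cball a (r / 2) \<subseteq> ball a r" using r by auto
  have "\<exists>C. \<forall>x\<in>cball a (r / 2). \<bar>A b j k x\<bar> \<le> C" if "b \<in> Basis" for b j k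
  proof -
    have "bounded (A b j k ` cball a (r / 2))"
      by (intro compact_imp_bounded compact_continuous_image
          continuous_on_subset[OF Cinf_on_imp_continuous[OF smooth[OF that]] sub]) simp
    then show ?thesis unfolding bounded_iff by auto
  qed
  then obtain f where f: "\<And>b j k x. b \<in> Basis \<Longrightarrow> x \<in> cball a (r / 2) \<Longrightarrow> \<bar>A b j k x\<bar> \<le> f b j k" by metis
  define C where "C = 1 + (\<Sum>b\<in>Basis. \<Sum>j\<in>UNIV. \<Sum>k\<in>UNIV. \<bar>f b j k\<bar>)"
  show thesis
  proof
    show "C > 0" unfolding C_def by (intro add_pos_nonneg sum_nonneg) auto
    fix b :: 'e and j k x assume b: "b \<in> Basis" and x: "x \<in> ball a (r / 2)"
    have "\<bar>f b j k\<bar> \<le> (\<Sum>k\<in>UNIV. \<bar>f b j k\<bar>)" by (rule member_le_sum) auto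
    also have "\<dots> \<le> (\<Sum>j\<in>UNIV. \<Sum>k\<in>UNIV. \<bar>f b j k\<bar>)"
      by (rule member_le_sum[of j UNIV "\<lambda>j. \<Sum>k\<in>UNIV. \<bar>f b j k\<bar>"]) (auto intro: sum_nonneg)
    also have "\<dots> \<le> (\<Sum>b\<in>Basis. \<Sum>j\<in>UNIV. \<Sum>k\<in>UNIV. \<bar>f b j k\<bar>)"
      by (rule member_le_sum[of b Basis "\<lambda>b. \<Sum>j\<in>UNIV. \<Sum>k\<in>UNIV. \<bar>f b j k\<bar>"]) (use b in \<open>auto intro!: sum_nonneg\<close>)
    finally show "\<bar>A b j k x\<bar> \<le> C" using f[OF b, of x j k] x by (simp add: C_def)
  qed
qed

lemma abs_sum_le_card:
  "finite I \<Longrightarrow> (\<And>i. i \<in> I \<Longrightarrow> \<bar>h i\<bar> \<le> (K::real)) \<Longrightarrow> \<bar>\<Sum>i\<in>I. h i\<bar> \<le> real (card I) * K"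
  using sum_norm_bound[of I h K] by simp

text \<open>The radius is independent of the initial value, as the system is linear. This is needed
  to superpose fundamental solutions on one ball.\<close>

lemma solution_exists:
  "\<exists>\<rho>>0. \<rho> \<le> r \<and> (\<forall>w. \<exists>u. (\<forall>j. Cinf_on (u j) (ball a \<rho>)) \<and> (\<forall>j. u j a = w j) \<and>
     (\<forall>j. \<forall>x\<in>ball a \<rho>. (u j has_derivative (\<lambda>v. \<Sum>b\<in>Basis. (v \<bullet> b) * (\<Sum>k\<in>UNIV. A b j k x * u k x))) (at x)))"
proof -
  obtain C where C: "C > 0" "\<And>b j k x. b \<in> Basis \<Longrightarrow> x \<in> ball a (r / 2) \<Longrightarrow> \<bar>A b j k x\<bar> \<le> C"
    by (rule bounded_coeffs) blast
  define N where "N = real CARD('n)"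
  define d where "d = real DIM('e)"
  have Nd: "N \<ge> 1" "d \<ge> 1" using DIM_positive[where 'a='e] by (auto simp: N_def d_def Suc_le_eq)
  \<comment> \<open>With this radius one integration step multiplies the sup norm by at most 1/8.
    The slack is for the defect, whose recursion has two terms of this kind and a share of the last
    increment, and which is shown to decay like \<open>(1/2) ^ n\<close>.\<close>
  define \<rho> where "\<rho> = min (r / 2) (1 / (8 * (d * (N * C))))"
  have NC: "N * C > 0" "d * (N * C) > 0" using Nd C by auto
  have \<rho>: "\<rho> > 0" "\<rho> \<le> r / 2" "\<rho> \<le> r" using r NC by (auto simp: \<rho>_def)
  have "\<rho> * (8 * (d * (N * C))) \<le> 1"
    using NC by (subst pos_le_divide_eq[symmetric]) (auto simp: \<rho>_def)
  then have q: "d * (\<rho> * (N * C)) \<le> 1 / 8" by (simp add: algebra_simps)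
  let ?B = "ball a \<rho>"
  have Br: "?B \<subseteq> ball a r" and Br2: "?B \<subseteq> ball a (r / 2)" using \<rho> by auto
  have ABd: "\<bar>A b j k x\<bar> \<le> C" if "b \<in> Basis" "x \<in> ?B" for b j k x using C(2) that Br2 by blast
  have xa: "\<bar>(x - a) \<bullet> b\<bar> \<le> \<rho>" if "b \<in> Basis" "x \<in> ?B" for b x
    using Basis_le_norm[OF that(1), of "x - a"] that(2) by (simp add: dist_norm norm_minus_commute)
  have rad: "\<bar>\<Sum>b\<in>Basis. ((x - a) \<bullet> b) * ray_integral m a (h b) x\<bar> \<le> d * (\<rho> * K)"
    if "x \<in> ?B" "\<And>b. b \<in> Basis \<Longrightarrow> continuous_on ?B (h b)" "\<And>b y. b \<in> Basis \<Longrightarrow> y \<in> ?B \<Longrightarrow> \<bar>h b y\<bar> \<le> K" for x h m K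
    unfolding d_def
  proof (rule abs_sum_le_card)
    fix b :: 'e assume b: "b \<in> Basis"
    have "\<bar>ray_integral m a (h b) x\<bar> \<le> K" by (rule ray_integral_bound[OF that(2)[OF b] that(1) that(3)[OF b]])
    then show "\<bar>((x - a) \<bullet> b) * ray_integral m a (h b) x\<bar> \<le> \<rho> * K"
      unfolding abs_mult using xa[OF b that(1)] \<rho>(1) by (intro mult_mono) auto
  qed simp
  have mv: "\<bar>\<Sum>k\<in>UNIV. A b j k y * h k\<bar> \<le> N * C * K" if "b \<in> Basis" "y \<in> ?B" "\<And>k. \<bar>h k\<bar> \<le> K" for b j y h K
  proof -
    have "\<bar>A b j k y * h k\<bar> \<le> C * K" for k unfolding abs_mult
      by (rule mult_mono) (use ABd[OF that(1,2)] that(3) C(1) in auto)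
    then have "\<bar>\<Sum>k\<in>UNIV. A b j k y * h k\<bar> \<le> real (card (UNIV :: 'n set)) * (C * K)" by (intro abs_sum_le_card) auto
    then show ?thesis by (simp add: N_def mult.assoc)
  qed
  have cA: "continuous_on ?B (A b j k)" if "b \<in> Basis" for b j k
    using continuous_on_subset[OF Cinf_on_imp_continuous[OF smooth[OF that]] Br] .
  show ?thesis
  proof (intro exI[of _ \<rho>] conjI allI \<rho>)
    fix w :: "'n \<Rightarrow> real"
    let ?u = "picard w"
    define M where "M = 1 + (\<Sum>j\<in>UNIV. \<bar>w j\<bar>)"
    have M: "M > 0" "\<And>j. \<bar>w j\<bar> \<le> M"
    proof -
      show "M > 0" unfolding M_def by (intro add_pos_nonneg sum_nonneg) auto
      show "\<bar>w j\<bar> \<le> M" for j using member_le_sum[of j UNIV "\<lambda>j. \<bar>w j\<bar>"] by (simp add: M_def)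
    qed
    have cu: "continuous_on ?B (?u n k)" for n k
      using continuous_on_subset[OF Cinf_on_imp_continuous[OF picard_smooth] Br] .
    have step: "\<bar>?u (Suc n) j x - ?u n j x\<bar> \<le> M * (1 / 8) ^ n" if "x \<in> ?B" for n j x
      using that
    proof (induction n arbitrary: j x)
      case 0
      have "\<bar>\<Sum>b\<in>Basis. ((x - a) \<bullet> b) * ray_integral 0 a (\<lambda>y. \<Sum>k\<in>UNIV. A b j k y * ?u 0 k y) x\<bar> \<le> d * (\<rho> * (N * C * M))"
        by (rule rad[OF 0]) (use mv M in \<open>auto intro!: continuous_on_sum continuous_on_mult cA\<close>)
      also have "\<dots> = (d * (\<rho> * (N * C))) * M" by simp
      also have "\<dots> \<le> 1 * M" using q M(1) by (intro mult_right_mono) auto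
      finally show ?case by simp
    next
      case (Suc n)
      have "?u (Suc (Suc n)) j x - ?u (Suc n) j x =
         (\<Sum>b\<in>Basis. ((x - a) \<bullet> b) * ray_integral 0 a (\<lambda>y. \<Sum>k\<in>UNIV. A b j k y * (?u (Suc n) k y - ?u n k y)) x)"
      proof -
        have "ray_integral 0 a (\<lambda>y. \<Sum>k\<in>UNIV. A b j k y * ?u (Suc n) k y) x - ray_integral 0 a (\<lambda>y. \<Sum>k\<in>UNIV. A b j k y * ?u n k y) x =
          ray_integral 0 a (\<lambda>y. \<Sum>k\<in>UNIV. A b j k y * (?u (Suc n) k y - ?u n k y)) x" if b: "b \<in> Basis" for b
          by (subst ray_integral_diff[OF _ _ Suc.prems])
            (auto intro!: continuous_on_sum continuous_on_mult cA[OF b] cu simp: sum_subtractf right_diff_distrib simp del: picard.simps)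
        then show ?thesis
          by (simp add: sum_subtractf[symmetric] right_diff_distrib[symmetric] del: picard.simps(1))
      qed
      also have "\<bar>\<dots>\<bar> \<le> d * (\<rho> * (N * C * (M * (1/8) ^ n)))"
        by (rule rad[OF Suc.prems])
          (use mv Suc.IH in \<open>auto intro!: continuous_on_sum continuous_on_mult continuous_on_diff cA cu simp del: picard.simps\<close>)
      also have "\<dots> = (d * (\<rho> * (N * C))) * (M * (1/8) ^ n)" by simp
      also have "\<dots> \<le> (1 / 8) * (M * (1/8) ^ n)" using q M(1) by (intro mult_right_mono) auto
      finally show ?case by simp
    qed
    have far: "\<bar>?u (n + m) j x - ?u n j x\<bar> \<le> 2 * M * ((1/8) ^ n - (1/8) ^ (n + m))" if "x \<in> ?B" for n m j x
    proof (induction m)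
      case (Suc m)
      have "2 * M * (1/8) ^ (n + m) - 2 * M * (1/8) ^ (n + Suc m) \<ge> M * (1/8) ^ (n + m)" using M(1) by simp
      then show ?case using Suc step[OF that, of "n + m" j] by (simp add: algebra_simps del: picard.simps)
    qed simp
    have tail: "\<bar>?u (n + m) j x - ?u n j x\<bar> \<le> 2 * M * (1/8) ^ n" if "x \<in> ?B" for n m j x
    proof -
      have "0 \<le> 2 * M * (1/8) ^ (n + m)" using M by simp
      then show ?thesis using far[OF that, of n m j] by (simp add: algebra_simps del: picard.simps)
    qed
    define U where "U j x = lim (\<lambda>n. ?u n j x)" for j x
    have U: "(\<lambda>n. ?u n j x) \<longlonglongrightarrow> U j x" if x: "x \<in> ?B" for j x
    proof -
      have "Cauchy (\<lambda>n. ?u n j x)"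
      proof (rule metric_CauchyI)
        fix e :: real assume e: "e > 0"
        have "(\<lambda>n. 2 * M * (1/8) ^ n) \<longlonglongrightarrow> 2 * M * 0" by (intro tendsto_intros LIMSEQ_power_zero) auto
        then have "\<forall>\<^sub>F n in sequentially. 2 * M * (1/8) ^ n < e / 2" using e by (intro order_tendstoD) auto
        then obtain n0 where n0: "2 * M * (1/8) ^ n0 < e / 2" by (auto simp: eventually_sequentially)
        have n1: "\<bar>?u m j x - ?u n0 j x\<bar> < e / 2" if "m \<ge> n0" for m
          using tail[OF x, of n0 "m - n0" j] that n0 by simp
        show "\<exists>M. \<forall>m\<ge>M. \<forall>n\<ge>M. dist (?u m j x) (?u n j x) < e"
        proof (intro exI[of _ n0] allI impI)
          fix m n assume "m \<ge> n0" "n \<ge> n0"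
          then show "dist (?u m j x) (?u n j x) < e" using n1[of m] n1[of n] unfolding dist_real_def by linarith
        qed
      qed
      then show ?thesis unfolding U_def Cauchy_convergent_iff convergent_LIMSEQ_iff .
    qed
    have Ubd: "\<bar>U j x - ?u n j x\<bar> \<le> 2 * M * (1/8) ^ n" if x: "x \<in> ?B" for j x n
    proof -
      have "(\<lambda>m. \<bar>?u (n + m) j x - ?u n j x\<bar>) \<longlonglongrightarrow> \<bar>U j x - ?u n j x\<bar>"
        using LIMSEQ_ignore_initial_segment[OF U[OF x], of n] by (intro tendsto_intros) (simp add: add.commute)
      then show ?thesis by (rule Lim_bounded) (use tail[OF x] in auto)
    qed
    \<comment> \<open>The factor 4 makes the contribution of the last increment at most a quarter of
      the bound; the ray integral contributes another quarter, which together is half of the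
      bound.\<close>
    define K where "K = 4 * (N * C * M)"
    have K: "K > 0" using NC M by (simp add: K_def)
    have z: "\<bar>defect w n c j x\<bar> \<le> K * (1/2) ^ n" if "c \<in> Basis" "x \<in> ?B" for n c j x
      using that
    proof (induction n arbitrary: c j x)
      case 0
      have "frechet_derivative (\<lambda>x::'e. w j) (at x) c = 0"
        using frechet_derivative_at[OF has_derivative_const[of "w j" "at x"]] by metis
      then have "defect w 0 c j x = - (\<Sum>k\<in>UNIV. A c j k x * w k)" by (simp add: defect_def)
      then show ?case using mv[OF 0(1,2), of w M j] M(2) NC M(1) by (simp add: K_def)
    next
      case (Suc n)
      have xr: "x \<in> ball a r" using Suc.prems Br by blast
      have cz: "continuous_on ?B (defect w n b k)" if "b \<in> Basis" for b k
        using continuous_on_subset[OF defect_continuous[OF that] Br] .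
      have 1: "\<bar>\<Sum>k\<in>UNIV. A c j k x * (?u n k x - ?u (Suc n) k x)\<bar> \<le> N * C * (M * (1/8) ^ n)"
        by (rule mv[OF Suc.prems]) (use step[OF Suc.prems(2)] abs_minus_commute in metis)
      have 2: "\<bar>\<Sum>b\<in>Basis. ((x - a) \<bullet> b) * ray_integral 1 a
         (\<lambda>y. \<Sum>k\<in>UNIV. A b j k y * defect w n c k y - A c j k y * defect w n b k y) x\<bar> \<le> d * (\<rho> * (2 * (N * C * (K * (1/2) ^ n))))"
      proof (rule rad[OF Suc.prems(2)])
        fix b :: 'e assume b: "b \<in> Basis"
        show "continuous_on ?B (\<lambda>y. \<Sum>k\<in>UNIV. A b j k y * defect w n c k y - A c j k y * defect w n b k y)"
          by (intro continuous_on_sum continuous_on_diff continuous_on_mult cA cz b Suc.prems)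
        fix y assume y: "y \<in> ?B"
        show "\<bar>\<Sum>k\<in>UNIV. A b j k y * defect w n c k y - A c j k y * defect w n b k y\<bar> \<le> 2 * (N * C * (K * (1/2) ^ n))"
          using mv[OF b y, of "\<lambda>k. defect w n c k y" "K * (1/2) ^ n" j] mv[OF Suc.prems(1) y, of "\<lambda>k. defect w n b k y" "K * (1/2) ^ n" j]
            Suc.IH[OF Suc.prems(1) y] Suc.IH[OF b y] by (simp add: sum_subtractf)
      qed
      have "d * (\<rho> * (2 * (N * C * (K * (1/2) ^ n)))) = (d * (\<rho> * (N * C))) * (2 * K * (1/2) ^ n)" by simp
      also have "\<dots> \<le> (1/8) * (2 * K * (1/2) ^ n)" using q K by (intro mult_right_mono) auto
      finally have 3: "d * (\<rho> * (2 * (N * C * (K * (1/2) ^ n)))) \<le> K * (1/2) ^ n / 4" by simp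
      have "(1/8::real) ^ n \<le> (1/2) ^ n" by (rule power_mono) auto
      then have 4: "N * C * (M * (1/8) ^ n) \<le> K * (1/2) ^ n / 4"
      proof -
        have "N * C * M * (1/8) ^ n \<le> N * C * M * (1/2) ^ n"
          using \<open>(1/8::real) ^ n \<le> (1/2) ^ n\<close> NC M(1) by (intro mult_left_mono) auto
        then show ?thesis by (simp add: K_def mult.assoc)
      qed
      have 5: "K * (1/2) ^ n / 4 + K * (1/2) ^ n / 4 = K * (1/2) ^ Suc n" by simp
      show ?case unfolding defect_Suc[OF Suc.prems(1) xr]
        by (rule order_trans[OF abs_triangle_ineq]) (use 1 2 3 4 5 in linarith)
    qed
    define U' where "U' j x v = (\<Sum>b\<in>Basis. (v \<bullet> b) * (\<Sum>k\<in>UNIV. A b j k x * U k x))" for j x v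
    have DU: "(U j has_derivative U' j x) (at x)" if x: "x \<in> ?B" for j x
    proof -
      have fd: "(?u n j has_derivative (\<lambda>v. \<Sum>b\<in>Basis. (v \<bullet> b) * dd (?u n j) b x)) (at x within ?B)" if "x \<in> ?B" for n x
      proof -
        have xr: "x \<in> ball a r" using that Br by blast
        have "frechet_derivative (?u n j) (at x) = (\<lambda>v. \<Sum>b\<in>Basis. (v \<bullet> b) * dd (?u n j) b x)"
          using Cinf_on_dir[OF picard_smooth xr] by blast
        then show ?thesis using Cinf_on_has_derivative[OF picard_smooth[of w n j] xr] has_derivative_at_withinI by metis
      qed
      have key: "\<bar>(\<Sum>b\<in>Basis. (v \<bullet> b) * dd (?u n j) b x) - U' j x v\<bar> \<le> d * (K + N * C * (2 * M)) * (1/2) ^ n * norm v"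
        if x: "x \<in> ?B" for n x v
      proof -
        have e: "defect w n b j x + (\<Sum>k\<in>UNIV. A b j k x * (?u n k x - U k x)) =
            dd (?u n j) b x - (\<Sum>k\<in>UNIV. A b j k x * U k x)" for b
          by (simp add: defect_def right_diff_distrib sum_subtractf)
        have "(\<Sum>b\<in>Basis. (v \<bullet> b) * dd (?u n j) b x) - U' j x v = (\<Sum>b\<in>Basis. (v \<bullet> b) *
            (defect w n b j x + (\<Sum>k\<in>UNIV. A b j k x * (?u n k x - U k x))))"
          unfolding e by (simp add: U'_def right_diff_distrib sum_subtractf)
        also have "\<bar>\<dots>\<bar> \<le> d * (norm v * ((K + N * C * (2 * M)) * (1/2) ^ n))"
          unfolding d_def
        proof (rule abs_sum_le_card)
          fix b :: 'e assume b: "b \<in> Basis"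
          have "\<bar>\<Sum>k\<in>UNIV. A b j k x * (?u n k x - U k x)\<bar> \<le> N * C * (2 * M * (1/8) ^ n)"
            by (rule mv[OF b x]) (use Ubd[OF x] abs_minus_commute in metis)
          also have "\<dots> \<le> N * C * (2 * M * (1/2) ^ n)"
            using NC M(1) by (intro mult_left_mono power_mono) auto
          finally have "\<bar>defect w n b j x + (\<Sum>k\<in>UNIV. A b j k x * (?u n k x - U k x))\<bar> \<le> (K + N * C * (2 * M)) * (1/2) ^ n"
            using z[OF b x, of n j] by (simp add: algebra_simps)
          then show "\<bar>(v \<bullet> b) * (defect w n b j x + (\<Sum>k\<in>UNIV. A b j k x * (?u n k x - U k x)))\<bar> \<le>
              norm v * ((K + N * C * (2 * M)) * (1/2) ^ n)"
            unfolding abs_mult using Basis_le_norm[OF b, of v] by (intro mult_mono) auto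
        qed simp
        finally show ?thesis by (simp add: mult_ac)
      qed
      \<comment> \<open>The derivatives of the iterates converge uniformly to \<open>U'\<close>: the
        defects tend to 0 and the iterates converge uniformly. Hence the limit is differentiable and
        solves the system.\<close>
      have "\<exists>G. \<forall>x\<in>?B. (\<lambda>n. ?u n j x) \<longlonglongrightarrow> G x \<and> (G has_derivative U' j x) (at x within ?B)"
      proof (rule has_derivative_sequence[OF convex_ball fd _ x U[OF x]])
        fix e :: real assume e: "e > 0"
        have "(\<lambda>n. d * (K + N * C * (2 * M)) * (1/2) ^ n) \<longlonglongrightarrow> d * (K + N * C * (2 * M)) * 0"
          by (intro tendsto_intros LIMSEQ_power_zero) auto
        then have "\<forall>\<^sub>F n in sequentially. d * (K + N * C * (2 * M)) * (1/2) ^ n < e" using e by (intro order_tendstoD) auto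
        then show "\<forall>\<^sub>F n in sequentially. \<forall>x\<in>?B. \<forall>h. norm ((\<Sum>b\<in>Basis. (h \<bullet> b) * dd (?u n j) b x) - U' j x h) \<le> e * norm h"
        proof (rule eventually_mono)
          fix n assume n: "d * (K + N * C * (2 * M)) * (1/2) ^ n < e"
          then show "\<forall>x\<in>?B. \<forall>h. norm ((\<Sum>b\<in>Basis. (h \<bullet> b) * dd (?u n j) b x) - U' j x h) \<le> e * norm h"
            using key[of _ _ n] by (smt (verit, ccfv_SIG) mult_right_mono norm_ge_zero real_norm_def)
        qed
      qed
      then obtain G where G: "\<And>x. x \<in> ?B \<Longrightarrow> (\<lambda>n. ?u n j x) \<longlonglongrightarrow> G x" "\<And>x. x \<in> ?B \<Longrightarrow> (G has_derivative U' j x) (at x within ?B)"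
        by blast
      have GU: "G y = U j y" if "y \<in> ?B" for y using LIMSEQ_unique[OF G(1)[OF that] U[OF that]] .
      have "(G has_derivative U' j x) (at x)" using G(2)[OF x] at_within_open[OF x open_ball] by simp
      then show ?thesis by (rule has_derivative_cong_open[OF _ open_ball x]) (rule GU)
    qed
    \<comment> \<open>Bootstrapping: the derivative of a solution is a combination of the solution
      with smooth coefficients, so each order of regularity yields the next.\<close>
    have Uk: "Ck_on k (U j) ?B" for k j
    proof (induction k arbitrary: j)
      case 0
      have "isCont (U j) x" if "x \<in> ?B" for x using has_derivative_continuous[OF DU[OF that, of j]] .
      then show ?case by (simp add: continuous_on_eq_continuous_at del: mem_ball)
    next
      case (Suc k)
      have Ck: "Ck_on k (A b j l) ?B" if "b \<in> Basis" for b j l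
        using Ck_on_subset[OF _ Br] smooth[OF that] unfolding Cinf_on_def by blast
      show ?case
        by (rule Ck_on_SucI[OF open_ball DU])
          (auto simp: U'_def intro!: Ck_on_sum Ck_on_mult Ck_on_const Ck Suc)
    qed
    have Ua: "U j a = w j" for j
    proof -
      have "?u n j a = w j" for n by (cases n) auto
      then have "(\<lambda>n. ?u n j a) = (\<lambda>n. w j)" by auto
      then show ?thesis using U[of a j] \<rho>(1) LIMSEQ_unique by (metis centre_in_ball tendsto_const)
    qed
    show "\<exists>u. (\<forall>j. Cinf_on (u j) ?B) \<and> (\<forall>j. u j a = w j) \<and>
     (\<forall>j. \<forall>x\<in>?B. (u j has_derivative (\<lambda>v. \<Sum>b\<in>Basis. (v \<bullet> b) * (\<Sum>k\<in>UNIV. A b j k x * u k x))) (at x))"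
      using Uk Ua DU unfolding U'_def Cinf_on_def by (intro exI[of _ U]) blast
  qed
qed

end

text \<open>Gronwall's argument for the squared length of the solution along a segment.\<close>

lemma linear_system_unique:
  fixes v :: "'n::finite \<Rightarrow> 'e::euclidean_space \<Rightarrow> real"
  assumes S: "convex S" and cA: "\<And>b j k. b \<in> Basis \<Longrightarrow> continuous_on S (A b j k)"
    and v: "\<And>j x. x \<in> S \<Longrightarrow> (v j has_derivative (\<lambda>h. \<Sum>b\<in>Basis. (h \<bullet> b) * (\<Sum>k\<in>UNIV. A b j k x * v k x))) (at x)"
    and p: "p \<in> S" "\<And>j. v j p = 0" and x: "x \<in> S"
  shows "v j x = 0"
proof -
  let ?p = "\<lambda>t. p + t *\<^sub>R (x - p)"
  have pS: "?p t \<in> S" if "t \<in> {0..1}" for t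
    using convexD_alt[OF S p(1) x, of t] that by (simp add: algebra_simps)
  define B where "B j k t = (\<Sum>b\<in>Basis. ((x - p) \<bullet> b) * A b j k (?p t))" for j k t
  have cB: "continuous_on {0..1} (B j k)" for j k
    unfolding B_def
    by (intro continuous_on_sum continuous_on_mult continuous_on_const continuous_on_compose2[OF cA])
      (auto intro!: continuous_intros pS)
  have "\<exists>K. \<forall>t\<in>{0..1}. \<bar>B j k t\<bar> \<le> K" for j k
    using compact_imp_bounded[OF compact_continuous_image[OF cB compact_Icc]] unfolding bounded_iff by auto
  then obtain f where f: "\<And>j k t. t \<in> {0..1} \<Longrightarrow> \<bar>B j k t\<bar> \<le> f j k" by metis
  define L where "L = (\<Sum>j\<in>UNIV. \<Sum>k\<in>UNIV. \<bar>f j k\<bar>)"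
  define F where "F t = (\<Sum>j\<in>UNIV. v j (?p t) * v j (?p t))" for t
  have dv: "((\<lambda>t. v j (?p t)) has_real_derivative (\<Sum>k\<in>UNIV. B j k t * v k (?p t))) (at t)" if t: "t \<in> {0..1}" for j t
  proof -
    have "((\<lambda>t. v j (?p t)) has_derivative
      (\<lambda>s. \<Sum>b\<in>Basis. ((s *\<^sub>R (x - p)) \<bullet> b) * (\<Sum>k\<in>UNIV. A b j k (?p t) * v k (?p t)))) (at t)"
      by (rule has_derivative_compose[where f = ?p and f' = "\<lambda>s. s *\<^sub>R (x - p)" and s = UNIV,
            OF _ v[OF pS[OF t], of j]]) (auto intro!: derivative_eq_intros)
    moreover have "(\<Sum>b\<in>Basis. ((s *\<^sub>R (x - p)) \<bullet> b) * (\<Sum>k\<in>UNIV. A b j k (?p t) * v k (?p t))) =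
      (\<Sum>k\<in>UNIV. B j k t * v k (?p t)) * s" for s
      unfolding B_def sum_distrib_right sum_distrib_left by (subst sum.swap) (simp add: mult_ac)
    ultimately show ?thesis by (simp add: has_field_derivative_def)
  qed
  have dF: "(F has_real_derivative (\<Sum>j\<in>UNIV. 2 * v j (?p t) * (\<Sum>k\<in>UNIV. B j k t * v k (?p t)))) (at t)" if "t \<in> {0..1}" for t
    unfolding F_def by (auto intro!: derivative_eq_intros dv[OF that] sum.cong)
  have Fle: "\<bar>v j (?p t) * v k (?p t)\<bar> \<le> F t" for j k t
  proof -
    have "(v i (?p t))\<^sup>2 \<le> F t" for i
      unfolding F_def power2_eq_square by (rule member_le_sum) auto
    from this[of j] this[of k] show ?thesis
      using sum_squares_bound[of "\<bar>v j (?p t)\<bar>" "\<bar>v k (?p t)\<bar>"] by (simp add: abs_mult)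
  qed
  have bd: "(\<Sum>j\<in>UNIV. 2 * v j (?p t) * (\<Sum>k\<in>UNIV. B j k t * v k (?p t))) \<le> 2 * L * F t" if t: "t \<in> {0..1}" for t
  proof -
    have "(\<Sum>j\<in>UNIV. 2 * v j (?p t) * (\<Sum>k\<in>UNIV. B j k t * v k (?p t))) = (\<Sum>j\<in>UNIV. \<Sum>k\<in>UNIV. 2 * (B j k t * (v j (?p t) * v k (?p t))))"
      by (simp add: sum_distrib_left mult_ac)
    also have "\<dots> \<le> (\<Sum>j\<in>UNIV. \<Sum>k\<in>UNIV. 2 * (\<bar>f j k\<bar> * F t))"
    proof (intro sum_mono mult_left_mono)
      fix j k
      have "B j k t * (v j (?p t) * v k (?p t)) \<le> \<bar>B j k t\<bar> * \<bar>v j (?p t) * v k (?p t)\<bar>"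
        by (metis abs_ge_self abs_mult)
      also have "\<dots> \<le> \<bar>f j k\<bar> * F t" using f[OF t, of j k] Fle[of j t k] by (intro mult_mono) auto
      finally show "B j k t * (v j (?p t) * v k (?p t)) \<le> \<bar>f j k\<bar> * F t" .
    qed simp
    also have "\<dots> = 2 * L * F t" unfolding L_def sum_distrib_left sum_distrib_right by (simp add: mult_ac)
    finally show ?thesis .
  qed
  have "F 1 * exp (- (2 * L) * 1) \<le> F 0 * exp (- (2 * L) * 0)"
  proof (rule DERIV_nonpos_imp_nonincreasing[of 0 1 "\<lambda>t. F t * exp (- (2 * L) * t)"])
    fix t :: real assume t: "0 \<le> t" "t \<le> 1"
    let ?d = "(\<Sum>j\<in>UNIV. 2 * v j (?p t) * (\<Sum>k\<in>UNIV. B j k t * v k (?p t)))"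
    have "((\<lambda>t. F t * exp (- (2 * L) * t)) has_real_derivative ?d * exp (- (2 * L) * t) + (exp (- (2 * L) * t) * (- (2 * L))) * F t) (at t)"
      by (rule DERIV_mult[OF dF]) (use t in \<open>auto intro!: derivative_eq_intros\<close>)
    also have "?d * exp (- (2 * L) * t) + (exp (- (2 * L) * t) * (- (2 * L))) * F t = (?d - 2 * L * F t) * exp (- (2 * L) * t)"
      by (simp add: algebra_simps)
    finally have "((\<lambda>t. F t * exp (- (2 * L) * t)) has_real_derivative (?d - 2 * L * F t) * exp (- (2 * L) * t)) (at t)" .
    moreover have "(?d - 2 * L * F t) * exp (- (2 * L) * t) \<le> 0" using bd[of t] t by (intro mult_nonpos_nonneg) auto
    ultimately show "\<exists>y. ((\<lambda>t. F t * exp (- (2 * L) * t)) has_real_derivative y) (at t) \<and> y \<le> 0" by blast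
  qed simp
  moreover have "F 0 = 0" using p(2) by (simp add: F_def)
  ultimately have "F 1 \<le> 0" by (simp add: mult_le_0_iff)
  then have "v j x * v j x \<le> 0" using Fle[of j 1 j] by simp
  then show ?thesis using zero_le_square[of "v j x"] by (metis antisym mult_eq_0_iff)
qed

context flat_system begin

text \<open>A local system needs prescribed values at every point, not only at the centre. The map
  from values at \<open>a\<close> to values at \<open>p\<close> is linear and, by uniqueness,
  injective, hence onto in finite dimension.\<close>

lemma solution_through:
  "\<exists>\<rho>>0. \<rho> \<le> r \<and> (\<forall>p\<in>ball a \<rho>. \<forall>w. \<exists>u. (\<forall>j. Cinf_on (u j) (ball a \<rho>)) \<and> (\<forall>j. u j p = w j) \<and>
     (\<forall>j. \<forall>x\<in>ball a \<rho>. (u j has_derivative (\<lambda>v. \<Sum>b\<in>Basis. (v \<bullet> b) * (\<Sum>k\<in>UNIV. A b j k x * u k x))) (at x)))"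
proof -
  obtain \<rho> where \<rho>: "\<rho> > 0" "\<rho> \<le> r" and ex: "\<And>w. \<exists>u. (\<forall>j. Cinf_on (u j) (ball a \<rho>)) \<and> (\<forall>j. u j a = w j) \<and>
     (\<forall>j. \<forall>x\<in>ball a \<rho>. (u j has_derivative (\<lambda>v. \<Sum>b\<in>Basis. (v \<bullet> b) * (\<Sum>k\<in>UNIV. A b j k x * u k x))) (at x))"
    using solution_exists by blast
  define \<Phi> where "\<Phi> = (\<lambda>i. SOME u. (\<forall>j. Cinf_on (u j) (ball a \<rho>)) \<and> (\<forall>j. u j a = (if j = i then 1 else 0)) \<and>
     (\<forall>j. \<forall>x\<in>ball a \<rho>. (u j has_derivative (\<lambda>v. \<Sum>b\<in>Basis. (v \<bullet> b) * (\<Sum>k\<in>UNIV. A b j k x * u k x))) (at x)))"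
  have \<Phi>: "Cinf_on (\<Phi> i j) (ball a \<rho>)" "\<Phi> i j a = (if j = i then 1 else 0)"
    "x \<in> ball a \<rho> \<Longrightarrow> (\<Phi> i j has_derivative (\<lambda>v. \<Sum>b\<in>Basis. (v \<bullet> b) * (\<Sum>k\<in>UNIV. A b j k x * \<Phi> i k x))) (at x)" for i j x
    using someI_ex[OF ex[of "\<lambda>j. if j = i then 1 else 0"]] unfolding \<Phi>_def by blast+
  define u where "u c j x = (\<Sum>i\<in>UNIV. c $ i * \<Phi> i j x)" for c :: "real^'n" and j x
  have u1: "Cinf_on (u c j) (ball a \<rho>)" for c j unfolding u_def[abs_def] using \<Phi>(1) by (intro Cinf_on_sum Cinf_on_mult) auto
  have u2: "(u c j has_derivative (\<lambda>v. \<Sum>b\<in>Basis. (v \<bullet> b) * (\<Sum>k\<in>UNIV. A b j k x * u c k x))) (at x)"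
    if x: "x \<in> ball a \<rho>" for c j x
  proof -
    have "(u c j has_derivative (\<lambda>v. \<Sum>i\<in>UNIV. c $ i * (\<Sum>b\<in>Basis. (v \<bullet> b) * (\<Sum>k\<in>UNIV. A b j k x * \<Phi> i k x)))) (at x)"
      unfolding u_def[abs_def] by (intro has_derivative_sum has_derivative_mult_right \<Phi>(3)[OF x])
    moreover have "(\<Sum>i\<in>UNIV. c $ i * (\<Sum>b\<in>Basis. (v \<bullet> b) * (\<Sum>k\<in>UNIV. A b j k x * \<Phi> i k x))) =
      (\<Sum>b\<in>Basis. (v \<bullet> b) * (\<Sum>k\<in>UNIV. A b j k x * u c k x))" for v
    proof -
      have "(\<Sum>i\<in>UNIV. c $ i * (\<Sum>b\<in>Basis. (v \<bullet> b) * (\<Sum>k\<in>UNIV. A b j k x * \<Phi> i k x))) =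
        (\<Sum>b\<in>Basis. \<Sum>i\<in>UNIV. c $ i * ((v \<bullet> b) * (\<Sum>k\<in>UNIV. A b j k x * \<Phi> i k x)))"
        unfolding sum_distrib_left[of "c $ _"] by (rule sum.swap)
      also have "\<dots> = (\<Sum>b\<in>Basis. (v \<bullet> b) * (\<Sum>i\<in>UNIV. \<Sum>k\<in>UNIV. A b j k x * (c $ i * \<Phi> i k x)))"
        by (simp add: sum_distrib_left mult_ac)
      also have "\<dots> = (\<Sum>b\<in>Basis. (v \<bullet> b) * (\<Sum>k\<in>UNIV. A b j k x * u c k x))"
        unfolding u_def sum_distrib_left[of "A _ _ _ _"] by (subst sum.swap) (rule refl)
      finally show ?thesis .
    qed
    ultimately show ?thesis by simp
  qed
  have ua: "u c j a = c $ j" for c j by (simp add: u_def \<Phi>(2) if_distrib[of "(*) _"] sum.delta' cong: if_cong)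
  show ?thesis
  proof (intro exI[of _ \<rho>] conjI ballI allI \<rho>)
    fix p and w :: "'n \<Rightarrow> real" assume p: "p \<in> ball a \<rho>"
    define L where "L c = (\<chi> j. u c j p)" for c
    have lin: "linear L"
      by (rule linearI) (auto simp: L_def u_def vec_eq_iff algebra_simps sum.distrib sum_distrib_left)
    have "inj L"
    proof (subst linear_injective_0[OF lin], intro allI impI)
      fix c assume "L c = 0"
      then have z: "u c j p = 0" for j by (simp add: L_def vec_eq_iff)
      have sub: "ball a \<rho> \<subseteq> ball a r" using \<rho>(2) by auto
      have "u c j a = 0" for j
      proof (rule linear_system_unique[where v = "u c" and A = A and p = p and S = "ball a \<rho>"])
        show "continuous_on (ball a \<rho>) (A b j k)" if "b \<in> Basis" for b j k
          using continuous_on_subset[OF Cinf_on_imp_continuous[OF smooth[OF that]] sub] .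
        show "(u c j has_derivative (\<lambda>v. \<Sum>b\<in>Basis. (v \<bullet> b) * (\<Sum>k\<in>UNIV. A b j k x * u c k x))) (at x)"
          if "x \<in> ball a \<rho>" for j x using u2[OF that] .
      qed (use \<rho> p z in auto)
      then show "c = 0" using ua by (simp add: vec_eq_iff)
    qed
    then have "surj L" using linear_injective_imp_surjective[OF lin] by blast
    then obtain c where "L c = (\<chi> j. w j)" by (metis surjD)
    then have "\<forall>j. u c j p = w j" by (simp add: L_def vec_eq_iff)
    then show "\<exists>u. (\<forall>j. Cinf_on (u j) (ball a \<rho>)) \<and> (\<forall>j. u j p = w j) \<and>
     (\<forall>j. \<forall>x\<in>ball a \<rho>. (u j has_derivative (\<lambda>v. \<Sum>b\<in>Basis. (v \<bullet> b) * (\<Sum>k\<in>UNIV. A b j k x * u k x))) (at x))"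
      using u1 u2 by (intro exI[of _ "u c"]) blast
  qed
qed

end

section \<open>Flat systems and closed forms on the manifold\<close>

context smooth_mfd begin

lemma coordsD:
  assumes "coords W (a :: 'e) r G h d"
  shows "open W" "r > 0" "W = G ` ball a r" "continuous_on (ball a r) G"
    "\<And>b. b \<in> Basis \<Longrightarrow> h b \<in> C" "\<And>b. d b \<in> VF" "\<And>b x. b \<in> Basis \<Longrightarrow> x \<in> ball a r \<Longrightarrow> h b (G x) = x \<bullet> b"
    "\<And>f. f \<in> C \<Longrightarrow> Cinf_on (\<lambda>x. f (G x)) (ball a r)"
    "\<And>f x. f \<in> C \<Longrightarrow> x \<in> ball a r \<Longrightarrow> ((\<lambda>x. f (G x)) has_derivative (\<lambda>v. \<Sum>b\<in>Basis. (v \<bullet> b) * d b f (G x))) (at x)"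
    "\<And>X f q. X \<in> VF \<Longrightarrow> f \<in> C \<Longrightarrow> q \<in> W \<Longrightarrow> X f q = (\<Sum>b\<in>Basis. X (h b) q * d b f q)"
    "\<And>b c q. b \<in> Basis \<Longrightarrow> c \<in> Basis \<Longrightarrow> q \<in> W \<Longrightarrow> d b (h c) q = (if b = c then 1 else 0)"
    "\<And>\<phi> s. Cinf_on \<phi> (ball a r) \<Longrightarrow> s < r \<Longrightarrow> \<exists>f\<in>C. \<forall>x\<in>ball a s. f (G x) = \<phi> x"
  using assms unfolding coords_def by ((elim conjE)?; simp del: mem_ball)+

lemma coords_image:
  assumes cc: "coords W (a :: 'e) r G h d" and S: "open S" "S \<subseteq> ball a r"
  shows "open (G ` S)"
proof -
  define H where "H q = (\<Sum>b\<in>Basis. h b q *\<^sub>R b)" for q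
  have HG: "H (G x) = x" if "x \<in> ball a r" for x
    using that coordsD(7)[OF cc] by (simp add: H_def euclidean_representation)
  have "continuous_on UNIV H" unfolding H_def
    using C_continuous[OF coordsD(5)[OF cc]] by (intro continuous_on_sum continuous_on_scaleR) auto
  then have "open (H -` S \<inter> W)" using open_vimage[OF S(1)] coordsD(1)[OF cc] by blast
  moreover have "G ` S = H -` S \<inter> W"
  proof
    show "G ` S \<subseteq> H -` S \<inter> W" using HG S(2) coordsD(3)[OF cc] by auto
    show "H -` S \<inter> W \<subseteq> G ` S" using HG coordsD(3)[OF cc] by auto
  qed
  ultimately show ?thesis by simp
qed

text \<open>The last clause of \<open>coords\<close> asks for smoothness on the whole ball of radius
  \<open>r\<close>. A local solution lives on a smaller ball and has to be cut off first.\<close>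

lemma coords_extend:
  assumes cc: "coords W (a :: 'e) r G h d" and \<phi>: "Cinf_on \<phi> (ball a \<rho>)" and s: "0 < s" "s < \<rho>" "\<rho> \<le> r"
  obtains f where "f \<in> C" "\<And>x. x \<in> ball a s \<Longrightarrow> f (G x) = \<phi> x"
proof -
  obtain \<psi> where \<psi>: "Cinf_on \<psi> UNIV" "\<forall>x\<in>cball a s. \<psi> x = 1" "\<forall>x. x \<notin> ball a ((s + \<rho>) / 2) \<longrightarrow> \<psi> x = (0::real)"
  proof -
    have "s < (s + \<rho>) / 2" using s by simp
    from bump_exists[OF s(1) this, of a] show thesis using that by blast
  qed
  define k where "k x = (if x \<in> ball a \<rho> then \<psi> x * \<phi> x else 0)" for x
  have "Cinf_on k (ball a r)"
  proof (rule Cinf_on_local)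
    fix x assume "x \<in> ball a r"
    show "\<exists>T. open T \<and> x \<in> T \<and> Cinf_on k T"
    proof (cases "x \<in> ball a \<rho>")
      case True
      have "Cinf_on (\<lambda>x. \<psi> x * \<phi> x) (ball a \<rho>)" using Cinf_on_subset[OF \<psi>(1)] \<phi> by (intro Cinf_on_mult) auto
      then have "Cinf_on k (ball a \<rho>)"
        using Cinf_on_cong[OF open_ball, of a \<rho> k "\<lambda>x. \<psi> x * \<phi> x"] by (simp add: k_def)
      then show ?thesis using True by blast
    next
      case False
      have "k y = 0" if "y \<in> - cball a ((s + \<rho>) / 2)" for y using that \<psi>(3) by (auto simp: k_def)
      then have "Cinf_on k (- cball a ((s + \<rho>) / 2))"
        using Cinf_on_cong[of "- cball a ((s + \<rho>) / 2)" k "\<lambda>x. 0"] by auto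
      moreover have "x \<in> - cball a ((s + \<rho>) / 2)" using False s by auto
      ultimately show ?thesis by blast
    qed
  qed
  moreover have "s < r" using s by simp
  ultimately obtain f where f: "f \<in> C" "\<forall>x\<in>ball a s. f (G x) = k x" using coordsD(12)[OF cc] by blast
  have "k x = \<phi> x" if "x \<in> ball a s" for x using that s \<psi>(2) by (auto simp: k_def)
  then show thesis using that f by auto
qed

lemma coords_bracket:
  assumes cc: "coords W (a :: 'e) r G h d" and q: "q \<in> W" and bc: "b \<in> Basis" "c \<in> Basis"
  shows "eqv q (bracket (d b) (d c)) vzero"
proof (rule eqvI)
  note dV = coordsD(6)[OF cc]
  have z: "d b (d c (h e)) q = 0" if "b \<in> Basis" "c \<in> Basis" "e \<in> Basis" for b c e
    using VF_locally_const[OF dV VF_C[OF dV coordsD(5)[OF cc that(3)]] coordsD(1)[OF cc] q] coordsD(11)[OF cc that(2,3)] by blast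
  fix f assume f: "f \<in> C"
  have "bracket (d b) (d c) (h e) q = 0" if "e \<in> Basis" for e
    using z[OF bc that] z[OF bc(2,1) that] by (simp add: bracket_def)
  then show "bracket (d b) (d c) f q = vzero f q"
    using coordsD(10)[OF cc bracket_VF[OF dV dV] f q, of b c] by simp
qed (use coordsD(6)[OF cc] in auto)

lemma coords_form:
  assumes cc: "coords W (a :: 'e) r G h d" and \<omega>: "one_form A \<omega>" and X: "X \<in> VF" and q: "q \<in> W"
  shows "\<omega> X q = (\<Sum>b\<in>Basis. X (h b) q * \<omega> (d b) q)"
proof -
  note dV = coordsD(6)[OF cc]
  let ?P = "vsum Basis (\<lambda>b. (\<lambda>p. X (h b) q) \<odot>\<^sub>v d b)"
  have P: "?P \<in> VF" using dV by auto
  have "eqv q X ?P" by (rule eqvI[OF X P]) (use coordsD(10)[OF cc X _ q] in \<open>simp add: vsum_def\<close>)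
  then have "\<omega> X q = \<omega> ?P q" by (rule form_eqv[OF \<omega> X P])
  then show ?thesis using form_vsum[OF \<omega>, of Basis "\<lambda>b. (\<lambda>p. X (h b) q) \<odot>\<^sub>v d b" q] dV by (simp add: form_scale[OF \<omega>])
qed

lemma nbhd_path_connected:
  fixes p :: 'a
  assumes "open N" "p \<in> N" shows "\<exists>W. open W \<and> p \<in> W \<and> W \<subseteq> N \<and> path_connected W"
proof -
  obtain W a r G h d where cc: "coords W (a::'e) r G h d" "p = G a" "p \<in> W" "W \<subseteq> N" by (rule coords_exist[OF assms])
  have W: "W = G ` ball a r" by (rule coordsD(3)[OF cc(1)])
  have "path_connected (G ` ball a r)"
    by (rule path_connected_continuous_image[OF coordsD(4)[OF cc(1)] convex_imp_path_connected[OF convex_ball]])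
  then show ?thesis using cc(3,4) coordsD(1)[OF cc(1)] W by metis
qed

lemma coords_dd:
  assumes cc: "coords W (a :: 'e) r G h d" and "f \<in> C" "x \<in> ball a r" "b \<in> Basis"
  shows "frechet_derivative (\<lambda>x. f (G x)) (at x) b = d b f (G x)"
proof -
  have "frechet_derivative (\<lambda>x. f (G x)) (at x) b = (\<Sum>c\<in>Basis. (b \<bullet> c) * d c f (G x))"
    using fun_cong[OF frechet_derivative_at[OF coordsD(9)[OF cc assms(2,3)], symmetric], of b] .
  also have "\<dots> = (\<Sum>c\<in>Basis. if c = b then d c f (G x) else 0)"
    by (rule sum.cong) (use assms(4) in \<open>auto simp: inner_Basis\<close>)
  finally show ?thesis using assms(4) by (simp add: sum.delta)
qed

text \<open>Flat linear systems on the manifold: the matrix of 1-forms \<open>B\<close> satisfies the integrability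
  condition on an open set \<open>V\<close>.\<close>

definition flat_matrix :: "'a set \<Rightarrow> ('a vfield \<Rightarrow> 'n \<Rightarrow> 'n::finite \<Rightarrow> 'a \<Rightarrow> real) \<Rightarrow> bool" where
  "flat_matrix V B \<longleftrightarrow> open V \<and> (\<forall>j k. one_form A (\<lambda>X. B X j k)) \<and>
     (\<forall>q\<in>V. \<forall>X\<in>VF. \<forall>Y\<in>VF. \<forall>j k. X (B Y j k) q - Y (B X j k) q - B (bracket X Y) j k q =
        (\<Sum>l\<in>UNIV. B X j l q * B Y l k q - B Y j l q * B X l k q))"

lemma flat_matrix_solution:
  fixes B :: "'a vfield \<Rightarrow> 'n \<Rightarrow> 'n::finite \<Rightarrow> 'a \<Rightarrow> real"
  assumes B: "flat_matrix V B" and p: "p \<in> V"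
  obtains U where "open U" "p \<in> U" "U \<subseteq> V"
    "\<And>q w. q \<in> U \<Longrightarrow> \<exists>f. (\<forall>j. f j \<in> C) \<and> (\<forall>j. f j q = w j) \<and> (\<forall>j. \<forall>q\<in>U. \<forall>X\<in>VF. X (f j) q = (\<Sum>k\<in>UNIV. B X j k q * f k q))"
proof -
  obtain W a r G h d where cc: "coords W (a::'e) r G h d" "p = G a" "p \<in> W" "W \<subseteq> V"
    by (rule coords_exist[of V p]) (use B p in \<open>auto simp: flat_matrix_def\<close>)
  note c = coordsD[OF cc(1)]
  have Bf: "one_form A (\<lambda>X. B X j k)" for j k using B by (simp add: flat_matrix_def)
  have BC: "B X j k \<in> C" if "X \<in> VF" for X j k using form_C[OF Bf that] .
  interpret flat_system "\<lambda>b j k x. B (d b) j k (G x)" a r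
  proof
    show "r > 0" by (rule c(2))
    show "Cinf_on (\<lambda>x. B (d b) j k (G x)) (ball a r)" for b j k using c(8)[OF BC[OF c(6)]] .
    fix x and b b' :: 'e and j k assume x: "x \<in> ball a r" and b: "b \<in> Basis" "b' \<in> Basis"
    have q: "G x \<in> W" "G x \<in> V" using x c(3) cc(4) by auto
    have "B (bracket (d b') (d b)) j k (G x) = 0"
      using form_eqv[OF Bf bracket_VF[OF c(6) c(6)] vzero_VF coords_bracket[OF cc(1) q(1) b(2,1)]] form_zero[OF Bf] by simp
    moreover have "d b' (B (d b) j k) (G x) - d b (B (d b') j k) (G x) - B (bracket (d b') (d b)) j k (G x) =
        (\<Sum>l\<in>UNIV. B (d b') j l (G x) * B (d b) l k (G x) - B (d b) j l (G x) * B (d b') l k (G x))"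
      using B q(2) c(6) unfolding flat_matrix_def by blast
    ultimately show "frechet_derivative (\<lambda>x. B (d b) j k (G x)) (at x) b' - frechet_derivative (\<lambda>x. B (d b') j k (G x)) (at x) b =
        (\<Sum>l\<in>UNIV. B (d b') j l (G x) * B (d b) l k (G x) - B (d b) j l (G x) * B (d b') l k (G x))"
      unfolding coords_dd[OF cc(1) BC[OF c(6)] x b(2)] coords_dd[OF cc(1) BC[OF c(6)] x b(1)] by simp
  qed
  obtain \<rho> where \<rho>: "\<rho> > 0" "\<rho> \<le> r" and ex: "\<And>p w. p \<in> ball a \<rho> \<Longrightarrow> \<exists>u. (\<forall>j. Cinf_on (u j) (ball a \<rho>)) \<and> (\<forall>j. u j p = w j) \<and>
     (\<forall>j. \<forall>x\<in>ball a \<rho>. (u j has_derivative (\<lambda>v. \<Sum>b\<in>Basis. (v \<bullet> b) * (\<Sum>k\<in>UNIV. B (d b) j k (G x) * u k x))) (at x))"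
    using solution_through by blast
  let ?S = "ball a (\<rho> / 2)"
  have S: "?S \<subseteq> ball a r" "?S \<subseteq> ball a \<rho>" using \<rho> by auto
  define U where "U = G ` ?S"
  show thesis
  proof (rule that[of U])
    show "open U" unfolding U_def by (rule coords_image[OF cc(1) _ S(1)]) simp
    show "p \<in> U" using \<rho> cc(2) by (auto simp: U_def)
    show "U \<subseteq> V" using S(1) c(3) cc(4) by (auto simp: U_def)
    fix q w assume "q \<in> U"
    then obtain y where y: "y \<in> ?S" "q = G y" by (auto simp: U_def)
    then obtain u where u: "\<And>j. Cinf_on (u j) (ball a \<rho>)" "\<And>j. u j y = w j"
      "\<And>j x. x \<in> ball a \<rho> \<Longrightarrow> (u j has_derivative (\<lambda>v. \<Sum>b\<in>Basis. (v \<bullet> b) * (\<Sum>k\<in>UNIV. B (d b) j k (G x) * u k x))) (at x)"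
      using ex[of y w] S(2) by blast
    have "\<exists>f. f \<in> C \<and> (\<forall>x\<in>?S. f (G x) = u j x)" for j
      using coords_extend[OF cc(1) u(1)[of j], of "\<rho> / 2"] \<rho> by (metis half_gt_zero field_sum_of_halves less_add_same_cancel1)
    then obtain f where f: "\<And>j. f j \<in> C" "\<And>j x. x \<in> ?S \<Longrightarrow> f j (G x) = u j x" by metis
    have "X (f j) q = (\<Sum>k\<in>UNIV. B X j k q * f k q)" if q: "q \<in> U" and X: "X \<in> VF" for j q X
    proof -
      from q obtain x where x: "x \<in> ?S" "q = G x" by (auto simp: U_def)
      have xr: "x \<in> ball a r" and xp: "x \<in> ball a \<rho>" using x S by blast+
      have qW: "q \<in> W" using xr x c(3) by auto
      have "((\<lambda>x. f j (G x)) has_derivative (\<lambda>v. \<Sum>b\<in>Basis. (v \<bullet> b) * (\<Sum>k\<in>UNIV. B (d b) j k (G x) * u k x))) (at x)"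
        by (rule has_derivative_cong_open[OF u(3)[OF xp] open_ball x(1)]) (simp add: f(2))
      from fun_cong[OF frechet_derivative_at[OF this, symmetric]]
      have "d b (f j) q = (\<Sum>b'\<in>Basis. (b \<bullet> b') * (\<Sum>k\<in>UNIV. B (d b') j k q * f k q))" if "b \<in> Basis" for b
        using coords_dd[OF cc(1) f(1) xr that, of j] f(2)[OF x(1)] x(2) by simp
      moreover have "(\<Sum>b'\<in>Basis. (b \<bullet> b') * Z b') = Z b" if "b \<in> Basis" for b :: 'e and Z
      proof -
        have "(\<Sum>b'\<in>Basis. (b \<bullet> b') * Z b') = (\<Sum>b'\<in>Basis. if b' = b then Z b' else 0)"
          by (rule sum.cong) (use that in \<open>auto simp: inner_Basis\<close>)
        then show ?thesis using that by (simp add: sum.delta)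
      qed
      ultimately have db: "d b (f j) q = (\<Sum>k\<in>UNIV. B (d b) j k q * f k q)" if "b \<in> Basis" for b
        using that by simp
      have "X (f j) q = (\<Sum>b\<in>Basis. \<Sum>k\<in>UNIV. X (h b) q * (B (d b) j k q * f k q))"
        unfolding c(10)[OF X f(1) qW] by (rule sum.cong) (simp_all add: db sum_distrib_left)
      also have "\<dots> = (\<Sum>k\<in>UNIV. (\<Sum>b\<in>Basis. X (h b) q * B (d b) j k q) * f k q)"
        by (subst sum.swap) (simp add: sum_distrib_right mult.assoc)
      finally show ?thesis using coords_form[OF cc(1) Bf X qW] by simp
    qed
    then show "\<exists>f. (\<forall>j. f j \<in> C) \<and> (\<forall>j. f j q = w j) \<and> (\<forall>j. \<forall>q\<in>U. \<forall>X\<in>VF. X (f j) q = (\<Sum>k\<in>UNIV. B X j k q * f k q))"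
      using f y u(2) by (intro exI[of _ f]) auto
  qed
qed

lemma matrix_system_unique_local:
  fixes B :: "'a vfield \<Rightarrow> 'n \<Rightarrow> 'n::finite \<Rightarrow> 'a \<Rightarrow> real"
  assumes B: "\<And>j k. one_form A (\<lambda>X. B X j k)" and V: "open V" "p \<in> V"
  obtains U where "open U" "p \<in> U" "U \<subseteq> V"
    "\<And>f q q'. (\<And>j. f j \<in> C) \<Longrightarrow> (\<And>j q X. q \<in> V \<Longrightarrow> X \<in> VF \<Longrightarrow> X (f j) q = (\<Sum>k\<in>UNIV. B X j k q * f k q)) \<Longrightarrow>
      q \<in> U \<Longrightarrow> (\<And>j. f j q = 0) \<Longrightarrow> q' \<in> U \<Longrightarrow> (\<forall>j. f j q' = 0)"
proof -
  obtain W a r G h d where cc: "coords W (a::'e) r G h d" "p = G a" "p \<in> W" "W \<subseteq> V" by (rule coords_exist[OF V])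
  note c = coordsD[OF cc(1)]
  show thesis
  proof (rule that[OF c(1) cc(3,4)], intro allI)
    fix f :: "'n \<Rightarrow> 'a \<Rightarrow> real" and q q' j
    assume f: "\<And>j. f j \<in> C" "\<And>j q X. q \<in> V \<Longrightarrow> X \<in> VF \<Longrightarrow> X (f j) q = (\<Sum>k\<in>UNIV. B X j k q * f k q)"
      and q: "q \<in> W" "\<And>j. f j q = 0" "q' \<in> W"
    obtain x x' where x: "x \<in> ball a r" "q = G x" "x' \<in> ball a r" "q' = G x'" using q c(3) by auto
    have "f j (G x') = 0"
    proof (rule linear_system_unique[OF convex_ball _ _ x(1) _ x(3), of "\<lambda>b j k x. B (d b) j k (G x)" "\<lambda>j x. f j (G x)"])
      show "continuous_on (ball a r) (\<lambda>x. B (d b) j k (G x))" for b j k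
        using Cinf_on_imp_continuous[OF c(8)[OF form_C[OF B c(6)]]] .
      show "((\<lambda>x. f j (G x)) has_derivative (\<lambda>h. \<Sum>b\<in>Basis. (h \<bullet> b) * (\<Sum>k\<in>UNIV. B (d b) j k (G x) * f k (G x)))) (at x)"
        if "x \<in> ball a r" for j x
      proof -
        have "G x \<in> V" using that c(3) cc(4) by auto
        then show ?thesis using c(9)[OF f(1) that, of j] f(2)[OF _ c(6)] by simp
      qed
    qed (use q x in auto)
    then show "f j q' = 0" using x by simp
  qed
qed

text \<open>Local primitives on a connected set differ by constants, so they form a local system
  with fibre the reals, and monodromy glues them.\<close>

lemma closed_form_has_potential:
  assumes sc: "simply_connected (UNIV :: 'a set)" and \<omega>: "one_form A \<omega>"
    and cl: "\<And>X Y p. X \<in> VF \<Longrightarrow> Y \<in> VF \<Longrightarrow> X (\<omega> Y) p - Y (\<omega> X) p - \<omega> (bracket X Y) p = 0"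
  obtains f where "f \<in> C" "\<And>X p. X \<in> VF \<Longrightarrow> X f p = \<omega> X p"
proof -
  \<comment> \<open>An inhomogeneous equation becomes a linear system when the constant is adjoined
    as a second unknown: the derivative of the component \<open>True\<close> is
    \<open>\<omega>\<close> times the component \<open>False\<close>, whose derivative is 0.
    Closedness of \<open>\<omega>\<close> is flatness.\<close>
  define B where "B X j k = (if j \<and> \<not> k then \<omega> X else (\<lambda>p. 0))" for X and j k :: bool
  have Bf: "one_form A (\<lambda>X. B X j k)" for j k
    using \<omega> by (cases "j \<and> \<not> k") (auto simp: B_def one_form_def)
  have B: "flat_matrix UNIV B"
    unfolding flat_matrix_def
  proof (intro conjI ballI allI open_UNIV Bf)
    fix q X Y and j k :: bool assume X: "X \<in> VF" and Y: "Y \<in> VF"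
    have "X (\<lambda>p. 0) q = 0" "Y (\<lambda>p. 0) q = 0" using VF_const X Y by auto
    then show "X (B Y j k) q - Y (B X j k) q - B (bracket X Y) j k q =
        (\<Sum>l\<in>UNIV. B X j l q * B Y l k q - B Y j l q * B X l k q)"
      using cl[OF X Y, of q] by (cases j; cases k) (simp_all add: B_def UNIV_bool)
  qed
  define sol where "sol W f \<longleftrightarrow> f \<in> C \<and> (\<forall>q\<in>W. \<forall>X\<in>VF. X f q = \<omega> X q)" for W f
  interpret local_system "\<lambda>q. UNIV :: real set" sol "\<lambda>f q. f q"
  proof
    show "\<exists>U. open U \<and> p \<in> U \<and> (\<forall>q\<in>U. \<forall>v\<in>UNIV. \<exists>f. sol U f \<and> f q = v)" for p
    proof -
      obtain U where U: "open U" "p \<in> U" "\<And>q w. q \<in> U \<Longrightarrow> \<exists>f. (\<forall>j. f j \<in> C) \<and> (\<forall>j. f j q = w j) \<and>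
          (\<forall>j. \<forall>q\<in>U. \<forall>X\<in>VF. X (f j) q = (\<Sum>k\<in>UNIV. B X j k q * f k q))"
        by (rule flat_matrix_solution[OF B UNIV_I[of p]]) blast
      obtain f where "(\<forall>j. f j \<in> C) \<and> (\<forall>j. f j p = (if j then 0 else 1)) \<and>
          (\<forall>j. \<forall>q\<in>U. \<forall>X\<in>VF. X (f j) q = (\<Sum>k\<in>UNIV. B X j k q * f k q))"
        using U(3)[OF U(2), of "\<lambda>j. if j then 0 else 1"] by (elim exE) (rule that)
      then have f: "\<And>j. f j \<in> C" "\<And>j. f j p = (if j then 0 else 1)"
        "\<And>j q X. q \<in> U \<Longrightarrow> X \<in> VF \<Longrightarrow> X (f j) q = (\<Sum>k\<in>UNIV. B X j k q * f k q)" by blast+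
      have "X (f False) q = 0" if "q \<in> U" "X \<in> VF" for q X using f(3)[OF that, of False] by (simp add: B_def)
      then obtain W where W: "open W" "p \<in> W" "W \<subseteq> U" "\<forall>q\<in>W. f False q = f False p"
        using deriv_zero_imp_locally_const[OF f(1)[of False] U(1,2)] by metis
      have "X (f True) q = \<omega> X q" if "q \<in> W" "X \<in> VF" for q X
        using f(3)[of q X True] that W f(2)[of False] by (auto simp: B_def UNIV_bool)
      then have sk: "sol W (\<lambda>p. f True p + k)" for k
        using f(1) by (auto simp: sol_def VF_add[OF _ f(1) C_const] VF_const intro: C_add)
      show ?thesis
      proof (intro exI[of _ W] conjI ballI W(1,2))
        fix q v
        show "\<exists>f. sol W f \<and> f q = v" using sk[of "v - f True q"]
          by (intro exI[of _ "\<lambda>p. f True p + (v - f True q)"]) simp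
      qed
    qed
    fix W f f' q r assume W: "open W" "connected W" and s: "sol W f" "sol W f'" and q: "q \<in> W" "f q = f' q" "r \<in> W"
    define k where "k = (\<lambda>p. f p - f' p)"
    have kC: "k \<in> C" unfolding k_def using s by (auto simp: sol_def)
    have k0: "X k y = 0" if "X \<in> VF" "y \<in> W" for X y
    proof -
      have "X f y = \<omega> X y" "X f' y = \<omega> X y" "f \<in> C" "f' \<in> C" using s that by (auto simp: sol_def)
      then show ?thesis unfolding k_def using VF_diff[OF that(1)] by simp
    qed
    have "k q = k r"
    proof (rule connected_local_const[OF W(2) q(1,3)], intro ballI)
      fix x assume x: "x \<in> W"
      have "\<exists>N. open N \<and> x \<in> N \<and> N \<subseteq> W \<and> (\<forall>y\<in>N. k y = k x)"
      proof (rule deriv_zero_imp_locally_const[OF kC W(1) x])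
        fix X y assume "X \<in> VF" "y \<in> W"
        then show "X k y = 0" by (rule k0)
      qed
      then obtain N where N: "open N" "x \<in> N" "\<And>y. y \<in> N \<Longrightarrow> k x = k y" by metis
      show "\<forall>\<^sub>F y in at x within W. k x = k y" unfolding eventually_at_topological
        by (intro exI[of _ N] conjI ballI impI N)
    qed
    then show "f r = f' r" using q(2) by (simp add: k_def)
  next
    show "sol W' f" if "sol W f" "W' \<subseteq> W" for W W' f
      using that by (simp add: sol_def subset_eq)
  qed (rule nbhd_path_connected UNIV_I; assumption)+
  obtain s where s: "\<And>p. \<exists>W f. open W \<and> p \<in> W \<and> sol W f \<and> (\<forall>q\<in>W. s q = f q)"
    by (rule monodromy[OF sc UNIV_I]) (rule that)
  have sC: "s \<in> C"
  proof (rule C_local)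
    fix p
    obtain W f where "open W" "p \<in> W" "sol W f" "\<forall>q\<in>W. s q = f q" using s[of p] by (elim exE conjE) (rule that)
    moreover have "f \<in> C" using calculation(3) by (simp add: sol_def)
    ultimately show "\<exists>W h. open W \<and> p \<in> W \<and> h \<in> C \<and> (\<forall>q\<in>W. s q = h q)"
      by (intro exI[of _ W] exI[of _ f] conjI)
  qed
  show thesis
  proof (rule that[OF sC])
    fix X p assume X: "X \<in> VF"
    obtain W f where "open W" "p \<in> W" "sol W f" "\<forall>q\<in>W. s q = f q" using s[of p] by (elim exE conjE) (rule that)
    then show "X s p = \<omega> X p" using VF_germ[OF X sC, of f W p] X by (simp add: sol_def)
  qed
qed

end

subsection \<open>Global frames\<close>

lemma sum_bool_option: "(\<Sum>l\<in>(UNIV :: bool option set). h l) = h None + h (Some True) + h (Some False :: bool option)"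
  for h :: "bool option \<Rightarrow> real"
proof -
  have u: "(UNIV :: bool option set) = {None, Some True, Some False}"
    by (auto simp: UNIV_option_conv UNIV_bool)
  show ?thesis unfolding u by (simp add: add.assoc)
qed

context sasaki begin

text \<open>The solutions \<open>(f, Y)\<close>: \<open>f\<close> is constant along \<open>\<xi>\<close>, has gradient \<open>Y\<close>, and in the two-dimensional
  quotient by the Reeb flow, of curvature \<open>-\<alpha>\<^sup>2\<close>, its Hessian is \<open>\<alpha>\<^sup>2 f\<close> times the metric. On the
  hyperbolic plane these functions are the restrictions of the linear functions of the hyperboloid model.\<close>

definition "hess_sol \<alpha> W z \<longleftrightarrow> fst z \<in> C \<and> snd z \<in> VF \<and> (\<forall>q\<in>W. \<eta> (snd z) q = 0 \<and>
  (\<forall>X\<in>VF. X (fst z) q = g X (snd z) q) \<and>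
  (\<forall>X\<in>VF. \<forall>Z\<in>VF. g (D X (snd z)) Z q = \<alpha> * \<alpha> * fst z q * (g X Z q - \<eta> X q * \<eta> Z q)
     - \<eta> X q * g (\<phi> (snd z)) Z q + g (\<phi> X) (snd z) q * \<eta> Z q))"

text \<open>The index \<open>None\<close> belongs to the function \<open>f\<close>,
  \<open>Some True\<close> and \<open>Some False\<close> to the components of its gradient along
  \<open>E\<close> and \<open>\<phi> E\<close>. The rotation entries are the connection form of the
  quotient by the Reeb flow.\<close>

definition hess_mat :: "real \<Rightarrow> 'a vfield \<Rightarrow> 'a vfield \<Rightarrow> bool option \<Rightarrow> bool option \<Rightarrow> 'a \<Rightarrow> real" where
  "hess_mat \<alpha> E X j k = (case j of
     None \<Rightarrow> (case k of None \<Rightarrow> (\<lambda>q. 0) | Some t \<Rightarrow> if t then g X E else g X (\<phi> E))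
   | Some s \<Rightarrow> (case k of None \<Rightarrow> (\<lambda>q. \<alpha> * \<alpha> * (if s then g X E else g X (\<phi> E)) q)
      | Some t \<Rightarrow> if s = t then (\<lambda>q. 0) else (\<lambda>q. (if s then 1 else -1) * (g (D X E) (\<phi> E) q + \<eta> X q))))"

lemma hess_mat_simps [simp]:
  "hess_mat \<alpha> E X None None = (\<lambda>q. 0)" "hess_mat \<alpha> E X None (Some True) = g X E"
  "hess_mat \<alpha> E X None (Some False) = g X (\<phi> E)"
  "hess_mat \<alpha> E X (Some True) None = (\<lambda>q. \<alpha> * \<alpha> * g X E q)" "hess_mat \<alpha> E X (Some False) None = (\<lambda>q. \<alpha> * \<alpha> * g X (\<phi> E) q)"
  "hess_mat \<alpha> E X (Some True) (Some True) = (\<lambda>q. 0)" "hess_mat \<alpha> E X (Some False) (Some False) = (\<lambda>q. 0)"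
  "hess_mat \<alpha> E X (Some True) (Some False) = (\<lambda>q. 1 * (g (D X E) (\<phi> E) q + \<eta> X q))"
  "hess_mat \<alpha> E X (Some False) (Some True) = (\<lambda>q. -1 * (g (D X E) (\<phi> E) q + \<eta> X q))"
  by (simp_all add: hess_mat_def)

lemma hess_mat_form:
  assumes E: "E \<in> VF" shows "one_form A (\<lambda>X. hess_mat \<alpha> E X j k)"
proof -
  have 0: "one_form A (\<lambda>X q. 0)" by (simp add: one_form_def)
  have 1: "one_form A (\<lambda>X. g X V)" if "V \<in> VF" for V
    using that by (simp add: one_form_def g_simps fun_eq_iff)
  have 2: "one_form A (\<lambda>X q. a * g X V q)" if "V \<in> VF" for V a
    using that by (simp add: one_form_def g_simps fun_eq_iff C_mult algebra_simps)
  have 3: "one_form A (\<lambda>X q. a * (g (D X E) (\<phi> E) q + \<eta> X q))" for a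
    using E by (simp add: one_form_def g_simps eta_simps endo_add[OF D_endo[OF E]] endo_scale[OF D_endo[OF E]]
        fun_eq_iff C_mult C_add algebra_simps)
  consider "j = None" "k = None" | "j = None" "k = Some True" | "j = None" "k = Some False"
    | "j = Some True" "k = None" | "j = Some False" "k = None" | "j = Some True" "k = Some True"
    | "j = Some True" "k = Some False" | "j = Some False" "k = Some True" | "j = Some False" "k = Some False"
    by (metis option.exhaust)
  then show ?thesis
    by cases (simp_all only: hess_mat_simps 0 1[OF E] 1[OF phi_VF[OF E]] 2[OF E] 2[OF phi_VF[OF E]] 3)
qed

text \<open>Flatness restates the structure equations. The rotation entry has exterior derivative
  \<open>\<alpha> * \<alpha>\<close> times the area form of the contact plane, which is what the row
  and column of \<open>f\<close> produce; here \<open>\<alpha> * \<alpha> = -(c + 3)\<close>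
  enters.\<close>

lemma hess_mat_flat:
  assumes chc: "constant_holomorphic_curvature A M D c" and a: "\<alpha> * \<alpha> = -(c + 3)" and F: "frame_on W E" and E: "E \<in> VF"
  shows "flat_matrix W (hess_mat \<alpha> E)"
  unfolding flat_matrix_def
proof (intro conjI ballI allI)
  show "open W" using F by (simp add: frame_on_def)
  show "one_form A (\<lambda>X. hess_mat \<alpha> E X j k)" for j k
    by (rule hess_mat_form[OF E])
  fix q X Y j k assume q: "q \<in> W" and X: "X \<in> VF" and Y: "Y \<in> VF"
  have fr: "frame q E" using F q by (simp add: frame_on_def)
  have z: "X (\<lambda>q. 0) q = 0" "Y (\<lambda>q. 0) q = 0" using VF_const X Y by auto
  have m: "V (\<lambda>q. a * g V' B q) q = a * V (g V' B) q" if "V \<in> VF" "V' \<in> VF" "B \<in> VF" for V V' B a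
    using VF_cmult[OF that(1) g_C[OF that(2,3)]] .
  have t: "V (\<lambda>q. a * (g (D V' E) (\<phi> E) q + \<eta> V' q)) q = a * (V (g (D V' E) (\<phi> E)) q + V (\<eta> V') q)" if "V \<in> VF" "V' \<in> VF" for V V' a
    using that E VF_cmult[OF that(1) C_add[OF g_C[OF D_VF[OF that(2) E] phi_VF[OF E]] eta_C[OF that(2)]], of a]
      VF_add[OF that(1) g_C[OF D_VF[OF that(2) E] phi_VF[OF E]] eta_C[OF that(2)]] by simp
  define x1 x2 y1 y2 tx ty where "x1 = g X E q" and "x2 = g X (\<phi> E) q" and "y1 = g Y E q" and "y2 = g Y (\<phi> E) q"
    and "tx = g (D X E) (\<phi> E) q + \<eta> X q" and "ty = g (D Y E) (\<phi> E) q + \<eta> Y q"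
  note defs = x1_def x2_def y1_def y2_def tx_def ty_def
  have c1: "X (g Y E) q - Y (g X E) q - g (bracket X Y) E q = tx * y2 - ty * x2"
    "X (g Y (\<phi> E)) q - Y (g X (\<phi> E)) q - g (bracket X Y) (\<phi> E) q = - tx * y1 + ty * x1"
    using coframe_ext_deriv[OF F q X Y] unfolding defs by auto
  have c2: "(X (g (D Y E) (\<phi> E)) q + X (\<eta> Y) q) - (Y (g (D X E) (\<phi> E)) q + Y (\<eta> X) q) -
      (g (D (bracket X Y) E) (\<phi> E) q + \<eta> (bracket X Y) q) = \<alpha> * \<alpha> * (x1 * y2 - x2 * y1)"
    using connection_form_ext_deriv[OF chc F q X Y] eta_ext_deriv[OF fr X Y] unfolding defs a by (simp add: algebra_simps)
  have c1': "a * X (g Y E) q - a * Y (g X E) q - a * g (bracket X Y) E q = a * (tx * y2 - ty * x2)"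
    "a * X (g Y (\<phi> E)) q - a * Y (g X (\<phi> E)) q - a * g (bracket X Y) (\<phi> E) q = a * (- tx * y1 + ty * x1)" for a
    unfolding c1[symmetric] by (simp_all add: algebra_simps)
  have c2': "- (X (g (D Y E) (\<phi> E)) q + X (\<eta> Y) q) + (Y (g (D X E) (\<phi> E)) q + Y (\<eta> X) q) +
      (g (D (bracket X Y) E) (\<phi> E) q + \<eta> (bracket X Y) q) = - \<alpha> * \<alpha> * (x1 * y2 - x2 * y1)"
    using c2 by linarith
  consider "j = None" "k = None" | "j = None" "k = Some True" | "j = None" "k = Some False"
    | "j = Some True" "k = None" | "j = Some False" "k = None" | "j = Some True" "k = Some True"
    | "j = Some True" "k = Some False" | "j = Some False" "k = Some True" | "j = Some False" "k = Some False"
    by (metis option.exhaust)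
  then show "X (hess_mat \<alpha> E Y j k) q - Y (hess_mat \<alpha> E X j k) q - hess_mat \<alpha> E (bracket X Y) j k q =
      (\<Sum>l\<in>UNIV. hess_mat \<alpha> E X j l q * hess_mat \<alpha> E Y l k q - hess_mat \<alpha> E Y j l q * hess_mat \<alpha> E X l k q)"
  proof cases
    case 7
    show ?thesis using c2 unfolding 7 sum_bool_option hess_mat_simps t[OF X Y] t[OF Y X] defs by (simp add: algebra_simps)
  next
    case 8
    show ?thesis using c2' unfolding 8 sum_bool_option hess_mat_simps t[OF X Y] t[OF Y X] defs by (simp add: algebra_simps)
  next
    case 4
    show ?thesis using c1'(1)[of "\<alpha> * \<alpha>"] unfolding 4 sum_bool_option hess_mat_simps m[OF X Y E] m[OF Y X E] defs by (simp add: algebra_simps)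
  next
    case 5
    show ?thesis using c1'(2)[of "\<alpha> * \<alpha>"] unfolding 5 sum_bool_option hess_mat_simps m[OF X Y phi_VF[OF E]] m[OF Y X phi_VF[OF E]] defs
      by (simp add: algebra_simps)
  next
    case 2
    show ?thesis using c1(1) unfolding 2 sum_bool_option hess_mat_simps defs by (simp add: algebra_simps)
  next
    case 3
    show ?thesis using c1(2) unfolding 3 sum_bool_option hess_mat_simps defs by (simp add: algebra_simps)
  qed (simp_all add: sum_bool_option z algebra_simps)
qed

definition hess_comp :: "'a vfield \<Rightarrow> ('a \<Rightarrow> real) \<times> 'a vfield \<Rightarrow> bool option \<Rightarrow> 'a \<Rightarrow> real" where
  "hess_comp E z j = (case j of None \<Rightarrow> fst z | Some s \<Rightarrow> if s then g (snd z) E else g (snd z) (\<phi> E))"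

lemma hess_comp_simps [simp]: "hess_comp E z None = fst z" "hess_comp E z (Some True) = g (snd z) E"
  "hess_comp E z (Some False) = g (snd z) (\<phi> E)"
  by (simp_all add: hess_comp_def)

lemma hess_comp_system:
  assumes s: "hess_sol \<alpha> V z" and F: "frame_on W E" and q: "q \<in> V" "q \<in> W" and X: "X \<in> VF"
  shows "X (hess_comp E z j) q = (\<Sum>k\<in>UNIV. hess_mat \<alpha> E X j k q * hess_comp E z k q)"
proof -
  define f Y where "f = fst z" and "Y = snd z"
  have fr: "frame q E" using F q by (simp add: frame_on_def)
  have E: "E \<in> VF" using fr by (rule frame_VF)
  have o: "onb q E (\<phi> E) \<xi>" using fr by (rule frame_onb)
  have Y: "Y \<in> VF" and h0: "\<eta> Y q = 0" and h1: "X f q = g X Y q"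
    and h2: "\<And>Z. Z \<in> VF \<Longrightarrow> g (D X Y) Z q = \<alpha> * \<alpha> * f q * (g X Z q - \<eta> X q * \<eta> Z q) - \<eta> X q * g (\<phi> Y) Z q + g (\<phi> X) Y q * \<eta> Z q"
    using s q(1) X unfolding hess_sol_def f_def Y_def by blast+
  note D = frame_D[OF F q(2) X]
  have e0: "\<eta> E q = 0" using fr by (simp add: frame_def)
  have r1: "X f q = g X E q * g Y E q + g X (\<phi> E) q * g Y (\<phi> E) q"
    using h1 h0 onb_g[OF o X Y] Y by simp
  have r2: "X (g Y E) q = \<alpha> * \<alpha> * g X E q * f q + (g (D X E) (\<phi> E) q + \<eta> X q) * g Y (\<phi> E) q"
    using D_metric[OF X Y E, of q] h2[OF E] onb_g[OF o Y D_VF[OF X E]] D phi_frame[OF fr Y] e0 h0 E X Y by (simp add: algebra_simps)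
  have r3: "X (g Y (\<phi> E)) q = \<alpha> * \<alpha> * g X (\<phi> E) q * f q - (g (D X E) (\<phi> E) q + \<eta> X q) * g Y E q"
    using D_metric[OF X Y phi_VF[OF E], of q] h2[OF phi_VF[OF E]] onb_g[OF o Y D_VF[OF X phi_VF[OF E]]] D phi_frame[OF fr Y] h0 E X Y
    by (simp add: algebra_simps)
  consider "j = None" | "j = Some True" | "j = Some False" by (metis option.exhaust)
  then show ?thesis
    by cases (use r1 r2 r3 in \<open>simp_all add: sum_bool_option f_def Y_def algebra_simps\<close>)
qed

lemma hess_system_sol:
  assumes F: "frame_on W E" and U: "U \<subseteq> W" and f: "\<And>j. f j \<in> C" and E: "E \<in> VF"
    and sys: "\<And>j q X. q \<in> U \<Longrightarrow> X \<in> VF \<Longrightarrow> X (f j) q = (\<Sum>k\<in>UNIV. hess_mat \<alpha> E X j k q * f k q)"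
  shows "hess_sol \<alpha> U (f None, f (Some True) \<odot>\<^sub>v E \<oplus>\<^sub>v f (Some False) \<odot>\<^sub>v \<phi> E)"
  unfolding hess_sol_def fst_conv snd_conv
proof (intro conjI ballI f)
  let ?f1 = "f (Some True)" and ?f2 = "f (Some False)"
  let ?Y = "?f1 \<odot>\<^sub>v E \<oplus>\<^sub>v ?f2 \<odot>\<^sub>v \<phi> E"
  show "?Y \<in> VF" using f E by auto
  fix q assume qU: "q \<in> U"
  then have q: "q \<in> W" using U by auto
  have fr: "frame q E" using F q by (simp add: frame_on_def)
  have o: "onb q E (\<phi> E) \<xi>" using fr by (rule frame_onb)
  have e0: "\<eta> E q = 0" using fr by (simp add: frame_def)
  show "\<eta> ?Y q = 0" using f E e0 by (simp add: eta_simps)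
  fix X assume X: "X \<in> VF"
  have s0: "X (f None) q = g X E q * ?f1 q + g X (\<phi> E) q * ?f2 q"
    and s1: "X ?f1 q = \<alpha> * \<alpha> * g X E q * f None q + (g (D X E) (\<phi> E) q + \<eta> X q) * ?f2 q"
    and s2: "X ?f2 q = \<alpha> * \<alpha> * g X (\<phi> E) q * f None q - (g (D X E) (\<phi> E) q + \<eta> X q) * ?f1 q"
    using sys[OF qU X] by (simp_all add: sum_bool_option algebra_simps)
  show "X (f None) q = g X ?Y q" using s0 f E X by (simp add: g_simps)
  fix Z assume Z: "Z \<in> VF"
  note D = frame_D[OF F q X]
  have DY: "g (D X ?Y) Z q = X ?f1 q * g E Z q + ?f1 q * g (D X E) Z q + X ?f2 q * g (\<phi> E) Z q + ?f2 q * g (D X (\<phi> E)) Z q"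
    using X Z E f VF_C[OF X] by (simp add: D_add D_scale g_simps)
  have phiY: "g (\<phi> ?Y) Z q = ?f1 q * g (\<phi> E) Z q - ?f2 q * g E Z q"
    using E f Z e0 by (simp add: phi_add phi_scale phi2[OF E] g_simps)
  have gY: "g (\<phi> X) ?Y q = - ?f1 q * g X (\<phi> E) q + ?f2 q * g X E q"
    using E f X phi_frame[OF fr X] by (simp add: g_simps)
  have d1: "g (D X E) Z q = g (D X E) (\<phi> E) q * g (\<phi> E) Z q - g X (\<phi> E) q * \<eta> Z q"
    using onb_g[OF o D_VF[OF X E] Z] D g_sym[OF phi_VF[OF E] Z] Z by simp
  have d2: "g (D X (\<phi> E)) Z q = - g (D X E) (\<phi> E) q * g E Z q + g X E q * \<eta> Z q"
    using onb_g[OF o D_VF[OF X phi_VF[OF E]] Z] D g_sym[OF E Z] Z by simp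
  have d3: "g X Z q = g X E q * g E Z q + g X (\<phi> E) q * g (\<phi> E) Z q + \<eta> X q * \<eta> Z q"
    using onb_g[OF o X Z] g_sym[OF E Z] g_sym[OF phi_VF[OF E] Z] X Z by simp
  show "g (D X ?Y) Z q = \<alpha> * \<alpha> * f None q * (g X Z q - \<eta> X q * \<eta> Z q) - \<eta> X q * g (\<phi> ?Y) Z q + g (\<phi> X) ?Y q * \<eta> Z q"
    unfolding DY phiY gY s1 s2 d1 d2 d3 by (simp add: algebra_simps)
qed

text \<open>The fibre at \<open>q\<close> consists of a number and a horizontal tangent vector at
  \<open>q\<close>. The vector is encoded as the functional sending \<open>k\<close> to
  \<open>Y k q\<close>, so that different fields with the same value at \<open>q\<close> give the
  same element.\<close>

lemma hess_local_system:
  assumes chc: "constant_holomorphic_curvature A M D c" and a: "\<alpha> * \<alpha> = -(c + 3)"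
  shows "local_system (\<lambda>q. {(a :: real, l). \<exists>Y\<in>VF. \<eta> Y q = 0 \<and> l = (\<lambda>k. Y k q)}) (hess_sol \<alpha>) (\<lambda>z q. (fst z q, \<lambda>k. snd z k q))"
proof
  show "\<exists>W. open W \<and> p \<in> W \<and> W \<subseteq> N \<and> path_connected W" if "open N" "p \<in> N" for p and N :: "'a set"
    by (rule nbhd_path_connected[OF that])
  show "hess_sol \<alpha> W' z" if "hess_sol \<alpha> W z" "W' \<subseteq> W" for W W' z
    using that unfolding hess_sol_def by (meson subsetD)
  show "(fst z q, \<lambda>k. snd z k q) \<in> {(a :: real, l). \<exists>Y\<in>VF. \<eta> Y q = 0 \<and> l = (\<lambda>k. Y k q)}" if "hess_sol \<alpha> W z" "q \<in> W" for W z q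
  proof -
    have "snd z \<in> VF" "\<eta> (snd z) q = 0" using that unfolding hess_sol_def by blast+
    then show ?thesis by auto
  qed
next
  fix p
  obtain W E where F: "frame_on W E" and pW: "p \<in> W" by (rule frame_exists[of p])
  then have E: "E \<in> VF" by (auto simp: frame_on_def frame_def)
  obtain U where U: "open U" "p \<in> U" "U \<subseteq> W" "\<And>q w. q \<in> U \<Longrightarrow> \<exists>f. (\<forall>j. f j \<in> C) \<and> (\<forall>j. f j q = w j) \<and>
      (\<forall>j. \<forall>q\<in>U. \<forall>X\<in>VF. X (f j) q = (\<Sum>k\<in>UNIV. hess_mat \<alpha> E X j k q * f k q))"
    by (rule flat_matrix_solution[OF hess_mat_flat[OF chc a F E] pW]) (rule that)
  show "\<exists>U. open U \<and> p \<in> U \<and> (\<forall>q\<in>U. \<forall>v\<in>{(a :: real, l). \<exists>Y\<in>VF. \<eta> Y q = 0 \<and> l = (\<lambda>k. Y k q)}.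
      \<exists>z. hess_sol \<alpha> U z \<and> (fst z q, \<lambda>k. snd z k q) = v)"
  proof (intro exI[of _ U] conjI ballI U(1,2))
    fix q v assume q: "q \<in> U" and v: "v \<in> {(a :: real, l). \<exists>Y\<in>VF. \<eta> Y q = 0 \<and> l = (\<lambda>k. Y k q)}"
    then obtain b Y where Y: "Y \<in> VF" "\<eta> Y q = 0" "v = (b, \<lambda>k. Y k q)" by auto
    obtain f where "(\<forall>j. f j \<in> C) \<and> (\<forall>j. f j q = (case j of None \<Rightarrow> b | Some s \<Rightarrow> if s then g Y E q else g Y (\<phi> E) q)) \<and>
      (\<forall>j. \<forall>q\<in>U. \<forall>X\<in>VF. X (f j) q = (\<Sum>k\<in>UNIV. hess_mat \<alpha> E X j k q * f k q))"
      using U(4)[OF q, of "\<lambda>j. case j of None \<Rightarrow> b | Some s \<Rightarrow> if s then g Y E q else g Y (\<phi> E) q"] by (elim exE) (rule that)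
    then have f: "\<And>j. f j \<in> C" "\<And>j. f j q = (case j of None \<Rightarrow> b | Some s \<Rightarrow> if s then g Y E q else g Y (\<phi> E) q)"
      "\<And>j q X. q \<in> U \<Longrightarrow> X \<in> VF \<Longrightarrow> X (f j) q = (\<Sum>k\<in>UNIV. hess_mat \<alpha> E X j k q * f k q)" by blast+
    have fr: "frame q E" using F q U(3) by (auto simp: frame_on_def)
    have "hess_sol \<alpha> U (f None, f (Some True) \<odot>\<^sub>v E \<oplus>\<^sub>v f (Some False) \<odot>\<^sub>v \<phi> E)"
      by (rule hess_system_sol[OF F U(3) f(1) E f(3)])
    moreover have "Y k q = g Y E q * E k q + g Y (\<phi> E) q * \<phi> E k q" for k
      using onb_span[OF frame_onb[OF fr] Y(1), of k] Y by simp
    ultimately show "\<exists>z. hess_sol \<alpha> U z \<and> (fst z q, \<lambda>k. snd z k q) = v"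
      by (intro exI[of _ "(f None, f (Some True) \<odot>\<^sub>v E \<oplus>\<^sub>v f (Some False) \<odot>\<^sub>v \<phi> E)"]) (simp add: f(2) Y(3))
  qed
next
  fix W z z' q r
  assume W: "open W" "connected W" and s: "hess_sol \<alpha> W z" "hess_sol \<alpha> W z'"
    and q: "q \<in> W" "(fst z q, \<lambda>k. snd z k q) = (fst z' q, \<lambda>k. snd z' k q)" "r \<in> W"
  \<comment> \<open>Agreement of the two values. Near each point it is equivalent to the vanishing
    of the difference of the component vectors, which solves a linear system, so \<open>P\<close> is
    locally constant.\<close>
  define P where "P y \<longleftrightarrow> fst z y = fst z' y \<and> eqv y (snd z) (snd z')" for y
  have zV: "fst z \<in> C" "fst z' \<in> C" "snd z \<in> VF" "snd z' \<in> VF" using s by (auto simp: hess_sol_def)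
  have "P q = P r"
  proof (rule connected_local_const[OF W(2) q(1,3)], intro ballI)
    fix x assume x: "x \<in> W"
    obtain N E where F: "frame_on N E" and xN: "x \<in> N" by (rule frame_exists[of x])
    then have E: "E \<in> VF" and oN: "open (W \<inter> N)" using W(1) by (auto simp: frame_on_def frame_def)
    obtain U where U: "open U" "x \<in> U" "U \<subseteq> W \<inter> N" and un: "\<And>f q q'. (\<And>j. f j \<in> C) \<Longrightarrow>
        (\<And>j q X. q \<in> W \<inter> N \<Longrightarrow> X \<in> VF \<Longrightarrow> X (f j) q = (\<Sum>k\<in>UNIV. hess_mat \<alpha> E X j k q * f k q)) \<Longrightarrow>
        q \<in> U \<Longrightarrow> (\<And>j. f j q = 0) \<Longrightarrow> q' \<in> U \<Longrightarrow> (\<forall>j. f j q' = 0)"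
      by (fact matrix_system_unique_local[where B = "hess_mat \<alpha> E", OF hess_mat_form[OF E] oN IntI[OF x xN]])
    define k where "k j = (\<lambda>y. hess_comp E z j y - hess_comp E z' j y)" for j
    have hC: "hess_comp E z j \<in> C" "hess_comp E z' j \<in> C" for j using zV E by (auto simp: hess_comp_def split: option.split)
    have kC: "k j \<in> C" for j unfolding k_def using hC by (rule C_diff)
    have ksys: "X (k j) y = (\<Sum>l\<in>UNIV. hess_mat \<alpha> E X j l y * k l y)" if "y \<in> W \<inter> N" "X \<in> VF" for j y X
      unfolding k_def VF_diff[OF that(2) hC]
      using hess_comp_system[OF s(1) F _ _ that(2), of y j] hess_comp_system[OF s(2) F _ _ that(2), of y j] that(1)
      by (simp add: sum_subtractf[symmetric] right_diff_distrib)
    have Pk: "P y \<longleftrightarrow> (\<forall>j. k j y = 0)" if y: "y \<in> U" for y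
    proof
      assume "P y"
      then show "\<forall>j. k j y = 0"
        using g_eqv(2)[OF E zV(3,4)] g_eqv(2)[OF phi_VF[OF E] zV(3,4)]
        by (auto simp: k_def P_def hess_comp_def split: option.split)
    next
      assume k: "\<forall>j. k j y = 0"
      have fr: "frame y E" using F y U(3) by (auto simp: frame_on_def)
      have "\<eta> (snd z) y = 0" "\<eta> (snd z') y = 0" using s y U(3) unfolding hess_sol_def by blast+
      then have "eqv y (snd z) (snd z')"
        using k[rule_format, of "Some True"] k[rule_format, of "Some False"] zV
        by (intro eqv_onbI[OF frame_onb[OF fr]]) (simp_all add: k_def)
      then show "P y" using k[rule_format, of None] by (simp add: P_def k_def)
    qed
    have "P x = P y" if y: "y \<in> U" for y
      using Pk[OF U(2)] Pk[OF y] un[OF kC ksys U(2) _ y] un[OF kC ksys y _ U(2)] by blast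
    then show "\<forall>\<^sub>F y in at x within W. P x = P y" unfolding eventually_at_topological using U(1,2) by blast
  qed
  moreover have "P q" using q(2) by (simp add: P_def eqv_def fun_eq_iff)
  ultimately have "P r" by simp
  then show "(fst z r, \<lambda>k. snd z k r) = (fst z' r, \<lambda>k. snd z' k r)" by (simp add: P_def eqv_def)
qed

lemma gaframe_exists:
  assumes chc: "constant_holomorphic_curvature A M D c" and c: "c < -3"
    and sc: "simply_connected (UNIV :: 'a set)" and con: "connected (UNIV :: 'a set)"
  obtains e where "gaframe (sqrt (-(c+3))) e"
proof -
  define \<alpha> where "\<alpha> = sqrt (-(c+3))"
  have \<alpha>: "\<alpha> > 0" "\<alpha> * \<alpha> = -(c+3)" using c by (auto simp: \<alpha>_def)
  interpret local_system "\<lambda>q. {(a :: real, l). \<exists>Y\<in>VF. \<eta> Y q = 0 \<and> l = (\<lambda>k. Y k q)}" "hess_sol \<alpha>" "\<lambda>z q. (fst z q, \<lambda>k. snd z k q)"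
    by (rule hess_local_system[OF chc \<alpha>(2)])
  obtain p0 :: 'a where True by simp
  obtain W0 E0 where "frame_on W0 E0" "p0 \<in> W0" by (rule frame_exists[of p0])
  then have E0: "frame p0 E0" "E0 \<in> VF" by (auto simp: frame_on_def frame_def)
  \<comment> \<open>The value 1 with a gradient of length \<open>\<alpha>\<close> is a null initial
    value for the quadratic form \<open>Q\<close> below.\<close>
  have v0: "(1, \<lambda>k. \<alpha> * E0 k p0) \<in> {(a :: real, l). \<exists>Y\<in>VF. \<eta> Y p0 = 0 \<and> l = (\<lambda>k. Y k p0)}"
    using E0 by (auto simp: frame_def eta_simps intro!: bexI[of _ "(\<lambda>p. \<alpha>) \<odot>\<^sub>v E0"])
  obtain s where s0: "s p0 = (1, \<lambda>k. \<alpha> * E0 k p0)"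
    and s: "\<And>p. \<exists>W z. open W \<and> p \<in> W \<and> hess_sol \<alpha> W z \<and> (\<forall>q\<in>W. s q = (fst z q, \<lambda>k. snd z k q))"
    by (rule monodromy[OF sc v0]) (rule that)
  define f where "f = (\<lambda>q. fst (s q))"
  define Y where "Y = (\<lambda>k q. snd (s q) k)"
  have loc: "\<exists>W z. open W \<and> p \<in> W \<and> hess_sol \<alpha> W z \<and> (\<forall>q\<in>W. f q = fst z q \<and> (\<forall>k. Y k q = snd z k q))" for p
  proof -
    obtain W z where "open W" "p \<in> W" "hess_sol \<alpha> W z" "\<forall>q\<in>W. s q = (fst z q, \<lambda>k. snd z k q)"
      using s[of p] by (elim exE conjE) (rule that)
    then show ?thesis by (intro exI[of _ W] exI[of _ z]) (simp add: f_def Y_def)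
  qed
  have fC: "f \<in> C"
  proof (rule C_local)
    fix p
    obtain W z where "open W" "p \<in> W" "hess_sol \<alpha> W z" "\<forall>q\<in>W. f q = fst z q \<and> (\<forall>k. Y k q = snd z k q)"
      using loc[of p] by (elim exE conjE) (rule that)
    then show "\<exists>W h. open W \<and> p \<in> W \<and> h \<in> C \<and> (\<forall>q\<in>W. f q = h q)"
      by (intro exI[of _ W] exI[of _ "fst z"]) (simp add: hess_sol_def)
  qed
  have YV: "Y \<in> VF"
  proof (rule VF_local)
    fix p
    obtain W z where z: "open W" "p \<in> W" "hess_sol \<alpha> W z" "\<forall>q\<in>W. f q = fst z q \<and> (\<forall>k. Y k q = snd z k q)"
      using loc[of p] by (elim exE conjE) (rule that)
    have zV: "snd z \<in> VF" using z(3) by (simp add: hess_sol_def)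
    show "\<exists>W Z. open W \<and> p \<in> W \<and> Z \<in> VF \<and> (\<forall>q\<in>W. \<forall>k\<in>C. Y k q = Z k q)"
      by (intro exI[of _ W] exI[of _ "snd z"] conjI z(1,2) zV) (use z(4) in simp)
    show "Y k p = 0" if "k \<notin> C" for k using z(2,4) VF_0[OF zV that] by simp
  qed
  have sol: "hess_sol \<alpha> UNIV (f, Y)"
    unfolding hess_sol_def fst_conv snd_conv
  proof (intro conjI ballI fC YV)
    fix q
    obtain W z where z: "open W" "q \<in> W" "hess_sol \<alpha> W z" "\<forall>q\<in>W. f q = fst z q \<and> (\<forall>k. Y k q = snd z k q)"
      using loc[of q] by (elim exE conjE) (rule that)
    have zV: "fst z \<in> C" "snd z \<in> VF" and z0: "\<eta> (snd z) q = 0"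
      and z1: "\<And>X. X \<in> VF \<Longrightarrow> X (fst z) q = g X (snd z) q"
      and z2: "\<And>X Z. X \<in> VF \<Longrightarrow> Z \<in> VF \<Longrightarrow> g (D X (snd z)) Z q = \<alpha> * \<alpha> * fst z q * (g X Z q - \<eta> X q * \<eta> Z q)
         - \<eta> X q * g (\<phi> (snd z)) Z q + g (\<phi> X) (snd z) q * \<eta> Z q"
      using z(2,3) unfolding hess_sol_def by blast+
    have eq: "eqv y Y (snd z)" if "y \<in> W" for y using z(4) that by (simp add: eqv_def)
    have gY: "g X Y y = g X (snd z) y" "g Y X y = g (snd z) X y" if "y \<in> W" "X \<in> VF" for X y
      using g_eqv[OF that(2) YV zV(2) eq[OF that(1)]] by auto
    show "\<eta> Y q = 0" using form_eqv[OF eta_form YV zV(2) eq[OF z(2)]] z0 by simp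
    fix X assume X: "X \<in> VF"
    have "X f q = X (fst z) q" by (rule VF_germ[OF X fC zV(1) z(1,2)]) (use z(4) in auto)
    then show "X f q = g X Y q" using z1[OF X] gY(1)[OF z(2) X] by simp
    fix Z assume Z: "Z \<in> VF"
    have "X (g Y Z) q = X (g (snd z) Z) q"
      by (rule VF_germ[OF X g_C[OF YV Z] g_C[OF zV(2) Z] z(1,2)]) (use gY(2) Z in auto)
    then have "g (D X Y) Z q = g (D X (snd z)) Z q"
      using D_metric[OF X YV Z, of q] D_metric[OF X zV(2) Z, of q] gY(2)[OF z(2) D_VF[OF X Z]] by simp
    moreover have "g (\<phi> Y) Z q = g (\<phi> (snd z)) Z q"
      by (rule g_eqv(2)[OF Z phi_VF[OF YV] phi_VF[OF zV(2)] phi_eqv[OF YV zV(2) eq[OF z(2)]]])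
    ultimately show "g (D X Y) Z q = \<alpha> * \<alpha> * f q * (g X Z q - \<eta> X q * \<eta> Z q) - \<eta> X q * g (\<phi> Y) Z q + g (\<phi> X) Y q * \<eta> Z q"
      using z2[OF X Z] z(2,4) gY(1)[OF z(2) phi_VF[OF X]] by simp
  qed
  then have h0: "\<And>q. \<eta> Y q = 0" and h1: "\<And>X q. X \<in> VF \<Longrightarrow> X f q = g X Y q"
    and h2: "\<And>X Z q. X \<in> VF \<Longrightarrow> Z \<in> VF \<Longrightarrow> g (D X Y) Z q = \<alpha> * \<alpha> * f q * (g X Z q - \<eta> X q * \<eta> Z q)
         - \<eta> X q * g (\<phi> Y) Z q + g (\<phi> X) Y q * \<eta> Z q"
    unfolding hess_sol_def by auto
  \<comment> \<open>The Lorentzian form of the hyperboloid model, up to scaling. It is a first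
    integral of the system, and it vanishes at \<open>p0\<close>, hence everywhere.\<close>
  define Q where "Q = (\<lambda>q. \<alpha> * \<alpha> * (f q * f q) - g Y Y q)"
  have QC: "Q \<in> C" unfolding Q_def by (intro C_diff C_mult C_const fC g_C YV)
  have phiYY: "g (\<phi> Y) Y q = 0" for q using phi_skew[OF YV YV, of q] g_sym[of Y "\<phi> Y" q] YV by simp
  have "X Q q = 0" if X: "X \<in> VF" for X q
  proof -
    have "X Q q = \<alpha> * \<alpha> * (2 * f q * X f q) - X (g Y Y) q"
      unfolding Q_def using VF_diff[OF X C_mult[OF C_const C_mult[OF fC fC]] g_C[OF YV YV]]
        VF_cmult[OF X C_mult[OF fC fC]] VF_mult[OF X fC fC] by simp
    moreover have "X (g Y Y) q = 2 * g (D X Y) Y q" using D_metric[OF X YV YV, of q] g_sym[of Y "D X Y" q] X YV by simp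
    ultimately show ?thesis using h1[OF X] h2[OF X YV] h0 phiYY by simp
  qed
  then have Qc: "Q q = Q p0" for q by (rule deriv_zero_imp_const[OF con QC])
  have "eqv p0 Y ((\<lambda>p. \<alpha>) \<odot>\<^sub>v E0)" by (simp add: eqv_def Y_def s0)
  then have "g Y Y p0 = \<alpha> * (\<alpha> * g E0 E0 p0)"
    using g_eqv(1)[OF YV YV, of "(\<lambda>p. \<alpha>) \<odot>\<^sub>v E0"] g_eqv(2)[OF _ YV, of "(\<lambda>p. \<alpha>) \<odot>\<^sub>v E0" "(\<lambda>p. \<alpha>) \<odot>\<^sub>v E0" p0] E0 YV
    by (simp add: g_simps)
  then have "Q p0 = 0" using E0(1) by (simp add: Q_def frame_def f_def s0)
  then have YY: "g Y Y q = \<alpha> * \<alpha> * (f q * f q)" for q using Qc[of q] by (simp add: Q_def)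
  \<comment> \<open>As \<open>Q\<close> is 0, a zero of \<open>f\<close> would also be a zero of
    \<open>Y\<close>, and uniqueness would make the whole solution vanish, against its value at
    \<open>p0\<close>.\<close>
  have f0: "f q \<noteq> 0" for q
  proof
    assume z: "f q = 0"
    then have "eqv q Y vzero" by (intro g_null_eqv[OF YV]) (simp add: YY)
    moreover have "hess_sol \<alpha> UNIV ((\<lambda>p. 0), vzero)"
      unfolding hess_sol_def fst_conv snd_conv
      using VF_const conn_zero[OF conn] by (auto simp: g_zero eta_simps phi_zero)
    ultimately have "(fst (f, Y) p0, \<lambda>k. snd (f, Y) k p0) = (fst ((\<lambda>p. 0::real), vzero) p0, \<lambda>k. snd ((\<lambda>p. 0::real), vzero) k p0)"
      using uniq[OF open_UNIV con sol, of "((\<lambda>p. 0), vzero)" q p0] z by (simp add: eqv_def)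
    then show False by (simp add: f_def s0)
  qed
  define h where "h q = - 1 / (\<alpha> * f q)" for q
  have hC: "h \<in> C" unfolding h_def[abs_def] by (rule C_divide) (use fC f0 \<alpha> in auto)
  define e where "e = h \<odot>\<^sub>v Y"
  have e: "e \<in> VF" using hC YV by (simp add: e_def)
  have hf: "h q * f q * \<alpha> = -1" for q using f0[of q] \<alpha>(1) by (simp add: h_def)
  have gee: "h q * (h q * g Y Y q) = 1" for q
  proof -
    have "h q * (h q * g Y Y q) = (h q * f q * \<alpha>) * (h q * f q * \<alpha>)" by (simp add: YY)
    then show ?thesis by (simp add: hf)
  qed
  have fr: "frame q e" for q
    unfolding frame_def using e hC YV h0 gee by (simp add: e_def g_simps eta_simps)
  have "gaframe \<alpha> e"
    unfolding gaframe_def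
  proof (intro conjI allI ballI fr)
    fix X q assume X: "X \<in> VF"
    have phie: "\<phi> e = h \<odot>\<^sub>v \<phi> Y" unfolding e_def using hC YV by (rule phi_scale)
    have "g (D X e) (\<phi> e) q = X h q * (h q * g Y (\<phi> Y) q) + h q * g (D X Y) (\<phi> e) q"
      unfolding phie using X hC YV VF_C[OF X hC] by (simp add: e_def D_scale g_simps algebra_simps)
    also have "\<dots> = h q * (\<alpha> * \<alpha> * f q * g X (\<phi> e) q - \<eta> X q * (h q * g (\<phi> Y) (\<phi> Y) q))"
      using phi_skew[OF YV YV, of q] phiYY h2[OF X phi_VF[OF e], of q] hC YV X e by (simp add: phie g_simps eta_simps)
    also have "g (\<phi> Y) (\<phi> Y) q = g Y Y q" using YV h0 by (simp add: g_phi)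
    also have "h q * (\<alpha> * \<alpha> * f q * g X (\<phi> e) q - \<eta> X q * (h q * g Y Y q)) =
        (h q * f q * \<alpha>) * \<alpha> * g X (\<phi> e) q - \<eta> X q * (h q * (h q * g Y Y q))" by (simp add: algebra_simps)
    finally show "g (D X e) (\<phi> e) q = - \<eta> X q - \<alpha> * g X (\<phi> e) q" unfolding hf gee by simp
  qed
  then show thesis using that by (simp add: \<alpha>_def)
qed

end

subsection \<open>Completeness\<close>

lemma Cinf_on_real_deriv:
  assumes "Cinf_on f (UNIV :: real set)"
  shows "(f has_real_derivative deriv f t) (at t)" "continuous_on UNIV (deriv f)"
proof -
  have D: "(f has_real_derivative frechet_derivative f (at t) 1) (at t)" for t
  proof (rule has_derivative_imp_has_field_derivative)
    show F: "(f has_derivative frechet_derivative f (at t)) (at t)" by (rule Cinf_on_has_derivative[OF assms UNIV_I])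
    show "u * frechet_derivative f (at t) 1 = frechet_derivative f (at t) u" for u
      using linear_cmul[OF bounded_linear.linear[OF has_derivative_bounded_linear[OF F]], of u 1] by simp
  qed
  then have d: "deriv f = (\<lambda>t. frechet_derivative f (at t) 1)" by (auto intro: DERIV_imp_deriv)
  show "(f has_real_derivative deriv f t) (at t)" using D d by simp
  show "continuous_on UNIV (deriv f)" unfolding d by (rule Cinf_on_imp_continuous[OF Cinf_on_deriv[OF assms]])
qed

context sasaki begin

definition "vel \<gamma> t X \<longleftrightarrow> X \<in> VF \<and> (\<forall>f\<in>C. ((\<lambda>s. f (\<gamma> s)) has_real_derivative X f (\<gamma> t)) (at t))"

abbreviation "spd \<equiv> speed A g"
abbreviation "dst \<equiv> riemannian_dist A g"

lemma smooth_curveD: "smooth_curve A \<gamma> \<Longrightarrow> f \<in> C \<Longrightarrow> Cinf_on (\<lambda>t. f (\<gamma> t)) UNIV"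
  by (auto simp: smooth_curve_def o_def)

lemma smooth_curveI: "(\<And>f. f \<in> C \<Longrightarrow> Cinf_on (\<lambda>t. f (\<gamma> t)) UNIV) \<Longrightarrow> smooth_curve A \<gamma>"
  by (auto simp: smooth_curve_def o_def)

lemma speed_eq:
  assumes "vel \<gamma> t X" shows "spd \<gamma> t = sqrt (g X X (\<gamma> t))"
proof -
  have X: "X \<in> VF" and dX: "\<And>f. f \<in> C \<Longrightarrow> ((\<lambda>s. f (\<gamma> s)) has_real_derivative X f (\<gamma> t)) (at t)"
    using assms by (auto simp: vel_def)
  have "(\<exists>X\<in>VF. (\<forall>f\<in>C. ((\<lambda>s. f (\<gamma> s)) has_real_derivative X f (\<gamma> t)) (at t)) \<and> s = sqrt (g X X (\<gamma> t))) \<longleftrightarrow>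
      s = sqrt (g X X (\<gamma> t))" (is "?l \<longleftrightarrow> ?r") for s
  proof
    assume ?r then show ?l using X dX by blast
  next
    assume ?l
    then obtain Y where Y: "Y \<in> VF" "\<forall>f\<in>C. ((\<lambda>s. f (\<gamma> s)) has_real_derivative Y f (\<gamma> t)) (at t)" "s = sqrt (g Y Y (\<gamma> t))"
      by (elim bexE conjE) (rule that)
    have "Y f (\<gamma> t) = X f (\<gamma> t)" for f
    proof (cases "f \<in> C")
      case True
      show ?thesis by (rule DERIV_unique[OF Y(2)[rule_format, OF True] dX[OF True]])
    qed (use VF_0[OF X] VF_0[OF Y(1)] in simp)
    then have "eqv (\<gamma> t) Y X" by (simp add: eqv_def)
    then show ?r using g_eqv(1)[OF Y(1) Y(1) X] g_eqv(2)[OF X Y(1) X] Y(1) X Y(3) by (metis)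
  qed
  then show ?thesis unfolding speed_def o_def by simp
qed

text \<open>Smooth curves are defined through the smooth functions along them, so their continuity
  has to be tested with a cutoff.\<close>

lemma curve_nbhd:
  assumes \<gamma>: "smooth_curve A \<gamma>" and V: "open V" "\<gamma> t \<in> V"
  obtains T where "open T" "t \<in> T" "\<gamma> ` T \<subseteq> V"
proof -
  obtain k K W where k: "k \<in> C" "K \<subseteq> V" "\<gamma> t \<in> W" "\<And>q. q \<in> W \<Longrightarrow> k q = 1" "\<And>q. q \<notin> K \<Longrightarrow> k q = 0"
    by (rule cutoff_exists[OF V]) blast
  have "continuous_on UNIV (\<lambda>s. k (\<gamma> s))" by (rule Cinf_on_imp_continuous[OF smooth_curveD[OF \<gamma> k(1)]])
  then have "open ((\<lambda>s. k (\<gamma> s)) -` {1/2<..})" by (simp add: open_vimage)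
  moreover have "k (\<gamma> s) > 1/2 \<Longrightarrow> \<gamma> s \<in> V" for s using k(2,5) by force
  ultimately show thesis using k(3,4) by (intro that[of "(\<lambda>s. k (\<gamma> s)) -` {1/2<..}"]) auto
qed

lemma vel_coords:
  assumes cc: "coords W a r G h d" and \<gamma>: "smooth_curve A \<gamma>" and T: "open T" "\<gamma> ` T \<subseteq> W" "t \<in> T"
  shows "vel \<gamma> t (vsum Basis (\<lambda>b. (\<lambda>p. deriv (\<lambda>s. h b (\<gamma> s)) t) \<odot>\<^sub>v d b))"
  unfolding vel_def
proof (intro conjI ballI)
  note c = coordsD[OF cc]
  show "vsum Basis (\<lambda>b. (\<lambda>p. deriv (\<lambda>s. h b (\<gamma> s)) t) \<odot>\<^sub>v d b) \<in> VF" using c(6) by (intro vsum_VF) auto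
  fix f assume f: "f \<in> C"
  define x where "x s = (\<Sum>b\<in>Basis. h b (\<gamma> s) *\<^sub>R b)" for s
  let ?c = "\<lambda>b. deriv (\<lambda>s. h b (\<gamma> s)) t"
  have x: "x s \<in> ball a r \<and> G (x s) = \<gamma> s" if "s \<in> T" for s
  proof -
    have "\<gamma> s \<in> G ` ball a r" using that T(2) unfolding c(3)[symmetric] by auto
    then obtain y where y: "y \<in> ball a r" "\<gamma> s = G y" by (elim imageE)
    then have "x s = y" unfolding x_def using c(7) by (simp add: euclidean_representation)
    then show ?thesis using y by simp
  qed
  have hd: "((\<lambda>s. h b (\<gamma> s)) has_derivative (\<lambda>u. u * ?c b)) (at t)" if "b \<in> Basis" for b
    using Cinf_on_real_deriv(1)[OF smooth_curveD[OF \<gamma> c(5)[OF that]], of t]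
    unfolding has_field_derivative_def by (simp only: mult.commute[of _ "?c b"])
  have xd: "(x has_derivative (\<lambda>u. \<Sum>b\<in>Basis. (u * ?c b) *\<^sub>R b)) (at t)"
    unfolding x_def by (intro has_derivative_sum has_derivative_scaleR_left hd)
  have "((\<lambda>s. f (G (x s))) has_derivative (\<lambda>u. \<Sum>b\<in>Basis. ((\<Sum>b\<in>Basis. (u * ?c b) *\<^sub>R b) \<bullet> b) * d b f (G (x t)))) (at t)"
    using diff_chain_at[OF xd c(9)[OF f conjunct1[OF x[OF T(3)]]]] by (simp add: o_def)
  then have "((\<lambda>s. f (\<gamma> s)) has_derivative (\<lambda>u. \<Sum>b\<in>Basis. ((\<Sum>b\<in>Basis. (u * ?c b) *\<^sub>R b) \<bullet> b) * d b f (G (x t)))) (at t)"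
    by (rule has_derivative_cong_open[OF _ T(1,3)]) (use x in auto)
  moreover have "(\<lambda>u. \<Sum>b\<in>Basis. ((\<Sum>b\<in>Basis. (u * ?c b) *\<^sub>R b) \<bullet> b) * d b f (G (x t))) =
      (*) (vsum Basis (\<lambda>b. (\<lambda>p. ?c b) \<odot>\<^sub>v d b) f (\<gamma> t))"
    using x[OF T(3)] by (auto simp: fun_eq_iff vsum_def vscale_def sum_distrib_left sum_distrib_right mult_ac intro!: sum.cong)
  ultimately show "((\<lambda>s. f (\<gamma> s)) has_real_derivative vsum Basis (\<lambda>b. (\<lambda>p. ?c b) \<odot>\<^sub>v d b) f (\<gamma> t)) (at t)"
    by (simp add: has_field_derivative_def)
qed

lemma velE:
  assumes \<gamma>: "smooth_curve A \<gamma>" obtains X where "vel \<gamma> t X"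
proof -
  obtain W a r G h d where cc: "coords W (a :: real^3) r G h d" "\<gamma> t \<in> W" by (rule coords_exist[OF open_UNIV UNIV_I])
  obtain T where T: "open T" "t \<in> T" "\<gamma> ` T \<subseteq> W" by (rule curve_nbhd[OF \<gamma> coordsD(1)[OF cc(1)] cc(2)])
  show thesis by (rule that[OF vel_coords[OF cc(1) \<gamma> T(1,3,2)]])
qed

lemma g_vsum: "X \<in> VF \<Longrightarrow> finite I \<Longrightarrow> (\<And>i. i \<in> I \<Longrightarrow> Y i \<in> VF) \<Longrightarrow>
    g X (vsum I (\<lambda>i. (\<lambda>p. c i) \<odot>\<^sub>v Y i)) p = (\<Sum>i\<in>I. c i * g X (Y i) p)"
  "X \<in> VF \<Longrightarrow> finite I \<Longrightarrow> (\<And>i. i \<in> I \<Longrightarrow> Y i \<in> VF) \<Longrightarrow>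
    g (vsum I (\<lambda>i. (\<lambda>p. c i) \<odot>\<^sub>v Y i)) X p = (\<Sum>i\<in>I. c i * g (Y i) X p)"
proof -
  assume *: "X \<in> VF" "finite I" "\<And>i. i \<in> I \<Longrightarrow> Y i \<in> VF"
  show 1: "g X (vsum I (\<lambda>i. (\<lambda>p. c i) \<odot>\<^sub>v Y i)) p = (\<Sum>i\<in>I. c i * g X (Y i) p)"
    using form_vsum[OF g_form[OF *(1)], of I "\<lambda>i. (\<lambda>p. c i) \<odot>\<^sub>v Y i" p] * by (simp add: g_simps)
  have "vsum I (\<lambda>i. (\<lambda>p. c i) \<odot>\<^sub>v Y i) \<in> VF" by (rule vsum_VF) (use * in auto)
  then show "g (vsum I (\<lambda>i. (\<lambda>p. c i) \<odot>\<^sub>v Y i)) X p = (\<Sum>i\<in>I. c i * g (Y i) X p)"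
    using 1 * g_sym by (simp cong: sum.cong)
qed

lemma speed_continuous:
  assumes \<gamma>: "smooth_curve A \<gamma>" shows "continuous_on UNIV (spd \<gamma>)"
proof -
  have "\<exists>T. open T \<and> t \<in> T \<and> continuous_on T (spd \<gamma>)" for t
  proof -
    obtain W a r G h d where cc: "coords W (a :: real^3) r G h d" "\<gamma> t \<in> W" by (rule coords_exist[OF open_UNIV UNIV_I])
    note c = coordsD[OF cc(1)]
    obtain T where T: "open T" "t \<in> T" "\<gamma> ` T \<subseteq> W" by (rule curve_nbhd[OF \<gamma> c(1) cc(2)])
    let ?c = "\<lambda>b. deriv (\<lambda>s. h b (\<gamma> s))"
    have V: "vsum Basis (\<lambda>b. (\<lambda>p. ?c b s) \<odot>\<^sub>v d b) \<in> VF" for s using c(6) by (intro vsum_VF) auto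
    have s: "spd \<gamma> s = sqrt (\<Sum>b\<in>Basis. ?c b s * (\<Sum>b'\<in>Basis. ?c b' s * g (d b') (d b) (\<gamma> s)))" if "s \<in> T" for s
      unfolding speed_eq[OF vel_coords[OF cc(1) \<gamma> T(1,3) that]] using c(6) V by (simp add: g_vsum)
    have "continuous_on T (\<lambda>s. g (d b) (d b') (\<gamma> s))" for b b'
      using Cinf_on_imp_continuous[OF smooth_curveD[OF \<gamma> g_C[OF c(6) c(6)]]] continuous_on_subset by blast
    moreover have "continuous_on T (?c b)" if "b \<in> Basis" for b
      using Cinf_on_real_deriv(2)[OF smooth_curveD[OF \<gamma> c(5)[OF that]]] continuous_on_subset by blast
    ultimately have "continuous_on T (\<lambda>s. sqrt (\<Sum>b\<in>Basis. ?c b s * (\<Sum>b'\<in>Basis. ?c b' s * g (d b') (d b) (\<gamma> s))))"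
      by (intro continuous_intros) auto
    then have "continuous_on T (spd \<gamma>)" using s by (simp cong: continuous_on_cong)
    then show ?thesis using T by blast
  qed
  then show ?thesis by (meson UNIV_I continuous_at_imp_continuous_on continuous_on_eq_continuous_at)
qed

lemma arc_length:
  assumes \<gamma>: "smooth_curve A \<gamma>" obtains L where "\<And>t. (L has_real_derivative spd \<gamma> t) (at t)"
proof -
  have "\<exists>L. \<forall>t::real. -\<infinity> < ereal t \<longrightarrow> ereal t < \<infinity> \<longrightarrow> (L has_vector_derivative spd \<gamma> t) (at t)"
    by (rule einterval_antiderivative) (use speed_continuous[OF \<gamma>] in \<open>auto simp: continuous_on_eq_continuous_at\<close>)
  then show thesis using that by (auto simp: has_real_derivative_iff_has_vector_derivative)
qed

lemma speed_nonneg: assumes "smooth_curve A \<gamma>" shows "spd \<gamma> t \<ge> 0"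
proof -
  obtain X where X: "vel \<gamma> t X" by (rule velE[OF assms])
  then show ?thesis using g_nonneg[of X "\<gamma> t"] by (simp add: speed_eq vel_def)
qed

lemma vel_compose:
  assumes "vel \<gamma> (h t) X" "(h has_real_derivative h') (at t)"
  shows "vel (\<lambda>t. \<gamma> (h t)) t ((\<lambda>p. h') \<odot>\<^sub>v X)"
  unfolding vel_def
proof (intro conjI ballI vscale_VF C_const)
  show "X \<in> VF" using assms(1) by (simp add: vel_def)
  fix f assume "f \<in> C"
  then have "((\<lambda>s. f (\<gamma> s)) has_real_derivative X f (\<gamma> (h t))) (at (h t))" using assms(1) by (simp add: vel_def)
  from DERIV_chain2[OF this assms(2)]
  show "((\<lambda>s. f (\<gamma> (h s))) has_real_derivative ((\<lambda>p. h') \<odot>\<^sub>v X) f (\<gamma> (h t))) (at t)" by (simp add: vscale_def mult.commute)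
qed

lemma smooth_curve_compose:
  assumes "smooth_curve A \<gamma>" "Cinf_on h (UNIV :: real set)" shows "smooth_curve A (\<lambda>t. \<gamma> (h t))"
  by (rule smooth_curveI, rule Cinf_on_compose_real[OF open_UNIV open_UNIV _ smooth_curveD[OF assms(1)] assms(2)]) auto

text \<open>\<open>L\<close> is an arc length function of \<open>\<gamma>\<close>, and
  \<open>\<epsilon>\<close> records whether \<open>h\<close> increases or decreases; so one
  statement covers concatenation and reversal of curves.\<close>

lemma reparam_length:
  assumes \<gamma>: "smooth_curve A \<gamma>" and L: "\<And>t. (L has_real_derivative spd \<gamma> t) (at t)"
    and h: "\<And>t. (h has_real_derivative h' t) (at t)" "\<And>t. \<epsilon> * h' t \<ge> 0" "\<epsilon> = 1 \<or> \<epsilon> = -1" and ab: "a \<le> b"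
  shows "(spd (\<lambda>t. \<gamma> (h t)) has_integral \<epsilon> * L (h b) - \<epsilon> * L (h a)) {a..b}"
proof (rule fundamental_theorem_of_calculus[OF ab])
  fix t
  obtain X where X: "vel \<gamma> (h t) X" by (rule velE[OF \<gamma>])
  then have XV: "X \<in> VF" by (simp add: vel_def)
  have "spd (\<lambda>t. \<gamma> (h t)) t = sqrt (h' t * h' t * g X X (\<gamma> (h t)))"
    unfolding speed_eq[OF vel_compose[OF X h(1)]] using XV by (simp add: g_simps mult.assoc)
  also have "\<dots> = \<epsilon> * h' t * spd \<gamma> (h t)"
    using h(2)[of t] h(3) by (auto simp: real_sqrt_mult speed_eq[OF X])
  finally have s: "spd (\<lambda>t. \<gamma> (h t)) t = \<epsilon> * (spd \<gamma> (h t) * h' t)" by (simp add: mult.commute)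
  have "((\<lambda>t. \<epsilon> * L (h t)) has_real_derivative \<epsilon> * (spd \<gamma> (h t) * h' t)) (at t)"
    by (intro DERIV_cmult DERIV_chain2[OF L h(1)])
  then show "((\<lambda>t. \<epsilon> * L (h t)) has_vector_derivative spd (\<lambda>t. \<gamma> (h t)) t) (at t within {a..b})"
    unfolding s by (simp add: has_real_derivative_iff_has_vector_derivative has_vector_derivative_at_within)
qed

definition "curve p q \<gamma> \<longleftrightarrow> smooth_curve A \<gamma> \<and> \<gamma> 0 = p \<and> \<gamma> 1 = q"

lemma length_eq:
  assumes \<gamma>: "smooth_curve A \<gamma>" and L: "\<And>t. (L has_real_derivative spd \<gamma> t) (at t)"
  shows "integral {0..1} (spd \<gamma>) = L 1 - L 0"
  using integral_unique[OF reparam_length[OF \<gamma> L, of "\<lambda>t. t" "\<lambda>t. 1" 1 0 1]] by simp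

lemma speed_cong:
  assumes \<gamma>: "smooth_curve A \<gamma>" and T: "open T" "t \<in> T" "\<And>s. s \<in> T \<Longrightarrow> \<gamma> s = \<sigma> s"
  shows "spd \<sigma> t = spd \<gamma> t"
proof -
  obtain X where X: "vel \<gamma> t X" by (rule velE[OF \<gamma>])
  have "vel \<sigma> t X" unfolding vel_def
  proof (intro conjI ballI)
    fix f assume f: "f \<in> C"
    have "((\<lambda>s. f (\<gamma> s)) has_real_derivative X f (\<sigma> t)) (at t)" using X f T by (simp add: vel_def)
    then show "((\<lambda>s. f (\<sigma> s)) has_real_derivative X f (\<sigma> t)) (at t)"
      unfolding has_field_derivative_def by (rule has_derivative_cong_open[OF _ T(1,2)]) (use T(3) in auto)
  qed (use X in \<open>simp add: vel_def\<close>)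
  then show ?thesis using X T by (simp add: speed_eq)
qed

lemma smooth_step_deriv:
  "(smooth_step has_real_derivative deriv smooth_step t) (at t)" "deriv smooth_step t \<ge> 0"
proof -
  show D: "(smooth_step has_real_derivative deriv smooth_step t) (at t)" by (rule Cinf_on_real_deriv(1)[OF Cinf_on_smooth_step])
  show "deriv smooth_step t \<ge> 0"
    by (rule mono_on_imp_deriv_nonneg[OF _ D, of UNIV]) (auto simp: mono_on_def smooth_step_mono)
qed

lemma curve_concat:
  assumes 1: "curve p q \<gamma>1" and 2: "curve q r \<gamma>2"
  obtains \<sigma> where "curve p r \<sigma>" "integral {0..1} (spd \<sigma>) = integral {0..1} (spd \<gamma>1) + integral {0..1} (spd \<gamma>2)"
proof -
  \<comment> \<open>The first reparametrisation has arrived at 1 when \<open>t = 1/3\<close>, the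
    second leaves 0 at \<open>t = 2/3\<close>. In between both curves rest at \<open>q\<close>,
    which makes the concatenation smooth.\<close>
  let ?h1 = "\<lambda>t. smooth_step (3 * t)" and ?h2 = "\<lambda>t. smooth_step (3 * t - 2)"
  define \<sigma> where "\<sigma> t = (if t < 1/2 then \<gamma>1 (?h1 t) else \<gamma>2 (?h2 t))" for t :: real
  have s1: "\<gamma>1 (?h1 t) = \<sigma> t" if "t \<in> {..<2/3}" for t
    using that 1 2 smooth_step_ge_1[of "3 * t"] smooth_step_le_0[of "3 * t - 2"] by (auto simp: \<sigma>_def curve_def)
  have s2: "\<gamma>2 (?h2 t) = \<sigma> t" if "t \<in> {1/3<..}" for t
    using that 1 2 smooth_step_ge_1[of "3 * t"] smooth_step_le_0[of "3 * t - 2"] by (auto simp: \<sigma>_def curve_def)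
  have D1: "(?h1 has_real_derivative deriv smooth_step (3 * t) * 3) (at t)" for t
    by (rule DERIV_chain2[OF smooth_step_deriv(1)]) (auto intro!: derivative_eq_intros)
  have D2: "(?h2 has_real_derivative deriv smooth_step (3 * t - 2) * 3) (at t)" for t
    by (rule DERIV_chain2[OF smooth_step_deriv(1)]) (auto intro!: derivative_eq_intros)
  have C1: "smooth_curve A (\<lambda>t. \<gamma>1 (?h1 t))"
    by (rule smooth_curve_compose, use 1 in \<open>simp add: curve_def\<close>)
      (intro Cinf_on_compose_real[OF open_UNIV open_UNIV _ Cinf_on_smooth_step] Cinf_on_mult Cinf_on_const Cinf_on_id open_UNIV, auto)
  have C2: "smooth_curve A (\<lambda>t. \<gamma>2 (?h2 t))"
    by (rule smooth_curve_compose, use 2 in \<open>simp add: curve_def\<close>)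
      (intro Cinf_on_compose_real[OF open_UNIV open_UNIV _ Cinf_on_smooth_step] Cinf_on_diff Cinf_on_mult Cinf_on_const Cinf_on_id open_UNIV, auto)
  have "smooth_curve A \<sigma>"
  proof (rule smooth_curveI, rule Cinf_on_local)
    fix f and t :: real assume f: "f \<in> C"
    show "\<exists>T. open T \<and> t \<in> T \<and> Cinf_on (\<lambda>t. f (\<sigma> t)) T"
    proof (cases "t < 2/3")
      case True
      have "Cinf_on (\<lambda>t. f (\<sigma> t)) {..<2/3}"
        using Cinf_on_subset[OF smooth_curveD[OF C1 f] subset_UNIV] Cinf_on_cong[OF open_lessThan, of "2/3" "\<lambda>t. f (\<gamma>1 (?h1 t))" "\<lambda>t. f (\<sigma> t)"] s1 by simp
      then show ?thesis using True by (intro exI[of _ "{..<2/3}"]) simp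
    next
      case False
      have "Cinf_on (\<lambda>t. f (\<sigma> t)) {1/3<..}"
        using Cinf_on_subset[OF smooth_curveD[OF C2 f] subset_UNIV] Cinf_on_cong[OF open_greaterThan, of "1/3" "\<lambda>t. f (\<gamma>2 (?h2 t))" "\<lambda>t. f (\<sigma> t)"] s2 by simp
      then show ?thesis using False by (intro exI[of _ "{1/3<..}"]) simp
    qed
  qed
  moreover have "\<sigma> 0 = p" "\<sigma> 1 = r" using 1 2 smooth_step_ge_1[of 1] smooth_step_le_0[of 0] by (auto simp: \<sigma>_def curve_def)
  ultimately have "curve p r \<sigma>" by (simp add: curve_def)
  moreover have "integral {0..1} (spd \<sigma>) = integral {0..1} (spd \<gamma>1) + integral {0..1} (spd \<gamma>2)"
  proof -
    have g1: "smooth_curve A \<gamma>1" and g2: "smooth_curve A \<gamma>2" using 1 2 by (auto simp: curve_def)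
    obtain L1 where L1: "\<And>t. (L1 has_real_derivative spd \<gamma>1 t) (at t)" by (rule arc_length[OF g1]) (rule that)
    obtain L2 where L2: "\<And>t. (L2 has_real_derivative spd \<gamma>2 t) (at t)" by (rule arc_length[OF g2]) (rule that)
    have "(spd (\<lambda>t. \<gamma>1 (?h1 t)) has_integral 1 * L1 (?h1 (1/2)) - 1 * L1 (?h1 0)) {0..1/2}"
      by (rule reparam_length[OF g1 L1 D1]) (use smooth_step_deriv(2) in auto)
    moreover have "spd (\<lambda>t. \<gamma>1 (?h1 t)) t = spd \<sigma> t" if "t \<in> {0..1/2}" for t
      by (rule speed_cong[OF C1, of "{..<2/3}", symmetric]) (use that s1 in auto)
    ultimately have "(spd \<sigma> has_integral 1 * L1 (?h1 (1/2)) - 1 * L1 (?h1 0)) {0..1/2}" by (rule has_integral_eq[rotated])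
    then have I1: "(spd \<sigma> has_integral L1 1 - L1 0) {0..1/2}"
      using smooth_step_ge_1[of "3/2"] smooth_step_le_0[of 0] by simp
    have "(spd (\<lambda>t. \<gamma>2 (?h2 t)) has_integral 1 * L2 (?h2 1) - 1 * L2 (?h2 (1/2))) {1/2..1}"
      by (rule reparam_length[OF g2 L2 D2]) (use smooth_step_deriv(2) in auto)
    moreover have "spd (\<lambda>t. \<gamma>2 (?h2 t)) t = spd \<sigma> t" if "t \<in> {1/2..1}" for t
      by (rule speed_cong[OF C2, of "{1/3<..}", symmetric]) (use that s2 in auto)
    ultimately have "(spd \<sigma> has_integral 1 * L2 (?h2 1) - 1 * L2 (?h2 (1/2))) {1/2..1}" by (rule has_integral_eq[rotated])
    then have "(spd \<sigma> has_integral L2 1 - L2 0) {1/2..1}"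
      using smooth_step_ge_1[of 1] smooth_step_le_0[of "-1/2"] by simp
    from has_integral_combine[OF _ _ I1 this] show ?thesis
      unfolding length_eq[OF g1 L1] length_eq[OF g2 L2] by (simp add: integral_unique)
  qed
  ultimately show thesis by (rule that)
qed

lemma curve_reverse:
  assumes 1: "curve p q \<gamma>"
  shows "curve q p (\<lambda>t. \<gamma> (1 - t))" "integral {0..1} (spd (\<lambda>t. \<gamma> (1 - t))) = integral {0..1} (spd \<gamma>)"
proof -
  have g1: "smooth_curve A \<gamma>" using 1 by (auto simp: curve_def)
  obtain L where L: "\<And>t. (L has_real_derivative spd \<gamma> t) (at t)" by (rule arc_length[OF g1]) (rule that)
  have "smooth_curve A (\<lambda>t. \<gamma> (1 - t))"
    by (rule smooth_curve_compose[OF g1]) (intro Cinf_on_diff Cinf_on_const Cinf_on_id open_UNIV)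
  then show "curve q p (\<lambda>t. \<gamma> (1 - t))" using 1 by (simp add: curve_def)
  have "((\<lambda>t. 1 - t) has_real_derivative -1) (at t)" for t :: real by (auto intro!: derivative_eq_intros)
  from integral_unique[OF reparam_length[OF g1 L this, of "-1" 0 1]]
  show "integral {0..1} (spd (\<lambda>t. \<gamma> (1 - t))) = integral {0..1} (spd \<gamma>)" by (simp add: length_eq[OF g1 L])
qed

lemma coords_curve:
  assumes cc: "coords W (a :: real^3) r G h d" and "p \<in> W" "q \<in> W"
  obtains \<gamma> where "curve p q \<gamma>"
proof -
  note c = coordsD[OF cc]
  obtain x y where xy: "x \<in> ball a r" "y \<in> ball a r" "p = G x" "q = G y" using assms(2,3) c(3) by blast
  let ?\<gamma> = "\<lambda>t. x + smooth_step t *\<^sub>R (y - x)"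
  have "?\<gamma> t = (1 - smooth_step t) *\<^sub>R x + smooth_step t *\<^sub>R y" for t by (simp add: algebra_simps)
  then have b: "?\<gamma> ` UNIV \<subseteq> ball a r"
    using convexD_alt[OF convex_ball xy(1,2)] smooth_step_bounds by auto
  have "smooth_curve A (\<lambda>t. G (?\<gamma> t))"
    by (rule smooth_curveI, rule Cinf_on_compose[OF open_UNIV open_ball b c(8)])
      (auto simp: inner_add_left intro!: Cinf_on_add Cinf_on_mult Cinf_on_smooth_step)
  then have "curve p q (\<lambda>t. G (?\<gamma> t))" using xy by (simp add: curve_def smooth_step_le_0 smooth_step_ge_1)
  then show thesis by (rule that)
qed

lemma curve_exists:
  assumes con: "connected (UNIV :: 'a set)" shows "\<exists>\<gamma>. curve p q \<gamma>"
proof -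
  let ?S = "{q. \<exists>\<gamma>. curve p q \<gamma>}"
  have loc: "\<exists>W. open W \<and> q \<in> W \<and> (\<forall>q'\<in>W. \<forall>q''\<in>W. q' \<in> ?S \<longrightarrow> q'' \<in> ?S)" for q
  proof -
    obtain W a r G h d where cc: "coords W (a :: real^3) r G h d" "q \<in> W" by (rule coords_exist[OF open_UNIV UNIV_I])
    have "q'' \<in> ?S" if q: "q' \<in> W" "q'' \<in> W" "q' \<in> ?S" for q' q''
    proof -
      obtain \<gamma> where 1: "curve q' q'' \<gamma>" by (rule coords_curve[OF cc(1) q(1,2)])
      obtain \<gamma>' where 2: "curve p q' \<gamma>'" using q(3) by blast
      show ?thesis by (rule curve_concat[OF 2 1]) blast
    qed
    then show ?thesis using coordsD(1)[OF cc(1)] cc(2) by blast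
  qed
  have "open ?S"
  proof (subst open_subopen, intro ballI)
    fix q assume q: "q \<in> ?S"
    obtain W where "open W" "q \<in> W" "\<forall>q'\<in>W. \<forall>q''\<in>W. q' \<in> ?S \<longrightarrow> q'' \<in> ?S" using loc[of q] by (elim exE conjE) (rule that)
    then show "\<exists>T. open T \<and> q \<in> T \<and> T \<subseteq> ?S" using q by (intro exI[of _ W] conjI subsetI) blast+
  qed
  moreover have "open (- ?S)"
  proof (subst open_subopen, intro ballI)
    fix q assume q: "q \<in> - ?S"
    obtain W where W: "open W" "q \<in> W" "\<forall>q'\<in>W. \<forall>q''\<in>W. q' \<in> ?S \<longrightarrow> q'' \<in> ?S" using loc[of q] by (elim exE conjE) (rule that)
    have "W \<subseteq> - ?S" using W(2,3) q by (metis (no_types, lifting) ComplD ComplI subsetI)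
    then show "\<exists>T. open T \<and> q \<in> T \<and> T \<subseteq> - ?S" using W(1,2) by (intro exI[of _ W]) simp
  qed
  moreover have "p \<in> ?S" using smooth_curveI[of "\<lambda>t. p"] by (auto simp: curve_def intro!: exI[of _ "\<lambda>t. p"])
  ultimately have "- ?S \<inter> UNIV = {}" using connectedD[OF con, of ?S "- ?S"] by (metis Compl_disjoint Compl_partition IntI Int_empty_left UNIV_I empty_iff subset_UNIV)
  then show ?thesis by auto
qed

lemma dst_eq: "dst p q = Inf ((\<lambda>\<gamma>. integral {0..1} (spd \<gamma>)) ` {\<gamma>. curve p q \<gamma>})"
  unfolding riemannian_dist_def curve_def by (rule arg_cong[of _ _ Inf]) auto

lemma length_nonneg: assumes "smooth_curve A \<gamma>" shows "integral {0..1} (spd \<gamma>) \<ge> 0"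
  by (cases "spd \<gamma> integrable_on {0..1}") (auto intro!: integral_nonneg speed_nonneg[OF assms] simp: not_integrable_integral)

lemma dst_le: assumes "curve p q \<gamma>" shows "dst p q \<le> integral {0..1} (spd \<gamma>)"
  unfolding dst_eq using assms length_nonneg by (intro cINF_lower bdd_belowI2[of _ 0]) (auto simp: curve_def)

lemma dst_ge:
  assumes "connected (UNIV :: 'a set)" "\<And>\<gamma>. curve p q \<gamma> \<Longrightarrow> b \<le> integral {0..1} (spd \<gamma>)"
  shows "b \<le> dst p q"
  unfolding dst_eq using curve_exists[OF assms(1), of p q] assms(2) by (intro cINF_greatest) auto

text \<open>A cutoff that is 1 at \<open>p\<close> and 0 outside \<open>U\<close> changes along a
  curve by at most \<open>B\<close> times the length, where \<open>B\<close> bounds its derivatives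
  on its compact support. So leaving \<open>U\<close> costs length at least
  \<open>1 / B\<close>.\<close>

lemma dst_nbhd:
  assumes con: "connected (UNIV :: 'a set)" and U: "open U" "p \<in> U"
  obtains r where "r > 0" "\<And>q. dst p q < r \<Longrightarrow> q \<in> U"
proof -
  obtain W E where F: "frame_on W E" and pW: "p \<in> W" by (rule frame_exists[of p])
  then have E: "E \<in> VF" and oW: "open (U \<inter> W)" using U by (auto simp: frame_on_def frame_def)
  obtain k K N where k: "k \<in> C" "compact K" "K \<subseteq> U \<inter> W" "p \<in> N" "\<And>q. q \<in> N \<Longrightarrow> k q = 1" "\<And>q. q \<notin> K \<Longrightarrow> k q = 0"
    by (rule cutoff_exists[OF oW]) (use U(2) pW in auto)
  let ?m = "\<lambda>q. \<bar>E k q\<bar> + \<bar>\<phi> E k q\<bar> + \<bar>\<xi> k q\<bar>"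
  have "continuous_on UNIV (X k)" if "X \<in> VF" for X by (rule C_continuous[OF VF_C[OF that k(1)]])
  then have "continuous_on UNIV ?m" using E by (intro continuous_intros) auto
  then have "bounded (?m ` K)" using compact_imp_bounded[OF compact_continuous_image[OF _ k(2)]] continuous_on_subset by blast
  then obtain B where B: "B > 0" "\<forall>q\<in>K. ?m q \<le> B" unfolding bounded_pos by auto
  have bd: "\<bar>X k q\<bar> \<le> B * sqrt (g X X q)" if X: "X \<in> VF" for X q
  proof (cases "q \<in> K")
    case False
    have "X k q = 0" by (rule VF_locally_const[OF X k(1), of "- K"]) (use False k(2,6) in \<open>auto intro: compact_imp_closed\<close>)
    then show ?thesis using B(1) g_nonneg[OF X] by simp
  next
    case True
    then have o: "onb q E (\<phi> E) \<xi>" using F k(3) frame_onb by (auto simp: frame_on_def)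
    have xi: "\<xi> \<in> VF" using o by (simp add: onb_def)
    let ?s = "sqrt (g X X q)"
    have "\<bar>g X E q\<bar> \<le> ?s" "\<bar>g X (\<phi> E) q\<bar> \<le> ?s" "\<bar>g X \<xi> q\<bar> \<le> ?s"
      unfolding onb_g[OF o X X] by (auto intro!: real_le_rsqrt simp: power2_eq_square)
    then have "\<bar>X k q\<bar> \<le> ?s * \<bar>E k q\<bar> + ?s * \<bar>\<phi> E k q\<bar> + ?s * \<bar>\<xi> k q\<bar>"
      unfolding onb_span[OF o X]
      by (intro order_trans[OF abs_triangle_ineq] add_mono) (auto simp: abs_mult intro!: mult_right_mono order_trans[OF abs_triangle_ineq] add_mono)
    also have "\<dots> = ?s * ?m q" by (simp add: algebra_simps)
    also have "\<dots> \<le> ?s * B" using B(2) True g_nonneg[OF X] by (intro mult_left_mono) auto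
    finally show ?thesis by (simp add: mult.commute)
  qed
  have "q \<in> U" if d: "dst p q < 1 / B" for q
  proof (rule ccontr)
    assume q: "q \<notin> U"
    have "1 / B \<le> integral {0..1} (spd \<gamma>)" if c: "curve p q \<gamma>" for \<gamma>
    proof -
      have \<gamma>: "smooth_curve A \<gamma>" using c by (simp add: curve_def)
      obtain L where L: "\<And>t. (L has_real_derivative spd \<gamma> t) (at t)" by (rule arc_length[OF \<gamma>]) (rule that)
      have "\<exists>y. ((\<lambda>t. k (\<gamma> t) + B * L t) has_real_derivative y) (at t) \<and> 0 \<le> y" for t
      proof -
        obtain X where X: "vel \<gamma> t X" by (rule velE[OF \<gamma>])
        have "((\<lambda>t. k (\<gamma> t) + B * L t) has_real_derivative X k (\<gamma> t) + B * spd \<gamma> t) (at t)"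
          using X k(1) by (intro DERIV_add DERIV_cmult L) (simp add: vel_def)
        moreover have "0 \<le> X k (\<gamma> t) + B * spd \<gamma> t"
          using bd[of X "\<gamma> t"] X unfolding speed_eq[OF X] by (simp add: vel_def)
        ultimately show ?thesis by blast
      qed
      then have "k (\<gamma> 0) + B * L 0 \<le> k (\<gamma> 1) + B * L 1"
        using DERIV_nonneg_imp_nondecreasing[of 0 1 "\<lambda>t. k (\<gamma> t) + B * L t"] by simp
      moreover have "k (\<gamma> 0) = 1" "k (\<gamma> 1) = 0" using c k(3-6) q by (auto simp: curve_def)
      ultimately show ?thesis unfolding length_eq[OF \<gamma> L] using B(1) by (simp add: field_simps)
    qed
    then have "1 / B \<le> dst p q" by (rule dst_ge[OF con])
    with d show False by simp
  qed
  then show thesis using B(1) by (intro that[of "1 / B"]) auto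
qed

lemma riemannian_metric_space:
  assumes con: "connected (UNIV :: 'a set)" shows "Metric_space UNIV dst"
proof
  show n: "0 \<le> dst p q" for p q by (rule dst_ge[OF con]) (simp add: curve_def length_nonneg)
  have "dst p q \<le> dst q p" for p q
    by (rule dst_ge[OF con]) (use dst_le[OF curve_reverse(1)] curve_reverse(2) in fastforce)
  then show "dst p q = dst q p" for p q by (simp add: order_antisym)
  have "dst p p = 0" for p
  proof -
    have v: "vel (\<lambda>t. p) t vzero" for t unfolding vel_def using vzero_VF by (simp add: vzero_def)
    have "spd (\<lambda>t. p) = (\<lambda>t. 0)" by (rule ext) (simp add: speed_eq[OF v] g_zero)
    then show ?thesis using dst_le[of p p "\<lambda>t. p"] n[of p p] by (simp add: curve_def smooth_curveI)
  qed
  moreover have "dst p q \<noteq> 0" if "p \<noteq> q" for p q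
  proof -
    have "\<exists>r>0. \<not> dst p q < r" by (rule dst_nbhd[OF con, of "- {q}" p]) (use that in blast)+
    then show ?thesis by auto
  qed
  ultimately show "(dst p q = 0) = (p = q)" for p q by blast
  show "dst p q \<le> dst p x + dst x q" for p x q
  proof -
    have "dst p q - integral {0..1} (spd \<gamma>) \<le> dst x q" if 1: "curve p x \<gamma>" for \<gamma>
    proof (rule dst_ge[OF con])
      fix \<gamma>' assume 2: "curve x q \<gamma>'"
      show "dst p q - integral {0..1} (spd \<gamma>) \<le> integral {0..1} (spd \<gamma>')"
        by (rule curve_concat[OF 1 2]) (use dst_le in fastforce)
    qed
    then have "dst p q - dst x q \<le> dst p x" by (intro dst_ge[OF con]) fastforce
    then show ?thesis by simp
  qed
qed

text \<open>Bounded velocity makes \<open>dst (\<gamma> s) (\<gamma> t)\<close> at most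
  \<open>B\<close> times \<open>\<bar>t - s\<bar>\<close>, so the sequence is Cauchy. The curve is
  smooth only on an open interval; its arcs become curves on the whole line by composition with
  \<open>smooth_step\<close>. The interval reaches to the left of 0, so that the first point of the
  sequence is interior.\<close>

lemma bounded_velocity_limit:
  assumes con: "connected (UNIV :: 'a set)" and cmp: "riemannian_complete A g"
    and \<gamma>: "\<And>f. f \<in> C \<Longrightarrow> Cinf_on (\<lambda>t. f (\<gamma> t)) {-1<..<1}"
    and v: "\<And>t. t \<in> {-1<..<1} \<Longrightarrow> vel \<gamma> t Z" and B: "\<And>t. t \<in> {-1<..<1} \<Longrightarrow> g Z Z (\<gamma> t) \<le> B * B" "B > 0"
  obtains m where "\<And>V. open V \<Longrightarrow> m \<in> V \<Longrightarrow> (\<forall>\<^sub>F n in sequentially. \<gamma> (1 - 1 / real (Suc n)) \<in> V)"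
proof -
  interpret MS: Metric_space UNIV dst by (rule riemannian_metric_space[OF con])
  have d: "dst (\<gamma> s) (\<gamma> t) \<le> B * \<bar>t - s\<bar>" if st: "s \<in> {0..<1}" "t \<in> {0..<1}" for s t
  proof -
    let ?h = "\<lambda>u. s + (t - s) * smooth_step u"
    have hi: "?h u \<in> {-1<..<1}" for u
    proof -
      have "?h u = (1 - smooth_step u) * s + smooth_step u * t" by (simp add: algebra_simps)
      moreover have "(1 - smooth_step u) * s + smooth_step u * t \<in> {0..<1}"
        using convex_bound_lt[of s 1 t "1 - smooth_step u" "smooth_step u"] st smooth_step_bounds[of u] by simp
      ultimately show ?thesis by simp
    qed
    have c: "curve (\<gamma> s) (\<gamma> t) (\<lambda>u. \<gamma> (?h u))" unfolding curve_def
    proof (intro conjI smooth_curveI)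
      fix f assume "f \<in> C"
      show "Cinf_on (\<lambda>u. f (\<gamma> (?h u))) UNIV"
        by (rule Cinf_on_compose_real[OF open_UNIV open_greaterThanLessThan _ \<gamma>[OF \<open>f \<in> C\<close>]])
          (use hi in \<open>auto intro!: Cinf_on_add Cinf_on_mult Cinf_on_smooth_step\<close>)
    qed (simp_all add: smooth_step_le_0 smooth_step_ge_1)
    have sm: "smooth_curve A (\<lambda>u. \<gamma> (?h u))" using c by (simp add: curve_def)
    obtain L where L: "\<And>t. (L has_real_derivative spd (\<lambda>u. \<gamma> (?h u)) t) (at t)" by (rule arc_length[OF sm]) (rule that)
    have ZV: "Z \<in> VF" using v[of 0] by (simp add: vel_def)
    have "\<exists>y. ((\<lambda>u. B * \<bar>t - s\<bar> * smooth_step u - L u) has_real_derivative y) (at u) \<and> 0 \<le> y" for u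
    proof -
      let ?d = "deriv smooth_step u"
      have "(?h has_real_derivative 0 + (t - s) * ?d) (at u)" by (intro DERIV_add DERIV_const DERIV_cmult smooth_step_deriv)
      from speed_eq[OF vel_compose[where h = ?h, OF v[OF hi] this]]
      have "spd (\<lambda>u. \<gamma> (?h u)) u = sqrt (((t - s) * ?d) * (((t - s) * ?d) * g Z Z (\<gamma> (?h u))))" using ZV by (simp add: g_simps)
      also have "\<dots> = \<bar>t - s\<bar> * ?d * sqrt (g Z Z (\<gamma> (?h u)))"
      proof -
        have "sqrt (z * (z * w)) = \<bar>z\<bar> * sqrt w" for z w
          using real_sqrt_mult[of "z\<^sup>2" w] by (simp add: power2_eq_square mult.assoc)
        then show ?thesis using smooth_step_deriv(2)[of u] by (simp only: abs_mult abs_of_nonneg)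
      qed
      also have "\<dots> \<le> \<bar>t - s\<bar> * ?d * B"
        using B(1)[OF hi, of u] B(2) smooth_step_deriv(2)[of u] by (intro mult_left_mono real_le_lsqrt) (auto simp: power2_eq_square)
      finally have "0 \<le> B * \<bar>t - s\<bar> * ?d - spd (\<lambda>u. \<gamma> (?h u)) u" by (simp add: algebra_simps)
      moreover have "((\<lambda>u. B * \<bar>t - s\<bar> * smooth_step u - L u) has_real_derivative B * \<bar>t - s\<bar> * ?d - spd (\<lambda>u. \<gamma> (?h u)) u) (at u)"
        by (intro DERIV_diff DERIV_cmult smooth_step_deriv L)
      ultimately show ?thesis by blast
    qed
    then have "- L 0 \<le> B * \<bar>t - s\<bar> - L 1"
      using DERIV_nonneg_imp_nondecreasing[of 0 1 "\<lambda>u. B * \<bar>t - s\<bar> * smooth_step u - L u"]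
      by (simp add: smooth_step_le_0 smooth_step_ge_1)
    then show ?thesis using dst_le[OF c] unfolding length_eq[OF sm L] by simp
  qed
  let ?\<sigma> = "\<lambda>n. \<gamma> (1 - 1 / real (Suc n))"
  have "MS.MCauchy ?\<sigma>" unfolding MS.MCauchy_def
  proof (intro conjI allI impI)
    fix e :: real assume "e > 0"
    then obtain N where N: "inverse (real (Suc N)) < e / B" using reals_Archimedean[of "e / B"] B(2) by auto
    have "dst (?\<sigma> n) (?\<sigma> n') < e" if "N \<le> n" "N \<le> n'" for n n'
    proof -
      have i: "0 < 1 / real (Suc k) \<and> 1 / real (Suc k) \<le> inverse (real (Suc N))" if "N \<le> k" for k
        using that by (simp add: field_simps)
      have "\<bar>(1 - 1 / real (Suc n')) - (1 - 1 / real (Suc n))\<bar> \<le> inverse (real (Suc N))"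
        using i[OF that(1)] i[OF that(2)] by linarith
      moreover have "dst (?\<sigma> n) (?\<sigma> n') \<le> B * \<bar>(1 - 1 / real (Suc n')) - (1 - 1 / real (Suc n))\<bar>" by (rule d) auto
      ultimately have "dst (?\<sigma> n) (?\<sigma> n') \<le> B * inverse (real (Suc N))"
        using B(2) by (meson mult_left_mono less_imp_le order_trans)
      also have "\<dots> < e" using N B(2) by (simp add: pos_less_divide_eq mult.commute)
      finally show ?thesis .
    qed
    then show "\<exists>N. \<forall>n n'. N \<le> n \<longrightarrow> N \<le> n' \<longrightarrow> dst (?\<sigma> n) (?\<sigma> n') < e" by blast
  qed simp
  then obtain m where m: "limitin MS.mtopology ?\<sigma> m sequentially"
    using cmp unfolding riemannian_complete_def MS.mcomplete_def by blast
  show thesis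
  proof (rule that)
    fix V assume V: "open V" "m \<in> V"
    have "openin MS.mtopology V" unfolding MS.openin_mtopology
    proof (intro conjI allI impI subset_UNIV)
      fix x assume "x \<in> V"
      show "\<exists>r>0. MS.mball x r \<subseteq> V"
        by (rule dst_nbhd[OF con V(1) \<open>x \<in> V\<close>]) (auto intro!: exI)
    qed
    then show "\<forall>\<^sub>F n in sequentially. \<gamma> (1 - 1 / real (Suc n)) \<in> V" using m V(2) unfolding limitin_def by blast
  qed
qed

end

subsection \<open>The developing map\<close>

text \<open>The functions \<open>x, y, t\<close> and the dual frame \<open>P1, P2, P3\<close> exhibit \<open>(x, y, t)\<close> as a local
  diffeomorphism. The bound makes the lifts of straight lines extend for all time.\<close>

locale developing = sasaki A M D
  for A :: "('a::{t2_space,second_countable_topology}, real^3) atlas" and M D +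
  fixes x y t :: "'a \<Rightarrow> real" and P1 P2 P3 :: "'a vfield"
  assumes xyt: "x \<in> Cinf A" "y \<in> Cinf A" "t \<in> Cinf A"
    and P: "P1 \<in> vfields A" "P2 \<in> vfields A" "P3 \<in> vfields A"
    and span: "\<And>X f p. X \<in> vfields A \<Longrightarrow> f \<in> Cinf A \<Longrightarrow> X f p = X x p * P1 f p + X y p * P2 f p + X t p * P3 f p"
    and con: "connected (UNIV :: 'a set)" and complete: "riemannian_complete A (rmetric M)"
    and bound: "\<And>R a b c. \<exists>B>0. \<forall>p. norm (x p, y p, t p) \<le> R \<longrightarrow>
      (let V = (\<lambda>p. a) \<odot>\<^sub>v P1 \<oplus>\<^sub>v (\<lambda>p. b) \<odot>\<^sub>v P2 \<oplus>\<^sub>v (\<lambda>p. c) \<odot>\<^sub>v P3 in rmetric M V V p \<le> B * B)"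
begin

definition "F p = (x p, y p, t p)"
text \<open>By \<open>span\<close>, \<open>P1, P2, P3\<close> play the part of the coordinate fields
  of \<open>x, y, t\<close>; this is the field with constant components \<open>v\<close>.\<close>

definition "Pv v = (\<lambda>p. fst v) \<odot>\<^sub>v P1 \<oplus>\<^sub>v (\<lambda>p. fst (snd v)) \<odot>\<^sub>v P2 \<oplus>\<^sub>v (\<lambda>p. snd (snd v)) \<odot>\<^sub>v P3"
text \<open>Only continuity of the section is required; its smoothness is a consequence, by
  \<open>csect_smooth\<close>.\<close>

definition "csect T H \<longleftrightarrow> continuous_on T H \<and> (\<forall>z\<in>T. F (H z) = z)"

lemma Pv_VF [simp]: "Pv v \<in> VF" using P by (simp add: Pv_def)

lemma Pv_apply: "Pv v f p = fst v * P1 f p + fst (snd v) * P2 f p + snd (snd v) * P3 f p"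
  by (simp add: Pv_def)

lemma Pv_bounded_linear: "bounded_linear (\<lambda>v. Pv v f p)"
  unfolding Pv_apply by (intro bounded_linear_add bounded_linear_mult_const[THEN bounded_linear_compose]
    bounded_linear_fst bounded_linear_snd bounded_linear_compose[OF bounded_linear_fst] bounded_linear_compose[OF bounded_linear_snd]
    bounded_linear_mult_const bounded_linear_compose[OF bounded_linear_mult_left])

lemma F_continuous: "continuous_on S F"
  unfolding F_def using xyt[THEN C_continuous] by (intro continuous_on_Pair) (auto intro: continuous_on_subset)

lemma csect_subset: "csect T H \<Longrightarrow> S \<subseteq> T \<Longrightarrow> csect S H"
  unfolding csect_def by (meson continuous_on_subset subsetD)

context
  fixes W a r G h d assumes cc: "coords W (a :: real^3) r G h d"
begin

lemmas c = coordsD[OF cc]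

text \<open>The inverse of the Jacobian \<open>chart_F'\<close> of \<open>F\<close> in the chart,
  read off from \<open>P1, P2, P3\<close>.\<close>

definition "chart_inv p v = (\<Sum>b\<in>Basis. Pv v (h b) p *\<^sub>R b)"
definition "chart_F' z v = ((\<Sum>b\<in>Basis. (v \<bullet> b) * d b x (G z)), (\<Sum>b\<in>Basis. (v \<bullet> b) * d b y (G z)), (\<Sum>b\<in>Basis. (v \<bullet> b) * d b t (G z)))"

lemma chart_inv_bounded_linear: "bounded_linear (chart_inv p)"
  unfolding chart_inv_def[abs_def] by (intro bounded_linear_sum bounded_linear_scaleR_const Pv_bounded_linear)

lemma chart_F_deriv: "z \<in> ball a r \<Longrightarrow> ((\<lambda>z. F (G z)) has_derivative chart_F' z) (at z)"
  unfolding F_def chart_F'_def[abs_def] by (intro has_derivative_Pair c(9) xyt)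

lemma chart_inv_F': assumes z: "z \<in> ball a r" shows "chart_inv (G z) \<circ> chart_F' z = id"
proof (rule ext, rule euclidean_eqI)
  fix v b' :: "real^3" assume b': "b' \<in> Basis"
  have W: "G z \<in> W" using z c(3) by auto
  have "(chart_inv (G z) \<circ> chart_F' z) v \<bullet> b' = Pv (chart_F' z v) (h b') (G z)"
    using b' by (simp add: chart_inv_def)
  also have "\<dots> = (\<Sum>b\<in>Basis. (v \<bullet> b) * (d b x (G z) * P1 (h b') (G z) + d b y (G z) * P2 (h b') (G z) + d b t (G z) * P3 (h b') (G z)))"
    by (simp add: Pv_apply chart_F'_def sum_distrib_right distrib_left sum.distrib mult.assoc)
  also have "\<dots> = (\<Sum>b\<in>Basis. (v \<bullet> b) * d b (h b') (G z))"
    by (rule sum.cong[OF refl]) (simp only: span[OF c(6) c(5)[OF b'], of _ "G z"])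
  also have "\<dots> = (\<Sum>b\<in>Basis. (v \<bullet> b) * (if b = b' then 1 else 0))" using c(11)[OF _ b' W] by simp
  also have "\<dots> = v \<bullet> b'" using b' by (simp add: if_distrib sum.delta cong: if_cong)
  finally show "(chart_inv (G z) \<circ> chart_F' z) v \<bullet> b' = id v \<bullet> b'" by simp
qed

lemma chart_F'_continuous:
  assumes z0: "z0 \<in> ball a r" and e: "e > 0"
  shows "\<exists>\<delta>>0. \<forall>z. dist z0 z < \<delta> \<longrightarrow> onorm (\<lambda>v. chart_F' z v - chart_F' z0 v) < e"
proof -
  define u where "u b z = (d b x (G z), d b y (G z), d b t (G z))" for b z
  have L: "chart_F' z v = (\<Sum>b\<in>Basis. (v \<bullet> b) *\<^sub>R u b z)" for z v
    by (simp add: chart_F'_def u_def sum_prod scaleR_Pair)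
  have cd: "continuous_on (ball a r) (\<lambda>z. d b k (G z))" if "k \<in> C" for b k
    by (rule continuous_on_compose2[OF C_continuous[OF VF_C[OF c(6) that]] c(4)]) simp
  have "continuous_on (ball a r) (\<lambda>z. \<Sum>b\<in>Basis. norm (u b z - u b z0))"
    unfolding u_def by (intro continuous_on_sum continuous_on_norm continuous_on_diff continuous_on_Pair continuous_on_const cd xyt)
  then have "isCont (\<lambda>z. \<Sum>b\<in>Basis. norm (u b z - u b z0)) z0" using z0 by (simp add: continuous_on_eq_continuous_at)
  then obtain \<delta> where \<delta>: "\<delta> > 0" "\<forall>z. dist z z0 < \<delta> \<longrightarrow> dist (\<Sum>b\<in>Basis. norm (u b z - u b z0)) (\<Sum>b\<in>Basis. norm (u b z0 - u b z0)) < e"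
    using e unfolding continuous_at_eps_delta by blast
  have "onorm (\<lambda>v. chart_F' z v - chart_F' z0 v) < e" if "dist z0 z < \<delta>" for z
  proof -
    have "onorm (\<lambda>v. chart_F' z v - chart_F' z0 v) \<le> (\<Sum>b\<in>Basis. norm (u b z - u b z0))"
    proof (rule onorm_le)
      fix v :: "real^3"
      have "chart_F' z v - chart_F' z0 v = (\<Sum>b\<in>Basis. (v \<bullet> b) *\<^sub>R (u b z - u b z0))"
        by (simp add: L sum_subtractf scaleR_diff_right)
      also have "norm \<dots> \<le> (\<Sum>b\<in>Basis. norm (u b z - u b z0) * norm v)"
        by (intro sum_norm_le) (simp add: mult.commute mult_right_mono Basis_le_norm)
      finally show "norm (chart_F' z v - chart_F' z0 v) \<le> (\<Sum>b\<in>Basis. norm (u b z - u b z0)) * norm v"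
        by (simp add: sum_distrib_right)
    qed
    moreover have "(\<Sum>b\<in>Basis. norm (u b z - u b z0)) < e"
      using \<delta>(2) that by (auto simp: dist_commute dist_real_def)
    ultimately show ?thesis by linarith
  qed
  then show ?thesis using \<delta>(1) by blast
qed

end

text \<open>The invertible and continuous Jacobian gives local injectivity, and invariance of domain
  turns this into a homeomorphism onto an open set.\<close>

lemma local_section:
  obtains N H \<epsilon> where "\<epsilon> > 0" "open N" "p \<in> N" "csect (ball (F p) \<epsilon>) H" "\<And>z. z \<in> ball (F p) \<epsilon> \<Longrightarrow> H z \<in> N"
    "\<And>q. q \<in> N \<Longrightarrow> F q \<in> ball (F p) \<epsilon> \<and> H (F q) = q"
proof -
  obtain W a r G h d where cc: "coords W (a :: real^3) r G h d" "p = G a" by (rule coords_exist[OF open_UNIV UNIV_I])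
  note c = coordsD[OF cc(1)]
  have a: "a \<in> ball a r" using c(2) by simp
  obtain r' where r': "r' > 0" "ball a r' \<subseteq> ball a r" "inj_on (\<lambda>z. F (G z)) (ball a r')"
    by (rule has_derivative_locally_injective[OF a open_ball chart_inv_bounded_linear[OF cc(1), of "G a"] chart_inv_F'[OF cc(1) a]
      chart_F_deriv[OF cc(1)] chart_F'_continuous[OF cc(1) a]])
  let ?FG = "\<lambda>z. F (G z)"
  have co: "continuous_on (ball a r') ?FG"
    by (rule continuous_on_compose2[OF F_continuous[of UNIV] continuous_on_subset[OF c(4) r'(2)]]) simp
  have dim: "DIM(ga) \<le> DIM(real^3)" by simp
  obtain gg where gg: "homeomorphism (ball a r') (?FG ` ball a r') ?FG gg"
    by (rule invariance_of_domain_homeomorphism[OF open_ball co dim r'(3)])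
  have "open (?FG ` ball a r')" by (rule invariance_of_domain_gen[OF open_ball co r'(3) dim])
  moreover have "F p \<in> ?FG ` ball a r'" using cc(2) r'(1) by auto
  ultimately obtain \<epsilon> where \<epsilon>: "\<epsilon> > 0" "ball (F p) \<epsilon> \<subseteq> ?FG ` ball a r'" using open_contains_ball by blast
  let ?S = "ball a r' \<inter> ?FG -` ball (F p) \<epsilon>"
  note hom1 = homeomorphism_apply1[OF gg]
  have hom2: "gg z \<in> ball a r' \<and> ?FG (gg z) = z" if "z \<in> ball (F p) \<epsilon>" for z
  proof -
    have "z \<in> ?FG ` ball a r'" using that \<epsilon>(2) by (rule rev_subsetD)
    then obtain w where w: "z = ?FG w" "w \<in> ball a r'" by (elim imageE)
    show ?thesis unfolding w(1) hom1[OF w(2)] by (intro conjI w(2) refl)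
  qed
  note hom3 = continuous_on_subset[OF homeomorphism_cont2[OF gg] \<epsilon>(2)]
  note hom = hom1 hom2 hom3
  have oS: "open ?S" by (rule continuous_open_preimage[OF co open_ball open_ball])
  show thesis
  proof (rule that[of \<epsilon> "G ` ?S" "\<lambda>z. G (gg z)"])
    show "open (G ` ?S)" by (rule coords_image[OF cc(1) oS]) (use r'(2) in auto)
    show "p \<in> G ` ?S" using cc(2) r'(1) \<epsilon>(1) by auto
    have "continuous_on (ball (F p) \<epsilon>) (\<lambda>z. G (gg z))"
      by (rule continuous_on_compose2[OF c(4) hom(3)]) (use hom(2) r'(2) in blast)
    then show "csect (ball (F p) \<epsilon>) (\<lambda>z. G (gg z))" using hom(2) by (simp add: csect_def)
    show "G (gg z) \<in> G ` ?S" if "z \<in> ball (F p) \<epsilon>" for z using hom(2)[OF that] that by auto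
    show "F q \<in> ball (F p) \<epsilon> \<and> G (gg (F q)) = q" if qS: "q \<in> G ` ?S" for q
    proof -
      obtain w where w: "q = G w" "w \<in> ball a r'" "F (G w) \<in> ball (F p) \<epsilon>" using qS by blast
      show ?thesis unfolding w(1) hom1[OF w(2)] by (intro conjI w(3) refl)
    qed
  qed (rule \<epsilon>(1))
qed

text \<open>The set of agreement is open because \<open>F\<close> is locally injective, and its
  complement is open because the manifold is Hausdorff.\<close>

lemma csect_unique:
  assumes H: "csect T H1" "csect T H2" and T: "connected T" and z: "z0 \<in> T" "H1 z0 = H2 z0" "z \<in> T"
  shows "H1 z = H2 z"
proof -
  have tend: "(H1 \<longlongrightarrow> H1 w) (at w within T)" "(H2 \<longlongrightarrow> H2 w) (at w within T)" if "w \<in> T" for w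
    using H that by (auto simp: csect_def continuous_on_def)
  have TT: "\<forall>\<^sub>F u in at w within T. u \<in> T" for w by (simp add: eventually_at_filter)
  have "(H1 z0 = H2 z0) = (H1 z = H2 z)"
  proof (rule connected_local_const[OF T z(1,3)], intro ballI)
    fix w assume w: "w \<in> T"
    show "\<forall>\<^sub>F u in at w within T. (H1 w = H2 w) = (H1 u = H2 u)"
    proof (cases "H1 w = H2 w")
      case True
      obtain N K \<epsilon> where N: "open N" "H1 w \<in> N" "\<And>q. q \<in> N \<Longrightarrow> F q \<in> ball (F (H1 w)) \<epsilon> \<and> K (F q) = q"
        by (rule local_section[of "H1 w"]) blast
      have "\<forall>\<^sub>F u in at w within T. H1 u \<in> N" "\<forall>\<^sub>F u in at w within T. H2 u \<in> N"
        using tend[OF w] N(1,2) True by (auto dest: topological_tendstoD)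
      then show ?thesis using TT
      proof eventually_elim
        case (elim u)
        have "F (H1 u) = F (H2 u)" using H elim(3) by (simp add: csect_def)
        then have "H1 u = H2 u" using N(3)[OF elim(1)] N(3)[OF elim(2)] by metis
        then show ?case using True by simp
      qed
    next
      case False
      obtain U V where "open U" "open V" "H1 w \<in> U" "H2 w \<in> V" "U \<inter> V = {}" using separation_t2[of "H1 w" "H2 w"] False by blast
      then have "\<forall>\<^sub>F u in at w within T. H1 u \<in> U" "\<forall>\<^sub>F u in at w within T. H2 u \<in> V"
        using tend[OF w] by (auto dest: topological_tendstoD)
      then show ?thesis by eventually_elim (use False \<open>U \<inter> V = {}\<close> in auto)
    qed
  qed
  then show ?thesis using z(2) by simp
qed

lemma csect_glue:
  assumes s: "\<And>i. i \<in> I \<Longrightarrow> open (T i) \<and> csect (T i) (K i)"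
    and agree: "\<And>i j z. i \<in> I \<Longrightarrow> j \<in> I \<Longrightarrow> z \<in> T i \<Longrightarrow> z \<in> T j \<Longrightarrow> K i z = K j z"
  shows "\<exists>H. csect (\<Union>i\<in>I. T i) H \<and> (\<forall>i\<in>I. \<forall>z\<in>T i. H z = K i z)"
proof -
  define H where "H z = K (SOME i. i \<in> I \<and> z \<in> T i) z" for z
  have H: "H z = K i z" if "i \<in> I" "z \<in> T i" for i z
  proof -
    have "(SOME i. i \<in> I \<and> z \<in> T i) \<in> I \<and> z \<in> T (SOME i. i \<in> I \<and> z \<in> T i)" by (rule someI[where x = i]) (simp add: that)
    then show ?thesis unfolding H_def using agree[of "SOME i. i \<in> I \<and> z \<in> T i" i z] that by simp
  qed
  have "continuous_on (T i) H" if "i \<in> I" for i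
    using s[OF that] H[OF that] continuous_on_cong[of "T i" "T i" H "K i"] by (simp add: csect_def)
  then have "continuous_on (\<Union>i\<in>I. T i) H" using s by (intro continuous_on_open_UN) auto
  moreover have "\<forall>z\<in>(\<Union>i\<in>I. T i). F (H z) = z" using H s by (auto simp: csect_def)
  ultimately have "csect (\<Union>i\<in>I. T i) H" by (simp add: csect_def)
  then show ?thesis using H by blast
qed

text \<open>A continuous inverse of a map with invertible derivative is differentiable. The
  derivative of \<open>f\<close> along \<open>H\<close> is again a smooth function along
  \<open>H\<close>, namely \<open>Pv v f\<close>, which makes \<open>csect_smooth\<close> a
  coinduction.\<close>

lemma csect_deriv:
  assumes T: "open T" and H: "csect T H" and z: "z \<in> T" and f: "f \<in> C"
  shows "((\<lambda>z. f (H z)) has_derivative (\<lambda>v. Pv v f (H z))) (at z)"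
proof -
  obtain W a r G h d where cc: "coords W (a :: real^3) r G h d" "H z \<in> W" by (rule coords_exist[OF open_UNIV UNIV_I])
  note c = coordsD[OF cc(1)]
  define T' where "T' = T \<inter> H -` W"
  have T': "open T'" "z \<in> T'" unfolding T'_def
    using continuous_open_preimage[OF _ T c(1)] H z cc(2) by (auto simp: csect_def)
  let ?k = "\<lambda>z. \<Sum>b\<in>Basis. h b (H z) *\<^sub>R b"
  have k: "?k u \<in> ball a r \<and> G (?k u) = H u" if "u \<in> T'" for u
  proof -
    have "H u \<in> G ` ball a r" using that unfolding T'_def c(3)[symmetric] by auto
    then obtain w where w: "w \<in> ball a r" "H u = G w" by (elim imageE)
    have "?k u = w" unfolding w(2) using c(7)[OF _ w(1)] by (simp add: euclidean_representation)
    then show ?thesis using w by simp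
  qed
  have cH: "isCont H z" using H z T by (simp add: csect_def continuous_on_eq_continuous_at)
  have ckb: "isCont (\<lambda>z. h b (H z)) z" if "b \<in> Basis" for b
    by (rule isCont_o2[where f = H and g = "h b", OF cH])
      (use C_continuous[OF c(5)[OF that]] in \<open>simp add: continuous_on_eq_continuous_at\<close>)
  have ck: "isCont ?k z" by (rule continuous_sum, rule continuous_scaleR[OF ckb continuous_const])
  have "(?k has_derivative chart_inv h (H z)) (at z)"
  proof (rule has_derivative_inverse_basic[of "\<lambda>u. F (G u)" "chart_F' G d (?k z)"])
    show "((\<lambda>u. F (G u)) has_derivative chart_F' G d (?k z)) (at (?k z))" by (rule chart_F_deriv[OF cc(1)]) (use k T'(2) in blast)
    show "bounded_linear (chart_inv h (H z))" by (rule chart_inv_bounded_linear[OF cc(1)])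
    show "chart_inv h (H z) \<circ> chart_F' G d (?k z) = id" using chart_inv_F'[OF cc(1), of "?k z"] k[OF T'(2)] by simp
    show "F (G (?k u)) = u" if "u \<in> T'" for u using k[OF that] H that by (simp add: csect_def T'_def)
  qed (use ck T' in auto)
  from diff_chain_at[OF this c(9)[OF f conjunct1[OF k[OF T'(2)]]]]
  have "((\<lambda>u. f (G (?k u))) has_derivative (\<lambda>v. \<Sum>b\<in>Basis. (chart_inv h (H z) v \<bullet> b) * d b f (H z))) (at z)"
    using k[OF T'(2)] by (simp add: o_def)
  moreover have "(\<Sum>b\<in>Basis. (chart_inv h (H z) v \<bullet> b) * d b f (H z)) = Pv v f (H z)" for v
    using c(10)[OF Pv_VF f cc(2), of v] by (simp add: chart_inv_def[OF cc(1)])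
  ultimately have "((\<lambda>u. f (G (?k u))) has_derivative (\<lambda>v. Pv v f (H z))) (at z)" by simp
  then show ?thesis by (rule has_derivative_cong_open[OF _ T']) (use k in auto)
qed

lemma csect_smooth:
  assumes T: "open T" and H: "csect T H" and f: "f \<in> C" shows "Cinf_on (\<lambda>z. f (H z)) T"
proof (rule Cinf_on_coinduct[OF T, where P = "\<lambda>\<psi>. \<exists>f\<in>C. \<psi> = (\<lambda>z. f (H z))"])
  show "\<exists>f'\<in>C. (\<lambda>z. f (H z)) = (\<lambda>z. f' (H z))" using f by blast
  fix \<psi> assume "\<exists>f\<in>C. \<psi> = (\<lambda>z. f (H z))"
  then obtain f where f: "f \<in> C" "\<psi> = (\<lambda>z. f (H z))" by blast
  show "\<exists>f'. (\<forall>z\<in>T. (\<psi> has_derivative f' z) (at z)) \<and> (\<forall>v. \<exists>f\<in>C. (\<lambda>z. f' z v) = (\<lambda>z. f (H z)))"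
    unfolding f(2) using csect_deriv[OF T H _ f(1)] VF_C[OF Pv_VF f(1)]
    by (intro exI[of _ "\<lambda>z v. Pv v f (H z)"]) blast
qed

text \<open>The lift by \<open>H\<close> of the radius towards \<open>b\<close> has bounded
  velocity, as \<open>F\<close> stays bounded on it. Completeness gives a limit \<open>m\<close>
  with \<open>F m = b\<close>, and the local section at \<open>m\<close> agrees with
  \<open>H\<close> at a late point of the radius, hence on the overlap.\<close>

lemma boundary_extension:
  assumes H: "csect (ball o' rr) H" and b: "dist o' b = rr" "rr > 0"
  obtains \<epsilon> K where "\<epsilon> > 0" "csect (ball b \<epsilon>) K" "\<And>z. z \<in> ball o' rr \<Longrightarrow> z \<in> ball b \<epsilon> \<Longrightarrow> K z = H z"
proof -
  let ?l = "\<lambda>s. o' + s *\<^sub>R (b - o')"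
  have l: "?l s \<in> ball o' rr" if "s \<in> {-1<..<1}" for s
    using that b by (auto simp: dist_norm norm_minus_commute abs_less_iff)
  let ?\<gamma> = "\<lambda>s. H (?l s)"
  have FH: "F (H z) = z" if "z \<in> ball o' rr" for z using H that by (simp add: csect_def)
  obtain B where B: "B > 0" "\<And>p. norm (F p) \<le> norm o' + rr \<Longrightarrow> g (Pv (b - o')) (Pv (b - o')) p \<le> B * B"
    using bound[of "norm o' + rr" "fst (b - o')" "fst (snd (b - o'))" "snd (snd (b - o'))"] unfolding Let_def Pv_def F_def by blast
  obtain m where m: "\<And>V. open V \<Longrightarrow> m \<in> V \<Longrightarrow> (\<forall>\<^sub>F n in sequentially. ?\<gamma> (1 - 1 / real (Suc n)) \<in> V)"
  proof (rule bounded_velocity_limit[OF con complete, of ?\<gamma> "Pv (b - o')" B])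
    fix f assume f: "f \<in> C"
    show "Cinf_on (\<lambda>s. f (?\<gamma> s)) {-1<..<1}"
      by (rule Cinf_on_compose[OF _ open_ball _ csect_smooth[OF open_ball H f]])
        (use l in \<open>auto simp: inner_add_left simp del: mem_ball intro!: Cinf_on_add Cinf_on_mult Cinf_on_id\<close>)
  next
    fix s :: real assume s: "s \<in> {-1<..<1}"
    show "vel ?\<gamma> s (Pv (b - o'))" unfolding vel_def
    proof (intro conjI ballI Pv_VF)
      fix f assume f: "f \<in> C"
      have "(?l has_derivative (\<lambda>u. u *\<^sub>R (b - o'))) (at s)" by (auto intro!: derivative_eq_intros)
      from diff_chain_at[OF this csect_deriv[OF open_ball H l[OF s] f]]
      have "((\<lambda>s. f (?\<gamma> s)) has_derivative (\<lambda>u. Pv (u *\<^sub>R (b - o')) f (?\<gamma> s))) (at s)" by (simp add: o_def)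
      moreover have "Pv (u *\<^sub>R (b - o')) f (?\<gamma> s) = Pv (b - o') f (?\<gamma> s) * u" for u
        by (simp add: Pv_apply algebra_simps)
      ultimately show "((\<lambda>s. f (?\<gamma> s)) has_real_derivative Pv (b - o') f (?\<gamma> s)) (at s)"
        by (simp add: has_field_derivative_def)
    qed
    have "norm (?l s) \<le> norm o' + rr"
      using l[OF s] norm_triangle_ineq[of o' "s *\<^sub>R (b - o')"] by (auto simp: dist_norm)
    then show "g (Pv (b - o')) (Pv (b - o')) (?\<gamma> s) \<le> B * B" by (intro B(2)) (simp add: FH[OF l[OF s]])
  qed (use B in auto)
  let ?s = "\<lambda>n. 1 - 1 / real (Suc n)"
  have sn: "?s n \<in> {-1<..<1}" for n by (auto simp: field_simps)
  have "(\<lambda>n. ?\<gamma> (?s n)) \<longlonglongrightarrow> m" using m by (intro topological_tendstoI) auto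
  moreover have "isCont F m" using F_continuous[of UNIV] by (simp add: continuous_on_eq_continuous_at)
  ultimately have "(\<lambda>n. F (?\<gamma> (?s n))) \<longlonglongrightarrow> F m" by (rule isCont_tendsto_compose[rotated])
  then have "(\<lambda>n. ?l (?s n)) \<longlonglongrightarrow> F m" by (simp only: FH[OF l[OF sn]])
  moreover have "(\<lambda>n. ?l (?s n)) \<longlonglongrightarrow> o' + (1 - 0) *\<^sub>R (b - o')"
    by (intro tendsto_intros LIMSEQ_Suc[OF lim_1_over_n])
  ultimately have Fm: "F m = b" using LIMSEQ_unique by fastforce
  obtain N K \<epsilon> where N: "\<epsilon> > 0" "open N" "m \<in> N" "csect (ball b \<epsilon>) K" "\<And>q. q \<in> N \<Longrightarrow> F q \<in> ball b \<epsilon> \<and> K (F q) = q"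
    by (rule local_section[of m]) (auto simp: Fm)
  obtain n where n: "?\<gamma> (?s n) \<in> N" using eventually_happens[OF m[OF N(2,3)]] by auto
  have i: "?l (?s n) \<in> ball o' rr" "?l (?s n) \<in> ball b \<epsilon>" "K (?l (?s n)) = H (?l (?s n))"
    using N(5)[OF n] FH[OF l[OF sn[of n]]] l[OF sn[of n]] by auto
  show thesis
  proof (rule that[OF N(1,4)])
    fix z assume z: "z \<in> ball o' rr" "z \<in> ball b \<epsilon>"
    show "K z = H z"
    proof (rule csect_unique[of "ball o' rr \<inter> ball b \<epsilon>" K H "?l (?s n)"])
      show "connected (ball o' rr \<inter> ball b \<epsilon>)" by (intro convex_connected convex_Int convex_ball)
    qed (use i z csect_subset[OF H] csect_subset[OF N(4)] in auto)
  qed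
qed

text \<open>The continuations at all boundary points are glued with \<open>H\<close>; compactness of
  the closed ball gives a uniform gain \<open>\<delta>\<close> of radius.\<close>

lemma section_extend:
  assumes H: "csect (ball o' rr) H" and rr: "rr > 0"
  obtains \<delta> K where "\<delta> > 0" "csect (ball o' (rr + \<delta>)) K" "K o' = H o'"
proof -
  have "\<forall>b. \<exists>\<epsilon> K. b \<in> sphere o' rr \<longrightarrow> \<epsilon> > 0 \<and> csect (ball b \<epsilon>) K \<and> (\<forall>z. z \<in> ball o' rr \<and> z \<in> ball b \<epsilon> \<longrightarrow> K z = H z)"
  proof
    fix b
    show "\<exists>\<epsilon> K. b \<in> sphere o' rr \<longrightarrow> \<epsilon> > 0 \<and> csect (ball b \<epsilon>) K \<and> (\<forall>z. z \<in> ball o' rr \<and> z \<in> ball b \<epsilon> \<longrightarrow> K z = H z)"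
    proof (cases "b \<in> sphere o' rr")
      case True
      then obtain \<epsilon> K where "\<epsilon> > 0" "csect (ball b \<epsilon>) K" "\<And>z. z \<in> ball o' rr \<Longrightarrow> z \<in> ball b \<epsilon> \<Longrightarrow> K z = H z"
        using boundary_extension[OF H _ rr, of b] by auto
      then show ?thesis by blast
    qed simp
  qed
  then obtain \<epsilon> K where K: "\<And>b. b \<in> sphere o' rr \<Longrightarrow> \<epsilon> b > 0" "\<And>b. b \<in> sphere o' rr \<Longrightarrow> csect (ball b (\<epsilon> b)) (K b)"
    "\<And>b z. b \<in> sphere o' rr \<Longrightarrow> z \<in> ball o' rr \<Longrightarrow> z \<in> ball b (\<epsilon> b) \<Longrightarrow> K b z = H z" by metis
  \<comment> \<open>The centre \<open>o'\<close> is not on the sphere and serves as the index of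
    \<open>H\<close> itself.\<close>
  define T where "T b = (if b = o' then ball o' rr else ball b (\<epsilon> b))" for b
  define L where "L b = (if b = o' then H else K b)" for b
  have on: "o' \<notin> sphere o' rr" using rr by auto
  have "\<exists>H. csect (\<Union>i\<in>insert o' (sphere o' rr). T i) H \<and> (\<forall>i\<in>insert o' (sphere o' rr). \<forall>z\<in>T i. H z = L i z)"
  proof (rule csect_glue[of "insert o' (sphere o' rr)" T L])
    show "open (T i) \<and> csect (T i) (L i)" if "i \<in> insert o' (sphere o' rr)" for i using that K(2)[of i] H by (cases "i = o'") (simp_all add: T_def L_def)
    fix i j z assume ij: "i \<in> insert o' (sphere o' rr)" "j \<in> insert o' (sphere o' rr)" and z: "z \<in> T i" "z \<in> T j"
    consider "i = o'" | "j = o'" | "i \<in> sphere o' rr" "j \<in> sphere o' rr" "i \<noteq> j" | "i = j" using ij by blast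
    then show "L i z = L j z"
    proof cases
      case 1 then show ?thesis using K(3)[of j z] ij z by (cases "j = o'") (auto simp: T_def L_def)
    next
      case 2 then show ?thesis using K(3)[of i z] ij z by (cases "i = o'") (auto simp: T_def L_def)
    next
      case 3
      then have n: "i \<noteq> o'" "j \<noteq> o'" using on by auto
      have zz: "z \<in> ball i (\<epsilon> i)" "z \<in> ball j (\<epsilon> j)" using z n by (auto simp: T_def)
      have e: "\<epsilon> i > 0" "\<epsilon> j > 0" using K(1) 3 by auto
      have dij: "dist i j < \<epsilon> i + \<epsilon> j" using zz dist_triangle_less_add[of i z "\<epsilon> i" j "\<epsilon> j"] by (simp add: dist_commute)
      \<comment> \<open>\<open>w\<close> divides the chord from \<open>i\<close> to \<open>j\<close>
        in the ratio of the two radii, so it lies in both small balls. By strict convexity it also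
        lies inside the ball of radius \<open>rr\<close>, where both continuations equal
        \<open>H\<close>.\<close>
      define u where "u = \<epsilon> i / (\<epsilon> i + \<epsilon> j)"
      define w where "w = (1 - u) *\<^sub>R i + u *\<^sub>R j"
      have u: "0 < u" "u < 1" "1 - u = \<epsilon> j / (\<epsilon> i + \<epsilon> j)" using e by (auto simp: u_def field_simps)
      have ue: "u * (\<epsilon> i + \<epsilon> j) = \<epsilon> i" "(1 - u) * (\<epsilon> i + \<epsilon> j) = \<epsilon> j" unfolding u(3) using e by (simp_all add: u_def)
      have "w \<in> open_segment i j" using u 3(3) by (auto simp: w_def in_segment)
      then have w1: "w \<in> ball o' rr" using dist_decreases_open_segment[of w i j o'] 3 by auto
      have "i - w = u *\<^sub>R (i - j)" "j - w = (1 - u) *\<^sub>R (j - i)" by (simp_all add: w_def algebra_simps)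
      then have "dist i w = u * dist i j" "dist j w = (1 - u) * dist i j" using u(1,2) by (simp_all add: dist_norm norm_minus_commute)
      then have w2: "w \<in> ball i (\<epsilon> i)" "w \<in> ball j (\<epsilon> j)"
        using mult_strict_left_mono[OF dij u(1)] mult_strict_left_mono[OF dij, of "1 - u"] u(1,2) ue by simp_all
      have "K i z = K j z"
      proof (rule csect_unique[of "ball i (\<epsilon> i) \<inter> ball j (\<epsilon> j)" "K i" "K j" w])
        show "connected (ball i (\<epsilon> i) \<inter> ball j (\<epsilon> j))" by (intro convex_connected convex_Int convex_ball)
        show "csect (ball i (\<epsilon> i) \<inter> ball j (\<epsilon> j)) (K i)" using K(2)[OF 3(1)] by (rule csect_subset) auto
        show "csect (ball i (\<epsilon> i) \<inter> ball j (\<epsilon> j)) (K j)" using K(2)[OF 3(2)] by (rule csect_subset) auto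
        show "K i w = K j w" using K(3)[OF 3(1) w1 w2(1)] K(3)[OF 3(2) w1 w2(2)] by simp
      qed (use w2 zz in auto)
      then show ?thesis using n by (simp add: L_def)
    qed simp
  qed
  then obtain H' where H': "csect (\<Union>i\<in>insert o' (sphere o' rr). T i) H'" "\<And>i z. i \<in> insert o' (sphere o' rr) \<Longrightarrow> z \<in> T i \<Longrightarrow> H' z = L i z"
    by blast
  let ?U = "\<Union>i\<in>insert o' (sphere o' rr). T i"
  have sub: "cball o' rr \<subseteq> ?U"
  proof
    fix z assume z: "z \<in> cball o' rr"
    show "z \<in> ?U"
    proof (cases "z \<in> sphere o' rr")
      case True
      then have "z \<in> T z" using K(1) on by (auto simp: T_def)
      then show ?thesis using True by blast
    next
      case False
      then have "z \<in> T o'" using z by (auto simp: T_def)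
      then show ?thesis by blast
    qed
  qed
  have "open ?U" by (auto simp: T_def)
  from compact_subset_open_imp_ball_epsilon_subset[OF compact_cball this sub]
  obtain \<delta> where \<delta>: "\<delta> > 0" "(\<Union>z\<in>cball o' rr. ball z \<delta>) \<subseteq> ?U" .
  have "ball o' (rr + \<delta>) \<subseteq> (\<Union>z\<in>cball o' rr. ball z \<delta>)"
  proof
    fix z assume z: "z \<in> ball o' (rr + \<delta>)"
    show "z \<in> (\<Union>z\<in>cball o' rr. ball z \<delta>)"
    proof (cases "dist o' z \<le> rr")
      case True then show ?thesis using \<delta>(1) by (intro UN_I[of z]) auto
    next
      case False
      define w where "w = o' + (rr / dist o' z) *\<^sub>R (z - o')"
      have d: "dist o' z > 0" using False rr by linarith
      have dw: "dist o' w = rr" using d rr by (simp add: w_def dist_norm norm_minus_commute)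
      have "z - w = (1 - rr / dist o' z) *\<^sub>R (z - o')" by (simp add: w_def algebra_simps)
      moreover have "rr / dist o' z \<le> 1" using False d by simp
      ultimately have "norm (z - w) = (1 - rr / dist o' z) * dist o' z" by (simp add: dist_norm norm_minus_commute)
      then have "dist w z < \<delta>" using z d by (simp add: dist_norm norm_minus_commute left_diff_distrib)
      then show ?thesis using dw by (intro UN_I[of w]) auto
    qed
  qed
  then have "csect (ball o' (rr + \<delta>)) H'" using \<delta>(2) by (intro csect_subset[OF H'(1)]) blast
  moreover have "H' o' = H o'" using H'(2)[of o' o'] rr by (simp add: T_def L_def)
  ultimately show thesis using \<delta>(1) by (intro that)
qed

text \<open>Sections normalised at the centre are unique, so those on concentric balls fit together.
  Were the admissible radii bounded, \<open>section_extend\<close> at their supremum would produce a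
  larger one.\<close>

lemma global_section: obtains H where "csect UNIV H" "H (F p0) = p0"
proof -
  let ?o = "F p0"
  define S where "S = {rr. rr > 0 \<and> (\<exists>H. csect (ball ?o rr) H \<and> H ?o = p0)}"
  have "\<forall>rr. \<exists>H. rr \<in> S \<longrightarrow> csect (ball ?o rr) H \<and> H ?o = p0" by (auto simp: S_def)
  then obtain h where h: "\<And>rr. rr \<in> S \<Longrightarrow> csect (ball ?o rr) (h rr) \<and> h rr ?o = p0" by metis
  have pos: "rr > 0" if "rr \<in> S" for rr using that by (simp add: S_def)
  have "\<exists>H. csect (\<Union>rr\<in>S. ball ?o rr) H \<and> (\<forall>rr\<in>S. \<forall>z\<in>ball ?o rr. H z = h rr z)"
  proof (rule csect_glue[of S "\<lambda>rr. ball ?o rr" h])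
    show "open (ball ?o rr) \<and> csect (ball ?o rr) (h rr)" if "rr \<in> S" for rr using h that by simp
    fix rr rr' z assume rr: "rr \<in> S" "rr' \<in> S" "z \<in> ball ?o rr" "z \<in> ball ?o rr'"
    show "h rr z = h rr' z"
    proof (rule csect_unique[of "ball ?o rr \<inter> ball ?o rr'" "h rr" "h rr'" ?o])
      show "connected (ball ?o rr \<inter> ball ?o rr')" by (intro convex_connected convex_Int convex_ball)
      show "csect (ball ?o rr \<inter> ball ?o rr') (h rr)" using h[OF rr(1)] by (auto intro: csect_subset)
      show "csect (ball ?o rr \<inter> ball ?o rr') (h rr')" using h[OF rr(2)] by (auto intro: csect_subset)
    qed (use h rr pos in auto)
  qed
  then obtain H where H: "csect (\<Union>rr\<in>S. ball ?o rr) H" "\<And>rr z. rr \<in> S \<Longrightarrow> z \<in> ball ?o rr \<Longrightarrow> H z = h rr z"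
    by blast
  obtain N K \<epsilon> where N: "\<epsilon> > 0" "csect (ball ?o \<epsilon>) K" "p0 \<in> N" "\<And>q. q \<in> N \<Longrightarrow> F q \<in> ball ?o \<epsilon> \<and> K (F q) = q"
    by (rule local_section[of p0]) blast
  have \<epsilon>S: "\<epsilon> \<in> S" using N by (auto simp: S_def)
  have Ho: "H ?o = p0" using H(2)[OF \<epsilon>S, of ?o] h[OF \<epsilon>S] N(1) by simp
  have down: "rr' \<in> S" if "rr \<in> S" "0 < rr'" "rr' \<le> rr" for rr rr'
    using that h[OF that(1)] csect_subset[of "ball ?o rr" "h rr" "ball ?o rr'"] by (auto simp: S_def subset_ball)
  have ubd: "\<not> bdd_above S"
  proof
    assume bdd: "bdd_above S"
    define rr where "rr = Sup S"
    have R0: "rr > 0" using cSup_upper[OF \<epsilon>S bdd] N(1) by (simp add: rr_def)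
    have "ball ?o rr \<subseteq> (\<Union>rr\<in>S. ball ?o rr)"
    proof
      fix z assume "z \<in> ball ?o rr"
      then obtain rr' where "rr' \<in> S" "dist ?o z < rr'" using less_cSupD[of S "dist ?o z"] \<epsilon>S by (auto simp: rr_def)
      then show "z \<in> (\<Union>rr\<in>S. ball ?o rr)" by auto
    qed
    then have "csect (ball ?o rr) H" by (rule csect_subset[OF H(1)])
    then obtain \<delta> K where "\<delta> > 0" "csect (ball ?o (rr + \<delta>)) K" "K ?o = H ?o" by (rule section_extend[OF _ R0])
    then have "rr + \<delta> \<in> S" using Ho R0 by (auto simp: S_def)
    from cSup_upper[OF this bdd] \<open>\<delta> > 0\<close> show False by (simp add: rr_def)
  qed
  have "z \<in> (\<Union>rr\<in>S. ball ?o rr)" for z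
  proof -
    obtain rr where "rr \<in> S" "dist ?o z < rr" using ubd unfolding bdd_above_def by (meson not_le)
    then show ?thesis by auto
  qed
  then have "csect UNIV H" using csect_subset[OF H(1), of UNIV] by blast
  then show thesis using Ho by (rule that)
qed

text \<open>The image of a global section is open and closed: a neighbourhood on which a local
  section inverts \<open>F\<close> lies in the image as soon as it meets it. So \<open>H\<close> is
  onto and inverts \<open>F\<close> on both sides.\<close>

lemma developing_bij: "bij F" "csect UNIV (inv F)"
proof -
  obtain p0 :: 'a where True by simp
  obtain H where H: "csect UNIV H" by (rule global_section[of p0])
  have FH: "F (H z) = z" for z using H unfolding csect_def by blast
  have key: "N \<subseteq> range H" if N: "csect (ball b \<epsilon>) K" "\<And>q. q \<in> N \<Longrightarrow> F q \<in> ball b \<epsilon> \<and> K (F q) = q" and q: "q \<in> N" "q \<in> range H" for N b \<epsilon> K q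
  proof
    fix q' assume q': "q' \<in> N"
    have e: "K (F q) = H (F q)" using N(2)[OF q(1)] q(2) FH by auto
    have "K (F q') = H (F q')"
      by (rule csect_unique[OF N(1) csect_subset[OF H subset_UNIV] connected_ball, of "F q"]) (use N(2) q(1) q' e in auto)
    then show "q' \<in> range H" using N(2)[OF q'] by (metis rangeI)
  qed
  have loc: "\<exists>N. open N \<and> p \<in> N \<and> (\<forall>q\<in>N. q \<in> range H \<longrightarrow> N \<subseteq> range H)" for p
  proof -
    obtain N K \<epsilon> where N: "open N" "p \<in> N" "csect (ball (F p) \<epsilon>) K" "\<And>q. q \<in> N \<Longrightarrow> F q \<in> ball (F p) \<epsilon> \<and> K (F q) = q"
      by (rule local_section[of p]) blast
    have "N \<subseteq> range H" if "q \<in> N" "q \<in> range H" for q by (rule key[OF N(3,4) that])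
    then show ?thesis using N(1,2) by blast
  qed
  have "open (range H)" by (subst open_subopen) (meson loc)
  moreover have "open (- range H)" by (subst open_subopen) (meson loc ComplD ComplI subsetD subsetI)
  ultimately have "- range H \<inter> UNIV = {}" using connectedD[OF con, of "range H" "- range H"] by auto
  then have r: "range H = UNIV" by auto
  have HF: "H (F q) = q" for q using r FH by (metis UNIV_I imageE)
  show "bij F" using HF FH by (metis bijI')
  have "inv F = H" using HF FH \<open>bij F\<close> by (metis bij_inv_eq_iff ext)
  then show "csect UNIV (inv F)" using H by simp
qed

end

subsection \<open>Transport of structure\<close>

lemma push_vfield_add: "push_vfield F (X \<oplus>\<^sub>v Y) = push_vfield F X \<oplus>\<^sub>v push_vfield F Y"
  by (simp add: push_vfield_def vadd_def fun_eq_iff)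

lemma push_vfield_zero: "push_vfield F vzero = vzero"
  by (simp add: push_vfield_def vzero_def fun_eq_iff)

lemma push_vfield_diff: "push_vfield F (X \<ominus>\<^sub>v Y) = push_vfield F X \<ominus>\<^sub>v push_vfield F Y"
  by (simp add: push_vfield_def vdiff_def fun_eq_iff)

lemma push_vfield_scale: "push_vfield F (h \<odot>\<^sub>v X) = (h \<circ> inv F) \<odot>\<^sub>v push_vfield F X"
  by (simp add: push_vfield_def vscale_def fun_eq_iff)

lemma inv_comp [simp]: "bij F \<Longrightarrow> inv F (F p) = p" "bij F \<Longrightarrow> F (inv F z) = z"
  by (auto simp: bij_is_inj bij_is_surj surj_f_inv_f)

lemma push_vfield_inv: assumes "bij F"
  shows "push_vfield (inv F) (push_vfield F X) = X" "push_vfield F (push_vfield (inv F) Z) = Z"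
  using assms by (simp_all add: push_vfield_def inv_inv_eq o_def)

lemma push_vfield_bracket: "bij F \<Longrightarrow> push_vfield F (bracket X Y) = bracket (push_vfield F X) (push_vfield F Y)"
  by (simp add: push_vfield_def bracket_def o_def)

lemma diffeomorphism_inv: "diffeomorphism A B F \<Longrightarrow> diffeomorphism B A (inv F)"
  by (simp add: diffeomorphism_def bij_imp_bij_inv inv_inv_eq)

lemma diffeomorphism_Cinf:
  assumes d: "diffeomorphism A B F"
  shows "f \<circ> F \<in> Cinf A \<longleftrightarrow> f \<in> Cinf B"
proof
  assume "f \<circ> F \<in> Cinf A"
  then have "(f \<circ> F) \<circ> inv F \<in> Cinf B" using d by (auto simp: diffeomorphism_def smooth_map_def)
  then show "f \<in> Cinf B" using d by (simp add: o_def diffeomorphism_def)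
qed (use d in \<open>auto simp: diffeomorphism_def smooth_map_def\<close>)

lemma push_vfield_vfields:
  assumes d: "diffeomorphism A B F" and X: "X \<in> vfields A"
  shows "push_vfield F X \<in> vfields B"
proof -
  note Ci = diffeomorphism_Cinf[OF d]
  have b: "bij F" using d by (simp add: diffeomorphism_def)
  have X': "\<And>f. f \<in> Cinf A \<Longrightarrow> X f \<in> Cinf A" "\<And>f. f \<notin> Cinf A \<Longrightarrow> X f = (\<lambda>p. 0)"
    "\<And>f h a b. f \<in> Cinf A \<Longrightarrow> h \<in> Cinf A \<Longrightarrow> X (\<lambda>p. a * f p + b * h p) = (\<lambda>p. a * X f p + b * X h p)"
    "\<And>f h. f \<in> Cinf A \<Longrightarrow> h \<in> Cinf A \<Longrightarrow> X (\<lambda>p. f p * h p) = (\<lambda>p. f p * X h p + h p * X f p)"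
    using X by (auto simp: vfields_def)
  have 1: "push_vfield F X f \<in> Cinf B" if "f \<in> Cinf B" for f
    using X'(1)[of "f \<circ> F"] that Ci[of "X (f \<circ> F) \<circ> inv F"] Ci[of f] b by (simp add: push_vfield_def o_def)
  have 2: "push_vfield F X f = (\<lambda>p. 0)" if "f \<notin> Cinf B" for f
    using X'(2)[of "f \<circ> F"] that Ci[of f] by (simp add: push_vfield_def o_def)
  have 3: "push_vfield F X (\<lambda>p. a * f p + b * h p) = (\<lambda>p. a * push_vfield F X f p + b * push_vfield F X h p)"
    "push_vfield F X (\<lambda>p. f p * h p) = (\<lambda>p. f p * push_vfield F X h p + h p * push_vfield F X f p)"
    if "f \<in> Cinf B" "h \<in> Cinf B" for f h a b
    using X'(3)[of "f \<circ> F" "h \<circ> F" a b] X'(4)[of "f \<circ> F" "h \<circ> F"] that Ci[of f] Ci[of h] \<open>bij F\<close>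
    by (simp_all add: push_vfield_def o_def)
  show ?thesis using 1 2 3 by (simp add: vfields_def)
qed

context
  fixes A :: "('a, 'e::euclidean_space) atlas" and B :: "('b, 'd::euclidean_space) atlas" and F
  assumes d: "diffeomorphism A B F"
begin

lemma d_bij: "bij F" using d by (simp add: diffeomorphism_def)

lemmas d_push = push_vfield_vfields[OF d] push_vfield_vfields[OF diffeomorphism_inv[OF d]]

lemma d_Cinf: "h \<in> Cinf A \<Longrightarrow> h \<circ> inv F \<in> Cinf B" "k \<in> Cinf B \<Longrightarrow> k \<circ> F \<in> Cinf A"
  using d by (auto simp: diffeomorphism_def smooth_map_def)

lemma pull_form:
  assumes w: "one_form B \<omega>" shows "one_form A (\<lambda>X. \<omega> (push_vfield F X) \<circ> F)"
  unfolding one_form_def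
proof (intro conjI ballI)
  note w' = w[unfolded one_form_def, THEN conjunct1] w[unfolded one_form_def, THEN conjunct2, THEN conjunct1]
    w[unfolded one_form_def, THEN conjunct2, THEN conjunct2]
  fix X assume X: "X \<in> vfields A"
  show "\<omega> (push_vfield F X) \<circ> F \<in> Cinf A" using w'(1) d_push(1)[OF X] d_Cinf(2) by blast
  show "\<omega> (push_vfield F (X \<oplus>\<^sub>v Y)) \<circ> F = (\<lambda>p. (\<omega> (push_vfield F X) \<circ> F) p + (\<omega> (push_vfield F Y) \<circ> F) p)" if "Y \<in> vfields A" for Y
    using w'(2)[rule_format, OF d_push(1)[OF X] d_push(1)[OF that]] by (simp add: push_vfield_add fun_eq_iff)
  show "\<omega> (push_vfield F (h \<odot>\<^sub>v X)) \<circ> F = (\<lambda>p. h p * (\<omega> (push_vfield F X) \<circ> F) p)" if "h \<in> Cinf A" for h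
    using w'(3)[rule_format, OF d_Cinf(1)[OF that] d_push(1)[OF X]] d_bij by (simp add: push_vfield_scale fun_eq_iff)
qed

lemma pull_endo:
  assumes w: "endo_field B \<phi>" shows "endo_field A (\<lambda>X. push_vfield (inv F) (\<phi> (push_vfield F X)))"
  unfolding endo_field_def
proof (intro conjI ballI)
  note w' = w[unfolded endo_field_def, THEN conjunct1] w[unfolded endo_field_def, THEN conjunct2, THEN conjunct1]
    w[unfolded endo_field_def, THEN conjunct2, THEN conjunct2]
  let ?p = "\<lambda>X. push_vfield (inv F) (\<phi> (push_vfield F X))"
  fix X assume X: "X \<in> vfields A"
  show "?p X \<in> vfields A" using w'(1) d_push(1)[OF X] d_push(2) by blast
  show "?p (X \<oplus>\<^sub>v Y) = ?p X \<oplus>\<^sub>v ?p Y" if "Y \<in> vfields A" for Y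
    using w'(2)[rule_format, OF d_push(1)[OF X] d_push(1)[OF that]] by (simp add: push_vfield_add)
  show "?p (h \<odot>\<^sub>v X) = h \<odot>\<^sub>v ?p X" if "h \<in> Cinf A" for h
    using w'(3)[rule_format, OF d_Cinf(1)[OF that] d_push(1)[OF X]] d_bij
    by (simp add: push_vfield_scale inv_inv_eq) (simp add: o_def)
qed

lemma pull_metric: "riemannian_metric B g \<Longrightarrow> riemannian_metric A (\<lambda>X Y. g (push_vfield F X) (push_vfield F Y) \<circ> F)"
  unfolding riemannian_metric_def
proof (intro conjI ballI allI impI)
  assume *: "(\<forall>X\<in>vfields B. one_form B (g X)) \<and> (\<forall>X\<in>vfields B. \<forall>Y\<in>vfields B. g X Y = g Y X) \<and>
    (\<forall>X\<in>vfields B. \<forall>p. (\<exists>f. X f p \<noteq> 0) \<longrightarrow> g X X p > 0)"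
  fix X assume X: "X \<in> vfields A"
  show "one_form A (\<lambda>Y. g (push_vfield F X) (push_vfield F Y) \<circ> F)" using pull_form * d_push(1)[OF X] by blast
  show "g (push_vfield F X) (push_vfield F Y) \<circ> F = g (push_vfield F Y) (push_vfield F X) \<circ> F" if "Y \<in> vfields A" for Y
    using * d_push(1)[OF X] d_push(1)[OF that] by metis
  fix p assume "\<exists>f. X f p \<noteq> 0"
  then obtain f where "X f p \<noteq> 0" by blast
  then have "push_vfield F X (f \<circ> inv F) (F p) \<noteq> 0" using d_bij by (simp add: push_vfield_def o_def)
  then have "0 < g (push_vfield F X) (push_vfield F X) (F p)" using * d_push(1)[OF X] by blast
  then show "0 < (g (push_vfield F X) (push_vfield F X) \<circ> F) p" by simp
qed

lemma pull_linear_connection: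
  assumes D: "linear_connection B D" shows "linear_connection A (pull_connection F D)"
proof -
  have 1: "endo_field A (\<lambda>X. pull_connection F D X Y)" if "Y \<in> vfields A" for Y
    using pull_endo[of "\<lambda>X. D X (push_vfield F Y)"] D d_push(1)[OF that] by (simp add: linear_connection_def pull_connection_def)
  have "push_vfield F X (h \<circ> inv F) = X h \<circ> inv F" for X h
    using d_bij by (simp add: push_vfield_def o_def)
  then show ?thesis using 1 D d_push d_Cinf d_bij
    by (simp add: linear_connection_def pull_connection_def push_vfield_add push_vfield_scale push_vfield_inv o_def inv_inv_eq)
qed

end

lemma Cinf_ga_atlas: "f \<in> Cinf ga_atlas \<longleftrightarrow> Cinf_on f UNIV"
  by (simp add: Cinf_def ga_atlas_def inv_id[unfolded id_def] id_def o_def)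

lemma ga_mult_expand: "ga_mult a z = (fst a + fst z, exp (fst a) * fst (snd z) + fst (snd a), snd (snd a) + snd (snd z))"
  by (cases a; cases z) simp

lemma Cinf_ga_mult: assumes f: "f \<in> Cinf ga_atlas" shows "f \<circ> ga_mult a \<in> Cinf ga_atlas"
proof -
  have "Cinf_on (\<lambda>z. f (ga_mult a z)) UNIV"
  proof (rule Cinf_on_compose[OF open_UNIV open_UNIV, where f = f and G = "ga_mult a"])
    fix b :: ga
    have c: "Cinf_on (\<lambda>z::ga. fst z) UNIV" "Cinf_on (\<lambda>z::ga. fst (snd z)) UNIV" "Cinf_on (\<lambda>z::ga. snd (snd z)) UNIV"
      by (auto intro!: Cinf_on_linear bounded_linear_intros)
    have e: "(\<lambda>z. ga_mult a z \<bullet> b) = (\<lambda>z. (fst a + fst z) * fst b + ((exp (fst a) * fst (snd z) + fst (snd a)) * fst (snd b) + (snd (snd a) + snd (snd z)) * snd (snd b)))"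
      by (simp add: fun_eq_iff ga_mult_expand inner_prod_def)
    show "Cinf_on (\<lambda>z. ga_mult a z \<bullet> b) UNIV"
      unfolding e by (intro Cinf_on_add Cinf_on_mult Cinf_on_const c open_UNIV)
  qed (use f in \<open>auto simp: Cinf_ga_atlas\<close>)
  then show ?thesis by (simp add: Cinf_ga_atlas o_def)
qed

lemma left_invariant_at_one:
  assumes Y: "left_invariant ga_atlas ga_mult Y" and f: "f \<in> Cinf ga_atlas"
  shows "Y f a = Y (f \<circ> ga_mult a) (0, 0, 0)"
proof -
  have "Y (f \<circ> ga_mult a) = Y f \<circ> ga_mult a" using assms unfolding left_invariant_def by blast
  then show ?thesis by (simp add: ga_mult_expand)
qed

text \<open>A left invariant field is determined by its value at the identity, which is
  \<open>(0, 0, 0)\<close> because the first coordinate is the logarithm of the dilation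
  factor.\<close>

lemma left_invariant_combination:
  assumes L: "left_invariant ga_atlas ga_mult L1" "left_invariant ga_atlas ga_mult L2" "left_invariant ga_atlas ga_mult L3"
    and Y: "left_invariant ga_atlas ga_mult Y"
    and 0: "\<And>f. f \<in> Cinf ga_atlas \<Longrightarrow> Y f (0, 0, 0) = a * L1 f (0, 0, 0) + b * L2 f (0, 0, 0) + c * L3 f (0, 0, 0)"
  shows "Y = (\<lambda>p. a) \<odot>\<^sub>v L1 \<oplus>\<^sub>v (\<lambda>p. b) \<odot>\<^sub>v L2 \<oplus>\<^sub>v (\<lambda>p. c) \<odot>\<^sub>v L3"
proof (intro ext)
  fix f p
  show "Y f p = ((\<lambda>p. a) \<odot>\<^sub>v L1 \<oplus>\<^sub>v (\<lambda>p. b) \<odot>\<^sub>v L2 \<oplus>\<^sub>v (\<lambda>p. c) \<odot>\<^sub>v L3) f p"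
  proof (cases "f \<in> Cinf ga_atlas")
    case True
    note one = left_invariant_at_one[OF _ True, of _ p]
    show ?thesis unfolding vadd_def vscale_def one[OF Y] one[OF L(1)] one[OF L(2)] one[OF L(3)]
      by (rule 0[OF Cinf_ga_mult[OF True]])
  next
    case False
    then show ?thesis using L Y by (simp add: left_invariant_def vfields_def vadd_def vscale_def)
  qed
qed

context developing begin

lemma F_diffeomorphism: "diffeomorphism A ga_atlas F"
  unfolding diffeomorphism_def smooth_map_def
proof (intro conjI ballI developing_bij(1))
  fix f :: "ga \<Rightarrow> real" assume "f \<in> Cinf ga_atlas"
  have "(\<lambda>p. F p \<bullet> b) \<in> C" for b
  proof -
    have e: "(\<lambda>p. F p \<bullet> b) = (\<lambda>p. x p * fst b + (y p * fst (snd b) + t p * snd (snd b)))"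
      by (simp add: fun_eq_iff F_def inner_prod_def)
    show ?thesis unfolding e by (intro C_add C_mult xyt C_const)
  qed
  then show "f \<circ> F \<in> C" using C_compose_vec[of F f] \<open>f \<in> Cinf ga_atlas\<close> by (simp add: Cinf_ga_atlas o_def)
next
  fix f assume "f \<in> C"
  then show "f \<circ> inv F \<in> Cinf ga_atlas"
    using csect_smooth[OF open_UNIV developing_bij(2)] by (simp add: Cinf_ga_atlas o_def)
qed

text \<open>The condition on the components \<open>w\<close> is equivariance: the derivative of left
  translation by \<open>a\<close> multiplies the second component by \<open>exp (fst a)\<close> and
  fixes the others.\<close>

lemma push_left_invariant:
  assumes X: "X \<in> VF" and Xw: "\<And>k p. k \<in> C \<Longrightarrow> X k p = Pv (w (F p)) k p"
    and w: "\<And>a z. w (ga_mult a z) = (fst (w z), exp (fst a) * fst (snd (w z)), snd (snd (w z)))"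
  shows "left_invariant ga_atlas ga_mult (push_vfield F X)"
  unfolding left_invariant_def
proof (intro conjI allI ballI)
  note d = F_diffeomorphism
  note b = developing_bij(1)
  show "push_vfield F X \<in> vfields ga_atlas" by (rule push_vfield_vfields[OF d X])
  fix a f assume f: "f \<in> Cinf ga_atlas"
  have der: "(k has_derivative (\<lambda>v. Pv v (k \<circ> F) (inv F z))) (at z)" if "k \<in> Cinf ga_atlas" for k z
    using csect_deriv[OF open_UNIV developing_bij(2) UNIV_I d_Cinf(2)[OF d that], of z] b by (simp add: o_def)
  have pX: "push_vfield F X k z = Pv (w z) (k \<circ> F) (inv F z)" if "k \<in> Cinf ga_atlas" for k z
    using Xw[OF d_Cinf(2)[OF d that]] b by (simp add: push_vfield_def)
  have fa: "f \<circ> ga_mult a \<in> Cinf ga_atlas" by (rule Cinf_ga_mult[OF f])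
  show "push_vfield F X (f \<circ> ga_mult a) = push_vfield F X f \<circ> ga_mult a"
  proof
    fix z
    have "(ga_mult a has_derivative (\<lambda>v. (fst v, exp (fst a) * fst (snd v), snd (snd v)))) (at z)"
      unfolding ga_mult_expand[abs_def] by (auto intro!: derivative_eq_intros)
    from diff_chain_at[OF this der[OF f]]
    have "(\<lambda>v. Pv v ((f \<circ> ga_mult a) \<circ> F) (inv F z)) =
      (\<lambda>v. Pv (fst v, exp (fst a) * fst (snd v), snd (snd v)) (f \<circ> F) (inv F (ga_mult a z)))"
      using has_derivative_unique[OF der[OF fa, of z]] by (simp add: o_def)
    then have "Pv (w z) ((f \<circ> ga_mult a) \<circ> F) (inv F z) = Pv (w (ga_mult a z)) (f \<circ> F) (inv F (ga_mult a z))"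
      unfolding w by (rule fun_cong)
    then show "push_vfield F X (f \<circ> ga_mult a) z = (push_vfield F X f \<circ> ga_mult a) z"
      by (simp add: pX[OF f] pX[OF fa])
  qed
qed

end

section \<open>Group coordinates from a frame, and the identification with the group\<close>

context sasaki begin

lemma gaframe_g:
  assumes "gaframe \<alpha> e"
  shows "e \<in> VF" "onb p e (\<phi> e) \<xi>" "g e e p = 1" "g (\<phi> e) (\<phi> e) p = 1" "g \<xi> \<xi> p = 1" "g e (\<phi> e) p = 0" "g (\<phi> e) e p = 0"
    "g (\<phi> e) \<xi> p = 0" "g \<xi> e p = 0" "g e \<xi> p = 0" "g \<xi> (\<phi> e) p = 0"
proof -
  have f: "frame p e" for p by (rule gaframe_frame[OF assms])
  show e: "e \<in> VF" by (rule frame_VF[OF f])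
  show o: "onb p e (\<phi> e) \<xi>" by (rule frame_onb[OF f])
  show "g e e p = 1" "g (\<phi> e) (\<phi> e) p = 1" "g \<xi> \<xi> p = 1" "g e (\<phi> e) p = 0" "g (\<phi> e) \<xi> p = 0" "g \<xi> e p = 0"
    using o unfolding onb_def by blast+
  then show "g (\<phi> e) e p = 0" "g e \<xi> p = 0" "g \<xi> (\<phi> e) p = 0" using g_sym e by (metis phi_VF xi_VF)+
qed

lemma gaframe_structure:
  assumes ga: "gaframe \<alpha> e" and X: "X \<in> VF" and Y: "Y \<in> VF"
  shows "X (g Y e) p - Y (g X e) p - g (bracket X Y) e p = 0"
    "X (g Y (\<phi> e)) p - Y (g X (\<phi> e)) p - g (bracket X Y) (\<phi> e) p = \<alpha> * (g X (\<phi> e) p * g Y e p - g Y (\<phi> e) p * g X e p)"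
    "X (\<eta> Y) p - Y (\<eta> X) p - \<eta> (bracket X Y) p = 2 * (g X (\<phi> e) p * g Y e p - g Y (\<phi> e) p * g X e p)"
proof -
  have F: "frame_on UNIV e" using ga by (simp add: frame_on_def gaframe_def)
  have s: "g (D X e) (\<phi> e) p = - \<eta> X p - \<alpha> * g X (\<phi> e) p" "g (D Y e) (\<phi> e) p = - \<eta> Y p - \<alpha> * g Y (\<phi> e) p"
    using ga X Y by (auto simp: gaframe_def)
  show "X (g Y e) p - Y (g X e) p - g (bracket X Y) e p = 0"
    unfolding coframe_ext_deriv(1)[OF F UNIV_I X Y] s by simp
  show "X (g Y (\<phi> e)) p - Y (g X (\<phi> e)) p - g (bracket X Y) (\<phi> e) p = \<alpha> * (g X (\<phi> e) p * g Y e p - g Y (\<phi> e) p * g X e p)"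
    unfolding coframe_ext_deriv(2)[OF F UNIV_I X Y] s by (simp add: algebra_simps)
  show "X (\<eta> Y) p - Y (\<eta> X) p - \<eta> (bracket X Y) p = 2 * (g X (\<phi> e) p * g Y e p - g Y (\<phi> e) p * g X e p)"
    unfolding eta_ext_deriv[OF gaframe_frame[OF ga] X Y] by (simp add: algebra_simps)
qed

text \<open>The defining properties of a derivation give only sums and products, so the chain rule
  is verified in coordinates.\<close>

lemma VF_exp:
  assumes X: "X \<in> VF" and x: "x \<in> C" shows "X (\<lambda>q. exp (x q)) p = exp (x p) * X x p"
proof -
  have ex: "(\<lambda>q. exp (x q)) \<in> C" by (rule C_compose[OF x Cinf_on_exp]) auto
  obtain W a r G h d where cc: "coords W (a :: real^3) r G h d" "p = G a" "p \<in> W" by (rule coords_exist[OF open_UNIV UNIV_I])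
  note c = coordsD[OF cc(1)]
  have a: "a \<in> ball a r" using c(2) by simp
  let ?v = "\<Sum>b\<in>Basis. X (h b) p *\<^sub>R b"
  have "((\<lambda>z. exp (x (G z))) has_derivative (\<lambda>v. exp (x p) * (\<Sum>b\<in>Basis. (v \<bullet> b) * d b x p))) (at a)"
    using DERIV_compose_FDERIV[OF DERIV_exp c(9)[OF x a]] by (simp add: cc(2) mult.commute)
  from has_derivative_unique[OF this c(9)[OF ex a]]
  have "exp (x p) * (\<Sum>b\<in>Basis. (?v \<bullet> b) * d b x p) = (\<Sum>b\<in>Basis. (?v \<bullet> b) * d b (\<lambda>q. exp (x q)) p)"
    unfolding cc(2) by (rule fun_cong)
  then show ?thesis unfolding c(10)[OF X x cc(3)] c(10)[OF X ex cc(3)] by simp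
qed

text \<open>The form dual to \<open>e\<close> is closed. The form dual to \<open>\<phi> e\<close>
  becomes closed after multiplication by the integrating factor \<open>exp x\<close>, which fixes
  the factor \<open>\<alpha>\<close> in \<open>x\<close>. Subtracting \<open>2 / \<alpha>\<close>
  times the form dual to \<open>\<phi> e\<close> from \<open>\<eta>\<close> cancels the exterior
  derivative of \<open>\<eta>\<close>.\<close>

lemma gaframe_potentials:
  assumes ga: "gaframe \<alpha> e" and \<alpha>: "\<alpha> \<noteq> 0" and sc: "simply_connected (UNIV :: 'a set)"
  obtains x y t where "x \<in> C" "y \<in> C" "t \<in> C" "\<And>X p. X \<in> VF \<Longrightarrow> X x p = \<alpha> * g X e p"
    "\<And>X p. X \<in> VF \<Longrightarrow> X y p = exp (x p) * g X (\<phi> e) p" "\<And>X p. X \<in> VF \<Longrightarrow> X t p = \<eta> X p - 2 / \<alpha> * g X (\<phi> e) p"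
proof -
  have e: "e \<in> VF" by (rule gaframe_g(1)[OF ga])
  note s = gaframe_structure[OF ga]
  have cm: "X (\<lambda>q. a * k q) p = a * X k p" if "X \<in> VF" "k \<in> C" for X k p and a :: real by (rule VF_cmult[OF that])
  obtain x where x: "x \<in> C" "\<And>X p. X \<in> VF \<Longrightarrow> X x p = \<alpha> * g X e p"
  proof (rule closed_form_has_potential[OF sc, of "\<lambda>X p. \<alpha> * g X e p"])
    show "one_form A (\<lambda>X p. \<alpha> * g X e p)" using e by (simp add: one_form_def g_simps fun_eq_iff C_mult algebra_simps)
    fix X Y p assume X: "X \<in> VF" and Y: "Y \<in> VF"
    have "\<alpha> * (X (g Y e) p - Y (g X e) p - g (bracket X Y) e p) = 0" unfolding s(1)[OF X Y] by simp
    then show "X (\<lambda>p. \<alpha> * g Y e p) p - Y (\<lambda>p. \<alpha> * g X e p) p - \<alpha> * g (bracket X Y) e p = 0"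
      using X Y e by (simp add: cm algebra_simps)
  qed (rule that)
  have ex: "(\<lambda>q. exp (x q)) \<in> C" by (rule C_compose[OF x(1) Cinf_on_exp]) auto
  have Xex: "X (\<lambda>q. exp (x q)) p = exp (x p) * (\<alpha> * g X e p)" if X: "X \<in> VF" for X p
    using VF_exp[OF X x(1)] x(2)[OF X] by simp
  obtain y where y: "y \<in> C" "\<And>X p. X \<in> VF \<Longrightarrow> X y p = exp (x p) * g X (\<phi> e) p"
  proof (rule closed_form_has_potential[OF sc, of "\<lambda>X p. exp (x p) * g X (\<phi> e) p"])
    show "one_form A (\<lambda>X p. exp (x p) * g X (\<phi> e) p)" using e ex by (simp add: one_form_def g_simps fun_eq_iff C_mult algebra_simps)
    fix X Y p assume X: "X \<in> VF" and Y: "Y \<in> VF"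
    have "X (\<lambda>p. exp (x p) * g Y (\<phi> e) p) p - Y (\<lambda>p. exp (x p) * g X (\<phi> e) p) p - exp (x p) * g (bracket X Y) (\<phi> e) p =
      exp (x p) * ((X (g Y (\<phi> e)) p - Y (g X (\<phi> e)) p - g (bracket X Y) (\<phi> e) p) + \<alpha> * (g X e p * g Y (\<phi> e) p - g Y e p * g X (\<phi> e) p))"
      using VF_mult[OF X ex g_C[OF Y phi_VF[OF e]], of p] VF_mult[OF Y ex g_C[OF X phi_VF[OF e]], of p]
      by (simp add: Xex[OF X] Xex[OF Y] algebra_simps)
    also have "\<dots> = 0" unfolding s(2)[OF X Y] by (simp add: algebra_simps)
    finally show "X (\<lambda>p. exp (x p) * g Y (\<phi> e) p) p - Y (\<lambda>p. exp (x p) * g X (\<phi> e) p) p - exp (x p) * g (bracket X Y) (\<phi> e) p = 0" .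
  qed (rule that)
  define k where "k = 2 / \<alpha>"
  have ka: "k * \<alpha> = 2" using \<alpha> by (simp add: k_def)
  obtain t where t: "t \<in> C" "\<And>X p. X \<in> VF \<Longrightarrow> X t p = \<eta> X p - k * g X (\<phi> e) p"
  proof (rule closed_form_has_potential[OF sc, of "\<lambda>X p. \<eta> X p - k * g X (\<phi> e) p"])
    show "one_form A (\<lambda>X p. \<eta> X p - k * g X (\<phi> e) p)"
      unfolding one_form_def
    proof (intro conjI ballI)
      fix X assume X: "X \<in> VF"
      show "(\<lambda>p. \<eta> X p - k * g X (\<phi> e) p) \<in> C" by (intro C_diff C_mult C_const eta_C g_C X phi_VF e)
    qed (use e in \<open>simp_all add: g_simps eta_simps fun_eq_iff algebra_simps\<close>)
    fix X Y p assume X: "X \<in> VF" and Y: "Y \<in> VF"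
    have "X (\<lambda>p. \<eta> Y p - k * g Y (\<phi> e) p) p - Y (\<lambda>p. \<eta> X p - k * g X (\<phi> e) p) p - (\<eta> (bracket X Y) p - k * g (bracket X Y) (\<phi> e) p) =
      (X (\<eta> Y) p - Y (\<eta> X) p - \<eta> (bracket X Y) p) - k * (X (g Y (\<phi> e)) p - Y (g X (\<phi> e)) p - g (bracket X Y) (\<phi> e) p)"
      using VF_diff[OF X eta_C[OF Y] C_mult[OF C_const g_C[OF Y phi_VF[OF e]]]] VF_diff[OF Y eta_C[OF X] C_mult[OF C_const g_C[OF X phi_VF[OF e]]]]
      by (simp add: cm X Y e algebra_simps)
    also have "\<dots> = 0" unfolding s(2,3)[OF X Y] mult.assoc[symmetric] ka by simp
    finally show "X (\<lambda>p. \<eta> Y p - k * g Y (\<phi> e) p) p - Y (\<lambda>p. \<eta> X p - k * g X (\<phi> e) p) p - (\<eta> (bracket X Y) p - k * g (bracket X Y) (\<phi> e) p) = 0" .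
  qed (rule that)
  show thesis by (rule that[OF x(1) y(1) t(1) x(2) y(2) t(2)[unfolded k_def]])
qed

text \<open>In the coordinates \<open>x, y, t\<close> the frame becomes \<open>\<alpha> \<partial>\<^sub>x, exp x \<partial>\<^sub>y - (2 / \<alpha>) \<partial>\<^sub>t, \<partial>\<^sub>t\<close>.\<close>

lemma gaframe_developing:
  assumes ga: "gaframe \<alpha> e" and \<alpha>: "\<alpha> > 0" and sc: "simply_connected (UNIV :: 'a set)"
    and con: "connected (UNIV :: 'a set)" and cmp: "riemannian_complete A g"
  obtains F where "diffeomorphism A ga_atlas F" "left_invariant ga_atlas ga_mult (push_vfield F e)"
    "left_invariant ga_atlas ga_mult (push_vfield F (\<phi> e))" "left_invariant ga_atlas ga_mult (push_vfield F \<xi>)"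
proof -
  obtain x y t where xyt: "x \<in> C" "y \<in> C" "t \<in> C" and d: "\<And>X p. X \<in> VF \<Longrightarrow> X x p = \<alpha> * g X e p"
    "\<And>X p. X \<in> VF \<Longrightarrow> X y p = exp (x p) * g X (\<phi> e) p" "\<And>X p. X \<in> VF \<Longrightarrow> X t p = \<eta> X p - 2 / \<alpha> * g X (\<phi> e) p"
    by (rule gaframe_potentials[OF ga _ sc]) (use \<alpha> in auto)
  note G = gaframe_g[OF ga]
  have ex: "(\<lambda>q. exp (- x q)) \<in> C" by (rule C_compose[OF C_minus[OF xyt(1)] Cinf_on_exp]) auto
  \<comment> \<open>The coordinate fields of \<open>x\<close> and \<open>y\<close>, found by solving
    the coordinate expressions of the frame for them; that of \<open>t\<close> is
    \<open>\<xi>\<close>.\<close>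
  define P1 P2 where "P1 = (\<lambda>p. 1 / \<alpha>) \<odot>\<^sub>v e" and "P2 = (\<lambda>q. exp (- x q)) \<odot>\<^sub>v (\<phi> e \<oplus>\<^sub>v (\<lambda>p. 2 / \<alpha>) \<odot>\<^sub>v \<xi>)"
  have PV: "P1 \<in> VF" "P2 \<in> VF" using ex G(1) by (auto simp: P1_def P2_def)
  interpret developing A M D x y t P1 P2 \<xi>
  proof unfold_locales
    fix X f p assume X: "X \<in> VF" and f: "f \<in> C"
    have "exp (x p) * exp (- x p) = 1" by (simp flip: exp_add)
    then have ee: "exp (x p) * u * (exp (- x p) * v) = u * v" for u v
      using mult.commute[of "exp (x p)" u] by (metis (no_types) mult.assoc mult_1)
    have P2: "P2 f p = exp (- x p) * (\<phi> e f p + 2 / \<alpha> * \<xi> f p)" by (simp add: P2_def)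
    have "X y p * P2 f p = g X (\<phi> e) p * (\<phi> e f p + 2 / \<alpha> * \<xi> f p)" unfolding d(2)[OF X] P2 by (rule ee)
    then show "X f p = X x p * P1 f p + X y p * P2 f p + X t p * \<xi> f p"
      using \<alpha> X onb_span[OF G(2) X, of f p] by (simp add: d P1_def algebra_simps)
  next
    fix rr a b c :: real
    \<comment> \<open>The only unbounded factor in the lengths of the coordinate fields is
      \<open>exp (- x p)\<close>, and it is at most \<open>exp rr\<close> where the norm of the
      coordinates is at most \<open>rr\<close>. The bound sought is a positive number whose square
      exceeds \<open>K\<close>; \<open>K + 1\<close> is one.\<close>
    define K where "K = (a / \<alpha>)\<^sup>2 + (exp rr * b)\<^sup>2 + (2 / \<alpha> * (exp rr * \<bar>b\<bar>) + \<bar>c\<bar>)\<^sup>2"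
    have K: "K \<ge> 0" by (simp add: K_def)
    have "g V V p \<le> (K + 1) * (K + 1)" if n: "norm (x p, y p, t p) \<le> rr"
      and V: "V = (\<lambda>p. a) \<odot>\<^sub>v P1 \<oplus>\<^sub>v (\<lambda>p. b) \<odot>\<^sub>v P2 \<oplus>\<^sub>v (\<lambda>p. c) \<odot>\<^sub>v \<xi>" for V p
    proof -
      have VV: "V \<in> VF" using PV by (simp add: V)
      have v: "g V e p = a / \<alpha>" "g V (\<phi> e) p = b * exp (- x p)" "g V \<xi> p = b * exp (- x p) * (2 / \<alpha>) + c"
        using PV ex G(1) gaframe_frame[OF ga, of p] by (simp_all add: V P1_def P2_def g_simps eta_simps frame_def G(3-))
      have "\<bar>x p\<bar> \<le> rr" using n norm_fst_le[of "x p" "(y p, t p)"] by simp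
      then have le: "exp (- x p) \<le> exp rr" by simp
      have "g V V p = (a / \<alpha>)\<^sup>2 + (b * exp (- x p))\<^sup>2 + (b * exp (- x p) * (2 / \<alpha>) + c)\<^sup>2"
        using onb_g[OF G(2) VV VV, of p] unfolding v by (simp add: power2_eq_square)
      also have "\<dots> \<le> K" unfolding K_def
      proof (intro add_mono order_refl)
        have b: "\<bar>b * exp (- x p)\<bar> \<le> exp rr * \<bar>b\<bar>" using mult_right_mono[OF le abs_ge_zero[of b]]
          by (simp only: abs_mult abs_exp_cancel mult.commute[of "\<bar>b\<bar>"])
        then show "(b * exp (- x p))\<^sup>2 \<le> (exp rr * b)\<^sup>2" by (simp add: abs_le_square_iff[symmetric] abs_mult)
        have "\<bar>b * exp (- x p) * (2 / \<alpha>) + c\<bar> \<le> \<bar>b * exp (- x p)\<bar> * (2 / \<alpha>) + \<bar>c\<bar>"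
          using abs_triangle_ineq[of "b * exp (- x p) * (2 / \<alpha>)" c] \<alpha> by (simp add: abs_mult)
        also have "\<dots> \<le> exp rr * \<bar>b\<bar> * (2 / \<alpha>) + \<bar>c\<bar>" using b \<alpha> by (intro add_mono mult_right_mono) auto
        finally show "(b * exp (- x p) * (2 / \<alpha>) + c)\<^sup>2 \<le> (2 / \<alpha> * (exp rr * \<bar>b\<bar>) + \<bar>c\<bar>)\<^sup>2"
          using \<alpha> by (intro power2_le_iff_abs_le[THEN iffD2]) (auto simp: mult.commute)
      qed
      also have "\<dots> \<le> (K + 1) * (K + 1)" using K by (simp add: algebra_simps)
      finally show ?thesis .
    qed
    then show "\<exists>B>0. \<forall>p. norm (x p, y p, t p) \<le> rr \<longrightarrow>
      (let V = (\<lambda>p. a) \<odot>\<^sub>v P1 \<oplus>\<^sub>v (\<lambda>p. b) \<odot>\<^sub>v P2 \<oplus>\<^sub>v (\<lambda>p. c) \<odot>\<^sub>v \<xi> in g V V p \<le> B * B)"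
      using K by (intro exI[of _ "K + 1"]) (simp add: Let_def)
  qed (use xyt PV con cmp in auto)
  show thesis
  proof (rule that[OF F_diffeomorphism])
    have "e k p = Pv (\<alpha>, 0, 0) k p" for k p unfolding Pv_apply using \<alpha> by (simp add: P1_def)
    then show "left_invariant ga_atlas ga_mult (push_vfield F e)" by (intro push_left_invariant[where w = "\<lambda>z. (\<alpha>, 0, 0)"] G(1)) auto
    show "left_invariant ga_atlas ga_mult (push_vfield F \<xi>)"
      by (rule push_left_invariant[where w = "\<lambda>z. (0, 0, 1)"]) (auto simp: Pv_apply)
    have "\<phi> e k p = Pv (0, exp (fst (F p)), - 2 / \<alpha>) k p" for k p
    proof -
      have "exp (x p) * P2 k p = (exp (x p) * exp (- x p)) * (\<phi> e k p + 2 / \<alpha> * \<xi> k p)"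
        by (simp add: P2_def mult.assoc)
      also have "\<dots> = \<phi> e k p + 2 / \<alpha> * \<xi> k p" by (simp flip: exp_add)
      finally show ?thesis unfolding Pv_apply F_def by simp
    qed
    then show "left_invariant ga_atlas ga_mult (push_vfield F (\<phi> e))"
      by (intro push_left_invariant[where w = "\<lambda>z. (0, exp (fst z), - 2 / \<alpha>)"] phi_VF G(1)) (auto simp: ga_mult_expand exp_add)
  qed
qed

text \<open>The structure on the group is defined by transport along \<open>F\<close>, so that
  \<open>F\<close> is an isomorphism by construction; the work lies in the left invariance of the
  frame. The connection is the transport of \<open>D + Sten\<close>, for which the frame is parallel
  and hence every left invariant field, being a constant combination of it.\<close>

lemma gaframe_identification:
  assumes ga: "gaframe (sqrt (-(c+3))) e" and c: "c < -3" and sc: "simply_connected (UNIV :: 'a set)"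
    and con: "connected (UNIV :: 'a set)" and cmp: "riemannian_complete A g"
  obtains F D' where "ga_identification c A M F" "cartan_schouten_minus ga_atlas ga_mult D'"
    "connection_diff A (pull_connection F D') D = Sten (-1) ((\<lambda>p. sqrt (-(c+3))) \<odot>\<^sub>v \<phi> e)"
proof -
  let ?\<alpha> = "sqrt (-(c+3))"
  have \<alpha>: "?\<alpha> > 0" using c by simp
  obtain F where d: "diffeomorphism A ga_atlas F" and L: "left_invariant ga_atlas ga_mult (push_vfield F e)"
    "left_invariant ga_atlas ga_mult (push_vfield F (\<phi> e))" "left_invariant ga_atlas ga_mult (push_vfield F \<xi>)"
    by (rule gaframe_developing[OF ga \<alpha> sc con cmp])
  note d' = diffeomorphism_inv[OF d]
  note bij = d_bij[OF d]
  note pV = d_push[OF d]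
  note pi = push_vfield_inv[OF bij]
  note G = gaframe_g[OF ga]
  have ii: "inv (inv F) = F" by (rule inv_inv_eq[OF bij])
  define N where "N = \<lparr>form = (\<lambda>Z. \<eta> (push_vfield (inv F) Z) \<circ> inv F), reeb = push_vfield F \<xi>,
    endo = (\<lambda>Z. push_vfield F (\<phi> (push_vfield (inv F) Z))),
    rmetric = (\<lambda>Z W. g (push_vfield (inv F) Z) (push_vfield (inv F) W) \<circ> inv F)\<rparr>"
  have "contact_isomorphism A M ga_atlas N F"
    unfolding contact_isomorphism_def using d bij by (simp add: N_def pi o_def)
  moreover have "ga_sasakian_structure c N" unfolding ga_sasakian_structure_def
  proof (intro conjI exI)
    show "one_form ga_atlas (form N)" using pull_form[OF d' eta_form] by (simp add: N_def)
    show "endo_field ga_atlas (endo N)" using pull_endo[OF d' cm(3)] by (simp add: N_def ii)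
    show "riemannian_metric ga_atlas (rmetric N)" using pull_metric[OF d' metric] by (simp add: N_def)
    show "bracket (push_vfield F e) (push_vfield F (\<phi> e)) = (\<lambda>p. ?\<alpha>) \<odot>\<^sub>v push_vfield F (\<phi> e) \<oplus>\<^sub>v (\<lambda>p. 2) \<odot>\<^sub>v push_vfield F \<xi>"
      unfolding push_vfield_bracket[OF bij, symmetric] gaframe_bracket(1)[OF ga] by (simp add: push_vfield_add push_vfield_scale o_def)
    show "bracket (push_vfield F (\<phi> e)) (push_vfield F \<xi>) = vzero" "bracket (push_vfield F \<xi>) (push_vfield F e) = vzero"
      unfolding push_vfield_bracket[OF bij, symmetric] gaframe_bracket(2,3)[OF ga] by (simp_all add: push_vfield_zero)
    show "endo N (push_vfield F (\<phi> e)) = vzero \<ominus>\<^sub>v push_vfield F e"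
    proof -
      have "\<phi> (\<phi> e) = vzero \<ominus>\<^sub>v e" using phi2[OF G(1)] gaframe_frame[OF ga] by (simp add: fun_eq_iff frame_def)
      then show ?thesis by (simp add: N_def pi push_vfield_diff push_vfield_zero)
    qed
    show "\<forall>X\<in>vfields ga_atlas. form N X = rmetric N X (push_vfield F \<xi>)"
    proof
      fix Z assume "Z \<in> vfields ga_atlas"
      from pV(2)[OF this] show "form N Z = rmetric N Z (push_vfield F \<xi>)"
        using g_xi g_sym by (simp add: N_def pi fun_eq_iff)
    qed
  qed (use L G phi_xi in \<open>simp_all add: N_def pi o_def push_vfield_zero\<close>)
  ultimately have F: "ga_identification c A M F" unfolding ga_identification_def by blast
  define D0 where "D0 = (\<lambda>X Y. D X Y \<oplus>\<^sub>v Sten (-1) ((\<lambda>p. ?\<alpha>) \<odot>\<^sub>v \<phi> e) X Y)"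
  have l0: "linear_connection A D0" unfolding D0_def by (rule lin[OF Sten_parallel]) (use G(1) in auto)
  have D0: "D0 X e = vzero" "D0 X (\<phi> e) = vzero" "D0 X \<xi> = vzero" if "X \<in> VF" for X
    unfolding D0_def by (rule gaframe_parallel[OF ga that])+
  define D' where "D' = pull_connection (inv F) D0"
  have l': "linear_connection ga_atlas D'" unfolding D'_def by (rule pull_linear_connection[OF d' l0])
  have "cartan_schouten_minus ga_atlas ga_mult D'" unfolding cartan_schouten_minus_def
  proof (intro conjI allI impI l')
    fix X Y assume XY: "left_invariant ga_atlas ga_mult X \<and> left_invariant ga_atlas ga_mult Y"
    then have V: "X \<in> vfields ga_atlas" "Y \<in> vfields ga_atlas" by (auto simp: left_invariant_def)
    let ?X = "push_vfield (inv F) X" and ?Y = "push_vfield (inv F) Y"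
    have V': "?X \<in> VF" "?Y \<in> VF" using V pV(2) by auto
    let ?o = "inv F (0, 0, 0)"
    let ?a = "g ?Y e ?o" and ?b = "g ?Y (\<phi> e) ?o" and ?c = "g ?Y \<xi> ?o"
    have "Y = (\<lambda>p. ?a) \<odot>\<^sub>v push_vfield F e \<oplus>\<^sub>v (\<lambda>p. ?b) \<odot>\<^sub>v push_vfield F (\<phi> e) \<oplus>\<^sub>v (\<lambda>p. ?c) \<odot>\<^sub>v push_vfield F \<xi>"
    proof (rule left_invariant_combination[OF L conjunct2[OF XY]])
      fix f assume "f \<in> Cinf ga_atlas"
      have "Y f (0, 0, 0) = ?Y (f \<circ> F) ?o" using bij by (simp add: push_vfield_def ii o_def)
      also have "\<dots> = ?a * e (f \<circ> F) ?o + ?b * \<phi> e (f \<circ> F) ?o + ?c * \<xi> (f \<circ> F) ?o" by (rule onb_span[OF G(2) V'(2)])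
      finally show "Y f (0, 0, 0) = ?a * push_vfield F e f (0, 0, 0) + ?b * push_vfield F (\<phi> e) f (0, 0, 0) + ?c * push_vfield F \<xi> f (0, 0, 0)"
        by (simp add: push_vfield_def)
    qed
    then have "?Y = push_vfield (inv F) ((\<lambda>p. ?a) \<odot>\<^sub>v push_vfield F e \<oplus>\<^sub>v (\<lambda>p. ?b) \<odot>\<^sub>v push_vfield F (\<phi> e) \<oplus>\<^sub>v (\<lambda>p. ?c) \<odot>\<^sub>v push_vfield F \<xi>)"
      by (rule arg_cong)
    also have "\<dots> = (\<lambda>p. ?a) \<odot>\<^sub>v e \<oplus>\<^sub>v (\<lambda>p. ?b) \<odot>\<^sub>v \<phi> e \<oplus>\<^sub>v (\<lambda>p. ?c) \<odot>\<^sub>v \<xi>"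
      by (simp add: push_vfield_add push_vfield_scale pi o_def)
    finally have Y: "?Y = (\<lambda>p. ?a) \<odot>\<^sub>v e \<oplus>\<^sub>v (\<lambda>p. ?b) \<odot>\<^sub>v \<phi> e \<oplus>\<^sub>v (\<lambda>p. ?c) \<odot>\<^sub>v \<xi>" .
    have "D0 ?X ((\<lambda>p. a) \<odot>\<^sub>v e \<oplus>\<^sub>v (\<lambda>p. b) \<odot>\<^sub>v \<phi> e \<oplus>\<^sub>v (\<lambda>p. c) \<odot>\<^sub>v \<xi>) = vzero" for a b c
      using V'(1) G(1) VF_const[OF V'(1)] by (simp add: conn_add[OF l0] conn_scale[OF l0] D0 fun_eq_iff)
    then have "D0 ?X ?Y = vzero" using Y by metis
    then show "D' X Y = vzero" by (simp add: D'_def pull_connection_def ii push_vfield_zero)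
  qed
  moreover have "pull_connection F D' X Y = D0 X Y" for X Y
    by (simp add: D'_def pull_connection_def ii pi)
  then have "connection_diff A (pull_connection F D') D = Sten (-1) ((\<lambda>p. ?\<alpha>) \<odot>\<^sub>v \<phi> e)"
    using D0 by (intro connection_diff_gaframe[OF ga pull_linear_connection[OF d l']]) auto
  ultimately show thesis by (rule that[OF F])
qed

text \<open>Pulling back the first field of the left invariant frame gives \<open>e\<close>. Through
  it the connection of any identification takes the explicit form \<open>Sten\<close>, which
  \<open>gaframe_homogeneous\<close> shows to be a homogeneous structure.\<close>

lemma identification_imp_gaframe:
  assumes F: "ga_identification c A M F" and D': "cartan_schouten_minus ga_atlas ga_mult D'"
  obtains e where "gaframe (sqrt (-(c+3))) e"
    "connection_diff A (pull_connection F D') D = Sten (-1) ((\<lambda>p. sqrt (-(c+3))) \<odot>\<^sub>v \<phi> e)"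
proof -
  let ?\<alpha> = "sqrt (-(c+3))"
  obtain N where N: "ga_sasakian_structure c N" and iso: "contact_isomorphism A M ga_atlas N F"
    using F unfolding ga_identification_def by blast
  obtain e1 e2 e3 where li: "left_invariant ga_atlas ga_mult e1" "left_invariant ga_atlas ga_mult e2" "left_invariant ga_atlas ga_mult e3"
    and br: "bracket e1 e2 = (\<lambda>p. ?\<alpha>) \<odot>\<^sub>v e2 \<oplus>\<^sub>v (\<lambda>p. 2) \<odot>\<^sub>v e3" "bracket e3 e1 = vzero"
    and m: "rmetric N e1 e1 = (\<lambda>p. 1)" "rmetric N e3 e1 = (\<lambda>p. 0)" and en: "endo N e1 = e2" "reeb N = e3"
    using N unfolding ga_sasakian_structure_def by (elim conjE exE) (rule that)
  have d: "diffeomorphism A ga_atlas F" and i2: "push_vfield F \<xi> = reeb N"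
    and i3: "\<And>X. X \<in> VF \<Longrightarrow> push_vfield F (\<phi> X) = endo N (push_vfield F X)"
    and i4: "\<And>X Y. X \<in> VF \<Longrightarrow> Y \<in> VF \<Longrightarrow> rmetric N (push_vfield F X) (push_vfield F Y) \<circ> F = g X Y"
    using iso unfolding contact_isomorphism_def by auto
  note bij = d_bij[OF d]
  note pi = push_vfield_inv[OF bij]
  note pV = d_push[OF d]
  define e where "e = push_vfield (inv F) e1"
  have lV: "e1 \<in> vfields ga_atlas" "e2 \<in> vfields ga_atlas" using li by (auto simp: left_invariant_def)
  have e: "e \<in> VF" unfolding e_def by (rule pV(2)[OF lV(1)])
  have Fe: "push_vfield F e = e1" by (simp add: e_def pi)
  have Fp: "push_vfield F (\<phi> e) = e2" using i3[OF e] Fe en by simp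
  have Fx: "push_vfield F \<xi> = e3" using i2 en by simp
  have inj: "X = Y" if "push_vfield F X = push_vfield F Y" for X Y using that pi(1) by metis
  have fr: "frame p e" for p
    unfolding frame_def using e i4[OF e e, symmetric] i4[OF xi_VF e, symmetric] m g_xi[OF e] by (simp add: Fe Fx)
  have ga: "gaframe ?\<alpha> e"
  proof (rule bracket_imp_gaframe[OF fr])
    show "bracket e (\<phi> e) = (\<lambda>p. ?\<alpha>) \<odot>\<^sub>v \<phi> e \<oplus>\<^sub>v (\<lambda>p. 2) \<odot>\<^sub>v \<xi>"
      by (rule inj) (simp add: push_vfield_bracket[OF bij] push_vfield_add push_vfield_scale Fe Fp Fx br o_def)
    show "bracket \<xi> e = vzero" by (rule inj) (simp add: push_vfield_bracket[OF bij] Fe Fx br push_vfield_zero)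
  qed
  let ?D = "pull_connection F D'"
  have l: "linear_connection A ?D" using pull_linear_connection[OF d] D' by (simp add: cartan_schouten_minus_def)
  \<comment> \<open>The (-)-connection is prescribed only for left invariant directions;
    function-linearity in the direction extends the vanishing to all \<open>X\<close>.\<close>
  have kill: "?D X E = vzero" if X: "X \<in> VF" and E: "E \<in> VF" and lE: "left_invariant ga_atlas ga_mult (push_vfield F E)" for X E
  proof -
    have z: "?D e E = vzero" "?D (\<phi> e) E = vzero" "?D \<xi> E = vzero"
      using D' li lE by (auto simp: cartan_schouten_minus_def pull_connection_def Fe Fp Fx push_vfield_zero)
    have "X = g X e \<odot>\<^sub>v e \<oplus>\<^sub>v g X (\<phi> e) \<odot>\<^sub>v \<phi> e \<oplus>\<^sub>v g X \<xi> \<odot>\<^sub>v \<xi>"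
      using onb_span[OF frame_onb[OF fr] X] by (simp add: fun_eq_iff)
    then have "?D X E = ?D (g X e \<odot>\<^sub>v e \<oplus>\<^sub>v g X (\<phi> e) \<odot>\<^sub>v \<phi> e \<oplus>\<^sub>v g X \<xi> \<odot>\<^sub>v \<xi>) E" by (rule arg_cong)
    also have "\<dots> = vzero"
      using X e by (simp add: endo_add[OF conn_endo[OF l E]] endo_scale[OF conn_endo[OF l E]] z fun_eq_iff)
    finally show ?thesis .
  qed
  show thesis
  proof (rule that[OF ga connection_diff_gaframe[OF ga l]])
    fix X assume X: "X \<in> VF"
    show "?D X e = vzero" "?D X (\<phi> e) = vzero" "?D X \<xi> = vzero"
      by (rule kill[OF X]; use e li Fe Fp Fx in simp)+
  qed
qed

end

text \<open>For \<open>c < -3\<close> the existence of an identification and of the connection is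
  part of the claim, since the second set of the union would be empty without them.\<close>

theorem corollary8p2:
  fixes A :: "('a::{t2_space,second_countable_topology}, real^3) atlas"
    and M :: "'a contact_structure"
    and D :: "'a vfield \<Rightarrow> 'a vfield \<Rightarrow> 'a vfield"
    and c :: real
  assumes "sasakian_space_form A M D c"
    and "simply_connected (UNIV :: 'a set)"
  shows "(c \<ge> -3 \<longrightarrow>
            {S. homogeneous_contact_riemannian_structure A M D S} = {A_tensor A M r | r. True}) \<and>
         (c < -3 \<longrightarrow>
            (\<exists>F D'. ga_identification c A M F \<and> cartan_schouten_minus ga_atlas ga_mult D') \<and>
            {S. homogeneous_contact_riemannian_structure A M D S} =
              {A_tensor A M r | r. True} \<union>
              {connection_diff A (pull_connection F D') D | F D'.
                 ga_identification c A M F \<and> cartan_schouten_minus ga_atlas ga_mult D'})"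
proof -
  have ssf: "sasakian A M D" and con: "connected (UNIV :: 'a set)" and cmp: "riemannian_complete A (rmetric M)"
    and chc: "constant_holomorphic_curvature A M D c"
    using assms(1) by (auto simp: sasakian_space_form_def)
  interpret sasaki A M D by unfold_locales (rule ssf)
  let ?H = "homogeneous_contact_riemannian_structure A M D"
  let ?I = "\<lambda>S. \<exists>F D'. S = connection_diff A (pull_connection F D') D \<and>
    ga_identification c A M F \<and> cartan_schouten_minus ga_atlas ga_mult D'"
  have A: "?H (A_tensor A M r)" for r by (rule A_tensor_homogeneous[OF chc])
  have H: "(\<exists>r. S = A_tensor A M r) \<or> (c < -3 \<and> ?I S)" if S: "?H S" for S
  proof -
    obtain r U where "U \<in> VF" "\<forall>p. \<eta> U p = 0" "S = Sten r U" "\<forall>W\<in>VF. D W U \<oplus>\<^sub>v S W U = vzero"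
      by (rule homogeneous_imp_Sten[OF con S]) blast
    then have U: "U \<in> VF" "\<And>p. \<eta> U p = 0" "S = Sten r U" "\<And>W. W \<in> VF \<Longrightarrow> D W U \<oplus>\<^sub>v S W U = vzero" by blast+
    show ?thesis
    proof (cases "U = vzero")
      case True
      then show ?thesis using U(3) Sten_zero by auto
    next
      case False
      obtain e where e: "c < -3" "r = -1" "gaframe (sqrt (-(c+3))) e" "U = (\<lambda>p. sqrt (-(c+3))) \<odot>\<^sub>v \<phi> e"
        by (rule Sten_imp_gaframe[OF chc con U(1,2) False U(4)[unfolded U(3)]])
      obtain F D' where "ga_identification c A M F" "cartan_schouten_minus ga_atlas ga_mult D'"
        "connection_diff A (pull_connection F D') D = Sten (-1) ((\<lambda>p. sqrt (-(c+3))) \<odot>\<^sub>v \<phi> e)"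
        by (rule gaframe_identification[OF e(3,1) assms(2) con cmp])
      then have "?I S" unfolding U(3) e(2,4) by metis
      then show ?thesis using e(1) by blast
    qed
  qed
  have I: "?H S" if "?I S" for S
  proof -
    obtain F D' where S: "S = connection_diff A (pull_connection F D') D" and i: "ga_identification c A M F" "cartan_schouten_minus ga_atlas ga_mult D'"
      using \<open>?I S\<close> by blast
    obtain e where e: "gaframe (sqrt (-(c+3))) e"
      "connection_diff A (pull_connection F D') D = Sten (-1) ((\<lambda>p. sqrt (-(c+3))) \<odot>\<^sub>v \<phi> e)"
      by (rule identification_imp_gaframe[OF i])
    show ?thesis unfolding S e(2) by (rule gaframe_homogeneous[OF e(1) chc])
  qed
  have ex: "\<exists>F D'. ga_identification c A M F \<and> cartan_schouten_minus ga_atlas ga_mult D'" if "c < -3"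
  proof -
    obtain e where e: "gaframe (sqrt (-(c+3))) e" by (rule gaframe_exists[OF chc \<open>c < -3\<close> assms(2) con])
    obtain F D' where "ga_identification c A M F" "cartan_schouten_minus ga_atlas ga_mult D'"
      by (rule gaframe_identification[OF e \<open>c < -3\<close> assms(2) con cmp])
    then show ?thesis by blast
  qed
  show ?thesis
  proof (intro conjI impI)
    assume "c \<ge> -3"
    then show "{S. ?H S} = {A_tensor A M r | r. True}" using A H by fastforce
  next
    assume c: "c < -3"
    show "\<exists>F D'. ga_identification c A M F \<and> cartan_schouten_minus ga_atlas ga_mult D'" by (rule ex[OF c])
    show "{S. ?H S} = {A_tensor A M r | r. True} \<union> {connection_diff A (pull_connection F D') D | F D'.
        ga_identification c A M F \<and> cartan_schouten_minus ga_atlas ga_mult D'}" using A H I by fast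
  qed
qed

end
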